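(* Let $\alpha$ be a mixing Noetherian $\mathbb{Z}^2$-action by continuous automorphisms of a compact metrizable abelian zero-dimensional group $X$, and let $\mathsf{h}=\mathsf{h}(\alpha)$ be its topological entropy. Then there exist a mixing Noetherian entropy rank one $\mathbb{Z}^2$-action $\beta$ by continuous automorphisms of a compact abelian zero-dimensional group and constants $A,B>0$ such that for every $\Lambda\in\mathcal{L}_2$, \[A\,e^{\mathsf{h}[\Lambda]}\leqslant\mathsf{F}_\alpha(\Lambda)\leqslant B\,e^{\mathsf{h}[\Lambda]}\,\mathsf{F}_\beta(\Lambda).\]
   Context: $\mathcal{L}_2$ is the set of finite-index subgroups of $\mathbb{Z}^2$, $[\Lambda]=|\mathbb{Z}^2/\Lambda|$, $\mathsf{F}_\alpha(\Lambda)$ is the number of points fixed by $\alpha^{\mathbf{n}}$ for all $\mathbf{n}\in\Lambda$. Noetherian: the dual module $\widehat{X}$ is a Noetherian module over $R_2=\mathbb{Z}[u_1^{\pm1},u_2^{\pm1}]$ (with $u^{\mathbf{n}}$ acting as the dual of $\alpha^{\mathbf{n}}$). Entropy rank one: every $\beta^{\mathbf{n}}$ has finite topological entropy. Mixing is with respect to Haar measure. *)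

theory Defs
  imports "HOL-Analysis.Analysis" "HOL-Library.Product_Plus"
begin

definition cpt_ab_group ::
  "'a topology \<Rightarrow> ('a \<Rightarrow> 'a \<Rightarrow> 'a) \<Rightarrow> ('a \<Rightarrow> 'a) \<Rightarrow> 'a \<Rightarrow> bool" where
  "cpt_ab_group T add neg zero \<longleftrightarrow>
     zero \<in> topspace T \<and>
     (\<forall>x\<in>topspace T. \<forall>y\<in>topspace T. add x y \<in> topspace T) \<and>
     (\<forall>x\<in>topspace T. neg x \<in> topspace T) \<and>
     (\<forall>x\<in>topspace T. \<forall>y\<in>topspace T. \<forall>z\<in>topspace T. add (add x y) z = add x (add y z)) \<and>
     (\<forall>x\<in>topspace T. \<forall>y\<in>topspace T. add x y = add y x) \<and>
     (\<forall>x\<in>topspace T. add zero x = x) \<and>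
     (\<forall>x\<in>topspace T. add (neg x) x = zero) \<and>
     continuous_map (prod_topology T T) T (\<lambda>(x, y). add x y) \<and>
     continuous_map T T neg \<and>
     compact_space T \<and> Hausdorff_space T"

definition z2_aut_action ::
  "'a topology \<Rightarrow> ('a \<Rightarrow> 'a \<Rightarrow> 'a) \<Rightarrow> (int \<times> int \<Rightarrow> 'a \<Rightarrow> 'a) \<Rightarrow> bool" where
  "z2_aut_action T add \<alpha> \<longleftrightarrow>
     (\<forall>n. continuous_map T T (\<alpha> n)) \<and>
     (\<forall>n. \<forall>x\<in>topspace T. \<forall>y\<in>topspace T. \<alpha> n (add x y) = add (\<alpha> n x) (\<alpha> n y)) \<and>
     (\<forall>x\<in>topspace T. \<alpha> 0 x = x) \<and>
     (\<forall>m n. \<forall>x\<in>topspace T. \<alpha> (m + n) x = \<alpha> m (\<alpha> n x))"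

definition is_haar :: "'a topology \<Rightarrow> ('a \<Rightarrow> 'a \<Rightarrow> 'a) \<Rightarrow> 'a measure \<Rightarrow> bool" where
  "is_haar T add \<mu> \<longleftrightarrow>
     space \<mu> = topspace T \<and>
     sets \<mu> = sigma_sets (topspace T) {U. openin T U} \<and>
     emeasure \<mu> (space \<mu>) = 1 \<and>
     (\<forall>x\<in>topspace T. \<forall>A\<in>sets \<mu>. measure \<mu> (add x ` A) = measure \<mu> A)"

definition haar_mixing ::
  "'a topology \<Rightarrow> ('a \<Rightarrow> 'a \<Rightarrow> 'a) \<Rightarrow> (int \<times> int \<Rightarrow> 'a \<Rightarrow> 'a) \<Rightarrow> bool" where
  "haar_mixing T add \<alpha> \<longleftrightarrow>
     (\<forall>\<mu>. is_haar T add \<mu> \<longrightarrow>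
        (\<forall>A\<in>sets \<mu>. \<forall>B\<in>sets \<mu>.
           ((\<lambda>n. measure \<mu> ({x\<in>topspace T. \<alpha> n x \<in> A} \<inter> B))
              \<longlongrightarrow> measure \<mu> A * measure \<mu> B) cofinite))"

definition is_character :: "'a topology \<Rightarrow> ('a \<Rightarrow> 'a \<Rightarrow> 'a) \<Rightarrow> ('a \<Rightarrow> complex) \<Rightarrow> bool" where
  "is_character T add \<gamma> \<longleftrightarrow>
     continuous_map T euclidean \<gamma> \<and>
     (\<forall>x\<in>topspace T. cmod (\<gamma> x) = 1) \<and>
     (\<forall>x\<in>topspace T. \<forall>y\<in>topspace T. \<gamma> (add x y) = \<gamma> x * \<gamma> y) \<and>
     \<gamma> \<in> extensional (topspace T)"

text \<open>An \<open>R\<^sub>2\<close>-submodule of the dual group \<open>X^\<close>, where \<open>u\<^sup>n\<close> acts as the dual of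
  \<open>\<alpha>\<^sup>n\<close>: a subgroup closed under all \<open>\<gamma> \<mapsto> \<gamma> \<circ> \<alpha>\<^sup>n\<close>, \<open>n \<in> \<int>\<^sup>2\<close>.\<close>
definition dual_submodule ::
  "'a topology \<Rightarrow> ('a \<Rightarrow> 'a \<Rightarrow> 'a) \<Rightarrow> (int \<times> int \<Rightarrow> 'a \<Rightarrow> 'a) \<Rightarrow> ('a \<Rightarrow> complex) set \<Rightarrow> bool" where
  "dual_submodule T add \<alpha> M \<longleftrightarrow>
     (\<forall>\<gamma>\<in>M. is_character T add \<gamma>) \<and>
     restrict (\<lambda>_. 1) (topspace T) \<in> M \<and>
     (\<forall>\<gamma>\<in>M. \<forall>\<psi>\<in>M. restrict (\<lambda>x. \<gamma> x * \<psi> x) (topspace T) \<in> M) \<and>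
     (\<forall>\<gamma>\<in>M. restrict (\<lambda>x. inverse (\<gamma> x)) (topspace T) \<in> M) \<and>
     (\<forall>\<gamma>\<in>M. \<forall>n. restrict (\<lambda>x. \<gamma> (\<alpha> n x)) (topspace T) \<in> M)"

definition noetherian_action ::
  "'a topology \<Rightarrow> ('a \<Rightarrow> 'a \<Rightarrow> 'a) \<Rightarrow> (int \<times> int \<Rightarrow> 'a \<Rightarrow> 'a) \<Rightarrow> bool" where
  "noetherian_action T add \<alpha> \<longleftrightarrow>
     (\<forall>Ms :: nat \<Rightarrow> ('a \<Rightarrow> complex) set.
        (\<forall>k. dual_submodule T add \<alpha> (Ms k)) \<and> (\<forall>k. Ms k \<subseteq> Ms (Suc k))
        \<longrightarrow> (\<exists>N. \<forall>k\<ge>N. Ms k = Ms N))"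

definition open_covers :: "'a topology \<Rightarrow> 'a set set set" where
  "open_covers T = {\<U>. finite \<U> \<and> (\<forall>U\<in>\<U>. openin T U) \<and> \<Union>\<U> = topspace T}"

definition cover_join :: "'a topology \<Rightarrow> ('i \<Rightarrow> 'a \<Rightarrow> 'a) \<Rightarrow> 'i set \<Rightarrow> 'a set set \<Rightarrow> 'a set set" where
  "cover_join T a F \<U> =
     {topspace T \<inter> (\<Inter>i\<in>F. {x. a i x \<in> f i}) | f. \<forall>i\<in>F. f i \<in> \<U>}"

definition cover_num :: "'a topology \<Rightarrow> 'a set set \<Rightarrow> nat" where
  "cover_num T \<V> = (LEAST n. \<exists>\<W>\<subseteq>\<V>. finite \<W> \<and> \<Union>\<W> = topspace T \<and> card \<W> = n)"

definition top_entropy_z2 :: "'a topology \<Rightarrow> (int \<times> int \<Rightarrow> 'a \<Rightarrow> 'a) \<Rightarrow> ereal" where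
  "top_entropy_z2 T \<alpha> =
     (SUP \<U>\<in>open_covers T. limsup (\<lambda>N::nat.
        ereal (ln (real (cover_num T (cover_join T \<alpha> ({0..<int N} \<times> {0..<int N}) \<U>)))
               / (real N)\<^sup>2)))"

definition top_entropy_map :: "'a topology \<Rightarrow> ('a \<Rightarrow> 'a) \<Rightarrow> ereal" where
  "top_entropy_map T f =
     (SUP \<U>\<in>open_covers T. limsup (\<lambda>N::nat.
        ereal (ln (real (cover_num T (cover_join T (\<lambda>k. f ^^ k) {0..<N} \<U>))) / real N)))"

definition entropy_rank_one :: "'a topology \<Rightarrow> (int \<times> int \<Rightarrow> 'a \<Rightarrow> 'a) \<Rightarrow> bool" where
  "entropy_rank_one T \<beta> \<longleftrightarrow> (\<forall>n. top_entropy_map T (\<beta> n) < \<infinity>)"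

definition z2_cosets :: "(int \<times> int) set \<Rightarrow> (int \<times> int) set set" where
  "z2_cosets \<Lambda> = (\<lambda>x. (\<lambda>l. x + l) ` \<Lambda>) ` UNIV"

definition finite_index_subgroup :: "(int \<times> int) set \<Rightarrow> bool" where
  "finite_index_subgroup \<Lambda> \<longleftrightarrow>
     0 \<in> \<Lambda> \<and> (\<forall>a\<in>\<Lambda>. \<forall>b\<in>\<Lambda>. a + b \<in> \<Lambda>) \<and> (\<forall>a\<in>\<Lambda>. - a \<in> \<Lambda>) \<and>
     finite (z2_cosets \<Lambda>)"

definition z2_index :: "(int \<times> int) set \<Rightarrow> nat" where
  "z2_index \<Lambda> = card (z2_cosets \<Lambda>)"

definition fix_count :: "'a topology \<Rightarrow> (int \<times> int \<Rightarrow> 'a \<Rightarrow> 'a) \<Rightarrow> (int \<times> int) set \<Rightarrow> ereal" where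
  "fix_count T \<alpha> \<Lambda> =
     (let P = {x\<in>topspace T. \<forall>n\<in>\<Lambda>. \<alpha> n x = x}
      in if finite P then ereal (real (card P)) else \<infinity>)"

end

(*
  Let M be the character module of X. It is a Noetherian torsion module over the group ring, mixing means
  that no nonzero element of M is fixed by some u^n with n nonzero, and the number of points fixed by Lambda
  is the index of I_Lambda M in M, where I_Lambda is the ideal generated by u^s - 1 and u^t - 1 for a basis
  s, t of Lambda. The entropy is the growth rate of log |sp W F| as W runs through the squares, where F is a
  finite subgroup generating M and sp W F is spanned by the translates of F by the exponents in W.

  Lower bound. Restrict the Koszul complex of (u^s - 1, u^t - 1) to windows consisting of translates of a
  fundamental domain of Lambda. By mixing its second homology vanishes, so for F generating M the second
  mixed difference of log |sp W F| over large windows is at most log |M / I_Lambda M|. Summing up and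
  covering a large square by strips of windows gives exp (h [Lambda]) <= |M / I_Lambda M|, so A = 1 works.

  Upper bound. Order the exponents by the functional phi, and call a submodule L monically closed if
  g y : L implies y : L for every operator g with leading term 1. By Noetherian induction from M downwards,
  every such L admits C, q and a finite F with |M / (I_Lambda M + L)| <= C q^[Lambda] for all Lambda and
  |(sp W F + L) / L| >= q^|W| for all finite W; a step enlarges L by a cyclic module on which a prime p acts
  by 0 and which is free modulo L, and then by its monic closure. The smallest such L is the submodule N of
  elements killed by a monic operator. It yields q <= exp h and the factor |N / I_Lambda N|, which is the
  number of fixed points of the dual beta of N. A monic operator killing N reduces a strip to its boundary
  layer, so the elements beta^n have finite entropy.
*)
theory Submission
  imports Defs "HOL-Library.Function_Algebras"
begin

subsection \<open>Subgroups and indices\<close>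

text \<open>In the Euler characteristic of the Koszul complex on windows only two terms are not
  sizes of spans: the cokernel, which is compared with M / I_Lambda M once windows are large, and
  the kernel, which contains a copy of the smallest term. The lower bound may discard the rest of
  that kernel. The upper bound has to control it by a constant that does not depend on Lambda, and
  this is done only for an ideal J in a free cyclic module: there the ambient complex is exact, so
  the excess consists of classes fixed modulo J by Lambda, and the chain condition puts all such
  classes, for all Lambda, into one finite extension of J. The monic closure of a cyclic module
  reduces to this case because a single monic operator embeds it into the cyclic module. The slope
  of phi is irrational so that leading exponents are unique; then a relation modulo p can be
  normalised to a monic one, and u^s - 1 is monic up to a unit, which is how monic closure replaces
  mixing modulo L. The group dual to N is built on the real numbers: M is countable, so points of a
  quotient of X can be coded by subsets of the natural numbers.\<close>

definition subgp :: "'g::ab_group_add set \<Rightarrow> bool" where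
  "subgp H \<longleftrightarrow> 0 \<in> H \<and> (\<forall>x\<in>H. \<forall>y\<in>H. x - y \<in> H)"

lemma subgpI: "0 \<in> H \<Longrightarrow> (\<And>x y. x \<in> H \<Longrightarrow> y \<in> H \<Longrightarrow> x - y \<in> H) \<Longrightarrow> subgp H"
  by (auto simp: subgp_def)

lemma subgp_0: "subgp H \<Longrightarrow> 0 \<in> H"
  and subgp_diff: "subgp H \<Longrightarrow> x \<in> H \<Longrightarrow> y \<in> H \<Longrightarrow> x - y \<in> H"
  by (auto simp: subgp_def)

lemma subgp_minus: "subgp H \<Longrightarrow> x \<in> H \<Longrightarrow> - x \<in> H"
  using subgp_diff[of H 0 x] subgp_0[of H] by simp

lemma subgp_add: "subgp H \<Longrightarrow> x \<in> H \<Longrightarrow> y \<in> H \<Longrightarrow> x + y \<in> H"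
  using subgp_diff[of H x "- y"] subgp_minus[of H y] by simp

lemma subgp_diff_comm: "subgp H \<Longrightarrow> x - y \<in> H \<longleftrightarrow> y - x \<in> H"
  using subgp_minus[of H "x - y"] subgp_minus[of H "y - x"] by auto

lemma subgp_diff_trans: "subgp H \<Longrightarrow> x - y \<in> H \<Longrightarrow> y - z \<in> H \<Longrightarrow> x - z \<in> H"
  using subgp_add[of H "x - y" "y - z"] by simp

lemma subgp_sum: "subgp H \<Longrightarrow> (\<And>i. i \<in> I \<Longrightarrow> f i \<in> H) \<Longrightarrow> sum f I \<in> H"
  by (induction I rule: infinite_finite_induct) (auto intro: subgp_0 subgp_add)

lemma subgp_singleton: "subgp {0}" by (auto simp: subgp_def)

lemma subgp_Int: "subgp H \<Longrightarrow> subgp K \<Longrightarrow> subgp (H \<inter> K)"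
  by (auto simp: subgp_def)

lemma subgp_image:
  assumes H: "subgp H" and f: "\<And>x y. f (x - y) = f x - f y"
  shows "subgp (f ` H)"
proof (rule subgpI)
  have "f 0 = 0" using f[of 0 0] by simp
  then show "0 \<in> f ` H" using subgp_0[OF H] by (metis imageI)
  fix x y assume "x \<in> f ` H" "y \<in> f ` H"
  then show "x - y \<in> f ` H" by (auto simp: f[symmetric] intro!: imageI subgp_diff[OF H])
qed

lemma subgp_Times: "subgp H \<Longrightarrow> subgp K \<Longrightarrow> subgp (H \<times> K)"
  by (auto simp: subgp_def zero_prod_def)

definition gsum :: "'g::ab_group_add set \<Rightarrow> 'g set \<Rightarrow> 'g set" where
  "gsum H K = {x + y |x y. x \<in> H \<and> y \<in> K}"

lemma gsumI: "x \<in> H \<Longrightarrow> y \<in> K \<Longrightarrow> x + y \<in> gsum H K"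
  by (auto simp: gsum_def)

lemma gsum_left: "subgp K \<Longrightarrow> x \<in> H \<Longrightarrow> x \<in> gsum H K"
  using gsumI[of x H 0 K] subgp_0[of K] by simp

lemma gsum_right: "subgp H \<Longrightarrow> x \<in> K \<Longrightarrow> x \<in> gsum H K"
  using gsumI[of 0 H x K] subgp_0[of H] by simp

lemma subgp_gsum:
  assumes "subgp H" "subgp K" shows "subgp (gsum H K)"
proof (rule subgpI)
  show "0 \<in> gsum H K" using gsum_left[of K 0 H] assms subgp_0 by blast
next
  fix x y assume "x \<in> gsum H K" "y \<in> gsum H K"
  then obtain a b c d where "x = a + b" "y = c + d" "a \<in> H" "c \<in> H" "b \<in> K" "d \<in> K"
    by (auto simp: gsum_def)
  then have "x - y = (a - c) + (b - d)" "a - c \<in> H" "b - d \<in> K"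
    using assms by (auto simp: subgp_diff)
  then show "x - y \<in> gsum H K" by (metis gsumI)
qed

lemma gsum_subset: "subgp A \<Longrightarrow> H \<subseteq> A \<Longrightarrow> K \<subseteq> A \<Longrightarrow> gsum H K \<subseteq> A"
  by (auto simp: gsum_def intro!: subgp_add)

lemma gsum_mono: "H \<subseteq> H' \<Longrightarrow> K \<subseteq> K' \<Longrightarrow> gsum H K \<subseteq> gsum H' K'"
  by (auto simp: gsum_def)

section \<open>Indices of one subgroup modulo another\<close>

definition coset :: "'g::ab_group_add set \<Rightarrow> 'g \<Rightarrow> 'g set" where
  "coset K x = {y. y - x \<in> K}"

text \<open>For subgroups this is the image of \<open>H\<close> in the quotient by \<open>K\<close>,
  so \<open>ix H K\<close> is the order of (H + K)/K, equivalently of H/(H \<inter> K). Counts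
  modulo a fixed \<open>L\<close> can then be taken of spans that do not contain \<open>L\<close>.
  An infinite family has \<open>card\<close> 0, which is why finiteness is tracked separately by
  \<open>fin_ix\<close>.\<close>

definition cosets_met :: "'g::ab_group_add set \<Rightarrow> 'g set \<Rightarrow> 'g set set" where
  "cosets_met H K = coset K ` H"

definition ix :: "'g::ab_group_add set \<Rightarrow> 'g set \<Rightarrow> nat" where
  "ix H K = card (cosets_met H K)"

abbreviation fin_ix :: "'g::ab_group_add set \<Rightarrow> 'g set \<Rightarrow> bool" where
  "fin_ix H K \<equiv> finite (cosets_met H K)"

lemma coset_eq_iff:
  assumes "subgp K" shows "coset K x = coset K y \<longleftrightarrow> x - y \<in> K"
proof
  assume "coset K x = coset K y"
  moreover have "x \<in> coset K x" using assms by (simp add: coset_def subgp_0)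
  ultimately show "x - y \<in> K" by (auto simp: coset_def)
next
  assume "x - y \<in> K"
  then have "z - x \<in> K \<longleftrightarrow> z - y \<in> K" for z
    using subgp_diff_trans[OF assms, of z x y] subgp_diff_trans[OF assms, of z y x]
      subgp_diff_comm[OF assms, of x y] by auto
  then show "coset K x = coset K y" by (auto simp: coset_def)
qed

definition crep :: "'g::ab_group_add set \<Rightarrow> 'g set \<Rightarrow> 'g set \<Rightarrow> 'g" where
  "crep H K c = (SOME x. x \<in> H \<and> coset K x = c)"

lemma crep:
  assumes "c \<in> cosets_met H K" shows "crep H K c \<in> H" "coset K (crep H K c) = c"
proof -
  have "\<exists>x. x \<in> H \<and> coset K x = c" using assms by (auto simp: cosets_met_def)
  from someI_ex[OF this] show "crep H K c \<in> H" "coset K (crep H K c) = c"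
    by (auto simp: crep_def)
qed

lemma crep_diff:
  assumes "subgp K" "x \<in> H" shows "x - crep H K (coset K x) \<in> K" "crep H K (coset K x) \<in> H"
  using crep[of "coset K x" H K] assms coset_eq_iff[of K x "crep H K (coset K x)"]
  by (auto simp: cosets_met_def)

lemma crep_inj:
  assumes "subgp K" "c \<in> cosets_met H K" "d \<in> cosets_met H K" "crep H K c - crep H K d \<in> K"
  shows "c = d"
  using assms crep coset_eq_iff by metis

text \<open>Composing \<open>f\<close> with chosen coset representatives gives an injection into
  \<open>S\<close>. Since \<open>f\<close> is an arbitrary function, chosen preimages and normal
  forms can be used for counting.\<close>

lemma ix_le_inj:
  assumes "subgp K" "finite S" "f ` H \<subseteq> S"
    and "\<And>x y. x \<in> H \<Longrightarrow> y \<in> H \<Longrightarrow> f x = f y \<Longrightarrow> x - y \<in> K"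
  shows "fin_ix H K" "ix H K \<le> card S"
proof -
  let ?g = "\<lambda>c. f (crep H K c)"
  have inj: "inj_on ?g (cosets_met H K)"
  proof (rule inj_onI)
    fix c d assume "c \<in> cosets_met H K" "d \<in> cosets_met H K" "?g c = ?g d"
    then have "crep H K c - crep H K d \<in> K" by (intro assms(4) crep(1))
    then show "c = d" by (rule crep_inj[OF assms(1) \<open>c \<in> _\<close> \<open>d \<in> _\<close>])
  qed
  have sub: "?g ` cosets_met H K \<subseteq> S"
    using assms(3) crep(1) by (intro image_subsetI) blast
  show "fin_ix H K" using inj sub assms(2) by (meson finite_imageD finite_subset)
  show "ix H K \<le> card S" unfolding ix_def by (rule card_inj_on_le[OF inj sub assms(2)])
qed

lemma ix_ge_inj:
  assumes "subgp K" "fin_ix H K" "f ` S \<subseteq> H"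
    and "\<And>s t. s \<in> S \<Longrightarrow> t \<in> S \<Longrightarrow> f s - f t \<in> K \<Longrightarrow> s = t"
  shows "finite S" "card S \<le> ix H K"
proof -
  have inj: "inj_on (\<lambda>s. coset K (f s)) S"
    using assms(4) coset_eq_iff[OF assms(1)] by (intro inj_onI) metis
  have sub: "(\<lambda>s. coset K (f s)) ` S \<subseteq> cosets_met H K" using assms(3) by (auto simp: cosets_met_def)
  show "finite S" using inj sub assms(2) by (meson finite_imageD finite_subset)
  show "card S \<le> ix H K" unfolding ix_def by (rule card_inj_on_le[OF inj sub assms(2)])
qed

lemma ix_le_map:
  assumes "subgp K" "subgp K'" "fin_ix H' K'" "f ` H \<subseteq> H'"
    and "\<And>x y. x \<in> H \<Longrightarrow> y \<in> H \<Longrightarrow> f x - f y \<in> K' \<Longrightarrow> x - y \<in> K"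
  shows "fin_ix H K" "ix H K \<le> ix H' K'"
proof -
  have 1: "(\<lambda>x. coset K' (f x)) ` H \<subseteq> cosets_met H' K'" using assms(4) by (auto simp: cosets_met_def)
  have 2: "x - y \<in> K" if "x \<in> H" "y \<in> H" "coset K' (f x) = coset K' (f y)" for x y
    using assms(5)[OF that(1,2)] that(3) coset_eq_iff[OF assms(2)] by blast
  show "fin_ix H K" by (rule ix_le_inj(1)[OF assms(1,3) 1 2])
  show "ix H K \<le> ix H' K'" unfolding ix_def[of H'] by (rule ix_le_inj(2)[OF assms(1,3) 1 2])
qed

lemma ix_mono:
  assumes "subgp K" "subgp K'" "fin_ix H' K'" "H \<subseteq> H'" "K' \<subseteq> K"
  shows "fin_ix H K" "ix H K \<le> ix H' K'"
  using ix_le_map[OF assms(1-3), of "\<lambda>x. x" H] assms(4,5) by auto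

lemma ix_pos: "fin_ix H K \<Longrightarrow> H \<noteq> {} \<Longrightarrow> 0 < ix H K"
  by (simp add: ix_def card_gt_0_iff cosets_met_def)

lemma fin_ix_finite: "finite H \<Longrightarrow> fin_ix H K"
  by (simp add: cosets_met_def)

lemma ix_le_card: "finite H \<Longrightarrow> ix H K \<le> card H"
  by (simp add: ix_def cosets_met_def card_image_le)

lemma ix_zero: "ix H {0} = card H"
  unfolding ix_def cosets_met_def
  by (rule card_image) (auto intro!: inj_onI simp: coset_eq_iff subgp_singleton)

lemma ix_gsum_right:
  assumes "subgp K" shows "cosets_met (gsum H K) K = cosets_met H K"
proof -
  have "coset K (x + y) = coset K x" if "y \<in> K" for x y
    using that assms by (simp add: coset_eq_iff)
  then have "cosets_met (gsum H K) K \<subseteq> cosets_met H K"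
    by (auto simp: cosets_met_def gsum_def)
  moreover have "cosets_met H K \<subseteq> cosets_met (gsum H K) K"
    unfolding cosets_met_def by (rule image_mono) (use gsum_left[OF assms] in blast)
  ultimately show ?thesis by blast
qed

text \<open>An element is determined modulo \<open>L\<close> by its coset modulo \<open>K\<close>
  together with the coset modulo \<open>L\<close> of what remains after subtracting the chosen
  representative.\<close>

lemma tower_le:
  assumes "subgp K" "subgp L" "fin_ix H K" "fin_ix K L"
  shows "fin_ix H L" "ix H L \<le> ix H K * ix K L"
proof -
  let ?f = "\<lambda>x. (coset K x, coset L (x - crep H K (coset K x)))"
  have 1: "?f ` H \<subseteq> cosets_met H K \<times> cosets_met K L"
    using crep_diff[OF assms(1)] by (auto simp: cosets_met_def)
  have 2: "x - y \<in> L" if "x \<in> H" "y \<in> H" "?f x = ?f y" for x y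
  proof -
    define r where "r = crep H K (coset K y)"
    have e: "coset K x = coset K y" "coset L (x - crep H K (coset K x)) = coset L (y - r)"
      using that(3) unfolding prod.inject r_def by blast+
    have "coset L (x - r) = coset L (y - r)" using e(2) unfolding e(1) r_def .
    then have "(x - r) - (y - r) \<in> L" using coset_eq_iff[OF assms(2)] by blast
    then show ?thesis by simp
  qed
  have fS: "finite (cosets_met H K \<times> cosets_met K L)" using assms(3,4) by simp
  show "fin_ix H L" by (rule ix_le_inj(1)[OF assms(2) fS 1 2])
  show "ix H L \<le> ix H K * ix K L"
    unfolding ix_def[of H K] ix_def[of K L] card_cartesian_product[symmetric]
    by (rule ix_le_inj(2)[OF assms(2) fS 1 2])
qed

text \<open>Sums of a representative modulo \<open>Y\<close> and a representative modulo
  \<open>L\<close> are pairwise incongruent modulo \<open>L\<close>, because \<open>A\<close> and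
  \<open>L\<close> vanish modulo \<open>Y\<close>. This multiplies the lower bounds for spans in
  \<open>upper_claim_step\<close>.\<close>

lemma tower_ge:
  assumes "subgp Y" "subgp L" "fin_ix C L" "A \<subseteq> Y" "L \<subseteq> Y"
    "\<And>a b. a \<in> A \<Longrightarrow> b \<in> B \<Longrightarrow> b + a \<in> C"
  shows "ix B Y * ix A L \<le> ix C L"
proof -
  let ?S = "cosets_met B Y \<times> cosets_met A L"
  let ?f = "\<lambda>(c, d). crep B Y c + crep A L d"
  have 1: "?f ` ?S \<subseteq> C" using assms(6) by (auto dest: crep)
  have 2: "s = t" if s: "s \<in> ?S" and t: "t \<in> ?S" and d: "?f s - ?f t \<in> L" for s t
  proof -
    obtain c d c' d' where [simp]: "s = (c, d)" "t = (c', d')" by fastforce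
    have m: "c \<in> cosets_met B Y" "c' \<in> cosets_met B Y" "d \<in> cosets_met A L" "d' \<in> cosets_met A L"
      using s t by auto
    have a: "crep A L d \<in> Y" "crep A L d' \<in> Y" using m crep assms(4) by blast+
    have "crep B Y c - crep B Y c' = (?f s - ?f t) - (crep A L d - crep A L d')" by simp
    also have "\<dots> \<in> Y" using a d assms by (meson subgp_diff subsetD)
    finally have "c = c'" using crep_inj[OF assms(1)] m by blast
    then have "d = d'" using d crep_inj[OF assms(2)] m by auto
    with \<open>c = c'\<close> show ?thesis by simp
  qed
  show ?thesis using ix_ge_inj(2)[OF assms(2,3) 1 2] by (simp add: ix_def card_cartesian_product)
qed

lemma tower_eq:
  assumes "subgp H" "subgp K" "subgp L" "L \<subseteq> K" "K \<subseteq> H" "fin_ix H L"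
  shows "ix H L = ix H K * ix K L"
proof (rule antisym)
  have "fin_ix H K" by (rule ix_mono(1)[OF assms(2,3,6) subset_refl assms(4)])
  moreover have "fin_ix K L" by (rule ix_mono(1)[OF assms(3,3,6,5) subset_refl])
  ultimately show "ix H L \<le> ix H K * ix K L" by (rule tower_le(2)[OF assms(2,3)])
  show "ix H K * ix K L \<le> ix H L"
    by (rule tower_ge[OF assms(2,3,6) subset_refl assms(4)]) (meson assms(1,5) subgp_add subsetD)
qed

text \<open>The isomorphism theorem for the map that \<open>f\<close> induces from H/K into the
  quotient by \<open>L\<close>: the order is that of the image times that of the kernel.\<close>

lemma hom_count:
  assumes "subgp H" "subgp K" "subgp L" "fin_ix H K"
    and add: "\<And>x y. x \<in> H \<Longrightarrow> y \<in> H \<Longrightarrow> f (x - y) = f x - f y"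
    and K: "K \<subseteq> {x\<in>H. f x \<in> L}"
  shows "ix H K = ix (f ` H) L * ix {x\<in>H. f x \<in> L} K" "fin_ix (f ` H) L"
    "fin_ix {x\<in>H. f x \<in> L} K"
proof -
  let ?N = "{x\<in>H. f x \<in> L}"
  have f0: "f 0 = 0" using add[of 0 0] subgp_0[OF assms(1)] by simp
  have N: "subgp ?N"
    using subgp_0[OF assms(1)] subgp_0[OF assms(3)] f0 subgp_diff[OF assms(1)] subgp_diff[OF assms(3)] add
    by (simp add: subgp_def)
  have fN: "fin_ix H ?N" by (rule ix_mono[OF N assms(2,4)]) (use K in auto)
  show "fin_ix ?N K" by (rule ix_mono[OF assms(2,2,4)]) auto
  define g where "g y = (SOME x. x \<in> H \<and> f x = y)" for y
  have g: "g y \<in> H" "f (g y) = y" if "y \<in> f ` H" for y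
  proof -
    have "\<exists>x. x \<in> H \<and> f x = y" using that by blast
    from someI_ex[OF this] show "g y \<in> H" "f (g y) = y" by (auto simp: g_def)
  qed
  have *: "fin_ix (f ` H) L" "ix (f ` H) L \<le> ix H ?N"
  proof -
    have d: "y - y' \<in> L" if "y \<in> f ` H" "y' \<in> f ` H" "g y - g y' \<in> ?N" for y y'
    proof -
      have "f (g y - g y') = y - y'" using add[OF g(1) g(1), OF that(1,2)] g(2) that(1,2) by simp
      with that(3) show ?thesis by simp
    qed
    have gH: "g ` f ` H \<subseteq> H" using g(1) by blast
    show "fin_ix (f ` H) L" "ix (f ` H) L \<le> ix H ?N"
      using ix_le_map[OF assms(3) N fN gH d] by blast+
  qed
  moreover have "ix H ?N \<le> ix (f ` H) L"
  proof (rule ix_le_map(2)[OF N assms(3) *(1) subset_refl])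
    fix x y assume "x \<in> H" "y \<in> H" "f x - f y \<in> L"
    then show "x - y \<in> ?N" using add[of x y] subgp_diff[OF assms(1)] by simp
  qed
  ultimately have "ix H ?N = ix (f ` H) L" by simp
  with tower_eq[OF assms(1) N assms(2) K _ assms(4)] show "ix H K = ix (f ` H) L * ix ?N K" by auto
  show "fin_ix (f ` H) L" by (rule *)
qed

lemma ix_Times:
  assumes "subgp K" "subgp L"
  shows "ix (G \<times> H) (K \<times> L) = ix G K * ix H L"
    "fin_ix G K \<Longrightarrow> fin_ix H L \<Longrightarrow> fin_ix (G \<times> H) (K \<times> L)"
proof -
  have c: "coset (K \<times> L) (x, y) = coset K x \<times> coset L y" for x y
    by (auto simp: coset_def)
  have ne: "coset K x \<noteq> {}" "coset L y \<noteq> {}" for x y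
  proof -
    have "x \<in> coset K x" "y \<in> coset L y" using assms subgp_0 by (auto simp: coset_def)
    then show "coset K x \<noteq> {}" "coset L y \<noteq> {}" by blast+
  qed
  have e: "cosets_met (G \<times> H) (K \<times> L) = (\<lambda>(c, d). c \<times> d) ` (cosets_met G K \<times> cosets_met H L)"
  proof (intro equalityI subsetI)
    fix C assume "C \<in> cosets_met (G \<times> H) (K \<times> L)"
    then obtain x y where "x \<in> G" "y \<in> H" "C = coset K x \<times> coset L y"
      unfolding cosets_met_def using c by blast
    then show "C \<in> (\<lambda>(c, d). c \<times> d) ` (cosets_met G K \<times> cosets_met H L)"
      by (intro image_eqI[of _ _ "(coset K x, coset L y)"]) (simp_all add: cosets_met_def)
  next
    fix C assume "C \<in> (\<lambda>(c, d). c \<times> d) ` (cosets_met G K \<times> cosets_met H L)"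
    then obtain x y where "x \<in> G" "y \<in> H" "C = coset K x \<times> coset L y"
      unfolding cosets_met_def by auto
    then show "C \<in> cosets_met (G \<times> H) (K \<times> L)"
      unfolding cosets_met_def by (intro image_eqI[of _ _ "(x, y)"]) (simp_all add: c)
  qed
  have inj: "inj_on (\<lambda>(c, d). c \<times> d) (cosets_met G K \<times> cosets_met H L)"
  proof (rule inj_onI)
    fix p q assume "p \<in> cosets_met G K \<times> cosets_met H L" "q \<in> cosets_met G K \<times> cosets_met H L"
      and *: "(case p of (c, d) \<Rightarrow> c \<times> d) = (case q of (c, d) \<Rightarrow> c \<times> d)"
    then obtain x y x' y' where "p = (coset K x, coset L y)" "q = (coset K x', coset L y')"
      unfolding cosets_met_def by auto
    with * show "p = q" using ne(1)[of x] ne(2)[of y] ne(1)[of x'] ne(2)[of y'] by (simp add: times_eq_iff)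
  qed
  show "ix (G \<times> H) (K \<times> L) = ix G K * ix H L"
    unfolding ix_def e card_image[OF inj] by (simp add: card_cartesian_product)
  show "fin_ix G K \<Longrightarrow> fin_ix H L \<Longrightarrow> fin_ix (G \<times> H) (K \<times> L)" unfolding e by auto
qed

text \<open>The Euler characteristic of the Koszul complex of two commuting operators, with the homology written
  as indices so that no subtraction or division occurs.\<close>

lemma koszul_count:
  fixes \<sigma> \<tau> :: "'g::ab_group_add \<Rightarrow> 'g"
  assumes sub: "subgp L" "subgp G10" "subgp G01" "subgp G11"
    and L: "L \<subseteq> G10" "L \<subseteq> G01" "L \<subseteq> G11"
    and fin: "fin_ix G10 L" "fin_ix G01 L" "fin_ix G11 L"
    and hom: "\<And>x y. \<sigma> (x - y) = \<sigma> x - \<sigma> y" "\<And>x y. \<tau> (x - y) = \<tau> x - \<tau> y"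
    and maps: "\<tau> ` G10 \<subseteq> G11" "\<sigma> ` G01 \<subseteq> G11" "\<sigma> ` L \<subseteq> L" "\<tau> ` L \<subseteq> L"
  defines "Imk \<equiv> gsum (gsum (\<tau> ` G10) (\<sigma> ` G01)) L"
    and "Ker \<equiv> {p \<in> G10 \<times> G01. \<tau> (fst p) + \<sigma> (snd p) \<in> L}"
  shows "ix G11 Imk * (ix G10 L * ix G01 L) = ix G11 L * ix Ker (L \<times> L)"
    "fin_ix Ker (L \<times> L)" "subgp Imk" "fin_ix G11 Imk"
proof -
  let ?f = "\<lambda>p. \<tau> (fst p) + \<sigma> (snd p)"
  have add: "?f (p - q) = ?f p - ?f q" for p q by (simp add: hom algebra_simps)
  have image: "?f ` (G10 \<times> G01) = gsum (\<tau> ` G10) (\<sigma> ` G01)"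
  proof (intro equalityI subsetI)
    fix z assume "z \<in> ?f ` (G10 \<times> G01)"
    then show "z \<in> gsum (\<tau> ` G10) (\<sigma> ` G01)" by (auto intro!: gsumI)
  next
    fix z assume "z \<in> gsum (\<tau> ` G10) (\<sigma> ` G01)"
    then obtain x y where "x \<in> G10" "y \<in> G01" "z = \<tau> x + \<sigma> y" by (auto simp: gsum_def)
    then show "z \<in> ?f ` (G10 \<times> G01)" by (intro image_eqI[of _ _ "(x, y)"]) auto
  qed
  have H: "subgp (G10 \<times> G01)" "subgp (L \<times> L)" using sub by (auto intro: subgp_Times)
  have sG: "subgp (gsum (\<tau> ` G10) (\<sigma> ` G01))"
    using subgp_image[OF H(1) add] unfolding image .
  show sIm: "subgp Imk" unfolding Imk_def by (rule subgp_gsum[OF sG sub(1)])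
  have fH: "fin_ix (G10 \<times> G01) (L \<times> L)" using ix_Times(2) sub fin by blast
  have sub2: "L \<times> L \<subseteq> {p \<in> G10 \<times> G01. ?f p \<in> L}"
  proof
    fix p assume p: "p \<in> L \<times> L"
    then have "\<tau> (fst p) \<in> L" "\<sigma> (snd p) \<in> L" using maps(3,4) by (simp_all add: mem_Times_iff image_subset_iff)
    then have "?f p \<in> L" by (rule subgp_add[OF sub(1)])
    with p L(1,2) show "p \<in> {p \<in> G10 \<times> G01. ?f p \<in> L}" by (simp add: mem_Times_iff subset_iff)
  qed
  note hc = hom_count[OF H sub(1) fH, of ?f, OF add sub2]
  have LI: "L \<subseteq> Imk" unfolding Imk_def using gsum_right[OF sG] by blast
  have IG: "Imk \<subseteq> G11" unfolding Imk_def by (intro gsum_subset sub(4) maps(1,2) L(3))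
  have "ix G11 L = ix G11 Imk * ix Imk L" by (rule tower_eq[OF sub(4) sIm sub(1) LI IG fin(3)])
  moreover have "ix Imk L = ix (?f ` (G10 \<times> G01)) L"
    unfolding Imk_def image ix_def ix_gsum_right[OF sub(1)] ..
  ultimately show "ix G11 Imk * (ix G10 L * ix G01 L) = ix G11 L * ix Ker (L \<times> L)"
    using hc(1) unfolding ix_Times(1)[OF sub(1) sub(1)] Ker_def by (simp only: mult.assoc)
  show "fin_ix Ker (L \<times> L)" unfolding Ker_def by (rule hc(3))
  show "fin_ix G11 Imk" by (rule ix_mono(1)[OF sIm sub(1) fin(3) subset_refl LI])
qed


subsection \<open>Modules over the group ring of the plane lattice\<close>

text \<open>An injective additive functional: every nonempty finite set of exponents has a unique leading element.\<close>

definition phi :: "int \<times> int \<Rightarrow> real" where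
  "phi m = of_int (fst m) + sqrt 2 * of_int (snd m)"

lemma phi_add: "phi (m + n) = phi m + phi n"
  and phi_minus: "phi (- m) = - phi m"
  and phi_diff: "phi (m - n) = phi m - phi n"
  and phi_0: "phi 0 = 0"
  by (simp_all add: phi_def algebra_simps)

text \<open>Infinite descent: both entries of a solution are even, and halving them gives a smaller
  one. This is the irrationality of the square root of 2, which makes \<open>phi\<close>
  injective.\<close>

lemma two_square_nat: "(a::nat) * a = 2 * (b * b) \<Longrightarrow> b = 0"
proof (induction b arbitrary: a rule: less_induct)
  case (less b)
  have "even (a * a)" using less.prems by simp
  then obtain c where c: "a = 2 * c" by (auto elim: evenE)
  then have "b * b = 2 * (c * c)" using less.prems by simp
  then have "even (b * b)" by simp
  then obtain d where d: "b = 2 * d" by (auto elim: evenE)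
  have "c * c = 2 * (d * d)" using \<open>b * b = 2 * (c * c)\<close> d by simp
  then have "b \<noteq> 0 \<Longrightarrow> d = 0" using less.IH[of d c] d by simp
  then show ?case using d by auto
qed

lemma phi_eq_0: assumes "phi m = 0" shows "m = 0"
proof -
  obtain a b where m: "m = (a, b)" by fastforce
  have "real_of_int a = - sqrt 2 * real_of_int b" using assms m by (simp add: phi_def)
  then have "real_of_int a * real_of_int a = (- sqrt 2 * real_of_int b) * (- sqrt 2 * real_of_int b)"
    by simp
  also have "\<dots> = 2 * (real_of_int b * real_of_int b)" by (simp add: algebra_simps)
  finally have "real_of_int (a * a) = real_of_int (2 * (b * b))" by simp
  then have "a * a = 2 * (b * b)" by linarith
  then have "\<bar>a\<bar> * \<bar>a\<bar> = 2 * (\<bar>b\<bar> * \<bar>b\<bar>)" by (simp add: abs_mult[symmetric])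
  then have "nat \<bar>a\<bar> * nat \<bar>a\<bar> = 2 * (nat \<bar>b\<bar> * nat \<bar>b\<bar>)"
    by (metis abs_ge_zero nat_mult_distrib nat_numeral zero_le_numeral)
  then have "b = 0" using two_square_nat by fastforce
  with \<open>a * a = 2 * (b * b)\<close> m show ?thesis by (simp add: zero_prod_def)
qed

lemma phi_inj: "phi m = phi n \<Longrightarrow> m = n"
  using phi_eq_0[of "m - n"] by (simp add: phi_diff)

section \<open>Multiples, and cyclic subgroups generated by torsion elements\<close>

primrec nm :: "nat \<Rightarrow> 'g::ab_group_add \<Rightarrow> 'g" where
  "nm 0 x = 0"
| "nm (Suc k) x = nm k x + x"

lemma nm_add: "nm (j + k) x = nm j x + nm k x"
  by (induction k) (simp_all add: algebra_simps)

lemma nm_zero: "nm k 0 = 0"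
  by (induction k) simp_all

lemma nm_mult: "nm (j * k) x = nm j (nm k x)"
  by (induction j) (simp_all add: nm_add algebra_simps)

lemma nm_diff: "nm k (x - y) = nm k x - nm k y"
  by (induction k) (simp_all add: algebra_simps)

lemma nm_in: "subgp H \<Longrightarrow> x \<in> H \<Longrightarrow> nm k x \<in> H"
  by (induction k) (simp_all add: subgp_0 subgp_add)

lemma nm_sub: "j \<le> k \<Longrightarrow> nm (k - j) x = nm k x - nm j x"
  using nm_add[of "k - j" j x] by (simp add: algebra_simps)

text \<open>Only natural multiples are listed; for a torsion element they already contain the
  negatives, so this is the cyclic subgroup generated by \<open>x\<close>.\<close>

definition cyc :: "'g::ab_group_add \<Rightarrow> 'g set" where
  "cyc x = range (\<lambda>k. nm k x)"

lemma cyc_self: "x \<in> cyc x"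
  unfolding cyc_def by (rule image_eqI[of _ _ 1]) simp_all

lemma cyc_subset: "subgp H \<Longrightarrow> x \<in> H \<Longrightarrow> cyc x \<subseteq> H"
  unfolding cyc_def using nm_in by blast

lemma
  assumes n: "n > 0" "nm n x = 0"
  shows finite_cyc: "finite (cyc x)" and subgp_cyc: "subgp (cyc x)"
proof -
  have z: "nm (k * n) x = 0" for k using nm_mult[of k n x] n by (simp add: nm_zero)
  have "nm k x = nm (k mod n) x" for k
    using nm_add[of "k div n * n" "k mod n" x] z by simp
  then have "cyc x \<subseteq> (\<lambda>k. nm k x) ` {..<n}" unfolding cyc_def using n(1) by force
  then show "finite (cyc x)" by (rule finite_subset) simp
  show "subgp (cyc x)"
  proof (rule subgpI)
    show "0 \<in> cyc x" unfolding cyc_def by (rule image_eqI[of _ _ 0]) simp_all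
    fix a b assume "a \<in> cyc x" "b \<in> cyc x"
    then obtain i j where a: "a = nm i x" and b: "b = nm j x" unfolding cyc_def by blast
    have "j \<le> i + j * n" using n(1) by (simp add: trans_le_add2)
    then have "nm (i + j * n - j) x = a - b" using nm_sub[of j "i + j * n" x] z a b by (simp add: nm_add)
    then show "a - b \<in> cyc x" unfolding cyc_def by (metis rangeI)
  qed
qed

section \<open>Submodules, group ring operators and spans of translates\<close>

locale z2_module =
  fixes u :: "int \<times> int \<Rightarrow> 'g::ab_group_add \<Rightarrow> 'g"
  assumes u_diff: "u n (x - y) = u n x - u n y"
    and u_id: "u 0 x = x"
    and u_plus: "u (m + n) x = u m (u n x)"
begin

lemma u_zero: "u n 0 = 0" using u_diff[of n 0 0] by simp
lemma u_minus: "u n (- x) = - u n x" using u_diff[of n 0 x] by (simp add: u_zero)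
lemma u_add: "u n (x + y) = u n x + u n y" using u_diff[of n x "- y"] by (simp add: u_minus)
lemma u_sum: "u n (sum f I) = (\<Sum>i\<in>I. u n (f i))"
  by (induction I rule: infinite_finite_induct) (simp_all add: u_zero u_add)
lemma u_comm: "u m (u n x) = u n (u m x)" by (metis add.commute u_plus)
lemma u_inv: "u (- n) (u n x) = x" "u n (u (- n) x) = x"
  using u_plus[of "- n" n x] u_plus[of n "- n" x] by (simp_all add: u_id)
lemma u_nm: "u n (nm k x) = nm k (u n x)"
  by (induction k) (simp_all add: u_zero u_add)
lemma u_inj: "u n x = u n y \<Longrightarrow> x = y" by (metis u_inv(1))

definition submod :: "'g set \<Rightarrow> bool" where
  "submod H \<longleftrightarrow> subgp H \<and> (\<forall>n. \<forall>x\<in>H. u n x \<in> H)"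

lemma submodI: "subgp H \<Longrightarrow> (\<And>n x. x \<in> H \<Longrightarrow> u n x \<in> H) \<Longrightarrow> submod H"
  unfolding submod_def by blast
lemma submod_subgp: "submod H \<Longrightarrow> subgp H" by (simp add: submod_def)
lemma submod_u: "submod H \<Longrightarrow> x \<in> H \<Longrightarrow> u n x \<in> H" unfolding submod_def by blast
lemma submod_gsum:
  assumes "submod H" "submod K" shows "submod (gsum H K)"
proof (rule submodI)
  show "subgp (gsum H K)" using assms by (intro subgp_gsum submod_subgp)
  fix n x assume "x \<in> gsum H K"
  then obtain a b where "a \<in> H" "b \<in> K" "x = a + b" by (auto simp: gsum_def)
  then show "u n x \<in> gsum H K" using assms by (simp add: u_add gsumI submod_u)
qed

text \<open>Operators of group ring elements with support in \<open>W\<close>, built monomial by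
  monomial with coefficients 1 and -1, so that repeated monomials give arbitrary integer
  coefficients. The operators themselves are the objects, and different polynomials may give the
  same one.\<close>

inductive_set Op :: "(int \<times> int) set \<Rightarrow> ('g \<Rightarrow> 'g) set" for W where
  Op_zero: "(\<lambda>x. 0) \<in> Op W"
| Op_snoc: "T \<in> Op W \<Longrightarrow> m \<in> W \<Longrightarrow> (\<lambda>x. T x + u m x) \<in> Op W"
| Op_snoc': "T \<in> Op W \<Longrightarrow> m \<in> W \<Longrightarrow> (\<lambda>x. T x - u m x) \<in> Op W"

lemma Op_diff: "T \<in> Op W \<Longrightarrow> T (x - y) = T x - T y"
  by (induction rule: Op.induct) (simp_all add: u_diff)

lemma Op_0: "T \<in> Op W \<Longrightarrow> T 0 = 0"
  using Op_diff[of T W 0 0] by simp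

lemma Op_add: "T \<in> Op W \<Longrightarrow> T (x + y) = T x + T y"
  using Op_diff[of T W x "- y"] Op_diff[of T W 0 y] Op_0[of T W] by simp

lemma Op_u: "T \<in> Op W \<Longrightarrow> T (u n x) = u n (T x)"
  by (induction rule: Op.induct) (simp_all add: u_diff u_add u_zero u_comm[of n])

lemma Op_closed: "T \<in> Op W \<Longrightarrow> submod H \<Longrightarrow> x \<in> H \<Longrightarrow> T x \<in> H"
  by (induction rule: Op.induct) (simp_all add: subgp_0 subgp_add subgp_diff submod_subgp submod_u)

lemma Op_mono: "T \<in> Op W \<Longrightarrow> W \<subseteq> W' \<Longrightarrow> T \<in> Op W'"
  by (induction rule: Op.induct) (blast intro: Op.intros)+

lemma Op_plus: "T' \<in> Op W \<Longrightarrow> T \<in> Op W \<Longrightarrow> (\<lambda>x. T x + T' x) \<in> Op W"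
proof (induction rule: Op.induct)
  case (Op_snoc T' m)
  have "(\<lambda>x. (T x + T' x) + u m x) \<in> Op W" using Op_snoc by (intro Op.Op_snoc) simp_all
  then show ?case by (simp add: add.assoc)
next
  case (Op_snoc' T' m)
  have "(\<lambda>x. (T x + T' x) - u m x) \<in> Op W" using Op_snoc' by (intro Op.Op_snoc') simp_all
  then show ?case by (simp add: algebra_simps)
qed simp

lemma Op_uminus: "T \<in> Op W \<Longrightarrow> (\<lambda>x. - T x) \<in> Op W"
proof (induction rule: Op.induct)
  case (Op_snoc T m)
  have "(\<lambda>x. - T x - u m x) \<in> Op W" using Op_snoc by (intro Op.Op_snoc') simp_all
  then show ?case by simp
next
  case (Op_snoc' T m)
  have "(\<lambda>x. - T x + u m x) \<in> Op W" using Op_snoc' by (intro Op.Op_snoc) simp_all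
  then show ?case by simp
qed (simp add: Op.Op_zero)

lemma Op_shift: "T \<in> Op W \<Longrightarrow> (\<And>m. m \<in> W \<Longrightarrow> n + m \<in> W') \<Longrightarrow> (\<lambda>x. u n (T x)) \<in> Op W'"
proof (induction rule: Op.induct)
  case Op_zero
  then show ?case by (simp add: u_zero Op.Op_zero)
next
  case (Op_snoc T m)
  have "(\<lambda>x. u n (T x) + u (n + m) x) \<in> Op W'" using Op_snoc by (intro Op.Op_snoc) simp_all
  then show ?case by (simp add: u_add u_plus)
next
  case (Op_snoc' T m)
  have "(\<lambda>x. u n (T x) - u (n + m) x) \<in> Op W'" using Op_snoc' by (intro Op.Op_snoc') simp_all
  then show ?case by (simp add: u_diff u_plus)
qed

lemma Op_comp:
  "T \<in> Op W \<Longrightarrow> T' \<in> Op W' \<Longrightarrow> (\<And>m n. m \<in> W \<Longrightarrow> n \<in> W' \<Longrightarrow> m + n \<in> W'') \<Longrightarrow>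
    (\<lambda>x. T (T' x)) \<in> Op W''"
proof (induction rule: Op.induct)
  case Op_zero
  then show ?case by (simp add: Op.Op_zero)
next
  case (Op_snoc T m)
  have "(\<lambda>x. u m (T' x)) \<in> Op W''" using Op_snoc by (intro Op_shift[of T' W']) simp_all
  then show ?case using Op_plus[of _ W'' "\<lambda>x. T (T' x)"] Op_snoc by simp
next
  case (Op_snoc' T m)
  have "(\<lambda>x. u m (T' x)) \<in> Op W''" using Op_snoc' by (intro Op_shift[of T' W']) simp_all
  then have "(\<lambda>x. - u m (T' x)) \<in> Op W''" by (rule Op_uminus)
  then show ?case using Op_plus[of "\<lambda>x. - u m (T' x)" W'' "\<lambda>x. T (T' x)"] Op_snoc' by simp
qed

lemma Op_commute: "T \<in> Op W \<Longrightarrow> T' \<in> Op W' \<Longrightarrow> T (T' x) = T' (T x)"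
  by (induction rule: Op.induct) (simp_all add: Op_0 Op_add Op_diff Op_u)

lemma Op_finite: "T \<in> Op W \<Longrightarrow> \<exists>V. finite V \<and> V \<subseteq> W \<and> T \<in> Op V"
proof (induction rule: Op.induct)
  case Op_zero
  then show ?case by (intro exI[of _ "{}"]) (simp add: Op.Op_zero)
next
  case (Op_snoc T m)
  then obtain V where V: "finite V" "V \<subseteq> W" "T \<in> Op V" by blast
  have "T \<in> Op (insert m V)" by (rule Op_mono[OF V(3)]) blast
  then show ?case using V Op_snoc.hyps
    by (intro exI[of _ "insert m V"]) (simp add: Op.Op_snoc)
next
  case (Op_snoc' T m)
  then obtain V where V: "finite V" "V \<subseteq> W" "T \<in> Op V" by blast
  have "T \<in> Op (insert m V)" by (rule Op_mono[OF V(3)]) blast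
  then show ?case using V Op_snoc'.hyps
    by (intro exI[of _ "insert m V"]) (simp add: Op.Op_snoc')
qed

lemma u_Op: "m \<in> W \<Longrightarrow> u m \<in> Op W"
  using Op.Op_snoc[OF Op.Op_zero, of m W] by simp

lemma nm_Op: "T \<in> Op W \<Longrightarrow> (\<lambda>x. nm k (T x)) \<in> Op W"
  by (induction k) (simp_all add: Op.Op_zero Op_plus)

abbreviation neg :: "(int \<times> int) set" where "neg \<equiv> {m. phi m < 0}"

text \<open>The operators with leading exponent \<open>0\<close> and leading coefficient \<open>1\<close>.\<close>

definition mon :: "('g \<Rightarrow> 'g) set" where
  "mon = {g. \<exists>T\<in>Op neg. g = (\<lambda>x. x + T x)}"

lemma monI: "T \<in> Op neg \<Longrightarrow> (\<lambda>x. x + T x) \<in> mon" by (auto simp: mon_def)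

lemma mon_id: "(\<lambda>x. x) \<in> mon" using monI[OF Op.Op_zero] by simp

lemma mon_Op: "g \<in> mon \<Longrightarrow> g \<in> Op UNIV"
proof -
  assume "g \<in> mon"
  then obtain T where T: "T \<in> Op neg" and g: "g = (\<lambda>x. x + T x)" by (auto simp: mon_def)
  have "T \<in> Op UNIV" by (rule Op_mono[OF T]) simp
  then show ?thesis using Op_plus[OF _ u_Op[of 0 UNIV], of T] g by (simp add: u_id)
qed

lemma mon_comp: "g \<in> mon \<Longrightarrow> g' \<in> mon \<Longrightarrow> (\<lambda>x. g (g' x)) \<in> mon"
proof -
  assume "g \<in> mon" "g' \<in> mon"
  then obtain T T' where T: "T \<in> Op neg" "T' \<in> Op neg"
    and g: "g = (\<lambda>x. x + T x)" "g' = (\<lambda>x. x + T' x)" by (auto simp: mon_def)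
  have "(\<lambda>x. T (T' x)) \<in> Op neg" by (rule Op_comp[OF T]) (simp add: phi_add)
  then have "(\<lambda>x. (T' x + T x) + T (T' x)) \<in> Op neg" by (intro Op_plus T)
  from monI[OF this] show ?thesis by (simp add: g Op_add[OF T(1)] add.assoc)
qed

lemma mon_one_minus: "phi m < 0 \<Longrightarrow> (\<lambda>x. x - u m x) \<in> mon"
  using monI[OF Op.Op_snoc'[OF Op.Op_zero, of m neg]] by simp

text \<open>For a finite \<open>W\<close> and a subgroup \<open>F\<close> this is the subgroup
  generated by the translates of \<open>F\<close>. A sum over an infinite index set is 0 by
  convention, so \<open>W\<close> is kept finite where it matters and \<open>gen\<close> is a union
  over finite sets.\<close>

definition sp :: "(int \<times> int) set \<Rightarrow> 'g set \<Rightarrow> 'g set" where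
  "sp W F = (\<lambda>f. \<Sum>n\<in>W. u n (f n)) ` {f. \<forall>n\<in>W. f n \<in> F}"

lemma spE:
  assumes "x \<in> sp W F" obtains f where "\<forall>n\<in>W. f n \<in> F" "x = (\<Sum>n\<in>W. u n (f n))"
  using assms unfolding sp_def by blast

lemma spI: "(\<And>n. n \<in> W \<Longrightarrow> f n \<in> F) \<Longrightarrow> (\<Sum>n\<in>W. u n (f n)) \<in> sp W F"
  unfolding sp_def by blast

lemma sp_subset:
  assumes "subgp H" "\<And>m x. m \<in> W \<Longrightarrow> x \<in> F \<Longrightarrow> u m x \<in> H" shows "sp W F \<subseteq> H"
proof
  fix x assume "x \<in> sp W F"
  then obtain f where f: "\<forall>n\<in>W. f n \<in> F" "x = (\<Sum>n\<in>W. u n (f n))" by (rule spE)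
  show "x \<in> H" unfolding f(2) by (rule subgp_sum[OF assms(1)]) (use assms(2) f(1) in blast)
qed

lemma subgp_sp:
  assumes "subgp F" shows "subgp (sp W F)"
proof (rule subgpI)
  have "(\<Sum>n\<in>W. u n 0) \<in> sp W F" by (rule spI) (rule subgp_0[OF assms])
  then show "0 \<in> sp W F" by (simp add: u_zero)
  fix x y assume x: "x \<in> sp W F" and y: "y \<in> sp W F"
  obtain f where f: "\<forall>n\<in>W. f n \<in> F" "x = (\<Sum>n\<in>W. u n (f n))" using x by (rule spE)
  obtain g where g: "\<forall>n\<in>W. g n \<in> F" "y = (\<Sum>n\<in>W. u n (g n))" using y by (rule spE)
  have "x - y = (\<Sum>n\<in>W. u n (f n - g n))" by (simp add: f(2) g(2) u_diff sum_subtractf)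
  also have "\<dots> \<in> sp W F" by (rule spI) (use f(1) g(1) subgp_diff[OF assms] in blast)
  finally show "x - y \<in> sp W F" .
qed

lemma u_in_sp:
  assumes "finite W" "0 \<in> F" "m \<in> W" "x \<in> F" shows "u m x \<in> sp W F"
proof -
  have "(\<Sum>n\<in>W. u n (if n = m then x else 0)) = (\<Sum>n\<in>W. if n = m then u m x else 0)"
    by (rule sum.cong) (simp_all add: u_zero)
  also have "\<dots> = u m x" using assms by simp
  finally show ?thesis using spI[of W "\<lambda>n. if n = m then x else 0" F] assms by metis
qed

lemma sp_subset_sp:
  assumes "subgp F'" "finite W'" "W \<subseteq> W'" "F \<subseteq> F'" shows "sp W F \<subseteq> sp W' F'"
  using assms subgp_0[OF assms(1)] by (intro sp_subset subgp_sp u_in_sp) auto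

lemma sp_Un_subset:
  assumes "subgp F" "finite W" "finite W'"
  shows "sp (W \<union> W') F \<subseteq> gsum (sp W F) (sp W' F)"
proof (rule sp_subset)
  show "subgp (gsum (sp W F) (sp W' F))" by (intro subgp_gsum subgp_sp assms)
  fix m x assume m: "m \<in> W \<union> W'" and x: "x \<in> F"
  show "u m x \<in> gsum (sp W F) (sp W' F)"
  proof (cases "m \<in> W")
    case True
    show ?thesis
      by (rule gsum_left[OF subgp_sp[OF assms(1)] u_in_sp[OF assms(2) subgp_0[OF assms(1)] True x]])
  next
    case False
    with m have "m \<in> W'" by blast
    show ?thesis
      by (rule gsum_right[OF subgp_sp[OF assms(1)] u_in_sp[OF assms(3) subgp_0[OF assms(1)] \<open>m \<in> W'\<close> x]])
  qed
qed

lemma sp_empty: "sp {} F = {0}" by (auto simp: sp_def)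

lemma finite_gsum: "finite H \<Longrightarrow> finite K \<Longrightarrow> finite (gsum H K)"
  and card_gsum: "finite H \<Longrightarrow> finite K \<Longrightarrow> card (gsum H K) \<le> card H * card K"
  for H K :: "'g set"
proof -
  have e: "gsum H K = (\<lambda>(x, y). x + y) ` (H \<times> K)" for H K :: "'g set" by (force simp: gsum_def)
  show "finite H \<Longrightarrow> finite K \<Longrightarrow> finite (gsum H K)" by (simp add: e)
  show "finite H \<Longrightarrow> finite K \<Longrightarrow> card (gsum H K) \<le> card H * card K"
    using card_image_le[of "H \<times> K" "\<lambda>(x, y). x + y"] by (simp add: e card_cartesian_product)
qed

lemma sp_image: "u n ` sp W F = sp ((+) n ` W) F"
proof -
  have inj: "inj_on ((+) n) W" by simp
  have 1: "u n (\<Sum>m\<in>W. u m (f m)) = (\<Sum>m\<in>(+) n ` W. u m (f (m - n)))" for f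
    by (simp add: sum.reindex[OF inj] u_sum u_plus)
  show ?thesis
  proof (intro equalityI subsetI)
    fix x assume "x \<in> u n ` sp W F"
    then obtain f where f: "\<forall>n\<in>W. f n \<in> F" "x = u n (\<Sum>m\<in>W. u m (f m))"
      by (elim imageE spE) blast
    show "x \<in> sp ((+) n ` W) F" unfolding f(2) 1 by (rule spI) (use f(1) in auto)
  next
    fix x assume x: "x \<in> sp ((+) n ` W) F"
    obtain f where f: "\<forall>m\<in>(+) n ` W. f m \<in> F" "x = (\<Sum>m\<in>(+) n ` W. u m (f m))"
      using x by (rule spE)
    have "x = u n (\<Sum>m\<in>W. u m (f (n + m)))" unfolding 1 f(2) by simp
    moreover have "(\<Sum>m\<in>W. u m (f (n + m))) \<in> sp W F" by (rule spI) (use f(1) in auto)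
    ultimately show "x \<in> u n ` sp W F" by blast
  qed
qed

lemma card_sp_shift: "card (sp ((+) n ` W) F) = card (sp W F)"
  unfolding sp_image[symmetric] by (rule card_image) (auto intro!: inj_onI dest: u_inj)

lemma
  assumes "subgp F" "finite F" "finite W"
  shows finite_sp: "finite (sp W F)" and card_sp_le: "card (sp W F) \<le> card F ^ card W"
proof -
  have "finite (sp W F) \<and> card (sp W F) \<le> card F ^ card W"
    using assms(3)
  proof (induction W rule: finite_induct)
    case empty
    then show ?case by (simp add: sp_empty)
  next
    case (insert m W)
    have s: "sp (insert m W) F \<subseteq> gsum (sp {m} F) (sp W F)"
      using sp_Un_subset[OF assms(1), of "{m}" W] insert by simp
    have m: "sp {m} F \<subseteq> u m ` F" unfolding sp_def by auto
    have fm: "finite (sp {m} F)" using finite_subset[OF m] assms(2) by simp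
    have cm: "card (sp {m} F) \<le> card F"
      using card_mono[OF _ m] card_image_le[OF assms(2), of "u m"] assms(2) by simp
    have fg: "finite (gsum (sp {m} F) (sp W F))" using finite_gsum fm insert.IH by blast
    have "card (sp (insert m W) F) \<le> card (sp {m} F) * card (sp W F)"
      using card_mono[OF fg s] card_gsum[OF fm, of "sp W F"] insert.IH by simp
    also have "\<dots> \<le> card F * card F ^ card W" using cm insert.IH by (intro mult_mono) simp_all
    finally show ?case using insert.hyps finite_subset[OF s fg] by simp
  qed
  then show "finite (sp W F)" "card (sp W F) \<le> card F ^ card W" by blast+
qed

lemma card_sp_Un:
  assumes "subgp F" "finite F" "finite W" "finite W'"
  shows "card (sp (W \<union> W') F) \<le> card (sp W F) * card (sp W' F)"
  using card_mono[OF finite_gsum sp_Un_subset[OF assms(1,3,4)]] finite_sp[OF assms(1,2)] assms(3,4)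
    card_gsum[of "sp W F" "sp W' F"] by simp

lemma card_sp_mono:
  assumes "subgp F" "finite F" "finite W'" "W \<subseteq> W'"
  shows "card (sp W F) \<le> card (sp W' F)"
  using assms by (intro card_mono finite_sp sp_subset_sp) auto

lemma card_sp_pos:
  assumes "subgp F" "finite F" "finite W" shows "card (sp W F) > 0"
  using finite_sp[OF assms] subgp_0[OF subgp_sp[OF assms(1)]] card_gt_0_iff by blast

text \<open>The coefficients lie in one cyclic group, so they can be absorbed into an operator
  applied to its generator. This turns relations in a span into relations over the group
  ring.\<close>

lemma sp_Op:
  assumes "x \<in> sp W (cyc y)" "finite W" shows "\<exists>T\<in>Op W. x = T y"
proof -
  obtain f where f: "\<forall>n\<in>W. f n \<in> cyc y" "x = (\<Sum>n\<in>W. u n (f n))"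
    using assms(1) by (rule spE)
  have "\<exists>T\<in>Op W. (\<Sum>n\<in>V. u n (f n)) = T y" if "V \<subseteq> W" for V
    using finite_subset[OF that assms(2)] that
  proof (induction V rule: finite_induct)
    case empty
    then show ?case using Op.Op_zero[of W] by force
  next
    case (insert m V)
    then obtain T where T: "T \<in> Op W" "(\<Sum>n\<in>V. u n (f n)) = T y" by blast
    obtain k where k: "f m = nm k y" using f(1) insert.prems by (auto simp: cyc_def)
    have "(\<lambda>x. nm k (u m x) + T x) \<in> Op W"
      using insert.prems by (intro Op_plus T nm_Op u_Op) simp
    moreover have "(\<Sum>n\<in>insert m V. u n (f n)) = nm k (u m y) + T y"
      using insert.hyps by (simp add: T k u_nm)
    ultimately show ?case by (intro bexI[of _ "\<lambda>x. nm k (u m x) + T x"])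
  qed
  then show ?thesis using f(2) by blast
qed

definition gen :: "'g set \<Rightarrow> 'g set" where
  "gen F = \<Union>{sp V F |V. finite V}"

lemma sp_gen: "finite V \<Longrightarrow> sp V F \<subseteq> gen F" by (auto simp: gen_def)

lemma gen_self: "0 \<in> F \<Longrightarrow> F \<subseteq> gen F"
  using u_in_sp[of "{0}" F 0] sp_gen[of "{0}" F] by (auto simp: u_id)

lemma submod_gen:
  assumes "subgp F" shows "submod (gen F)"
proof (rule submodI[OF subgpI])
  show "0 \<in> gen F" using gen_self subgp_0 assms by blast
  fix x y assume "x \<in> gen F" "y \<in> gen F"
  then obtain V W where V: "finite V" "x \<in> sp V F" and W: "finite W" "y \<in> sp W F"
    by (auto simp: gen_def)
  have "x \<in> sp (V \<union> W) F" using V W sp_subset_sp[OF assms, of "V \<union> W" V F] by blast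
  moreover have "y \<in> sp (V \<union> W) F" using V W sp_subset_sp[OF assms, of "V \<union> W" W F] by blast
  ultimately have "x - y \<in> sp (V \<union> W) F" by (rule subgp_diff[OF subgp_sp[OF assms]])
  then show "x - y \<in> gen F" using V W sp_gen[of "V \<union> W" F] by blast
next
  fix n x assume "x \<in> gen F"
  then obtain V where V: "finite V" "x \<in> sp V F" by (auto simp: gen_def)
  then have "u n x \<in> sp ((+) n ` V) F" using sp_image by blast
  then show "u n x \<in> gen F" using V sp_gen[of "(+) n ` V" F] by blast
qed

lemma gen_subset:
  assumes "submod H" "F \<subseteq> H" shows "gen F \<subseteq> H"
proof -
  have "sp V F \<subseteq> H" for V
    using assms submod_u submod_subgp by (intro sp_subset) blast+
  then show ?thesis unfolding gen_def by blast
qed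

end


subsection \<open>Sublattices and their windows\<close>

text \<open>Coordinates for the basis (a, 0), (b, c), the Hermite normal form of a sublattice. For
  positive \<open>a\<close> and \<open>c\<close>, \<open>pbox a c\<close> is a fundamental domain,
  so the index is the product of \<open>a\<close> and \<open>c\<close> for every
  \<open>b\<close>.\<close>

definition lat :: "int \<Rightarrow> int \<Rightarrow> int \<Rightarrow> int \<Rightarrow> int \<Rightarrow> int \<times> int" where
  "lat a b c k l = (k * a + l * b, l * c)"

definition pbox :: "int \<Rightarrow> int \<Rightarrow> (int \<times> int) set" where
  "pbox a c = {0..<a} \<times> {0..<c}"

definition win :: "int \<Rightarrow> int \<Rightarrow> int \<Rightarrow> nat \<Rightarrow> nat \<Rightarrow> (int \<times> int) set" where
  "win a b c i j = (\<lambda>(k, l, p). lat a b c (int k) (int l) + p) ` ({..<i} \<times> {..<j} \<times> pbox a c)"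

lemma lat_simps: "lat a b c 0 0 = 0" "lat a b c 1 0 = (a, 0)" "lat a b c 0 1 = (b, c)"
  "lat a b c (k + k') (l + l') = lat a b c k l + lat a b c k' l'"
  by (simp_all add: lat_def zero_prod_def algebra_simps)

lemma finite_pbox: "finite (pbox a c)" by (simp add: pbox_def)

lemma finite_win: "finite (win a b c i j)" by (simp add: win_def finite_pbox)

lemma winI: "k < i \<Longrightarrow> l < j \<Longrightarrow> p \<in> pbox a c \<Longrightarrow> lat a b c (int k) (int l) + p \<in> win a b c i j"
  unfolding win_def by (rule image_eqI[of _ _ "(k, l, p)"]) simp_all

lemma winE:
  assumes "n \<in> win a b c i j"
  obtains k l p where "k < i" "l < j" "p \<in> pbox a c" "n = lat a b c (int k) (int l) + p"
  using assms unfolding win_def by auto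

lemma win_mono: "i \<le> i' \<Longrightarrow> j \<le> j' \<Longrightarrow> win a b c i j \<subseteq> win a b c i' j'"
  by (auto elim!: winE intro!: winI)

text \<open>Multiplying by a basis monomial lengthens a window by one in one direction only. This
  fixes the four window sizes of the truncated Koszul complex: i by j, i+1 by j, i by j+1 and i+1 by
  j+1.\<close>

lemma win_shift_s: "(+) (a, 0) ` win a b c i j \<subseteq> win a b c (Suc i) j"
proof
  fix n assume "n \<in> (+) (a, 0) ` win a b c i j"
  then obtain k l p where *: "k < i" "l < j" "p \<in> pbox a c"
    "n = (a, 0) + (lat a b c (int k) (int l) + p)" by (auto elim!: winE)
  have n: "n = lat a b c (int (Suc k)) (int l) + p"
    using lat_simps(4)[of a b c 1 "int k" 0 "int l"] by (simp add: * lat_simps add.assoc)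
  show "n \<in> win a b c (Suc i) j" unfolding n by (rule winI) (use * in simp_all)
qed

lemma win_shift_t: "(+) (b, c) ` win a b c i j \<subseteq> win a b c i (Suc j)"
proof
  fix n assume "n \<in> (+) (b, c) ` win a b c i j"
  then obtain k l p where *: "k < i" "l < j" "p \<in> pbox a c"
    "n = (b, c) + (lat a b c (int k) (int l) + p)" by (auto elim!: winE)
  have n: "n = lat a b c (int k) (int (Suc l)) + p"
    using lat_simps(4)[of a b c 0 "int k" 1 "int l"] by (simp add: * lat_simps add.assoc)
  show "n \<in> win a b c i (Suc j)" unfolding n by (rule winI) (use * in simp_all)
qed

lemma divmod_unique: "0 \<le> y \<Longrightarrow> y < c \<Longrightarrow> 0 \<le> y' \<Longrightarrow> y' < c \<Longrightarrow> l * c + y = l' * c + y' \<Longrightarrow> l = l' \<and> y = (y'::int)"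
proof -
  assume *: "0 \<le> y" "y < c" "0 \<le> y'" "y' < c" "l * c + y = l' * c + y'"
  have d: "(m * c + z) div c = m" if "0 \<le> z" "z < c" for m z :: int using that by simp
  have "l = l'" using d[OF *(1,2), of l] d[OF *(3,4), of l'] unfolding *(5) by simp
  then show ?thesis using *(5) by simp
qed

lemma card_win:
  assumes "a > 0" "c > 0" shows "card (win a b c i j) = i * j * nat (a * c)"
proof -
  have "inj_on (\<lambda>(k, l, p). lat a b c (int k) (int l) + p) ({..<i} \<times> {..<j} \<times> pbox a c)"
  proof (rule inj_onI)
    fix x y assume x: "x \<in> {..<i} \<times> {..<j} \<times> pbox a c" and y: "y \<in> {..<i} \<times> {..<j} \<times> pbox a c"
      and e: "(case x of (k, l, p) \<Rightarrow> lat a b c (int k) (int l) + p) =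
        (case y of (k, l, p) \<Rightarrow> lat a b c (int k) (int l) + p)"
    obtain k l p q where X: "x = (k, l, (p, q))" by (metis surj_pair)
    obtain k' l' p' q' where Y: "y = (k', l', (p', q'))" by (metis surj_pair)
    have b: "0 \<le> p" "p < a" "0 \<le> p'" "p' < a" "0 \<le> q" "q < c" "0 \<le> q'" "q' < c"
      using x y X Y by (auto simp: pbox_def)
    have e1: "int l * c + q = int l' * c + q'" "int k * a + int l * b + p = int k' * a + int l' * b + p'"
      using e X Y by (auto simp: lat_def)
    have l: "int l = int l'" "q = q'" using divmod_unique[OF b(5-8) e1(1)] by auto
    then have "int k * a + p = int k' * a + p'" using e1(2) by simp
    from divmod_unique[OF b(1-4) this] have "int k = int k'" "p = p'" by auto
    with l X Y show "x = y" by simp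
  qed
  from card_image[OF this] show ?thesis
    using assms by (simp add: win_def pbox_def card_cartesian_product nat_mult_distrib)
qed

lemma win_one: "win a b c 1 1 = pbox a c"
  unfolding win_def by (auto simp: lat_simps(1) image_iff)

lemma lat_decomp:
  assumes "a > 0" "c > 0" shows "\<exists>k l p. v = lat a b c k l + p \<and> p \<in> pbox a c"
proof (intro exI conjI)
  let ?l = "snd v div c" let ?k = "(fst v - ?l * b) div a"
  let ?p = "((fst v - ?l * b) mod a, snd v mod c)"
  show "v = lat a b c ?k ?l + ?p" by (simp add: lat_def prod_eq_iff)
  show "?p \<in> pbox a c" using assms by (simp add: pbox_def)
qed

text \<open>One diagonal lattice vector moves a given finite set into all large windows. The shift
  is by an element of the sublattice, so it changes module elements only by members of the
  augmentation submodule.\<close>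

lemma win_absorb:
  assumes "a > 0" "c > 0" "finite V"
  shows "\<exists>p i0. \<forall>i\<ge>i0. \<forall>j\<ge>i0. p < i \<and> p < j \<and> (+) (lat a b c (int p) (int p)) ` V \<subseteq> win a b c i j"
proof -
  obtain k l q where q: "\<And>v. v = lat a b c (k v) (l v) + q v" "\<And>v. q v \<in> pbox a c"
    using lat_decomp[OF assms(1,2), of _ b] by metis
  have "finite ((\<lambda>v. nat \<bar>k v\<bar> + nat \<bar>l v\<bar>) ` V)" using assms(3) by simp
  then obtain N where N: "\<And>v. v \<in> V \<Longrightarrow> nat \<bar>k v\<bar> + nat \<bar>l v\<bar> \<le> N"
    unfolding finite_nat_set_iff_bounded_le by auto
  \<comment> \<open>The lattice coordinates of \<open>V\<close> lie between -N and N; after the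
    shift they lie between 0 and 2 N, so 2 N + 1 translates of the box in each direction
    suffice.\<close>
  have "N < i \<and> N < j \<and> (+) (lat a b c (int N) (int N)) ` V \<subseteq> win a b c i j"
    if "i \<ge> 2 * N + 1" "j \<ge> 2 * N + 1" for i j
  proof (intro conjI image_subsetI)
    show "N < i" "N < j" using that by simp_all
    fix v assume "v \<in> V"
    from N[OF this] have b: "nat (k v + int N) < i" "nat (l v + int N) < j"
      "0 \<le> k v + int N" "0 \<le> l v + int N" using that by linarith+
    have "lat a b c (int N) (int N) + v = lat a b c (int N + k v) (int N + l v) + q v"
      by (subst q(1)) (simp add: lat_simps(4) add.assoc)
    also have "\<dots> = lat a b c (int (nat (k v + int N))) (int (nat (l v + int N))) + q v"
      using b by (simp add: add.commute)
    also have "\<dots> \<in> win a b c i j" by (rule winI[OF b(1,2) q(2)])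
    finally show "lat a b c (int N) (int N) + v \<in> win a b c i j" .
  qed
  then show ?thesis by blast
qed

section \<open>The augmentation submodule and its trace on windows\<close>

context z2_module
begin

definition dd :: "int \<times> int \<Rightarrow> 'g \<Rightarrow> 'g" where "dd m x = u m x - x"

lemma dd_diff: "dd m (x - y) = dd m x - dd m y" by (simp add: dd_def u_diff)
lemma dd_add: "dd m (x + y) = dd m x + dd m y" by (simp add: dd_def u_add)
lemma dd_zero: "dd m 0 = 0" by (simp add: dd_def u_zero)
lemma dd_minus: "dd m (- x) = - dd m x" by (simp add: dd_def u_minus)
lemma dd_u: "dd m (u n x) = u n (dd m x)" by (simp add: dd_def u_diff u_comm[of m])
lemma dd_commute: "dd m (dd n x) = dd n (dd m x)" by (simp add: dd_def u_diff u_comm[of m] algebra_simps)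
lemma dd_Op: "T \<in> Op W \<Longrightarrow> T (dd m x) = dd m (T x)" by (simp add: dd_def Op_diff Op_u)
lemma dd_in: "submod H \<Longrightarrow> x \<in> H \<Longrightarrow> dd m x \<in> H"
  unfolding dd_def by (intro subgp_diff submod_subgp submod_u)

text \<open>For a submodule \<open>H\<close> this is its product with the ideal generated by u^s - 1
  and u^t - 1. The two generators are enough: \<open>aug_lat\<close> recovers u^n - 1 for every n of
  the lattice they span.\<close>

definition aug :: "int \<times> int \<Rightarrow> int \<times> int \<Rightarrow> 'g set \<Rightarrow> 'g set" where
  "aug s t H = gsum (dd s ` H) (dd t ` H)"

lemma augI: "x \<in> H \<Longrightarrow> y \<in> H \<Longrightarrow> dd s x + dd t y \<in> aug s t H"
  unfolding aug_def by (intro gsumI imageI)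

lemma augE:
  assumes "z \<in> aug s t H" obtains x y where "x \<in> H" "y \<in> H" "z = dd s x + dd t y"
  using assms unfolding aug_def gsum_def by blast

lemma submod_aug: assumes "submod H" shows "submod (aug s t H)"
proof (rule submodI)
  show "subgp (aug s t H)" unfolding aug_def
    by (intro subgp_gsum subgp_image submod_subgp assms) (simp_all add: dd_diff)
  fix n z assume "z \<in> aug s t H"
  then obtain x y where "x \<in> H" "y \<in> H" "z = dd s x + dd t y" by (rule augE)
  then show "u n z \<in> aug s t H"
    using augI[OF submod_u[OF assms, of x n] submod_u[OF assms, of y n]] by (simp add: u_add dd_u)
qed

lemma aug_subset: "submod H \<Longrightarrow> aug s t H \<subseteq> H"
  unfolding aug_def by (intro gsum_subset submod_subgp image_subsetI dd_in)

lemma aug_mono: "H \<subseteq> K \<Longrightarrow> aug s t H \<subseteq> aug s t K"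
  unfolding aug_def by (intro gsum_mono image_mono)

lemma aug_s: "submod H \<Longrightarrow> x \<in> H \<Longrightarrow> dd s x \<in> aug s t H"
  using augI[of x H 0 s t] subgp_0[OF submod_subgp] by (simp add: dd_zero)

lemma aug_t: "submod H \<Longrightarrow> x \<in> H \<Longrightarrow> dd t x \<in> aug s t H"
  using augI[of 0 H x s t] subgp_0[OF submod_subgp] by (simp add: dd_zero)

lemma stab_add:
  assumes "submod H" "subgp K" "\<forall>x\<in>H. dd m x \<in> K" "\<forall>x\<in>H. dd n x \<in> K"
  shows "\<forall>x\<in>H. dd (m + n) x \<in> K"
proof
  fix x assume "x \<in> H"
  have "dd (m + n) x = dd m (u n x) + dd n x" by (simp add: dd_def u_plus)
  also have "\<dots> \<in> K" using assms \<open>x \<in> H\<close> submod_u by (intro subgp_add) blast+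
  finally show "dd (m + n) x \<in> K" .
qed

lemma stab_minus:
  assumes "submod H" "subgp K" "\<forall>x\<in>H. dd m x \<in> K"
  shows "\<forall>x\<in>H. dd (- m) x \<in> K"
proof
  fix x assume "x \<in> H"
  have "dd (- m) x = - dd m (u (- m) x)" by (simp add: dd_def u_inv)
  also have "\<dots> \<in> K" using assms \<open>x \<in> H\<close> submod_u by (intro subgp_minus) blast+
  finally show "dd (- m) x \<in> K" .
qed

lemma stab_lat:
  assumes H: "submod H" and K: "subgp K"
    and s: "\<forall>x\<in>H. dd (a, 0) x \<in> K" and t: "\<forall>x\<in>H. dd (b, c) x \<in> K"
  shows "\<forall>x\<in>H. dd (lat a b c k l) x \<in> K"
proof -
  have 0: "\<forall>x\<in>H. dd 0 x \<in> K" using subgp_0[OF K] by (simp add: dd_def u_id)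
  have m: "\<forall>x\<in>H. dd (lat a b c k 0) x \<in> K" for k
  proof (induction k rule: int_induct[where k = 0])
    case base
    then show ?case using 0 by (simp add: lat_simps)
  next
    case (step1 i)
    then show ?case using stab_add[OF H K _ s] lat_simps(4)[of a b c i 1 0 0] by (simp add: lat_simps(2))
  next
    case (step2 i)
    have "lat a b c (i - 1) 0 = lat a b c i 0 + - (a, 0)" by (simp add: lat_def algebra_simps)
    then show ?case using stab_add[OF H K step2(2) stab_minus[OF H K s]] by simp
  qed
  have n: "\<forall>x\<in>H. dd (lat a b c 0 l) x \<in> K" for l
  proof (induction l rule: int_induct[where k = 0])
    case base
    then show ?case using 0 by (simp add: lat_simps)
  next
    case (step1 i)
    then show ?case using stab_add[OF H K _ t] lat_simps(4)[of a b c 0 0 i 1] by (simp add: lat_simps(3))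
  next
    case (step2 i)
    have "lat a b c 0 (i - 1) = lat a b c 0 i + - (b, c)" by (simp add: lat_def algebra_simps)
    then show ?case using stab_add[OF H K step2(2) stab_minus[OF H K t]] by simp
  qed
  show ?thesis using stab_add[OF H K m n, of k l] lat_simps(4)[of a b c k 0 0 l] by simp
qed

lemma aug_lat: "submod H \<Longrightarrow> x \<in> H \<Longrightarrow> dd (lat a b c k l) x \<in> aug (a, 0) (b, c) H"
  using stab_lat[of H "aug (a, 0) (b, c) H" a b c k l] submod_subgp[OF submod_aug] aug_s aug_t by blast

text \<open>The image of the last Koszul differential into the window of size i+1 by j+1, enlarged
  by \<open>L\<close>: the part of the augmentation submodule that is witnessed inside windows. It
  may be smaller than the part that merely lies in the window; for \<open>L\<close> zero and large
  windows \<open>aug_absorbed\<close> closes this gap.\<close>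

definition Imw :: "int \<Rightarrow> int \<Rightarrow> int \<Rightarrow> 'g set \<Rightarrow> 'g set \<Rightarrow> nat \<Rightarrow> nat \<Rightarrow> 'g set" where
  "Imw a b c F L i j = gsum (gsum (dd (b, c) ` gsum (sp (win a b c (Suc i) j) F) L)
      (dd (a, 0) ` gsum (sp (win a b c i (Suc j)) F) L)) L"

lemma subgp_Imw: "subgp F \<Longrightarrow> subgp L \<Longrightarrow> subgp (Imw a b c F L i j)"
  unfolding Imw_def by (intro subgp_gsum subgp_image subgp_sp) (simp_all add: dd_diff)

lemma Imw_s:
  assumes "subgp F" "subgp L" "x \<in> gsum (sp (win a b c i (Suc j)) F) L"
  shows "dd (a, 0) x \<in> Imw a b c F L i j"
  unfolding Imw_def
  by (rule gsum_left[OF assms(2)], rule gsum_right, intro subgp_gsum subgp_image subgp_sp assms)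
    (simp_all add: dd_diff assms(3))

lemma Imw_t:
  assumes "subgp F" "subgp L" "x \<in> gsum (sp (win a b c (Suc i) j) F) L"
  shows "dd (b, c) x \<in> Imw a b c F L i j"
  unfolding Imw_def
  by (rule gsum_left[OF assms(2)], rule gsum_left, intro subgp_gsum subgp_image subgp_sp assms)
    (simp_all add: dd_diff assms(3))

lemma u_lat_pbox_in:
  assumes F: "subgp F" and x: "x \<in> sp (pbox a c) F" and kl: "k < i" "l < j"
  shows "u (lat a b c (int k) (int l)) x \<in> sp (win a b c i j) F"
proof -
  have "u (lat a b c (int k) (int l)) x \<in> sp ((+) (lat a b c (int k) (int l)) ` pbox a c) F"
    using x sp_image by blast
  also have "\<dots> \<subseteq> sp (win a b c i j) F"
    using winI[OF kl] by (intro sp_subset_sp[OF F finite_win]) auto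
  finally show ?thesis .
qed

text \<open>Walk from the box to its translate one basis vector at a time, first \<open>l\<close>
  steps along (b, c) and then \<open>k\<close> steps along (a, 0). Each step contributes a
  differential of an intermediate translate that still lies in the required window, and the
  contributions telescope.\<close>

lemma Imw_shift:
  assumes F: "subgp F" and L: "subgp L" and x: "x \<in> sp (pbox a c) F" and kl: "k \<le> i" "l \<le> j"
  shows "dd (lat a b c (int k) (int l)) x \<in> Imw a b c F L i j"
  using kl
proof (induction k)
  case 0
  show ?case using \<open>l \<le> j\<close>
  proof (induction l)
    case 0
    show ?case using subgp_0[OF subgp_Imw[OF F L]] by (simp add: lat_simps dd_def u_id)
  next
    case (Suc l)
    let ?y = "u (lat a b c (int 0) (int l)) x"
    have "?y \<in> gsum (sp (win a b c (Suc i) j) F) L"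
      by (intro gsum_left[OF L] u_lat_pbox_in[OF F x]) (use Suc in simp_all)
    from Imw_t[OF F L this] have 1: "dd (b, c) ?y \<in> Imw a b c F L i j" .
    have 2: "dd (lat a b c (int 0) (int l)) x \<in> Imw a b c F L i j" using Suc by simp
    have "lat a b c (int 0) (int (Suc l)) = (b, c) + lat a b c (int 0) (int l)"
      by (simp add: lat_def algebra_simps)
    then have "dd (lat a b c (int 0) (int (Suc l))) x = dd (b, c) ?y + dd (lat a b c (int 0) (int l)) x"
      by (simp only: dd_def u_plus) simp
    then show ?case using subgp_add[OF subgp_Imw[OF F L] 1 2] by simp
  qed
next
  case (Suc k)
  let ?y = "u (lat a b c (int k) (int l)) x"
  have "?y \<in> gsum (sp (win a b c i (Suc j)) F) L"
    by (intro gsum_left[OF L] u_lat_pbox_in[OF F x]) (use Suc.prems in simp_all)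
  from Imw_s[OF F L this] have 1: "dd (a, 0) ?y \<in> Imw a b c F L i j" .
  have 2: "dd (lat a b c (int k) (int l)) x \<in> Imw a b c F L i j" using Suc by simp
  have "lat a b c (int (Suc k)) (int l) = (a, 0) + lat a b c (int k) (int l)"
    by (simp add: lat_def algebra_simps)
  then have "dd (lat a b c (int (Suc k)) (int l)) x = dd (a, 0) ?y + dd (lat a b c (int k) (int l)) x"
    by (simp only: dd_def u_plus) simp
  then show ?case using subgp_add[OF subgp_Imw[OF F L] 1 2] by simp
qed

text \<open>Every monomial of the window is a lattice translate of one in the box, and
  \<open>Imw_shift\<close> removes the translation. Hence the cokernel on a window is bounded by the
  span over a single box, uniformly in \<open>i\<close> and \<open>j\<close>.\<close>

lemma Imw_reduce:
  assumes F: "subgp F" and L: "subgp L" and x: "x \<in> gsum (sp (win a b c (Suc i) (Suc j)) F) L"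
  shows "\<exists>y\<in>sp (pbox a c) F. x - y \<in> Imw a b c F L i j"
proof -
  let ?I = "Imw a b c F L i j"
  have I: "subgp ?I" by (rule subgp_Imw[OF F L])
  have P: "subgp (sp (pbox a c) F)" by (rule subgp_sp[OF F])
  have LI: "L \<subseteq> ?I" unfolding Imw_def
    using gsum_right[of "gsum _ _" _ L] subgp_gsum subgp_image subgp_sp[OF F] L dd_diff by (metis subsetI)
  have sub: "gsum (sp (win a b c (Suc i) (Suc j)) F) L \<subseteq> gsum ?I (sp (pbox a c) F)"
  proof (rule gsum_subset[OF subgp_gsum[OF I P]])
    show "sp (win a b c (Suc i) (Suc j)) F \<subseteq> gsum ?I (sp (pbox a c) F)"
    proof (rule sp_subset[OF subgp_gsum[OF I P]])
      fix n f assume "n \<in> win a b c (Suc i) (Suc j)" and f: "f \<in> F"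
      then obtain k l p where *: "k < Suc i" "l < Suc j" "p \<in> pbox a c"
        "n = lat a b c (int k) (int l) + p" by (auto elim: winE)
      have p: "u p f \<in> sp (pbox a c) F" by (rule u_in_sp[OF finite_pbox subgp_0[OF F] *(3) f])
      have "dd (lat a b c (int k) (int l)) (u p f) \<in> ?I"
        by (rule Imw_shift[OF F L p]) (use * in simp_all)
      from gsumI[OF this p] show "u n f \<in> gsum ?I (sp (pbox a c) F)" by (simp add: *(4) dd_def u_plus)
    qed
    show "L \<subseteq> gsum ?I (sp (pbox a c) F)" using LI gsum_left[OF P] by blast
  qed
  obtain z y where "z \<in> ?I" "y \<in> sp (pbox a c) F" "x = z + y"
    using subsetD[OF sub x] unfolding gsum_def by blast
  then show ?thesis by (intro bexI[of _ y]) simp_all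
qed

end

section \<open>Noetherian torsion modules\<close>

locale noeth_module = z2_module +
  fixes M :: "'a set"
  assumes submod_M: "submod M"
    and acc: "\<And>S::nat \<Rightarrow> 'a set. (\<And>k. submod (S k)) \<Longrightarrow> (\<And>k. S k \<subseteq> M) \<Longrightarrow> (\<And>k. S k \<subseteq> S (Suc k)) \<Longrightarrow>
      \<exists>N. \<forall>k\<ge>N. S k = S N"
    and tors: "x \<in> M \<Longrightarrow> \<exists>n>0. nm n x = 0"
begin

lemma acc_max:
  assumes "\<A> \<noteq> {}" "\<And>H. H \<in> \<A> \<Longrightarrow> submod H \<and> H \<subseteq> M"
  shows "\<exists>H\<in>\<A>. \<forall>H'\<in>\<A>. H \<subseteq> H' \<longrightarrow> H' = H"
proof (rule ccontr)
  assume "\<not> ?thesis"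
  then have ex: "\<exists>H'\<in>\<A>. H \<subset> H'" if "H \<in> \<A>" for H using that by blast
  obtain H0 where "H0 \<in> \<A>" using assms(1) by blast
  define S where "S = rec_nat H0 (\<lambda>_ H. SOME H'. H' \<in> \<A> \<and> H \<subset> H')"
  have step: "S (Suc k) \<in> \<A> \<and> S k \<subset> S (Suc k)" if "S k \<in> \<A>" for k
    using someI_ex[of "\<lambda>H'. H' \<in> \<A> \<and> S k \<subset> H'"] ex[OF that] by (auto simp: S_def)
  have S: "S k \<in> \<A>" for k
  proof (induction k)
    case 0
    show ?case using \<open>H0 \<in> \<A>\<close> by (simp add: S_def)
  next
    case (Suc k)
    then show ?case using step by blast
  qed
  have "S k \<subseteq> S (Suc k)" for k using step[OF S] by blast
  then obtain N where "\<forall>k\<ge>N. S k = S N" using acc[of S] assms(2)[OF S] by blast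
  then have "S (Suc N) = S N" by (meson le_SucI order_refl)
  then show False using step[OF S, of N] by blast
qed

lemma finite_extend:
  assumes "subgp F" "finite F" "x \<in> M"
  shows "subgp (gsum F (cyc x))" "finite (gsum F (cyc x))" "x \<in> gsum F (cyc x)"
proof -
  obtain n where n: "n > 0" "nm n x = 0" using tors assms(3) by blast
  show "subgp (gsum F (cyc x))" by (intro subgp_gsum assms subgp_cyc[OF n])
  show "finite (gsum F (cyc x))" by (intro finite_gsum assms finite_cyc[OF n])
  show "x \<in> gsum F (cyc x)" by (rule gsum_right[OF assms(1) cyc_self])
qed

text \<open>A maximal submodule among those generated by a finite subgroup must be everything.
  Torsion is what allows the generators to form a finite subgroup, so that spans over finite windows
  are finite and can be counted.\<close>

lemma finitely_generated:
  assumes H: "submod H" "H \<subseteq> M"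
  shows "\<exists>F. subgp F \<and> finite F \<and> F \<subseteq> H \<and> gen F = H"
proof -
  let ?A = "{gen F |F. subgp F \<and> finite F \<and> F \<subseteq> H}"
  have ne: "?A \<noteq> {}" using subgp_singleton subgp_0[OF submod_subgp[OF H(1)]] by blast
  have sm: "submod G \<and> G \<subseteq> M" if "G \<in> ?A" for G using that submod_gen gen_subset[OF H(1)] H(2) by blast
  obtain G where G: "G \<in> ?A" "\<forall>H'\<in>?A. G \<subseteq> H' \<longrightarrow> H' = G"
    using acc_max[OF ne sm] by (rule bexE)
  then obtain F where F: "subgp F" "finite F" "F \<subseteq> H" and GF: "G = gen F" by blast
  have max: "gen F' = gen F" if "subgp F'" "finite F'" "F' \<subseteq> H" "gen F \<subseteq> gen F'" for F'
  proof -
    have "gen F' \<in> ?A" using that(1-3) by blast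
    then show ?thesis using G(2) that(4) unfolding GF by blast
  qed
  have "x \<in> gen F" if x: "x \<in> H" for x
  proof -
    have xM: "x \<in> M" using x H by blast
    let ?F = "gsum F (cyc x)"
    note E = finite_extend[OF F(1,2) xM]
    have FH: "?F \<subseteq> H" by (intro gsum_subset submod_subgp H F cyc_subset x)
    have F0: "0 \<in> F" "0 \<in> ?F" using F(1) E(1) subgp_0 by blast+
    have "F \<subseteq> ?F" using gsum_left[of "cyc x" _ F] subgp_cyc tors[OF xM] by blast
    then have "gen F \<subseteq> gen ?F" using gen_self[OF F0(2)] by (intro gen_subset submod_gen E) blast
    then have "gen ?F = gen F" by (intro max E FH)
    then show ?thesis using E(3) gen_self[OF F0(2)] by blast
  qed
  then show ?thesis using F gen_subset[OF H(1) F(3)] by blast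
qed

text \<open>Modulo lattice translations every exponent can be moved into the box, so the quotient is
  spanned by finitely many translates of a finite generating group.\<close>

lemma fin_ix_aug:
  assumes H: "submod H" "H \<subseteq> M" and ac: "a > 0" "c > 0"
  shows "fin_ix H (aug (a, 0) (b, c) H)"
proof -
  obtain F where F: "subgp F" "finite F" "F \<subseteq> H" "gen F = H" using finitely_generated[OF H] by blast
  let ?I = "aug (a, 0) (b, c) H"
  have I: "subgp ?I" by (rule submod_subgp[OF submod_aug[OF H(1)]])
  have S: "subgp (sp (pbox a c) F)" by (rule subgp_sp[OF F(1)])
  have sub: "H \<subseteq> gsum ?I (sp (pbox a c) F)"
  proof -
    have "sp V F \<subseteq> gsum ?I (sp (pbox a c) F)" for V
    proof (rule sp_subset[OF subgp_gsum[OF I S]])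
      fix n f assume f: "f \<in> F"
      obtain k l p where p: "n = lat a b c k l + p" "p \<in> pbox a c"
        using lat_decomp[OF ac] by blast
      have pf: "u p f \<in> sp (pbox a c) F" by (rule u_in_sp[OF finite_pbox subgp_0[OF F(1)] p(2) f])
      have "u p f \<in> H" using f F(3) H(1) submod_u by blast
      from gsumI[OF aug_lat[OF H(1) this, of a b c k l] pf]
      show "u n f \<in> gsum ?I (sp (pbox a c) F)" by (simp add: p(1) dd_def u_plus)
    qed
    then show ?thesis using F(4) unfolding gen_def by blast
  qed
  have "fin_ix (gsum (sp (pbox a c) F) ?I) ?I"
    unfolding ix_gsum_right[OF I] by (rule fin_ix_finite[OF finite_sp[OF F(1,2) finite_pbox]])
  moreover have "H \<subseteq> gsum (sp (pbox a c) F) ?I" using sub unfolding gsum_def by (force simp: add.commute)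
  ultimately show ?thesis using ix_mono(1)[OF I I] by blast
qed

end


lemma gsum_zero: "gsum H {0} = H" by (auto simp: gsum_def)

lemma ix_gsum: "subgp K \<Longrightarrow> ix (gsum H K) K = ix H K" by (simp add: ix_def ix_gsum_right)

text \<open>Summation of the mixed second difference over an n by m rectangle; the values on the two
  axes remain as boundary terms.\<close>

lemma telescope:
  fixes f :: "nat \<Rightarrow> nat \<Rightarrow> real"
  assumes "\<And>i j. f (Suc i) (Suc j) + f i j \<le> \<delta> + f (Suc i) j + f i (Suc j)"
  shows "f n m + f 0 0 \<le> f n 0 + f 0 m + real n * real m * \<delta>"
proof -
  have 1: "f (Suc i) m + f i 0 \<le> f (Suc i) 0 + f i m + real m * \<delta>" for i
  proof (induction m)
    case (Suc m)
    then show ?case using assms[of i m] by (simp add: algebra_simps)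
  qed simp
  show ?thesis
  proof (induction n)
    case (Suc n)
    then show ?case using 1[of n] by (simp add: algebra_simps)
  qed simp
qed

section \<open>The Koszul complex on windows\<close>

context z2_module
begin

text \<open>Window spans are always taken together with \<open>L\<close>. The lower bound uses the
  zero submodule and the upper bound a monically closed one, and the same complex serves
  both.\<close>

abbreviation G where "G a b c F L i j \<equiv> gsum (sp (win a b c i j) F) L"

definition Kerw where
  "Kerw a b c F L i j = {p \<in> G a b c F L (Suc i) j \<times> G a b c F L i (Suc j).
     dd (b, c) (fst p) + dd (a, 0) (snd p) \<in> L}"

lemma fin_ix_G: "subgp F \<Longrightarrow> finite F \<Longrightarrow> subgp L \<Longrightarrow> fin_ix (G a b c F L i j) L"
  unfolding ix_gsum_right by (intro fin_ix_finite finite_sp finite_win)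

lemma subgp_G: "subgp F \<Longrightarrow> subgp L \<Longrightarrow> subgp (G a b c F L i j)"
  by (intro subgp_gsum subgp_sp)

lemma G_mono: "subgp F \<Longrightarrow> i \<le> i' \<Longrightarrow> j \<le> j' \<Longrightarrow> G a b c F L i j \<subseteq> G a b c F L i' j'"
  by (intro gsum_mono subset_refl sp_subset_sp finite_win win_mono)

lemma dd_gsum:
  assumes F: "subgp F" and L: "submod L" and W: "finite W'" "W \<subseteq> W'" "(+) m ` W \<subseteq> W'"
    and x: "x \<in> gsum (sp W F) L"
  shows "dd m x \<in> gsum (sp W' F) L"
proof -
  obtain y l where y: "y \<in> sp W F" and l: "l \<in> L" and x: "x = y + l" using x by (auto simp: gsum_def)
  have "u m y \<in> sp ((+) m ` W) F" using y sp_image by blast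
  then have "u m y \<in> sp W' F" using sp_subset_sp[OF F W(1,3) subset_refl] by blast
  moreover have "y \<in> sp W' F" using y sp_subset_sp[OF F W(1,2) subset_refl] by blast
  ultimately have "dd m y \<in> sp W' F" unfolding dd_def by (rule subgp_diff[OF subgp_sp[OF F]])
  from gsumI[OF this dd_in[OF L l, of m]] show ?thesis unfolding x dd_add .
qed

lemma dd_t_G: "subgp F \<Longrightarrow> submod L \<Longrightarrow> x \<in> G a b c F L i j \<Longrightarrow> dd (b, c) x \<in> G a b c F L i (Suc j)"
  by (rule dd_gsum[OF _ _ finite_win win_mono win_shift_t]) simp_all

lemma dd_s_G: "subgp F \<Longrightarrow> submod L \<Longrightarrow> x \<in> G a b c F L i j \<Longrightarrow> dd (a, 0) x \<in> G a b c F L (Suc i) j"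
  by (rule dd_gsum[OF _ _ finite_win win_mono win_shift_s]) simp_all

lemma koszul_win:
  assumes F: "subgp F" "finite F" and L: "submod L"
  shows "ix (G a b c F L (Suc i) (Suc j)) (Imw a b c F L i j) *
      (ix (G a b c F L (Suc i) j) L * ix (G a b c F L i (Suc j)) L) =
      ix (G a b c F L (Suc i) (Suc j)) L * ix (Kerw a b c F L i j) (L \<times> L)"
    "fin_ix (Kerw a b c F L i j) (L \<times> L)"
    "fin_ix (G a b c F L (Suc i) (Suc j)) (Imw a b c F L i j)"
proof -
  have Ls: "subgp L" by (rule submod_subgp[OF L])
  have Lsub: "L \<subseteq> G a b c F L k l" for k l using gsum_right[OF subgp_sp[OF F(1)]] by blast
  have m1: "dd (b, c) ` G a b c F L (Suc i) j \<subseteq> G a b c F L (Suc i) (Suc j)"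
    by (rule image_subsetI) (rule dd_t_G[OF F(1) L])
  have m2: "dd (a, 0) ` G a b c F L i (Suc j) \<subseteq> G a b c F L (Suc i) (Suc j)"
    by (rule image_subsetI) (rule dd_s_G[OF F(1) L])
  have m3: "dd m ` L \<subseteq> L" for m by (rule image_subsetI) (rule dd_in[OF L])
  note k = koszul_count[OF Ls subgp_G[OF F(1) Ls] subgp_G[OF F(1) Ls] subgp_G[OF F(1) Ls]
      Lsub Lsub Lsub fin_ix_G[OF F Ls] fin_ix_G[OF F Ls] fin_ix_G[OF F Ls] dd_diff dd_diff m1 m2 m3 m3]
  show "ix (G a b c F L (Suc i) (Suc j)) (Imw a b c F L i j) *
      (ix (G a b c F L (Suc i) j) L * ix (G a b c F L i (Suc j)) L) =
      ix (G a b c F L (Suc i) (Suc j)) L * ix (Kerw a b c F L i j) (L \<times> L)"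
    unfolding Imw_def Kerw_def by (rule k(1))
  show "fin_ix (Kerw a b c F L i j) (L \<times> L)" unfolding Kerw_def by (rule k(2))
  show "fin_ix (G a b c F L (Suc i) (Suc j)) (Imw a b c F L i j)" unfolding Imw_def by (rule k(4))
qed

text \<open>The first Koszul differential, z to ((u^s - 1) z, - (u^t - 1) z), lands in the kernel of
  the second one, and \<open>H2\<close> makes it injective modulo \<open>L\<close>. Only this part
  of the kernel is kept for the lower bound.\<close>

lemma Kerw_lower:
  assumes F: "subgp F" "finite F" and L: "submod L"
    and H2: "\<And>z. z \<in> G a b c F L i j \<Longrightarrow> dd (a, 0) z \<in> L \<Longrightarrow> z \<in> L"
  shows "ix (G a b c F L i j) L \<le> ix (Kerw a b c F L i j) (L \<times> L)"
proof (rule ix_le_map(2)[OF submod_subgp[OF L] _ koszul_win(2)[OF F L]])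
  let ?f = "\<lambda>z. (dd (a, 0) z, - dd (b, c) z)"
  have Ls: "subgp L" by (rule submod_subgp[OF L])
  show "subgp (L \<times> L)" by (rule subgp_Times[OF Ls Ls])
  show "?f ` G a b c F L i j \<subseteq> Kerw a b c F L i j"
  proof (rule image_subsetI)
    fix z assume z: "z \<in> G a b c F L i j"
    have 1: "dd (a, 0) z \<in> G a b c F L (Suc i) j" by (rule dd_s_G[OF F(1) L z])
    have 2: "- dd (b, c) z \<in> G a b c F L i (Suc j)"
      by (rule subgp_minus[OF subgp_G[OF F(1) Ls] dd_t_G[OF F(1) L z]])
    show "?f z \<in> Kerw a b c F L i j"
      using 1 2 subgp_0[OF Ls] by (simp add: Kerw_def dd_minus dd_commute[of "(b, c)"])
  qed
  fix x y assume xy: "x \<in> G a b c F L i j" "y \<in> G a b c F L i j" "?f x - ?f y \<in> L \<times> L"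
  from xy(3) have "dd (a, 0) (x - y) \<in> L" by (simp add: dd_diff)
  then show "x - y \<in> L" by (rule H2[OF subgp_diff[OF subgp_G[OF F(1) Ls] xy(1,2)]])
qed

lemma Imw_subset:
  assumes H: "submod H" and L: "submod L" and F: "F \<subseteq> H" "L \<subseteq> H"
  shows "Imw a b c F L i j \<subseteq> gsum (aug (a, 0) (b, c) H) L"
proof -
  have G: "G a b c F L k l \<subseteq> H" for k l
    using H F submod_u by (intro gsum_subset sp_subset submod_subgp) blast+
  have A: "subgp (aug (a, 0) (b, c) H)" by (rule submod_subgp[OF submod_aug[OF H]])
  show ?thesis unfolding Imw_def
  proof (intro gsum_mono gsum_subset A image_subsetI subset_refl)
    fix x assume "x \<in> G a b c F L (Suc i) j"
    then show "dd (b, c) x \<in> aug (a, 0) (b, c) H" using G by (intro aug_t[OF H]) blast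
  next
    fix x assume "x \<in> G a b c F L i (Suc j)"
    then show "dd (a, 0) x \<in> aug (a, 0) (b, c) H" using G by (intro aug_s[OF H]) blast
  qed
qed

lemma card_sp_UN:
  assumes F: "subgp F" "finite F" and W: "finite W"
  shows "card (sp (\<Union>r<m::nat. (+) (v r) ` W) F) \<le> card (sp W F) ^ m"
proof (induction m)
  case 0
  then show ?case by (simp add: sp_empty)
next
  case (Suc m)
  have "card (sp (\<Union>r<Suc m. (+) (v r) ` W) F) =
      card (sp ((\<Union>r<m. (+) (v r) ` W) \<union> (+) (v m) ` W) F)" by (simp add: lessThan_Suc Un_commute)
  also have "\<dots> \<le> card (sp (\<Union>r<m. (+) (v r) ` W) F) * card (sp ((+) (v m) ` W) F)"
    by (rule card_sp_Un[OF F]) (simp_all add: W)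
  also have "\<dots> \<le> card (sp W F) ^ m * card (sp W F)"
    unfolding card_sp_shift by (rule mult_right_mono[OF Suc]) simp
  finally show ?case by (simp add: mult.commute)
qed

end

section \<open>Growth of spans over windows and over squares\<close>

lemma le_div_succ_mult: "(0::int) < q \<Longrightarrow> n \<le> (n div q + 1) * q"
  using div_mult_mod_eq[of n q] pos_mod_bound[of q n] unfolding distrib_right by linarith

text \<open>The square is cut into \<open>m\<close> horizontal strips of \<open>J\<close> lattice
  rows, each covered by one window. A window of \<open>J\<close> rows leans to the right by up to b
  J; the shift by -b J and the width N + b J compensate for this. The sign of \<open>b\<close> fixes
  the direction of the lean.\<close>

lemma strip_cover:
  assumes "a > 0" "b \<ge> 0" "c > 0" "int N + b * int J \<le> int i * a" "int N \<le> int m * (int J * c)"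
  shows "{0..<int N} \<times> {0..<int N} \<subseteq>
    (\<Union>r<m. (+) (- (b * int J), int r * (int J * c)) ` win a b c i J)"
proof
  fix v assume "v \<in> {0..<int N} \<times> {0..<int N}"
  then obtain x y where v: "v = (x, y)" and x: "0 \<le> x" "x < int N" and y: "0 \<le> y" "y < int N" by auto
  define q where "q = int J * c"
  have "0 < int m * q" using y assms(5) by (simp add: q_def)
  then have q: "q > 0" using assms(3) by (metis int_nat_eq less_irrefl mult_le_0_iff mult_nonneg_nonneg
        nat_int of_nat_0_le_iff order_less_le q_def zero_less_mult_iff)
  define r z where "r = y div q" and "z = y mod q"
  have z: "0 \<le> z" "z < q" "y = r * q + z" using q by (simp_all add: z_def r_def)
  have r0: "0 \<le> r" using y q by (simp add: r_def pos_imp_zdiv_nonneg_iff)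
  have "r * q < int m * q" using z y assms(5) by (simp add: q_def)
  then have r1: "r < int m" using q by simp
  define l where "l = z div c"
  have l0: "0 \<le> l" using z assms(3) by (simp add: l_def pos_imp_zdiv_nonneg_iff)
  have "l * c \<le> z" unfolding l_def using assms(3) div_mult_mod_eq[of z c] pos_mod_sign[of c z] by linarith
  then have "l * c < int J * c" using z by (simp add: q_def)
  then have l1: "l < int J" using assms(3) by simp
  define w where "w = x + b * int J - l * b"
  have "l * b \<le> int J * b" using l1 assms(2) by (intro mult_right_mono) simp_all
  then have w0: "0 \<le> w" using x by (simp add: w_def mult.commute)
  have "0 \<le> l * b" using l0 assms(2) by simp
  then have w1: "w < int i * a" using x assms(4) by (simp add: w_def)
  define k where "k = w div a"
  have k0: "0 \<le> k" using w0 assms(1) by (simp add: k_def pos_imp_zdiv_nonneg_iff)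
  have "k * a \<le> w" unfolding k_def using assms(1) div_mult_mod_eq[of w a] pos_mod_sign[of a w] by linarith
  then have "k * a < int i * a" using w1 by simp
  then have k1: "k < int i" using assms(1) by simp
  have p: "(w mod a, z mod c) \<in> pbox a c" using assms by (simp add: pbox_def)
  have "lat a b c (int (nat k)) (int (nat l)) + (w mod a, z mod c) \<in> win a b c i J"
    by (rule winI[OF _ _ p]) (use k0 k1 l0 l1 in linarith)+
  moreover have "v = (- (b * int J), int (nat r) * (int J * c)) +
      (lat a b c (int (nat k)) (int (nat l)) + (w mod a, z mod c))"
  proof -
    have "k * a + w mod a = w" "l * c + z mod c = z" by (simp_all add: k_def l_def)
    then show ?thesis using k0 l0 r0 z(3) by (simp add: v lat_def w_def q_def algebra_simps)
  qed
  moreover have "nat r < m" using r0 r1 by simp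
  ultimately show "v \<in> (\<Union>r<m. (+) (- (b * int J), int r * (int J * c)) ` win a b c i J)"
    by (intro UN_I[of "nat r"] image_eqI) simp_all
qed

context noeth_module
begin

lemma gen_in_sp:
  assumes F: "subgp F" and X: "finite X" "X \<subseteq> gen F"
  shows "\<exists>V. finite V \<and> X \<subseteq> sp V F"
  using X
proof (induction X rule: finite_induct)
  case empty
  then show ?case by blast
next
  case (insert x X)
  then obtain V where V: "finite V" "X \<subseteq> sp V F" by blast
  obtain V' where V': "finite V'" "x \<in> sp V' F" using insert.prems by (auto simp: gen_def)
  have "sp V F \<subseteq> sp (V \<union> V') F" "sp V' F \<subseteq> sp (V \<union> V') F"
    by (rule sp_subset_sp[OF F]; use V V' in simp)+
  then show ?case using V V' by (intro exI[of _ "V \<union> V'"]) auto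
qed

lemma sp_subset_M: "F \<subseteq> M \<Longrightarrow> sp W F \<subseteq> M"
  using submod_u[OF submod_M] by (intro sp_subset submod_subgp[OF submod_M]) blast

text \<open>An element of the augmentation submodule may have witnesses far outside the window.
  Reduction to the box leaves the finite set \<open>Q\<close>, whose witnesses lie in the span over
  one finite set \<open>V\<close>; a diagonal lattice vector moves \<open>V\<close> into every large
  window, and \<open>Imw_shift\<close> moves the result back.\<close>

lemma aug_absorbed:
  assumes F: "subgp F" "finite F" "F \<subseteq> M" "gen F = M" and ac: "a > 0" "c > 0"
  shows "\<exists>i0. \<forall>i\<ge>i0. \<forall>j\<ge>i0. sp (win a b c (Suc i) (Suc j)) F \<inter> aug (a, 0) (b, c) M \<subseteq> Imw a b c F {0} i j"
proof -
  let ?I = "aug (a, 0) (b, c) M"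
  define Q where "Q = sp (pbox a c) F \<inter> ?I"
  have Q: "finite Q" unfolding Q_def using finite_sp[OF F(1,2) finite_pbox] by blast
  have "\<exists>x1 x2. x1 \<in> M \<and> x2 \<in> M \<and> y = dd (a, 0) x1 + dd (b, c) x2" if "y \<in> Q" for y
    using that unfolding Q_def by (blast elim: augE)
  then obtain x1 x2 where x: "\<And>y. y \<in> Q \<Longrightarrow> x1 y \<in> M" "\<And>y. y \<in> Q \<Longrightarrow> x2 y \<in> M"
    "\<And>y. y \<in> Q \<Longrightarrow> y = dd (a, 0) (x1 y) + dd (b, c) (x2 y)" by metis
  have "finite (x1 ` Q \<union> x2 ` Q)" "x1 ` Q \<union> x2 ` Q \<subseteq> gen F" using Q x(1,2) F(4) by auto
  from gen_in_sp[OF F(1) this] obtain V where V: "finite V" "x1 ` Q \<union> x2 ` Q \<subseteq> sp V F" by blast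
  obtain p i0 where i0: "\<forall>i\<ge>i0. \<forall>j\<ge>i0. p < i \<and> p < j \<and> (+) (lat a b c (int p) (int p)) ` V \<subseteq> win a b c i j"
    using win_absorb[OF ac V(1)] by blast
  let ?N = "lat a b c (int p) (int p)"
  have S0: "submod {0}" by (rule submodI[OF subgp_singleton]) (simp add: u_zero)
  have "z \<in> Imw a b c F {0} i j" if ij: "i \<ge> i0" "j \<ge> i0"
    and z: "z \<in> sp (win a b c (Suc i) (Suc j)) F" "z \<in> ?I" for i j z
  proof -
    let ?J = "Imw a b c F {0} i j"
    have J: "subgp ?J" by (rule subgp_Imw[OF F(1) subgp_singleton])
    have JI: "?J \<subseteq> ?I"
      using Imw_subset[OF submod_M S0 F(3)] subgp_0[OF submod_subgp[OF submod_M]] by (simp add: gsum_zero)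
    obtain y where y: "y \<in> sp (pbox a c) F" "z - y \<in> ?J"
      using Imw_reduce[OF F(1) subgp_singleton, of z a b c i j] z(1) by (auto simp: gsum_zero)
    have "z - (z - y) \<in> ?I"
      by (rule subgp_diff[OF submod_subgp[OF submod_aug[OF submod_M]] z(2)]) (use y(2) JI in blast)
    then have yQ: "y \<in> Q" using y by (simp add: Q_def)
    have p: "p < i" "p < j" "(+) ?N ` V \<subseteq> win a b c i j" using i0 ij by blast+
    have uV: "u ?N w \<in> sp (win a b c i j) F" if "w \<in> sp V F" for w
    proof -
      have "u ?N w \<in> sp ((+) ?N ` V) F" using that sp_image by blast
      then show ?thesis using sp_subset_sp[OF F(1) finite_win p(3) subset_refl] by blast
    qed
    have 1: "u ?N (x1 y) \<in> G a b c F {0} i (Suc j)" "u ?N (x2 y) \<in> G a b c F {0} (Suc i) j"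
    proof -
      have x12: "u ?N (x1 y) \<in> G a b c F {0} i j" "u ?N (x2 y) \<in> G a b c F {0} i j"
        unfolding gsum_zero by (rule uV, use V(2) yQ in blast)+
      show "u ?N (x1 y) \<in> G a b c F {0} i (Suc j)"
        by (rule subsetD[OF G_mono[OF F(1)] x12(1)]) simp_all
      show "u ?N (x2 y) \<in> G a b c F {0} (Suc i) j"
        by (rule subsetD[OF G_mono[OF F(1)] x12(2)]) simp_all
    qed
    have "u ?N y = dd (a, 0) (u ?N (x1 y)) + dd (b, c) (u ?N (x2 y))"
      by (subst x(3)[OF yQ]) (simp add: u_add dd_u)
    also have "\<dots> \<in> ?J"
      by (intro subgp_add[OF J] Imw_s Imw_t F subgp_singleton 1)
    finally have uy: "u ?N y \<in> ?J" .
    have "dd ?N y \<in> ?J" by (rule Imw_shift[OF F(1) subgp_singleton y(1)]) (use p in simp_all)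
    from subgp_diff[OF J uy this] have "y \<in> ?J" by (simp add: dd_def)
    from subgp_add[OF J y(2) this] show ?thesis by simp
  qed
  then show ?thesis by blast
qed

text \<open>Mixing makes the first differential injective, so the kernel is at least as large as the
  span over the smallest window. Absorption makes the cokernel at most the index of the augmentation
  submodule. Inserted into the Euler characteristic, this bounds the mixed second difference of the
  logarithms.\<close>

lemma lower_step:
  assumes F: "subgp F" "finite F" "F \<subseteq> M" "gen F = M" and ac: "a > 0" "c > 0"
    and mix: "\<forall>n x. n \<noteq> 0 \<longrightarrow> x \<in> M \<longrightarrow> u n x = x \<longrightarrow> x = 0"
  shows "\<exists>i0. \<forall>i\<ge>i0. \<forall>j\<ge>i0.
    card (sp (win a b c (Suc i) (Suc j)) F) * card (sp (win a b c i j) F) \<le>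
    ix M (aug (a, 0) (b, c) M) * (card (sp (win a b c (Suc i) j) F) * card (sp (win a b c i (Suc j)) F))"
proof -
  let ?I = "aug (a, 0) (b, c) M"
  obtain i0 where i0: "\<forall>i\<ge>i0. \<forall>j\<ge>i0. sp (win a b c (Suc i) (Suc j)) F \<inter> ?I \<subseteq> Imw a b c F {0} i j"
    using aug_absorbed[OF F ac] by blast
  have S0: "submod {0}" by (rule submodI[OF subgp_singleton]) (simp add: u_zero)
  have "card (sp (win a b c (Suc i) (Suc j)) F) * card (sp (win a b c i j) F) \<le>
    ix M ?I * (card (sp (win a b c (Suc i) j) F) * card (sp (win a b c i (Suc j)) F))"
    if ij: "i \<ge> i0" "j \<ge> i0" for i j
  proof -
    let ?J = "Imw a b c F {0} i j"
    have H2: "z \<in> {0}" if "z \<in> G a b c F {0} i j" "dd (a, 0) z \<in> {0}" for z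
    proof -
      have "z \<in> M" using that(1) sp_subset_M[OF F(3)] by (auto simp: gsum_zero)
      then show ?thesis using mix[rule_format, of "(a, 0)" z] that(2) ac by (simp add: dd_def zero_prod_def)
    qed
    have k: "card (sp (win a b c i j) F) \<le> ix (Kerw a b c F {0} i j) ({0} \<times> {0})"
      using Kerw_lower[OF F(1,2) S0 H2] by (simp add: gsum_zero ix_zero)
    have "ix (G a b c F {0} (Suc i) (Suc j)) ?J \<le> ix M ?I"
    proof (rule ix_le_map(2)[OF subgp_Imw[OF F(1) subgp_singleton] submod_subgp[OF submod_aug[OF submod_M]]
          fin_ix_aug[OF submod_M subset_refl ac], of "\<lambda>x. x"])
      show "(\<lambda>x. x) ` G a b c F {0} (Suc i) (Suc j) \<subseteq> M" using sp_subset_M[OF F(3)] by (simp add: gsum_zero)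
      fix x y assume xy: "x \<in> G a b c F {0} (Suc i) (Suc j)" "y \<in> G a b c F {0} (Suc i) (Suc j)"
        and d: "x - y \<in> ?I"
      have "x - y \<in> sp (win a b c (Suc i) (Suc j)) F"
        using subgp_diff[OF subgp_G[OF F(1) subgp_singleton] xy] by (simp add: gsum_zero)
      then show "x - y \<in> ?J" using i0 ij d by blast
    qed
    then have "ix (G a b c F {0} (Suc i) (Suc j)) ?J * (card (sp (win a b c (Suc i) j) F) * card (sp (win a b c i (Suc j)) F))
        \<le> ix M ?I * (card (sp (win a b c (Suc i) j) F) * card (sp (win a b c i (Suc j)) F))"
      by (rule mult_right_mono) simp
    moreover have "ix (G a b c F {0} (Suc i) (Suc j)) ?J * (card (sp (win a b c (Suc i) j) F) * card (sp (win a b c i (Suc j)) F))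
       = card (sp (win a b c (Suc i) (Suc j)) F) * ix (Kerw a b c F {0} i j) ({0} \<times> {0})"
      using koszul_win(1)[OF F(1,2) S0, of a b c i j] by (simp add: gsum_zero ix_zero)
    moreover have "card (sp (win a b c (Suc i) (Suc j)) F) * card (sp (win a b c i j) F) \<le>
        card (sp (win a b c (Suc i) (Suc j)) F) * ix (Kerw a b c F {0} i j) ({0} \<times> {0})"
      by (rule mult_left_mono[OF k]) simp
    ultimately show ?thesis by linarith
  qed
  then show ?thesis by blast
qed

lemma win_growth:
  assumes F: "subgp F" "finite F" "F \<subseteq> M" "gen F = M" and ac: "a > 0" "c > 0"
    and mix: "\<forall>n x. n \<noteq> 0 \<longrightarrow> x \<in> M \<longrightarrow> u n x = x \<longrightarrow> x = 0"
  shows "\<exists>i0 C. C \<ge> 0 \<and> (\<forall>i\<ge>i0. \<forall>j\<ge>i0. ln (real (card (sp (win a b c i j) F))) \<le>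
     real i * real j * ln (real (ix M (aug (a, 0) (b, c) M))) + C * (real i + real j))"
proof -
  let ?D = "ix M (aug (a, 0) (b, c) M)"
  define f where "f i j = ln (real (card (sp (win a b c i j) F)))" for i j
  obtain i0 where i0: "\<And>i j. i \<ge> i0 \<Longrightarrow> j \<ge> i0 \<Longrightarrow>
    card (sp (win a b c (Suc i) (Suc j)) F) * card (sp (win a b c i j) F) \<le>
    ?D * (card (sp (win a b c (Suc i) j) F) * card (sp (win a b c i (Suc j)) F))"
    using lower_step[OF F ac mix] by blast
  have pos: "card (sp (win a b c i j) F) > 0" for i j by (rule card_sp_pos[OF F(1,2) finite_win])
  have D: "?D > 0"
    using ix_pos[OF fin_ix_aug[OF submod_M subset_refl ac]] subgp_0[OF submod_subgp[OF submod_M]] by blast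
  have step: "f (Suc i) (Suc j) + f i j \<le> ln ?D + f (Suc i) j + f i (Suc j)" if "i \<ge> i0" "j \<ge> i0" for i j
  proof -
    have "real (card (sp (win a b c (Suc i) (Suc j)) F)) * real (card (sp (win a b c i j) F)) \<le>
      real ?D * (real (card (sp (win a b c (Suc i) j) F)) * real (card (sp (win a b c i (Suc j)) F)))"
      using i0[OF that] by (simp only: of_nat_mult[symmetric] of_nat_le_iff)
    then have "ln (real (card (sp (win a b c (Suc i) (Suc j)) F)) * real (card (sp (win a b c i j) F))) \<le>
      ln (real ?D * (real (card (sp (win a b c (Suc i) j) F)) * real (card (sp (win a b c i (Suc j)) F))))"
      using pos D by (subst ln_le_cancel_iff) simp_all
    then show ?thesis using pos D by (simp add: f_def ln_mult)
  qed
  define d where "d = nat (a * c)"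
  \<comment> \<open>Along the two edges of the summation range the trivial bound |F|^|W| has a
    logarithm linear in the long side; \<open>C\<close> is its slope for windows with short side
    \<open>i0\<close>.\<close>
  define C where "C = real i0 * real d * ln (real (card F))"
  have F1: "card F \<ge> 1" using F(2) subgp_0[OF F(1)] card_gt_0_iff[of F] by (simp add: Suc_le_eq) blast
  have C0: "C \<ge> 0" using F1 by (simp add: C_def)
  have triv: "f i j \<le> real (i * j * d) * ln (real (card F))" for i j
  proof -
    have "card (sp (win a b c i j) F) \<le> card F ^ (i * j * d)"
      using card_sp_le[OF F(1,2) finite_win, of a b c i j] card_win[OF ac] by (simp add: d_def)
    then have "real (card (sp (win a b c i j) F)) \<le> real (card F) ^ (i * j * d)"
      by (simp only: of_nat_power[symmetric] of_nat_le_iff)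
    then have "f i j \<le> ln (real (card F) ^ (i * j * d))"
      unfolding f_def using pos F1 by (subst ln_le_cancel_iff) simp_all
    then show ?thesis using F1 by (simp add: ln_realpow)
  qed
  have "f i j \<le> real i * real j * ln ?D + C * (real i + real j)" if ij: "i \<ge> i0" "j \<ge> i0" for i j
  proof -
    have "f (i0 + (i - i0)) (i0 + (j - i0)) + f (i0 + 0) (i0 + 0) \<le>
      f (i0 + (i - i0)) (i0 + 0) + f (i0 + 0) (i0 + (j - i0)) + real (i - i0) * real (j - i0) * ln ?D"
      by (rule telescope[of "\<lambda>n m. f (i0 + n) (i0 + m)"]) (use step in simp)
    then have "f i j + f i0 i0 \<le> f i i0 + f i0 j + real (i - i0) * real (j - i0) * ln ?D"
      using ij by simp
    moreover have "f i0 i0 \<ge> 0" using pos[of i0 i0] by (simp add: f_def)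
    moreover have "real (i - i0) * real (j - i0) * ln ?D \<le> real i * real j * ln ?D"
      using D by (intro mult_right_mono mult_mono) simp_all
    moreover have "f i i0 \<le> C * real i" using triv[of i i0] by (simp add: C_def algebra_simps)
    moreover have "f i0 j \<le> C * real j" using triv[of i0 j] by (simp add: C_def algebra_simps)
    ultimately show ?thesis by (simp add: algebra_simps)
  qed
  then show ?thesis using C0 unfolding f_def by blast
qed

text \<open>The strip height \<open>J\<close> is fixed first: the edge term \<open>C\<close> of
  \<open>win_growth\<close> is paid once per strip, and high strips make its total at most half of
  \<epsilon> times N^2. Then \<open>N\<close> is taken large enough for the linear and constant
  terms.\<close>

lemma square_growth:
  assumes E: "subgp E" "finite E" "E \<subseteq> M" and abc: "a > 0" "b \<ge> 0" "c > 0"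
    and mix: "\<forall>n x. n \<noteq> 0 \<longrightarrow> x \<in> M \<longrightarrow> u n x = x \<longrightarrow> x = 0"
    and eps: "\<epsilon> > 0"
  shows "\<exists>N0. \<forall>N\<ge>N0. ln (real (card (sp ({0..<int N} \<times> {0..<int N}) E))) \<le>
    (ln (real (ix M (aug (a, 0) (b, c) M))) / real_of_int (a * c) + \<epsilon>) * (real N)\<^sup>2"
proof -
  obtain F0 where F0: "subgp F0" "finite F0" "F0 \<subseteq> M" "gen F0 = M"
    using finitely_generated[OF submod_M subset_refl] by blast
  \<comment> \<open>\<open>win_growth\<close> needs a group that generates the module, and enlarging
    \<open>E\<close> can only enlarge the span to be bounded.\<close>
  define F where "F = gsum E F0"
  have F: "subgp F" "finite F" "F \<subseteq> M" "gen F = M" "E \<subseteq> F"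
  proof -
    show 1: "subgp F" unfolding F_def by (rule subgp_gsum[OF E(1) F0(1)])
    show "finite F" unfolding F_def by (rule finite_gsum[OF E(2) F0(2)])
    show 2: "F \<subseteq> M" unfolding F_def by (rule gsum_subset[OF submod_subgp[OF submod_M] E(3) F0(3)])
    show "E \<subseteq> F" unfolding F_def using gsum_left[OF F0(1)] by blast
    have "F0 \<subseteq> F" unfolding F_def using gsum_right[OF E(1)] by blast
    then have "F0 \<subseteq> gen F" using gen_self[OF subgp_0[OF 1]] by blast
    then have "gen F0 \<subseteq> gen F" by (rule gen_subset[OF submod_gen[OF 1]])
    then show "gen F = M" using F0(4) gen_subset[OF submod_M 2] by blast
  qed
  define D where "D = ln (real (ix M (aug (a, 0) (b, c) M)))"
  have "ix M (aug (a, 0) (b, c) M) > 0"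
    using ix_pos[OF fin_ix_aug[OF submod_M subset_refl abc(1,3)]] subgp_0[OF submod_subgp[OF submod_M]] by blast
  then have D0: "D \<ge> 0" by (simp add: D_def)
  obtain i0 C where C0: "C \<ge> 0" and C: "\<And>i j. i \<ge> i0 \<Longrightarrow> j \<ge> i0 \<Longrightarrow>
      ln (real (card (sp (win a b c i j) F))) \<le> real i * real j * D + C * (real i + real j)"
    using win_growth[OF F(1-4) abc(1,3) mix] unfolding D_def by blast
  define A where "A = real_of_int a"
  define B where "B = real_of_int c"
  have AB: "A > 0" "B > 0" using abc by (simp_all add: A_def B_def)
  obtain J :: nat where J: "real J \<ge> C / (A * B) / (\<epsilon> / 2) + real i0 + 1" using real_arch_simple by blast
  have q0: "C / (A * B) / (\<epsilon> / 2) \<ge> 0" using C0 AB eps by simp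
  have J0: "J \<ge> i0" "real J > 0" using J q0 by linarith+
  have "C / (A * B) / (\<epsilon> / 2) \<le> real J" using J by linarith
  moreover have "\<epsilon> / 2 > 0" using eps by simp
  ultimately have "C / (A * B) \<le> real J * (\<epsilon> / 2)" by (simp only: pos_divide_le_eq)
  then have Je: "C / (A * B * real J) \<le> \<epsilon> / 2" using J0(2) AB by (simp add: field_simps)
  \<comment> \<open>Rounding up the number of columns needed for the width N + b J gives at most N /
    A + \<beta>.\<close>
  define \<beta> where "\<beta> = real_of_int (b * int J) / A + 1"
  have b0: "\<beta> \<ge> 0" using abc AB by (simp add: \<beta>_def)
  define A1 where "A1 = (real J * D + C) / A"
  define B1 where "B1 = \<beta> * real J * D + C * \<beta> + C * real J"
  have AB1: "A1 \<ge> 0" "B1 \<ge> 0" using D0 C0 AB b0 by (simp_all add: A1_def B1_def)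
  \<comment> \<open>\<open>K\<close> bounds the linear and the constant term together as a multiple
    of N, since N is at least 1.\<close>
  define K where "K = B1 / (real J * B) + A1 + B1"
  obtain N1 :: nat where N1: "real N1 \<ge> K / (\<epsilon> / 2)" using real_arch_simple by blast
  have main: "ln (real (card (sp ({0..<int N} \<times> {0..<int N}) E))) \<le>
    (D / real_of_int (a * c) + \<epsilon>) * (real N)\<^sup>2" if N: "N \<ge> N1 + nat a * i0 + 1" for N
  proof -
    define i where "i = nat ((int N + b * int J) div a) + 1"
    define m where "m = nat (int N div (int J * c)) + 1"
    have "0 \<le> int N + b * int J" using abc by simp
    then have ii: "int i = (int N + b * int J) div a + 1"
      using abc by (simp add: i_def pos_imp_zdiv_nonneg_iff)
    have Jc: "int J * c > 0" using J0 abc by simp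
    have mm: "int m = int N div (int J * c) + 1"
      using Jc by (simp add: m_def pos_imp_zdiv_nonneg_iff)
    have i1: "int N + b * int J \<le> int i * a"
      unfolding ii by (rule le_div_succ_mult[OF abc(1)])
    have m1: "int N \<le> int m * (int J * c)"
      unfolding mm by (rule le_div_succ_mult[OF Jc])
    have iu: "real i \<le> real N / A + \<beta>"
    proof -
      have "real_of_int (int i) \<le> real_of_int (int N + b * int J) / real_of_int a + 1"
        unfolding ii using real_of_int_div4[of "int N + b * int J" a] by simp
      then show ?thesis by (simp add: A_def \<beta>_def add_divide_distrib)
    qed
    have mu: "real m \<le> real N / (real J * B) + 1"
    proof -
      have "real_of_int (int m) \<le> real_of_int (int N) / real_of_int (int J * c) + 1"
        unfolding mm using real_of_int_div4[of "int N" "int J * c"] by simp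
      then show ?thesis by (simp add: B_def)
    qed
    have "int i0 * a \<le> int N"
    proof -
      have "nat a * i0 \<le> N" using N by simp
      then have "int (nat a * i0) \<le> int N" by (simp only: of_nat_le_iff)
      then show ?thesis using abc by (simp add: mult.commute)
    qed
    also have "int N \<le> int i * a" using i1 mult_nonneg_nonneg[OF abc(2), of "int J"] by linarith
    finally have ii0: "i \<ge> i0" using abc by simp
    let ?W = "win a b c i J"
    let ?U = "\<Union>r<m. (+) (- (b * int J), int r * (int J * c)) ` ?W"
    have fU: "finite ?U" by (simp add: finite_win)
    have "card (sp ({0..<int N} \<times> {0..<int N}) E) \<le> card (sp ?U F)"
      by (intro card_mono finite_sp F fU sp_subset_sp strip_cover abc i1 m1)
    also have "\<dots> \<le> card (sp ?W F) ^ m" by (rule card_sp_UN[OF F(1,2) finite_win])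
    finally have "real (card (sp ({0..<int N} \<times> {0..<int N}) E)) \<le> real (card (sp ?W F)) ^ m"
      by (simp only: of_nat_power[symmetric] of_nat_le_iff)
    then have "ln (real (card (sp ({0..<int N} \<times> {0..<int N}) E))) \<le> ln (real (card (sp ?W F)) ^ m)"
      using card_sp_pos[OF E(1,2), of "{0..<int N} \<times> {0..<int N}"] card_sp_pos[OF F(1,2) finite_win]
      by (subst ln_le_cancel_iff) simp_all
    also have "\<dots> = real m * ln (real (card (sp ?W F)))"
      using card_sp_pos[OF F(1,2) finite_win] by (simp add: ln_realpow)
    also have "\<dots> \<le> real m * (real i * real J * D + C * (real i + real J))"
      by (rule mult_left_mono[OF C[OF ii0 J0(1)]]) simp
    also have "\<dots> \<le> (real N / (real J * B) + 1) * ((real N / A + \<beta>) * real J * D + C * ((real N / A + \<beta>) + real J))"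
      using iu D0 C0 AB J0(2) by (intro mult_mono mu add_mono mult_right_mono mult_left_mono) auto
    also have "(real N / A + \<beta>) * real J * D + C * ((real N / A + \<beta>) + real J) = A1 * real N + B1"
      by (simp add: A1_def B1_def add_divide_distrib algebra_simps)
    also have "(real N / (real J * B) + 1) * (A1 * real N + B1) =
       A1 / (real J * B) * (real N)\<^sup>2 + (B1 / (real J * B) + A1) * real N + B1"
      by (simp add: power2_eq_square algebra_simps add_divide_distrib)
    also have "A1 / (real J * B) = D / real_of_int (a * c) + C / (A * B * real J)"
      using J0 AB by (simp add: A1_def A_def B_def field_simps)
    also have "(D / real_of_int (a * c) + C / (A * B * real J)) * (real N)\<^sup>2 +
        (B1 / (real J * B) + A1) * real N + B1 \<le>
        (D / real_of_int (a * c) + \<epsilon> / 2) * (real N)\<^sup>2 + (\<epsilon> / 2) * (real N)\<^sup>2"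
    proof -
      have N1': "real N \<ge> 1" "real N \<ge> K / (\<epsilon> / 2)" using N N1 by linarith+
      have "B1 \<le> B1 * real N" using AB1 N1' mult_left_mono[of 1 "real N" B1] by simp
      then have "(B1 / (real J * B) + A1) * real N + B1 \<le> K * real N" by (simp add: K_def algebra_simps)
      also have "K \<le> (\<epsilon> / 2) * real N" using N1'(2) eps by (simp add: field_simps)
      then have "K * real N \<le> (\<epsilon> / 2) * real N * real N" by (rule mult_right_mono) simp
      also have "\<dots> = (\<epsilon> / 2) * (real N)\<^sup>2" by (simp add: power2_eq_square)
      finally have 1: "(B1 / (real J * B) + A1) * real N + B1 \<le> (\<epsilon> / 2) * (real N)\<^sup>2" .
      have 2: "(D / real_of_int (a * c) + C / (A * B * real J)) * (real N)\<^sup>2 \<le>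
          (D / real_of_int (a * c) + \<epsilon> / 2) * (real N)\<^sup>2"
        by (intro mult_right_mono add_left_mono Je) simp
      show ?thesis using 1 2 by linarith
    qed
    also have "\<dots> = (D / real_of_int (a * c) + \<epsilon>) * (real N)\<^sup>2" by (simp add: algebra_simps)
    finally show ?thesis .
  qed
  show ?thesis unfolding D_def[symmetric]
    by (rule exI[of _ "N1 + nat a * i0 + 1"], intro allI impI, rule main)
qed

end


lemma ix_self: assumes "subgp K" "H \<subseteq> K" shows "ix H K \<le> 1"
proof -
  have "ix H K \<le> card {()}"
    by (rule ix_le_inj(2)[OF assms(1), of "{()}" "\<lambda>_. ()"]) (use assms subgp_diff in blast)+
  then show ?thesis by simp
qed

text \<open>Comparison of leading coefficients as n grows; \<open>k\<close> absorbs the offset at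
  which a summed inequality starts.\<close>

lemma quadratic_dominated:
  fixes \<delta> e c k :: real
  assumes "\<And>n::nat. real n * real n * \<delta> \<le> (k + real n) * (k + real n) * e + c"
  shows "\<delta> \<le> e"
proof (rule ccontr)
  assume "\<not> \<delta> \<le> e"
  then have eta: "\<delta> - e > 0" by simp
  define B where "B = \<bar>2 * k * e\<bar> + \<bar>k * k * e + c\<bar>"
  obtain n :: nat where n: "real n > B / (\<delta> - e) + 1" using reals_Archimedean2 by blast
  have B0: "B \<ge> 0" by (simp add: B_def)
  have q0: "B / (\<delta> - e) \<ge> 0" using B0 eta by simp
  have n1: "real n \<ge> 1" "B / (\<delta> - e) < real n" using n q0 by linarith+
  then have nB: "B < real n * (\<delta> - e)" using eta by (simp add: pos_divide_less_eq)
  have "real n * (real n * (\<delta> - e)) \<le> 2 * k * e * real n + (k * k * e + c)"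
    using assms[of n] by (simp add: algebra_simps)
  also have "\<dots> \<le> \<bar>2 * k * e\<bar> * real n + \<bar>k * k * e + c\<bar> * real n"
  proof (rule add_mono)
    show "2 * k * e * real n \<le> \<bar>2 * k * e\<bar> * real n" by (rule mult_right_mono) simp_all
    have "\<bar>k * k * e + c\<bar> * 1 \<le> \<bar>k * k * e + c\<bar> * real n" by (rule mult_left_mono[OF n1(1)]) simp
    then show "k * k * e + c \<le> \<bar>k * k * e + c\<bar> * real n"
      using abs_ge_self[of "k * k * e + c"] by (metis mult.right_neutral order_trans)
  qed
  also have "\<dots> = real n * B" by (simp add: B_def algebra_simps)
  finally have "real n * (\<delta> - e) \<le> B" using n1 by simp
  with nB show False by simp
qed

section \<open>Monic closure\<close>

context z2_module
begin

text \<open>Up to the unit u^s, the operator u^s - 1 is the monic operator 1 - u^(-s), because s =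
  (a, 0) has positive \<open>phi\<close>. Monic closure thus does modulo \<open>L\<close> what
  mixing does in the module itself.\<close>

lemma mon_closed_dd:
  assumes H: "submod L" "a > 0" and L: "\<forall>g\<in>mon. g z \<in> L \<longrightarrow> z \<in> L" and z: "dd (a, 0) z \<in> L"
  shows "z \<in> L"
proof -
  have m: "(\<lambda>x. x - u (- (a, 0)) x) \<in> mon" using H(2) by (intro mon_one_minus) (simp add: phi_def)
  have "z - u (- (a, 0)) z \<in> L"
  proof -
    have "u (- (a, 0)) (dd (a, 0) z) \<in> L" by (rule submod_u[OF H(1) z])
    then show ?thesis unfolding dd_def u_diff u_inv .
  qed
  with L[rule_format, OF m] show ?thesis by simp
qed

end

context noeth_module
begin

definition mclosed :: "'a set \<Rightarrow> bool" where
  "mclosed L \<longleftrightarrow> (\<forall>g\<in>mon. \<forall>y\<in>M. g y \<in> L \<longrightarrow> y \<in> L)"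

lemma mon_preimage:
  assumes A: "submod A" and g: "g \<in> mon" shows "submod {y\<in>M. g y \<in> A}"
proof -
  note gO = mon_Op[OF g]
  show ?thesis
    using submod_M A Op_0[OF gO]
    by (intro submodI subgpI) (auto simp: Op_diff[OF gO] Op_u[OF gO] intro: subgp_diff submod_subgp submod_u subgp_0)
qed

text \<open>Preimages of \<open>A\<close> under monic operators grow under composition, since the
  operators commute. A maximal one exists by the chain condition, is closed, and is cut out by a
  single \<open>g\<close>; this operator later embeds the closure into \<open>A\<close>.\<close>

lemma mon_closure:
  assumes A: "submod A" "A \<subseteq> M"
  shows "\<exists>g\<in>mon. submod {y\<in>M. g y \<in> A} \<and> A \<subseteq> {y\<in>M. g y \<in> A} \<and> mclosed {y\<in>M. g y \<in> A}"
proof -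
  let ?Y = "\<lambda>g. {y\<in>M. g y \<in> A}"
  have ne: "?Y ` mon \<noteq> {}" using mon_id by blast
  have sm: "submod H \<and> H \<subseteq> M" if "H \<in> ?Y ` mon" for H using that mon_preimage[OF A(1)] by blast
  obtain H where H: "H \<in> ?Y ` mon" "\<forall>H'\<in>?Y ` mon. H \<subseteq> H' \<longrightarrow> H' = H"
    using acc_max[OF ne sm] by (rule bexE)
  from H(1) obtain g where g: "g \<in> mon" "H = ?Y g" by blast
  have AY: "A \<subseteq> ?Y g" using A Op_closed[OF mon_Op[OF g(1)] A(1)] by blast
  have "mclosed (?Y g)" unfolding mclosed_def
  proof (intro ballI impI)
    fix h y assume h: "h \<in> mon" and y: "y \<in> M" and hy: "h y \<in> ?Y g"
    let ?k = "\<lambda>y. g (h y)"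
    have k: "?k \<in> mon" by (rule mon_comp[OF g(1) h])
    have "?Y g \<subseteq> ?Y ?k"
    proof
      fix z assume z: "z \<in> ?Y g"
      have "h (g z) \<in> A" using z Op_closed[OF mon_Op[OF h] A(1)] by blast
      then have "g (h z) \<in> A" using Op_commute[OF mon_Op[OF h] mon_Op[OF g(1)]] by simp
      then show "z \<in> ?Y ?k" using z by blast
    qed
    moreover have "?Y ?k \<in> ?Y ` mon" using k by (rule imageI)
    ultimately have "?Y ?k = ?Y g" using H(2)[rule_format, of "?Y ?k"] unfolding g(2) by metis
    moreover have "y \<in> ?Y ?k" using hy y by simp
    ultimately show "y \<in> ?Y g" by (simp only:)
  qed
  then show ?thesis using g mon_preimage[OF A(1) g(1)] AY by blast
qed

text \<open>The constant in the upper bound must not depend on the lattice. A lattice with basis (a,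
  0), (b, c) contains a c times the plane lattice, so it is enough to look at elements fixed modulo
  \<open>J\<close> by k times the plane lattice. These submodules increase along divisibility of k,
  so a maximal one, at \<open>k0\<close>, contains all others; it is finite over \<open>J\<close>
  because \<open>J\<close> contains its augmentation submodule of level \<open>k0\<close>.\<close>

lemma fixed_level:
  assumes A: "submod A" "A \<subseteq> M" and J: "submod J" "J \<subseteq> A"
  shows "\<exists>E. submod E \<and> E \<subseteq> A \<and> fin_ix E J \<and> J \<subseteq> E \<and>
    (\<forall>a b c z. a > 0 \<longrightarrow> c > 0 \<longrightarrow> z \<in> A \<longrightarrow> dd (a, 0) z \<in> J \<longrightarrow> dd (b, c) z \<in> J \<longrightarrow> z \<in> E)"
proof -
  define S where "S s t = {z\<in>A. dd s z \<in> J \<and> dd t z \<in> J}" for s t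
  have S: "submod (S s t)" for s t
    unfolding S_def
    using A(1) J(1) dd_zero
    by (intro submodI subgpI) (auto simp: dd_diff dd_u intro: subgp_diff submod_subgp submod_u subgp_0)
  have Sdd: "\<forall>x\<in>S s t. dd s x \<in> J" "\<forall>x\<in>S s t. dd t x \<in> J" for s t by (auto simp: S_def)
  have SA: "S s t \<subseteq> A" for s t by (auto simp: S_def)
  define E where "E k = S (k, 0) (0, k)" for k :: int
  have latE: "S (a, 0) (b, c) \<subseteq> E (a * c)" for a b c
  proof
    fix z assume z: "z \<in> S (a, 0) (b, c)"
    note st = stab_lat[OF S submod_subgp[OF J(1)] Sdd, rule_format, OF z]
    have "dd (a * c, 0) z \<in> J" using st[of c 0] by (simp add: lat_def mult.commute)
    \<comment> \<open>The vector (0, a c) is -b times (a, 0) plus a times (b, c).\<close>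
    moreover have "dd (0, a * c) z \<in> J" using st[of "- b" a] by (simp add: lat_def mult.commute)
    ultimately show "z \<in> E (a * c)" using z by (simp add: E_def S_def)
  qed
  have Emul: "E k \<subseteq> E (k * l)" "E k \<subseteq> E (l * k)" for k l
  proof -
    have "z \<in> E (k * l)" if z: "z \<in> E k" for z
    proof -
      note st = stab_lat[OF S submod_subgp[OF J(1)] Sdd, rule_format, OF z[unfolded E_def]]
      have "dd (k * l, 0) z \<in> J" using st[of l 0] by (simp add: lat_def mult.commute)
      moreover have "dd (0, k * l) z \<in> J" using st[of 0 l] by (simp add: lat_def mult.commute)
      ultimately show ?thesis using z by (simp add: E_def S_def)
    qed
    then show "E k \<subseteq> E (k * l)" "E k \<subseteq> E (l * k)" by (auto simp: mult.commute)
  qed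
  let ?A = "E ` {0<..}"
  have ne: "?A \<noteq> {}" by (simp add: greaterThan_non_empty)
  have sm: "submod H \<and> H \<subseteq> M" if "H \<in> ?A" for H using that S SA A(2) unfolding E_def by blast
  obtain H where H: "H \<in> ?A" "\<forall>H'\<in>?A. H \<subseteq> H' \<longrightarrow> H' = H"
    using acc_max[OF ne sm] by (rule bexE)
  from H(1) obtain k0 where k0: "k0 > 0" "H = E k0" by auto
  have all: "E k \<subseteq> E k0" if "k > 0" for k
  proof -
    have "E (k0 * k) \<in> ?A" using that k0 by simp
    then have "E (k0 * k) = E k0" using H(2) k0(2) Emul(1)[of k0 k] by blast
    then show ?thesis using Emul(2)[of k k0] by blast
  qed
  have fin: "fin_ix (E k0) J"
  proof (rule ix_mono(1)[OF submod_subgp[OF J(1)] submod_subgp[OF submod_aug] _ subset_refl])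
    show "submod (E k0)" unfolding E_def by (rule S)
    show "fin_ix (E k0) (aug (k0, 0) (0, k0) (E k0))"
      unfolding E_def using S SA A(2) k0(1) by (intro fin_ix_aug) blast+
    show "aug (k0, 0) (0, k0) (E k0) \<subseteq> J"
      unfolding aug_def E_def using Sdd by (intro gsum_subset submod_subgp J(1)) blast+
  qed
  have JE: "J \<subseteq> E k0"
    using J dd_in[OF J(1)] by (auto simp: E_def S_def)
  have "z \<in> E k0" if "a > 0" "c > 0" "z \<in> A" "dd (a, 0) z \<in> J" "dd (b, c) z \<in> J" for a b c z
  proof -
    have "z \<in> E (a * c)" using latE that by (auto simp: S_def)
    then show ?thesis using all[of "a * c"] that by auto
  qed
  then show ?thesis using fin JE S SA by (intro exI[of _ "E k0"]) (auto simp: E_def)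
qed

text \<open>With \<open>n\<close> the order of \<open>y\<close> modulo \<open>L\<close> and
  \<open>p\<close> a prime factor of it, the multiple of \<open>y\<close> by n / p has order
  \<open>p\<close> modulo \<open>L\<close>.\<close>

lemma prime_torsion:
  assumes L: "submod L" and y: "y \<in> M" "y \<notin> L"
  shows "\<exists>x p. x \<in> M \<and> x \<notin> L \<and> prime (p::nat) \<and> nm p x \<in> L"
proof -
  obtain n0 where n0: "n0 > 0 \<and> nm n0 y = 0" using tors[OF y(1)] by blast
  define n where "n = (LEAST n. n > 0 \<and> nm n y \<in> L)"
  have ex: "n0 > 0 \<and> nm n0 y \<in> L" using n0 subgp_0[OF submod_subgp[OF L]] by simp
  have n: "n > 0" "nm n y \<in> L" using LeastI[of "\<lambda>n. n > 0 \<and> nm n y \<in> L", OF ex] by (auto simp: n_def)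
  have least: "nm k y \<notin> L" if "0 < k" "k < n" for k
    using not_less_Least[of k "\<lambda>n. n > 0 \<and> nm n y \<in> L"] that by (auto simp: n_def)
  have "n \<noteq> 1" using n(2) y(2) by auto
  then obtain p where p: "prime p" "p dvd n" using prime_factor_nat by blast
  then obtain k where k: "n = p * k" by (elim dvdE)
  have "k > 0" "k < n" using k n(1) prime_gt_1_nat[OF p(1)] by auto
  then have "nm k y \<notin> L" by (rule least)
  moreover have "nm p (nm k y) \<in> L" using n(2) k nm_mult[of p k y] by simp
  moreover have "nm k y \<in> M" by (rule nm_in[OF submod_subgp[OF submod_M] y(1)])
  ultimately show ?thesis using p(1) by blast
qed

section \<open>The cyclic module generated by x modulo L, over the field with p elements\<close>

context
  fixes L x p
  assumes L: "submod L" "L \<subseteq> M" "mclosed L" and x: "x \<in> M" "x \<notin> L" and p: "prime (p::nat)" "nm p x \<in> L"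
begin

lemma cyc_fin: "subgp (cyc x)" "finite (cyc x)"
  using tors[OF x(1)] finite_cyc subgp_cyc by blast+

lemma subgp_L: "subgp L" by (rule submod_subgp[OF L(1)])

text \<open>A relation with leading coefficient \<open>k\<close> prime to \<open>p\<close> becomes
  monic after multiplication by an inverse of \<open>k\<close> modulo \<open>p\<close> and a shift
  by -m. Monic closure of \<open>L\<close> would then put \<open>x\<close> into
  \<open>L\<close>.\<close>

lemma top_coeff:
  assumes W: "finite W" "\<And>n. n \<in> W \<Longrightarrow> phi n < phi m" and k: "0 < k" "k < p"
  shows "nm k (u m x) \<notin> gsum (sp W (cyc x)) L"
proof
  assume "nm k (u m x) \<in> gsum (sp W (cyc x)) L"
  then obtain w l where w: "w \<in> sp W (cyc x)" and l: "l \<in> L" and e: "nm k (u m x) = w + l"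
    by (auto simp: gsum_def)
  obtain T where T: "T \<in> Op W" "w = T x" using sp_Op[OF w W(1)] by blast
  have "coprime p k" by (rule prime_imp_coprime[OF p(1)]) (use k nat_dvd_not_less in blast)
  then have "gcd k p = 1" by (simp add: coprime_iff_gcd_eq_1 gcd.commute)
  then obtain e1 f1 where ef: "k * e1 = p * f1 + 1" using bezout_nat[of k p] k by auto
  have pL: "nm p (u m x) \<in> L" using submod_u[OF L(1) p(2), of m] by (simp add: u_nm)
  have "u m x + nm f1 (nm p (u m x)) = nm e1 (nm k (u m x))"
    using ef by (simp add: nm_mult[symmetric] mult.commute add.commute)
  also have "\<dots> = nm e1 (T x) + nm e1 l" unfolding e T(2)
    using nm_diff[of e1 "T x" "- l"] nm_diff[of e1 0 l] by (simp add: nm_zero)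
  finally have eq: "u m x - nm e1 (T x) = nm e1 l - nm f1 (nm p (u m x))" by (simp add: algebra_simps)
  have "u m x - nm e1 (T x) \<in> L" unfolding eq by (intro subgp_diff[OF subgp_L] nm_in[OF subgp_L] l pL)
  then have "u (- m) (u m x - nm e1 (T x)) \<in> L" by (rule submod_u[OF L(1)])
  then have in_L: "x + (- u (- m) (nm e1 (T x))) \<in> L" by (simp add: u_diff u_inv)
  have "(\<lambda>x. u (- m) (nm e1 (T x))) \<in> Op neg"
    by (rule Op_shift[OF nm_Op[OF T(1)]]) (use W(2) in \<open>simp add: phi_add phi_minus phi_diff\<close>)
  then have "(\<lambda>x. x + (- u (- m) (nm e1 (T x)))) \<in> mon" by (intro monI Op_uminus)
  from L(3)[unfolded mclosed_def, rule_format, OF this x(1)] in_L x(2) show False by simp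
qed

text \<open>When exponents are added in increasing order of \<open>phi\<close>, each new one
  contributes a factor of exactly \<open>p\<close>: at least, because by \<open>top_coeff\<close>
  its multiples below \<open>p\<close> are incongruent, and at most, because p x lies in
  \<open>L\<close>. So \<open>x\<close> generates a free module over the group ring modulo
  \<open>p\<close>.\<close>

lemma ix_sp_cyc:
  assumes "finite W" shows "ix (sp W (cyc x)) L = p ^ card W"
  using assms
proof (induction W rule: finite_ranking_induct[where f = phi])
  case empty
  have "ix {0} L \<le> 1" by (rule ix_self[OF subgp_L]) (use subgp_0[OF subgp_L] in blast)
  moreover have "ix {0} L > 0" by (rule ix_pos[OF fin_ix_finite]) simp_all
  ultimately show ?case by (simp add: sp_empty)
next
  case (insert m W)
  show ?case
  proof (cases "m \<in> W")
    case True
    then show ?thesis using insert.IH by (simp add: insert_absorb)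
  next
    case False
    have lt: "phi n < phi m" if "n \<in> W" for n
      using insert.hyps(2)[OF that] phi_inj[of n m] that False by force
    let ?X = "cyc x" let ?S = "sp (insert m W) ?X" let ?K = "gsum (sp W ?X) L"
    note X = cyc_fin
    have K: "subgp ?K" by (intro subgp_gsum subgp_sp X subgp_L)
    have S: "subgp (gsum ?S L)" by (intro subgp_gsum subgp_sp X subgp_L)
    have fS: "fin_ix (gsum ?S L) L" unfolding ix_gsum_right[OF subgp_L]
      by (rule fin_ix_finite[OF finite_sp[OF X]]) (use insert in simp)
    have LK: "L \<subseteq> ?K" using gsum_right[OF subgp_sp[OF X(1)]] by blast
    have KS: "?K \<subseteq> gsum ?S L" by (intro gsum_mono sp_subset_sp X subset_refl) (use insert in auto)
    have fK: "fin_ix (gsum ?S L) ?K" by (rule ix_mono(1)[OF K subgp_L fS subset_refl LK])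
    have low: "p \<le> ix (gsum ?S L) ?K"
    proof -
      have "card {..<p} \<le> ix (gsum ?S L) ?K"
      proof (rule ix_ge_inj(2)[OF K fK, of "\<lambda>k. nm k (u m x)"])
        have "u m x \<in> ?S" by (rule u_in_sp) (use insert subgp_0[OF X(1)] cyc_self in auto)
        then show "(\<lambda>k. nm k (u m x)) ` {..<p} \<subseteq> gsum ?S L"
          by (intro image_subsetI nm_in[OF S] gsum_left[OF subgp_L])
        have *: "i = j" if "i \<le> j" "j < p" "nm j (u m x) - nm i (u m x) \<in> ?K" for i j
        proof (rule ccontr)
          assume "i \<noteq> j"
          then have "nm (j - i) (u m x) \<notin> ?K" using that by (intro top_coeff[OF insert.hyps(1) lt]) simp_all
          then show False using that nm_sub[OF that(1), of "u m x"] by simp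
        qed
        fix i j assume ij: "i \<in> {..<p}" "j \<in> {..<p}" "nm i (u m x) - nm j (u m x) \<in> ?K"
        show "i = j"
        proof (cases "i \<le> j")
          case True
          then show ?thesis using *[of i j] ij subgp_diff_comm[OF K, of "nm i (u m x)"] by simp
        next
          case False
          then show ?thesis using *[of j i] ij by simp
        qed
      qed
      then show ?thesis by simp
    qed
    have ex: "\<exists>k<p. z - nm k (u m x) \<in> ?K" if zS: "z \<in> gsum ?S L" for z
    proof -
      obtain s l where s: "s \<in> ?S" and l: "l \<in> L" and z: "z = s + l"
        using zS unfolding gsum_def by blast
      obtain f where f: "\<forall>n\<in>insert m W. f n \<in> ?X" "s = (\<Sum>n\<in>insert m W. u n (f n))" using s by (rule spE)
      obtain k where k: "f m = nm k x" using f(1) by (auto simp: cyc_def)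
      have w: "(\<Sum>n\<in>W. u n (f n)) \<in> sp W ?X" by (rule spI) (use f(1) in blast)
      have "s = nm k (u m x) + (\<Sum>n\<in>W. u n (f n))"
        using f(2) insert.hyps(1) False by (simp add: k u_nm)
      then have 1: "z - nm k (u m x) = (\<Sum>n\<in>W. u n (f n)) + l" using z by (simp add: algebra_simps)
      have "nm k (u m x) - nm (k mod p) (u m x) = nm (k div p * p) (u m x)"
        using nm_add[of "k div p * p" "k mod p" "u m x"] by simp
      also have "\<dots> = nm (k div p) (u m (nm p x))" by (simp add: nm_mult u_nm)
      also have "\<dots> \<in> L" by (intro nm_in[OF subgp_L] submod_u[OF L(1)] p(2))
      finally have 2: "nm k (u m x) - nm (k mod p) (u m x) \<in> ?K" using LK by blast
      have "z - nm k (u m x) \<in> ?K" unfolding 1 by (rule gsumI[OF w l])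
      from subgp_diff_trans[OF K this 2] have "z - nm (k mod p) (u m x) \<in> ?K" .
      then show ?thesis using prime_gt_0_nat[OF p(1)] by (intro exI[of _ "k mod p"]) simp
    qed
    define \<kappa> where "\<kappa> z = (SOME k. k < p \<and> z - nm k (u m x) \<in> ?K)" for z
    have \<kappa>: "\<kappa> z < p \<and> z - nm (\<kappa> z) (u m x) \<in> ?K" if "z \<in> gsum ?S L" for z
      unfolding \<kappa>_def using someI_ex[OF ex[OF that]] .
    have up: "ix (gsum ?S L) ?K \<le> p"
    proof -
      have "ix (gsum ?S L) ?K \<le> card {..<p}"
      proof (rule ix_le_inj(2)[OF K, of _ \<kappa>])
        show "finite {..<p}" by simp
        show "\<kappa> ` gsum ?S L \<subseteq> {..<p}" using \<kappa> by (intro image_subsetI) simp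
        fix z w assume zw: "z \<in> gsum ?S L" "w \<in> gsum ?S L" "\<kappa> z = \<kappa> w"
        have "(z - nm (\<kappa> z) (u m x)) - (w - nm (\<kappa> w) (u m x)) \<in> ?K"
          by (rule subgp_diff[OF K conjunct2[OF \<kappa>[OF zw(1)]] conjunct2[OF \<kappa>[OF zw(2)]]])
        then show "z - w \<in> ?K" using zw(3) by simp
      qed
      then show ?thesis by simp
    qed
    have "ix ?S L = ix (gsum ?S L) L" by (simp add: ix_gsum[OF subgp_L])
    also have "\<dots> = ix (gsum ?S L) ?K * ix ?K L" by (rule tower_eq[OF S K subgp_L LK KS fS])
    also have "ix ?K L = p ^ card W" using insert.IH by (simp add: ix_gsum[OF subgp_L])
    also have "ix (gsum ?S L) ?K = p" using low up by simp
    finally show ?thesis using insert.hyps(1) False by simp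
  qed
qed

lemma ix_G: "a > 0 \<Longrightarrow> c > 0 \<Longrightarrow> ix (G a b c (cyc x) L i j) L = p ^ (i * j * nat (a * c))"
  by (simp add: ix_gsum[OF subgp_L] ix_sp_cyc finite_win card_win)

lemma sp_cyc_M: "sp W (cyc x) \<subseteq> M"
  by (rule sp_subset_M[OF cyc_subset[OF submod_subgp[OF submod_M] x(1)]])

lemma G_M: "G a b c (cyc x) L i j \<subseteq> M"
  by (rule gsum_subset[OF submod_subgp[OF submod_M] sp_cyc_M L(2)])

text \<open>Exactness in the middle is obtained by counting. With d = a c, reduction to the box
  bounds the cokernel by p^d; the Euler characteristic then bounds the kernel by p^(i j d), which is
  already the size of the image of the first differential.\<close>

lemma Kerw_exact:
  assumes ac: "a > 0" "c > 0" and q: "q \<in> Kerw a b c (cyc x) L i j"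
  shows "\<exists>z\<in>G a b c (cyc x) L i j. fst q - dd (a, 0) z \<in> L \<and> snd q + dd (b, c) z \<in> L"
proof -
  let ?G = "\<lambda>i j. G a b c (cyc x) L i j" let ?K = "Kerw a b c (cyc x) L i j"
  let ?I = "Imw a b c (cyc x) L i j" let ?f = "\<lambda>z. (dd (a, 0) z, - dd (b, c) z)"
  define d where "d = nat (a * c)"
  note X = cyc_fin
  have LL: "subgp (L \<times> L)" by (rule subgp_Times[OF subgp_L subgp_L])
  have I: "subgp ?I" by (rule subgp_Imw[OF X(1) subgp_L])
  have LI: "L \<subseteq> ?I" unfolding Imw_def
    by (intro subsetI gsum_right subgp_gsum subgp_image subgp_sp X subgp_L) (simp_all add: dd_diff)
  define y where "y z = (SOME y. y \<in> sp (pbox a c) (cyc x) \<and> z - y \<in> ?I)" for z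
  have y: "y z \<in> sp (pbox a c) (cyc x) \<and> z - y z \<in> ?I" if "z \<in> ?G (Suc i) (Suc j)" for z
    unfolding y_def using someI_ex[of "\<lambda>y. y \<in> sp (pbox a c) (cyc x) \<and> z - y \<in> ?I"]
      Imw_reduce[OF X(1) subgp_L that] by blast
  have "ix (?G (Suc i) (Suc j)) ?I \<le> ix (sp (pbox a c) (cyc x)) L"
  proof (rule ix_le_map(2)[OF I subgp_L fin_ix_finite[OF finite_sp[OF X finite_pbox]], of y])
    show "y ` ?G (Suc i) (Suc j) \<subseteq> sp (pbox a c) (cyc x)" using y by blast
    fix z w assume zw: "z \<in> ?G (Suc i) (Suc j)" "w \<in> ?G (Suc i) (Suc j)" "y z - y w \<in> L"
    have "(z - y z) - (w - y w) + (y z - y w) \<in> ?I"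
      by (rule subgp_add[OF I subgp_diff[OF I conjunct2[OF y[OF zw(1)]] conjunct2[OF y[OF zw(2)]]] subsetD[OF LI zw(3)]])
    then show "z - w \<in> ?I" by simp
  qed
  also have "\<dots> = p ^ d"
    using ix_sp_cyc[OF finite_pbox, of a c] card_win[OF ac, of b 1 1, unfolded win_one] by (simp add: d_def)
  finally have Ip: "ix (?G (Suc i) (Suc j)) ?I \<le> p ^ d" .
  have "p ^ (Suc i * Suc j * d) * ix ?K (L \<times> L) =
      ix (?G (Suc i) (Suc j)) ?I * (p ^ (Suc i * j * d) * p ^ (i * Suc j * d))"
    using koszul_win(1)[OF X L(1), of a b c i j] unfolding ix_G[OF ac] d_def[symmetric] by simp
  also have "\<dots> \<le> p ^ d * (p ^ (Suc i * j * d) * p ^ (i * Suc j * d))"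
    by (rule mult_right_mono[OF Ip]) simp
  also have "\<dots> = p ^ (Suc i * Suc j * d) * p ^ (i * j * d)"
    by (simp add: power_add[symmetric] algebra_simps)
  finally have up: "ix ?K (L \<times> L) \<le> p ^ (i * j * d)" using prime_gt_0_nat[OF p(1)] by simp
  have fG: "?f ` ?G i j \<subseteq> ?K"
  proof (rule image_subsetI)
    fix z assume z: "z \<in> ?G i j"
    have 1: "dd (a, 0) z \<in> ?G (Suc i) j" by (rule dd_s_G[OF X(1) L(1) z])
    have 2: "- dd (b, c) z \<in> ?G i (Suc j)"
      by (rule subgp_minus[OF subgp_G[OF X(1) subgp_L] dd_t_G[OF X(1) L(1) z]])
    show "?f z \<in> ?K"
      using 1 2 subgp_0[OF subgp_L] by (simp add: Kerw_def dd_minus dd_commute[of "(b, c)"])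
  qed
  have sub: "cosets_met (?f ` ?G i j) (L \<times> L) \<subseteq> cosets_met ?K (L \<times> L)"
    unfolding cosets_met_def by (rule image_mono[OF fG])
  note finK = koszul_win(2)[OF X L(1), of a b c i j]
  have ffin: "fin_ix (?f ` ?G i j) (L \<times> L)" by (rule finite_subset[OF sub finK])
  have "p ^ (i * j * d) = ix (?G i j) L" unfolding ix_G[OF ac] d_def ..
  also have "\<dots> \<le> ix (?f ` ?G i j) (L \<times> L)"
  proof (rule ix_le_map(2)[OF subgp_L LL ffin subset_refl])
    fix z w assume zw: "z \<in> ?G i j" "w \<in> ?G i j" "?f z - ?f w \<in> L \<times> L"
    have d: "dd (a, 0) (z - w) \<in> L" using zw(3) by (simp add: dd_diff)
    have M: "z - w \<in> M" using subgp_diff[OF subgp_G[OF X(1) subgp_L] zw(1,2)] G_M by blast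
    have "\<forall>g\<in>mon. g (z - w) \<in> L \<longrightarrow> z - w \<in> L"
      using L(3)[unfolded mclosed_def, rule_format, OF _ M] by blast
    then show "z - w \<in> L" by (rule mon_closed_dd[OF L(1) ac(1) _ d])
  qed
  finally have "card (cosets_met ?K (L \<times> L)) \<le> card (cosets_met (?f ` ?G i j) (L \<times> L))"
    using up by (simp add: ix_def)
  \<comment> \<open>An inclusion of finite sets with the reverse inequality of cardinalities: every
    class of the kernel is hit.\<close>
  then have "cosets_met (?f ` ?G i j) (L \<times> L) = cosets_met ?K (L \<times> L)"
    by (rule card_seteq[OF finK sub])
  then have "coset (L \<times> L) q \<in> cosets_met (?f ` ?G i j) (L \<times> L)" using q by (simp add: cosets_met_def)
  then obtain z where z: "z \<in> ?G i j" "coset (L \<times> L) q = coset (L \<times> L) (?f z)"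
    unfolding cosets_met_def by blast
  then have "q - ?f z \<in> L \<times> L" using coset_eq_iff[OF LL] by blast
  then show ?thesis using z(1) by (intro bexI[of _ z]) (auto simp: mem_Times_iff)
qed

text \<open>The inequality of \<open>lower_step\<close> reversed, at the price of the factor
  \<open>ix E J\<close>. By \<open>Kerw_exact\<close> a kernel element over \<open>J\<close> comes
  from some \<open>z\<close> in the ambient window; this \<open>z\<close> is fixed modulo
  \<open>J\<close> by the lattice, so it lies in \<open>E\<close>. For the cokernel, finitely many
  representatives of \<open>J\<close> are moved into every large window.\<close>

lemma ideal_step:
  assumes J: "submod J" "L \<subseteq> J" "J \<subseteq> gsum (gen (cyc x)) L" and ac: "a > 0" "c > 0"
    and E: "submod E" "fin_ix E J" "J \<subseteq> E"
      "\<forall>z\<in>gsum (gen (cyc x)) L. dd (a, 0) z \<in> J \<longrightarrow> dd (b, c) z \<in> J \<longrightarrow> z \<in> E"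
  defines "JW \<equiv> \<lambda>i j. G a b c (cyc x) L i j \<inter> J"
  shows "\<exists>i0. \<forall>i\<ge>i0. \<forall>j\<ge>i0. ix J (gsum (aug (a, 0) (b, c) J) L) * (ix (JW (Suc i) j) L * ix (JW i (Suc j)) L)
    \<le> ix E J * (ix (JW (Suc i) (Suc j)) L * ix (JW i j) L)"
proof -
  let ?G = "\<lambda>i j. G a b c (cyc x) L i j" let ?X = "cyc x"
  note X = cyc_fin
  let ?R = "gsum (aug (a, 0) (b, c) J) L"
  have Js: "subgp J" by (rule submod_subgp[OF J(1)])
  have As: "subgp (aug (a, 0) (b, c) J)" by (rule submod_subgp[OF submod_aug[OF J(1)]])
  have R: "subgp ?R" by (rule subgp_gsum[OF As subgp_L])
  have JM: "J \<subseteq> M"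
    using J(3) gsum_subset[OF submod_subgp[OF submod_M] gen_subset[OF submod_M cyc_subset[OF submod_subgp[OF submod_M] x(1)]] L(2)]
    by blast
  have LL: "subgp (L \<times> L)" by (rule subgp_Times[OF subgp_L subgp_L])
  have JWs: "subgp (JW i j)" for i j unfolding JW_def by (intro subgp_Int subgp_G X subgp_L Js)
  have LG: "L \<subseteq> ?G i j" for i j using gsum_right[OF subgp_sp[OF X(1)]] by blast
  have LJW: "L \<subseteq> JW i j" for i j unfolding JW_def using J(2) LG by blast
  have fJW: "fin_ix (JW i j) L" for i j
    by (rule ix_mono(1)[OF subgp_L subgp_L fin_ix_G[OF X subgp_L]]) (auto simp: JW_def)
  have m1: "dd (b, c) ` JW (Suc i) j \<subseteq> JW (Suc i) (Suc j)" for i j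
    unfolding JW_def using dd_t_G[OF X(1) L(1)] dd_in[OF J(1)] by blast
  have m2: "dd (a, 0) ` JW i (Suc j) \<subseteq> JW (Suc i) (Suc j)" for i j
    unfolding JW_def using dd_s_G[OF X(1) L(1)] dd_in[OF J(1)] by blast
  have m3: "dd m ` L \<subseteq> L" for m by (rule image_subsetI) (rule dd_in[OF L(1)])
  note k = koszul_count[OF subgp_L JWs JWs JWs LJW LJW LJW fJW fJW fJW dd_diff dd_diff m1 m2 m3 m3]
  define KJ where "KJ i j = {q \<in> JW (Suc i) j \<times> JW i (Suc j). dd (b, c) (fst q) + dd (a, 0) (snd q) \<in> L}" for i j
  define IJ where "IJ i j = gsum (gsum (dd (b, c) ` JW (Suc i) j) (dd (a, 0) ` JW i (Suc j))) L" for i j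
  have kos: "ix (JW (Suc i) (Suc j)) (IJ i j) * (ix (JW (Suc i) j) L * ix (JW i (Suc j)) L) =
      ix (JW (Suc i) (Suc j)) L * ix (KJ i j) (L \<times> L)" for i j
    unfolding KJ_def IJ_def by (rule k(1))
  have IJs: "subgp (IJ i j)" and fIJ: "fin_ix (JW (Suc i) (Suc j)) (IJ i j)" for i j
    unfolding IJ_def by (rule k(3), rule k(4))
  have IJR: "IJ i j \<subseteq> ?R" for i j
    unfolding IJ_def
  proof (intro gsum_mono gsum_subset As image_subsetI subset_refl)
    fix z assume "z \<in> JW (Suc i) j" then show "dd (b, c) z \<in> aug (a, 0) (b, c) J"
      by (intro aug_t[OF J(1)]) (simp add: JW_def)
  next
    fix z assume "z \<in> JW i (Suc j)" then show "dd (a, 0) z \<in> aug (a, 0) (b, c) J"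
      by (intro aug_s[OF J(1)]) (simp add: JW_def)
  qed
  have GA: "?G i j \<subseteq> gsum (gen ?X) L" for i j by (intro gsum_mono sp_gen finite_win subset_refl)
  have kappa: "ix (KJ i j) (L \<times> L) \<le> ix E J * ix (JW i j) L" for i j
  proof -
    define \<zeta> where "\<zeta> q = (SOME z. z \<in> ?G i j \<and> fst q - dd (a, 0) z \<in> L \<and> snd q + dd (b, c) z \<in> L)" for q
    have z: "\<zeta> q \<in> ?G i j \<and> fst q - dd (a, 0) (\<zeta> q) \<in> L \<and> snd q + dd (b, c) (\<zeta> q) \<in> L" if "q \<in> KJ i j" for q
    proof -
      have "q \<in> Kerw a b c ?X L i j" using that by (auto simp: KJ_def Kerw_def JW_def)
      from Kerw_exact[OF ac this] show ?thesis unfolding \<zeta>_def Bex_def by (rule someI_ex)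
    qed
    have zE: "\<zeta> q \<in> E" if q: "q \<in> KJ i j" for q
    proof (rule E(4)[rule_format])
      have qJ: "fst q \<in> J" "snd q \<in> J" using q by (auto simp: KJ_def JW_def)
      show "\<zeta> q \<in> gsum (gen ?X) L" using z[OF q] GA by blast
      have "fst q - (fst q - dd (a, 0) (\<zeta> q)) \<in> J"
        by (rule subgp_diff[OF Js qJ(1)]) (use z[OF q] J(2) in blast)
      then show "dd (a, 0) (\<zeta> q) \<in> J" by simp
      have "(snd q + dd (b, c) (\<zeta> q)) - snd q \<in> J"
        by (rule subgp_diff[OF Js _ qJ(2)]) (use z[OF q] J(2) in blast)
      then show "dd (b, c) (\<zeta> q) \<in> J" by simp
    qed
    have fEG: "fin_ix (E \<inter> ?G i j) L" by (rule ix_mono(1)[OF subgp_L subgp_L fin_ix_G[OF X subgp_L]]) auto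
    have "ix (KJ i j) (L \<times> L) \<le> ix (E \<inter> ?G i j) L"
    proof (rule ix_le_map(2)[OF LL subgp_L fEG, of \<zeta>])
      show "\<zeta> ` KJ i j \<subseteq> E \<inter> ?G i j" using z zE by blast
      fix q r assume qr: "q \<in> KJ i j" "r \<in> KJ i j" "\<zeta> q - \<zeta> r \<in> L"
      have 1: "dd m (\<zeta> q) - dd m (\<zeta> r) \<in> L" for m using dd_in[OF L(1) qr(3), of m] by (simp add: dd_diff)
      have "(fst q - dd (a, 0) (\<zeta> q)) - (fst r - dd (a, 0) (\<zeta> r)) + (dd (a, 0) (\<zeta> q) - dd (a, 0) (\<zeta> r)) \<in> L"
        by (rule subgp_add[OF subgp_L subgp_diff[OF subgp_L] 1]) (use z[OF qr(1)] z[OF qr(2)] in blast)+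
      moreover have "(snd q + dd (b, c) (\<zeta> q)) - (snd r + dd (b, c) (\<zeta> r)) - (dd (b, c) (\<zeta> q) - dd (b, c) (\<zeta> r)) \<in> L"
        by (rule subgp_diff[OF subgp_L subgp_diff[OF subgp_L] 1]) (use z[OF qr(1)] z[OF qr(2)] in blast)+
      ultimately show "q - r \<in> L \<times> L" by (simp add: mem_Times_iff algebra_simps)
    qed
    also have "\<dots> \<le> ix (E \<inter> ?G i j) (JW i j) * ix (JW i j) L"
    proof (rule tower_le(2)[OF JWs subgp_L _ fJW])
      show "fin_ix (E \<inter> ?G i j) (JW i j)" by (rule ix_mono(1)[OF JWs subgp_L fEG subset_refl LJW])
    qed
    also have "ix (E \<inter> ?G i j) (JW i j) \<le> ix E J"
    proof (rule ix_le_map(2)[OF JWs Js E(2), of "\<lambda>z. z"])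
      show "(\<lambda>z. z) ` (E \<inter> ?G i j) \<subseteq> E" by auto
      fix v w assume "v \<in> E \<inter> ?G i j" "w \<in> E \<inter> ?G i j" "v - w \<in> J"
      then show "v - w \<in> JW i j" unfolding JW_def using subgp_diff[OF subgp_G[OF X(1) subgp_L]] by blast
    qed
    finally show ?thesis by simp
  qed
  \<comment> \<open>Representatives of a finite quotient of \<open>J\<close>. They are next replaced
    by elements of \<open>gen (cyc x)\<close> congruent to them modulo \<open>L\<close>, because
    those lie in the span over one finite set \<open>V\<close> that a lattice shift can carry into a
    window.\<close>
  define Q where "Q = crep J ?R ` cosets_met J ?R"
  have fR: "fin_ix J ?R"
    by (rule ix_mono(1)[OF R As fin_ix_aug[OF J(1) JM ac] subset_refl])
      (use gsum_left[OF subgp_L] in blast)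
  have Q: "finite Q" unfolding Q_def using fR by simp
  have QJ: "Q \<subseteq> J" unfolding Q_def using crep(1) by blast
  have "\<exists>y. y \<in> gen ?X \<and> r - y \<in> L" if r: "r \<in> Q" for r
  proof -
    have "r \<in> gsum (gen ?X) L" using r QJ J(3) by blast
    then obtain y l where "y \<in> gen ?X" "l \<in> L" "r = y + l" unfolding gsum_def by blast
    then show ?thesis by (intro exI[of _ y]) simp
  qed
  then obtain \<eta> where \<eta>: "\<And>r. r \<in> Q \<Longrightarrow> \<eta> r \<in> gen ?X \<and> r - \<eta> r \<in> L" by metis
  have "finite (\<eta> ` Q)" "\<eta> ` Q \<subseteq> gen ?X" using Q \<eta> by auto
  from gen_in_sp[OF X(1) this] obtain V where V: "finite V" "\<eta> ` Q \<subseteq> sp V ?X" by blast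
  obtain N0 i0 where i0: "\<forall>i\<ge>i0. \<forall>j\<ge>i0. N0 < i \<and> N0 < j \<and> (+) (lat a b c (int N0) (int N0)) ` V \<subseteq> win a b c i j"
    using win_absorb[OF ac V(1)] by blast
  let ?N = "lat a b c (int N0) (int N0)"
  have "ix J ?R * (ix (JW (Suc i) j) L * ix (JW i (Suc j)) L)
    \<le> ix E J * (ix (JW (Suc i) (Suc j)) L * ix (JW i j) L)" if ij: "i \<ge> i0" "j \<ge> i0" for i j
  proof -
    let ?r = "\<lambda>z. crep J ?R (coset ?R z)"
    have rQ: "?r z \<in> Q" if "z \<in> J" for z using that by (auto simp: Q_def cosets_met_def)
    have \<eta>J: "\<eta> (?r z) \<in> J" if "z \<in> J" for z
    proof -
      have "?r z - (?r z - \<eta> (?r z)) \<in> J" 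
        by (rule subgp_diff[OF Js]) (use \<eta>[OF rQ[OF that]] J(2) QJ rQ[OF that] in blast)+
      then show ?thesis by simp
    qed
    have close: "z - u ?N (\<eta> (?r z)) \<in> ?R" if "z \<in> J" for z
    proof -
      have 1: "z - ?r z \<in> ?R" by (rule crep_diff(1)[OF R that])
      have 2: "?r z - \<eta> (?r z) \<in> ?R" using \<eta>[OF rQ[OF that]] by (intro gsum_right[OF As]) blast
      have 3: "dd ?N (\<eta> (?r z)) \<in> ?R" by (rule gsum_left[OF subgp_L aug_lat[OF J(1) \<eta>J[OF that]]])
      have "(z - ?r z) + (?r z - \<eta> (?r z)) - dd ?N (\<eta> (?r z)) \<in> ?R"
        by (rule subgp_diff[OF R subgp_add[OF R 1 2] 3])
      then show ?thesis by (simp add: dd_def)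
    qed
    have "ix J ?R \<le> ix (JW (Suc i) (Suc j)) (IJ i j)"
    proof (rule ix_le_map(2)[OF R IJs fIJ, of "\<lambda>z. u ?N (\<eta> (?r z))"])
      show "(\<lambda>z. u ?N (\<eta> (?r z))) ` J \<subseteq> JW (Suc i) (Suc j)"
      proof (rule image_subsetI)
        fix z assume z: "z \<in> J"
        have "\<eta> (?r z) \<in> sp V ?X" using V(2) rQ[OF z] by blast
        then have 1: "u ?N (\<eta> (?r z)) \<in> sp ((+) ?N ` V) ?X" using sp_image by blast
        have "(+) ?N ` V \<subseteq> win a b c (Suc i) (Suc j)" using i0 ij by (meson le_SucI)
        from sp_subset_sp[OF X(1) finite_win this subset_refl] 1
        have "u ?N (\<eta> (?r z)) \<in> ?G (Suc i) (Suc j)" using gsum_left[OF subgp_L] by blast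
        then show "u ?N (\<eta> (?r z)) \<in> JW (Suc i) (Suc j)"
          using submod_u[OF J(1) \<eta>J[OF z]] by (simp add: JW_def)
      qed
      fix z w assume zw: "z \<in> J" "w \<in> J" "u ?N (\<eta> (?r z)) - u ?N (\<eta> (?r w)) \<in> IJ i j"
      have "(z - u ?N (\<eta> (?r z))) - (w - u ?N (\<eta> (?r w))) + (u ?N (\<eta> (?r z)) - u ?N (\<eta> (?r w))) \<in> ?R"
        by (rule subgp_add[OF R subgp_diff[OF R close[OF zw(1)] close[OF zw(2)]] subsetD[OF IJR zw(3)]])
      then show "z - w \<in> ?R" by simp
    qed
    then have "ix J ?R * (ix (JW (Suc i) j) L * ix (JW i (Suc j)) L) \<le>
        ix (JW (Suc i) (Suc j)) (IJ i j) * (ix (JW (Suc i) j) L * ix (JW i (Suc j)) L)"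
      by (rule mult_right_mono) simp
    also have "\<dots> = ix (JW (Suc i) (Suc j)) L * ix (KJ i j) (L \<times> L)" by (rule kos)
    also have "\<dots> \<le> ix (JW (Suc i) (Suc j)) L * (ix E J * ix (JW i j) L)"
      by (rule mult_left_mono[OF kappa]) simp
    finally show ?thesis by (simp add: mult.left_commute)
  qed
  then show ?thesis by blast
qed

text \<open>Summed over an n by n square, \<open>ideal_step\<close> bounds n^2 times the logarithm
  of \<open>ix J ?R\<close> divided by \<open>ix E J\<close> by the size of \<open>J\<close> inside
  the window, up to a constant, and this is at most the size of the whole free window. Comparing
  quadratic terms gives the exponent; the constant \<open>ix E J\<close> comes from
  \<open>fixed_level\<close>.\<close>

lemma ideal_bound:
  assumes J: "submod J" "L \<subseteq> J" "J \<subseteq> gsum (gen (cyc x)) L"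
  shows "\<exists>C. \<forall>a b c. a > 0 \<longrightarrow> c > 0 \<longrightarrow> ix J (gsum (aug (a, 0) (b, c) J) L) \<le> C * p ^ nat (a * c)"
proof -
  let ?A = "gsum (gen (cyc x)) L"
  have A: "submod ?A" by (intro submod_gsum submod_gen cyc_fin L(1))
  have AM: "?A \<subseteq> M"
    by (rule gsum_subset[OF submod_subgp[OF submod_M] gen_subset[OF submod_M cyc_subset[OF submod_subgp[OF submod_M] x(1)]] L(2)])
  obtain E where E: "submod E" "E \<subseteq> ?A" "fin_ix E J" "J \<subseteq> E"
    and E': "\<And>a b c z. a > 0 \<Longrightarrow> c > 0 \<Longrightarrow> z \<in> ?A \<Longrightarrow> dd (a, 0) z \<in> J \<Longrightarrow> dd (b, c) z \<in> J \<Longrightarrow> z \<in> E"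
    using fixed_level[OF A AM J(1) J(3)] by blast
  have Js: "subgp J" by (rule submod_subgp[OF J(1)])
  have "ix J (gsum (aug (a, 0) (b, c) J) L) \<le> ix E J * p ^ nat (a * c)" if ac: "a > 0" "c > 0" for a b c
  proof -
    let ?R = "gsum (aug (a, 0) (b, c) J) L"
    define JW where "JW i j = G a b c (cyc x) L i j \<inter> J" for i j
    define d where "d = nat (a * c)"
    have Eb: "\<forall>z\<in>?A. dd (a, 0) z \<in> J \<longrightarrow> dd (b, c) z \<in> J \<longrightarrow> z \<in> E" using E'[OF ac] by blast
    obtain i0 where i0: "\<And>i j. i \<ge> i0 \<Longrightarrow> j \<ge> i0 \<Longrightarrow> ix J ?R * (ix (JW (Suc i) j) L * ix (JW i (Suc j)) L)
        \<le> ix E J * (ix (JW (Suc i) (Suc j)) L * ix (JW i j) L)"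
      using ideal_step[OF J ac E(1,3,4) Eb] unfolding JW_def by blast
    have fJW: "fin_ix (JW i j) L" and JWle: "ix (JW i j) L \<le> p ^ (i * j * d)" for i j
      using ix_mono[OF subgp_L subgp_L fin_ix_G[OF cyc_fin subgp_L, of a b c i j], of "JW i j"] ix_G[OF ac, of b i j]
      by (auto simp: JW_def d_def)
    have "0 \<in> JW i j" for i j
      unfolding JW_def using subgp_0[OF subgp_G[OF cyc_fin(1) subgp_L]] subgp_0[OF Js] by blast
    then have pos: "ix (JW i j) L > 0" for i j using ix_pos[OF fJW] by blast
    have Epos: "ix E J > 0" using ix_pos[OF E(3)] subgp_0[OF Js] E(4) by blast
    have As: "subgp (aug (a, 0) (b, c) J)" by (rule submod_subgp[OF submod_aug[OF J(1)]])
    have fR: "fin_ix J ?R"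
      by (rule ix_mono(1)[OF subgp_gsum[OF As subgp_L] As fin_ix_aug[OF J(1) _ ac] subset_refl])
        (use gsum_left[OF subgp_L] J(3) AM in blast)+
    have Rpos: "ix J ?R > 0" using ix_pos[OF fR] subgp_0[OF Js] by blast
    define f where "f i j = ln (real (ix (JW i j) L))" for i j
    define \<delta> where "\<delta> = ln (real (ix J ?R)) - ln (real (ix E J))"
    have f0: "f i j \<ge> 0" for i j using pos[of i j] by (simp add: f_def)
    have step: "\<delta> + f (Suc i) j + f i (Suc j) \<le> f (Suc i) (Suc j) + f i j" if "i \<ge> i0" "j \<ge> i0" for i j
    proof -
      have "real (ix J ?R) * (real (ix (JW (Suc i) j) L) * real (ix (JW i (Suc j)) L))
        \<le> real (ix E J) * (real (ix (JW (Suc i) (Suc j)) L) * real (ix (JW i j) L))"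
        using i0[OF that] by (simp only: of_nat_mult[symmetric] of_nat_le_iff)
      then have "ln (real (ix J ?R) * (real (ix (JW (Suc i) j) L) * real (ix (JW i (Suc j)) L)))
        \<le> ln (real (ix E J) * (real (ix (JW (Suc i) (Suc j)) L) * real (ix (JW i j) L)))"
        using pos Epos Rpos by (subst ln_le_cancel_iff) simp_all
      then show ?thesis using pos Epos Rpos by (simp add: f_def \<delta>_def ln_mult)
    qed
    have fup: "f i j \<le> real i * real j * (real d * ln (real p))" for i j
    proof -
      have "real (ix (JW i j) L) \<le> real p ^ (i * j * d)"
        using JWle[of i j] by (simp only: of_nat_power[symmetric] of_nat_le_iff)
      then have "f i j \<le> ln (real p ^ (i * j * d))"
        unfolding f_def using pos prime_gt_0_nat[OF p(1)] by (subst ln_le_cancel_iff) simp_all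
      then show ?thesis using prime_gt_0_nat[OF p(1)] by (simp add: ln_realpow)
    qed
    have "\<delta> \<le> real d * ln (real p)"
    proof (rule quadratic_dominated)
      fix n :: nat
      \<comment> \<open>The mixed difference is bounded from below here, so \<open>telescope\<close>
        is applied to the negative of \<open>f\<close>.\<close>
      have "- f (i0 + n) (i0 + n) + (- f (i0 + 0) (i0 + 0)) \<le>
        - f (i0 + n) (i0 + 0) + (- f (i0 + 0) (i0 + n)) + real n * real n * (- \<delta>)"
      proof (rule telescope[of "\<lambda>n m. - f (i0 + n) (i0 + m)"])
        fix i j
        show "- f (i0 + Suc i) (i0 + Suc j) + - f (i0 + i) (i0 + j)
          \<le> - \<delta> + - f (i0 + Suc i) (i0 + j) + - f (i0 + i) (i0 + Suc j)"
          using step[of "i0 + i" "i0 + j"] by simp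
      qed
      then have "real n * real n * \<delta> \<le> f (i0 + n) (i0 + n) + f i0 i0"
        using f0[of "i0 + n" i0] f0[of i0 "i0 + n"] by simp
      also have "f (i0 + n) (i0 + n) \<le> (real i0 + real n) * (real i0 + real n) * (real d * ln (real p))"
        using fup[of "i0 + n" "i0 + n"] by simp
      finally show "real n * real n * \<delta> \<le> (real i0 + real n) * (real i0 + real n) * (real d * ln (real p)) + f i0 i0"
        by simp
    qed
    then have "ln (real (ix J ?R)) \<le> ln (real (ix E J) * real p ^ d)"
      using Epos prime_gt_0_nat[OF p(1)] by (simp add: \<delta>_def ln_mult ln_realpow)
    then have "real (ix J ?R) \<le> real (ix E J) * real p ^ d"
      using Rpos Epos prime_gt_0_nat[OF p(1)] by (subst (asm) ln_le_cancel_iff) simp_all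
    then have "real (ix J ?R) \<le> real (ix E J * p ^ d)" by simp
    then show ?thesis unfolding d_def by (simp only: of_nat_le_iff)
  qed
  then show ?thesis by blast
qed

end

end


section \<open>Strips and rewriting by a monic relation\<close>

lemma strip_boundary_count:
  fixes m1 m2 b B L :: int
  assumes n: "m1 \<noteq> 0 \<or> m2 \<noteq> 0" and nn: "0 \<le> b" "0 \<le> B" "0 \<le> L"
  defines "f \<equiv> \<lambda>v::int \<times> int. m1 * fst v + m2 * snd v" and "g \<equiv> \<lambda>v::int \<times> int. m2 * fst v - m1 * snd v"
  defines "P \<equiv> {v. - B \<le> f v \<and> f v \<le> L \<and> - B \<le> g v \<and> g v \<le> B}"
  assumes S: "\<forall>t\<in>S. \<bar>f t\<bar> \<le> b \<and> \<bar>g t\<bar> \<le> b"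
  shows "finite P" "int (card {v\<in>P. \<exists>t\<in>S. t + v \<notin> P}) \<le> 2 * b * (2 * B + 1) + 2 * b * (L + B + 1)"
proof -
  have fadd: "f (v + w) = f v + f w" "g (v + w) = g v + g w" for v w
    by (simp_all add: f_def g_def algebra_simps)
  \<comment> \<open>\<open>f\<close> and \<open>g\<close> are coordinates along and across (m1, m2),
    and m1^2 + m2^2 is up to sign the determinant of this change of coordinates.\<close>
  have R: "m1 * m1 + m2 * m2 > 0" using n
    by (metis add_pos_nonneg add_nonneg_pos not_real_square_gt_zero zero_le_square mult_eq_0_iff order_le_less)
  have inj: "inj (\<lambda>v. (f v, g v))"
  proof (rule injI)
    fix v w assume "(f v, g v) = (f w, g w)"
    then have 1: "m1 * (fst v - fst w) + m2 * (snd v - snd w) = 0" "m2 * (fst v - fst w) - m1 * (snd v - snd w) = 0"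
      by (simp_all add: f_def g_def algebra_simps)
    have "(m1 * m1 + m2 * m2) * (fst v - fst w) =
      m1 * (m1 * (fst v - fst w) + m2 * (snd v - snd w)) + m2 * (m2 * (fst v - fst w) - m1 * (snd v - snd w))"
      by (simp add: algebra_simps)
    then have "(m1 * m1 + m2 * m2) * (fst v - fst w) = 0" by (simp add: 1 del: mult_eq_0_iff)
    then have a: "fst v - fst w = 0" using R by (metis less_irrefl mult_eq_0_iff)
    have "(m1 * m1 + m2 * m2) * (snd v - snd w) =
      m2 * (m1 * (fst v - fst w) + m2 * (snd v - snd w)) - m1 * (m2 * (fst v - fst w) - m1 * (snd v - snd w))"
      by (simp add: algebra_simps)
    then have "(m1 * m1 + m2 * m2) * (snd v - snd w) = 0" by (simp add: 1 del: mult_eq_0_iff)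
    then have "snd v - snd w = 0" using R by (metis less_irrefl mult_eq_0_iff)
    with a show "v = w" by (simp add: prod_eq_iff)
  qed
  have "(\<lambda>v. (f v, g v)) ` P \<subseteq> {- B..L} \<times> {- B..B}" by (auto simp: P_def)
  then show "finite P"
    using inj by (meson finite_SigmaI finite_atLeastAtMost_int finite_imageD finite_subset inj_on_subset subset_UNIV)
  \<comment> \<open>A point that some shift in \<open>S\<close> pushes out of \<open>P\<close> lies
    within \<open>b\<close> of one of the four sides: the first product collects the two ends, the
    second the two long sides.\<close>
  let ?Z = "({- B..<- B + b} \<union> {L - b<..L}) \<times> {- B..B} \<union> {- B..L} \<times> ({- B..<- B + b} \<union> {B - b<..B})"
  have "(\<lambda>v. (f v, g v)) ` {v\<in>P. \<exists>t\<in>S. t + v \<notin> P} \<subseteq> ?Z"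
  proof (rule image_subsetI)
    fix v assume "v \<in> {v\<in>P. \<exists>t\<in>S. t + v \<notin> P}"
    then obtain t where v: "v \<in> P" and t: "t \<in> S" "t + v \<notin> P" by blast
    have "\<bar>f t\<bar> \<le> b" "\<bar>g t\<bar> \<le> b" using S t by blast+
    moreover have "\<not> (- B \<le> f t + f v \<and> f t + f v \<le> L \<and> - B \<le> g t + g v \<and> g t + g v \<le> B)"
      using t(2) by (simp add: P_def fadd)
    moreover have "- B \<le> f v \<and> f v \<le> L \<and> - B \<le> g v \<and> g v \<le> B" using v by (simp add: P_def)
    ultimately have "(- B \<le> f v \<and> f v < - B + b \<or> L - b < f v \<and> f v \<le> L) \<and> - B \<le> g v \<and> g v \<le> B \<or>
      - B \<le> f v \<and> f v \<le> L \<and> (- B \<le> g v \<and> g v < - B + b \<or> B - b < g v \<and> g v \<le> B)" by linarith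
    then show "(f v, g v) \<in> ?Z" by auto
  qed
  moreover have fz: "finite ?Z" by simp
  ultimately have "card {v\<in>P. \<exists>t\<in>S. t + v \<notin> P} \<le> card ?Z"
    using inj by (intro card_inj_on_le[of "\<lambda>v. (f v, g v)"]) (auto intro: inj_on_subset)
  also have "card ?Z \<le> card (({- B..<- B + b} \<union> {L - b<..L}) \<times> {- B..B}) + card ({- B..L} \<times> ({- B..<- B + b} \<union> {B - b<..B}))"
    by (rule card_Un_le)
  also have "\<dots> = card ({- B..<- B + b} \<union> {L - b<..L}) * card {- B..B} + card {- B..L} * card ({- B..<- B + b} \<union> {B - b<..B})"
    by (simp add: card_cartesian_product)
  also have "\<dots> \<le> nat (2 * b) * card {- B..B} + card {- B..L} * nat (2 * b)"
  proof -
    have "card ({- B..<- B + b} \<union> {x - b<..x}) \<le> nat (2 * b)" for x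
    proof -
      have "card ({- B..<- B + b} \<union> {x - b<..x}) \<le> card {- B..<- B + b} + card {x - b<..x}" by (rule card_Un_le)
      also have "\<dots> = nat (2 * b)" using nn by simp
      finally show ?thesis .
    qed
    then show ?thesis by (intro add_mono mult_le_mono le_refl)
  qed
  finally have "int (card {v\<in>P. \<exists>t\<in>S. t + v \<notin> P}) \<le> int (nat (2 * b) * card {- B..B} + card {- B..L} * nat (2 * b))"
    by (simp only: of_nat_le_iff)
  also have "\<dots> = 2 * b * (2 * B + 1) + 2 * b * (L + B + 1)" using nn by (simp add: algebra_simps)
  finally show "int (card {v\<in>P. \<exists>t\<in>S. t + v \<notin> P}) \<le> 2 * b * (2 * B + 1) + 2 * b * (L + B + 1)" .
qed

context z2_module
begin

lemma Op_in: "T \<in> Op S \<Longrightarrow> subgp H \<Longrightarrow> (\<And>t. t \<in> S \<Longrightarrow> u t y \<in> H) \<Longrightarrow> T y \<in> H"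
  by (induction rule: Op.induct) (simp_all add: subgp_0 subgp_add subgp_diff)

text \<open>The relation rewrites a translate of \<open>f\<close> as a combination of translates
  with smaller \<open>phi\<close>. As long as these stay in \<open>P\<close> the rewriting
  continues; since \<open>P\<close> is finite it ends, at exponents from which some shift leaves
  \<open>P\<close>.\<close>

lemma sp_boundary:
  assumes F: "subgp F" and P: "finite P" and T: "T \<in> Op S" and S: "\<And>t. t \<in> S \<Longrightarrow> phi t < 0"
    and g: "\<And>n f. f \<in> F \<Longrightarrow> u n f + T (u n f) = 0"
  shows "sp P F \<subseteq> sp {v\<in>P. \<exists>t\<in>S. t + v \<notin> P} F"
proof -
  let ?R = "{v\<in>P. \<exists>t\<in>S. t + v \<notin> P}"
  have H: "subgp (sp ?R F)" by (rule subgp_sp[OF F])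
  have fR: "finite ?R" using P by simp
  have "u v f \<in> sp ?R F" if v: "v \<in> P" and f: "f \<in> F" for v f
    using v
  proof (induction "card {w\<in>P. phi w < phi v}" arbitrary: v rule: less_induct)
    case less
    show ?case
    proof (cases "v \<in> ?R")
      case True
      show ?thesis by (rule u_in_sp[OF fR subgp_0[OF F] True f])
    next
      case False
      have TH: "T (u v f) \<in> sp ?R F"
      proof (rule Op_in[OF T H])
        fix t assume t: "t \<in> S"
        have tv: "t + v \<in> P" using False t less.prems by blast
        have lt: "phi (t + v) < phi v" using S[OF t] by (simp add: phi_add)
        have "card {w\<in>P. phi w < phi (t + v)} < card {w\<in>P. phi w < phi v}"
          by (rule psubset_card_mono) (use P tv lt in auto)
        from less.hyps[OF this tv] show "u t (u v f) \<in> sp ?R F" by (simp add: u_plus)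
      qed
      have e: "u v f = - T (u v f)" using g[OF f, of v] by (simp add: eq_neg_iff_add_eq_0)
      show ?thesis by (subst e) (rule subgp_minus[OF H TH])
    qed
  qed
  then show ?thesis by (intro sp_subset[OF H])
qed

end

context noeth_module
begin

subsection \<open>The upper bound for periodic points\<close>

text \<open>The same base \<open>q\<close> occurs in both estimates: the first governs the periodic
  points, and the second will bound ln q by the entropy.\<close>

definition upper_claim :: "'a set \<Rightarrow> bool" where
  "upper_claim L \<longleftrightarrow> (\<exists>C q F. C > 0 \<and> q > 0 \<and> subgp F \<and> finite F \<and> F \<subseteq> M \<and>
     (\<forall>a b c. a > 0 \<longrightarrow> c > 0 \<longrightarrow> ix M (gsum (aug (a, 0) (b, c) M) L) \<le> C * q ^ nat (a * c)) \<and>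
     (\<forall>W. finite W \<longrightarrow> (q::nat) ^ card W \<le> ix (sp W F) L))"

lemma upper_claim_M: "upper_claim M"
proof -
  have Ms: "subgp M" by (rule submod_subgp[OF submod_M])
  have 1: "ix M (gsum (aug (a, 0) (b, c) M) M) \<le> 1" for a b c
    by (rule ix_self[OF subgp_gsum[OF submod_subgp[OF submod_aug[OF submod_M]] Ms]])
      (use gsum_right[OF submod_subgp[OF submod_aug[OF submod_M]]] in blast)
  have "1 \<le> ix (sp W {0}) M" if "finite W" for W
    using ix_pos[OF fin_ix_finite[OF finite_sp[OF subgp_singleton _ that]], of M] subgp_0[OF subgp_sp[OF subgp_singleton]]
    by (auto simp: Suc_le_eq)
  then show ?thesis unfolding upper_claim_def
    using 1 subgp_singleton subgp_0[OF Ms]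
    by (intro exI[of _ "1::nat"] exI[of _ "{0::'a}"]) simp
qed

text \<open>The closure \<open>Y\<close> of the cyclic module \<open>A\<close> need not be cyclic
  modulo \<open>L\<close>, but \<open>g\<close> maps it into \<open>A\<close>, injectively modulo
  \<open>L\<close> because \<open>L\<close> is monically closed. Thus Y/L is isomorphic to J/L, an
  ideal in a free module of rank one, and \<open>ideal_bound\<close> applies. The base grows from
  \<open>q\<close> to q p: in the upper estimate the new factor comes from \<open>J\<close>, in the
  lower one from the span of \<open>x\<close>.\<close>

lemma upper_claim_step:
  assumes L: "submod L" "L \<subseteq> M" "mclosed L" and ne: "L \<noteq> M"
  shows "\<exists>Y. submod Y \<and> Y \<subseteq> M \<and> mclosed Y \<and> L \<subset> Y \<and> (upper_claim Y \<longrightarrow> upper_claim L)"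
proof -
  obtain y0 where "y0 \<in> M" "y0 \<notin> L" using ne L(2) by blast
  from prime_torsion[OF L(1) this] obtain x p where x: "x \<in> M" "x \<notin> L" and p: "prime (p::nat)" "nm p x \<in> L"
    by blast
  note X = cyc_fin[OF L x p]
  have Ls: "subgp L" and Ms: "subgp M" using L(1) submod_M by (simp_all add: submod_subgp)
  let ?A = "gsum (gen (cyc x)) L"
  have A: "submod ?A" by (intro submod_gsum submod_gen X L(1))
  have XM: "cyc x \<subseteq> M" by (rule cyc_subset[OF Ms x(1)])
  have AM: "?A \<subseteq> M" by (rule gsum_subset[OF Ms gen_subset[OF submod_M XM] L(2)])
  obtain g where g: "g \<in> mon" and Y: "submod {y\<in>M. g y \<in> ?A}" "?A \<subseteq> {y\<in>M. g y \<in> ?A}" "mclosed {y\<in>M. g y \<in> ?A}"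
    using mon_closure[OF A AM] by blast
  define Y where "Y = {y\<in>M. g y \<in> ?A}"
  note gO = mon_Op[OF g]
  have Y: "submod Y" "?A \<subseteq> Y" "mclosed Y" "Y \<subseteq> M" using Y by (auto simp: Y_def)
  have Ysub: "subgp Y" by (rule submod_subgp[OF Y(1)])
  have LA: "L \<subseteq> ?A" using gsum_right[OF submod_subgp[OF submod_gen[OF X(1)]]] by blast
  have xgen: "cyc x \<subseteq> gen (cyc x)" by (rule gen_self[OF subgp_0[OF X(1)]])
  have xA: "cyc x \<subseteq> ?A" using xgen gsum_left[OF Ls] by blast
  have LY: "L \<subset> Y" using LA Y(2) xA cyc_self[of x] x(2) by blast
  define J where "J = gsum (g ` Y) L"
  have gY: "submod (g ` Y)"
  proof (rule submodI)
    show "subgp (g ` Y)" by (rule subgp_image[OF Ysub Op_diff[OF gO]])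
    fix n z assume "z \<in> g ` Y"
    then obtain y where "y \<in> Y" "z = g y" by blast
    then show "u n z \<in> g ` Y" using submod_u[OF Y(1)] Op_u[OF gO] by (metis imageI)
  qed
  have J: "submod J" "L \<subseteq> J" "J \<subseteq> ?A"
  proof -
    show "submod J" unfolding J_def by (rule submod_gsum[OF gY L(1)])
    show "L \<subseteq> J" unfolding J_def using gsum_right[OF submod_subgp[OF gY]] by blast
    show "J \<subseteq> ?A" unfolding J_def
      by (rule gsum_subset[OF submod_subgp[OF A] _ LA]) (auto simp: Y_def)
  qed
  obtain CJ where CJ: "\<And>a b c. a > 0 \<Longrightarrow> c > 0 \<Longrightarrow> ix J (gsum (aug (a, 0) (b, c) J) L) \<le> CJ * p ^ nat (a * c)"
    using ideal_bound[OF L x p J] by blast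
  have "upper_claim L" if cY: "upper_claim Y"
  proof -
    obtain C q F where C: "C > 0" "q > 0" and F: "subgp F" "finite F" "F \<subseteq> M"
      and up: "\<And>a b c. a > 0 \<Longrightarrow> c > 0 \<Longrightarrow> ix M (gsum (aug (a, 0) (b, c) M) Y) \<le> C * q ^ nat (a * c)"
      and low: "\<And>W. finite W \<Longrightarrow> (q::nat) ^ card W \<le> ix (sp W F) Y"
      using cY unfolding upper_claim_def by blast
    define F' where "F' = gsum F (cyc x)"
    have F': "subgp F'" "finite F'" "F' \<subseteq> M"
      unfolding F'_def by (rule subgp_gsum[OF F(1) X(1)], rule finite_gsum[OF F(2) X(2)], rule gsum_subset[OF Ms F(3) XM])
    have sub: "F \<subseteq> F'" "cyc x \<subseteq> F'"
      unfolding F'_def using gsum_left[OF X(1)] gsum_right[OF F(1)] by blast+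
    have low': "(q * p) ^ card W \<le> ix (sp W F') L" if W: "finite W" for W
    proof -
      have "(q * p) ^ card W = q ^ card W * p ^ card W" by (rule power_mult_distrib)
      also have "\<dots> \<le> ix (sp W F) Y * ix (sp W (cyc x)) L"
        unfolding ix_sp_cyc[OF L x p W] by (rule mult_right_mono[OF low[OF W]]) simp
      also have "\<dots> \<le> ix (sp W F') L"
      proof (rule tower_ge[OF Ysub Ls fin_ix_finite[OF finite_sp[OF F'(1,2) W]]])
        show "sp W (cyc x) \<subseteq> Y"
          using xA Y(1,2) submod_u by (intro sp_subset Ysub) blast
        show "L \<subseteq> Y" using LY by blast
        fix a b assume a: "a \<in> sp W (cyc x)" and b: "b \<in> sp W F"
        have "a \<in> sp W F'" using sp_subset_sp[OF F'(1) W subset_refl sub(2)] a by blast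
        moreover have "b \<in> sp W F'" using sp_subset_sp[OF F'(1) W subset_refl sub(1)] b by blast
        ultimately show "b + a \<in> sp W F'" by (simp add: subgp_add[OF subgp_sp[OF F'(1)]])
      qed
      finally show ?thesis .
    qed
    \<comment> \<open>The \<open>+ 1\<close> keeps the new constant positive, as
      \<open>upper_claim\<close> requires.\<close>
    have up': "ix M (gsum (aug (a, 0) (b, c) M) L) \<le> (C * (CJ + 1)) * (q * p) ^ nat (a * c)" if ac: "a > 0" "c > 0" for a b c
    proof -
      let ?I = "aug (a, 0) (b, c)"
      have Is: "subgp (?I H)" if "submod H" for H by (rule submod_subgp[OF submod_aug[OF that]])
      have IMs: "subgp (gsum (?I M) L)" "subgp (gsum (?I M) Y)" "subgp (gsum (?I Y) L)" "subgp (gsum (?I J) L)"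
        by (intro subgp_gsum Is submod_M Y(1) J(1) Ls Ysub)+
      have JM: "J \<subseteq> M" using J(3) AM by blast
      have fM: "fin_ix M (gsum (?I M) L)"
        by (rule ix_mono(1)[OF IMs(1) Is[OF submod_M] fin_ix_aug[OF submod_M subset_refl ac] subset_refl])
          (use gsum_left[OF Ls] in blast)
      have fMY: "fin_ix M (gsum (?I M) Y)"
        by (rule ix_mono(1)[OF IMs(2) IMs(1) fM subset_refl]) (use LY in \<open>intro gsum_mono subset_refl, blast\<close>)
      have fJ: "fin_ix J (gsum (?I J) L)"
        by (rule ix_mono(1)[OF IMs(4) Is[OF J(1)] fin_ix_aug[OF J(1) JM ac] subset_refl])
          (use gsum_left[OF Ls] in blast)
      have 1: "fin_ix Y (gsum (?I Y) L)" "ix Y (gsum (?I Y) L) \<le> ix J (gsum (?I J) L)"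
      proof -
        have gJ: "g ` Y \<subseteq> J" unfolding J_def using gsum_left[OF Ls] by blast
        have inj: "v - w \<in> gsum (?I Y) L" if vw: "v \<in> Y" "w \<in> Y" "g v - g w \<in> gsum (?I J) L" for v w
        proof -
          obtain i l where i: "i \<in> ?I J" and l: "l \<in> L" and e: "g v - g w = i + l" using vw(3) unfolding gsum_def by blast
          obtain j1 j2 where j: "j1 \<in> J" "j2 \<in> J" "i = dd (a, 0) j1 + dd (b, c) j2" using i by (rule augE)
          obtain y1 l1 where y1: "y1 \<in> Y" "l1 \<in> L" "j1 = g y1 + l1" using j(1) unfolding J_def gsum_def by blast
          obtain y2 l2 where y2: "y2 \<in> Y" "l2 \<in> L" "j2 = g y2 + l2" using j(2) unfolding J_def gsum_def by blast
          define w' where "w' = dd (a, 0) y1 + dd (b, c) y2"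
          have w'I: "w' \<in> ?I Y" unfolding w'_def by (rule augI[OF y1(1) y2(1)])
          have w'M: "w' \<in> M" using w'I aug_subset[OF Y(1)] Y(4) by blast
          \<comment> \<open>\<open>w'\<close> lifts the augmentation part of g v - g w through
            \<open>g\<close>; what is left over is sent into \<open>L\<close>, so it lies in
            \<open>L\<close> already.\<close>
          have "g (v - w - w') = dd (a, 0) l1 + dd (b, c) l2 + l"
            using e by (simp add: Op_diff[OF gO] Op_add[OF gO] w'_def dd_Op[OF gO] j(3) y1(3) y2(3) dd_add algebra_simps)
          also have "\<dots> \<in> L" by (intro subgp_add[OF Ls] dd_in[OF L(1)] y1(2) y2(2) l)
          finally have gl: "g (v - w - w') \<in> L" .
          have "v - w - w' \<in> M" using vw(1,2) w'M Y(4) by (intro subgp_diff[OF Ms]) blast+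
          then have "v - w - w' \<in> L" using L(3)[unfolded mclosed_def, rule_format, OF g _ gl] by blast
          from gsumI[OF w'I this] show ?thesis by simp
        qed
        show "fin_ix Y (gsum (?I Y) L)" "ix Y (gsum (?I Y) L) \<le> ix J (gsum (?I J) L)"
          by (rule ix_le_map[OF IMs(3,4) fJ gJ inj]; assumption)+
      qed
      \<comment> \<open>Choosing a component in \<open>Y\<close> bounds the index of
        \<open>gsum (?I M) L\<close> in \<open>gsum (?I M) Y\<close> by that of
        \<open>gsum (?I Y) L\<close> in \<open>Y\<close>.\<close>
      define \<pi> where "\<pi> z = (SOME y. y \<in> Y \<and> z - y \<in> ?I M)" for z
      have \<pi>: "\<pi> z \<in> Y \<and> z - \<pi> z \<in> ?I M" if z: "z \<in> gsum (?I M) Y" for z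
      proof -
        obtain m y where "m \<in> ?I M" "y \<in> Y" "z = m + y" using z unfolding gsum_def by blast
        then have "y \<in> Y \<and> z - y \<in> ?I M" by simp
        then show ?thesis unfolding \<pi>_def by (rule someI)
      qed
      have I_R: "?I M \<subseteq> gsum (?I M) L" using gsum_left[OF Ls] by blast
      have YR: "gsum (?I Y) L \<subseteq> gsum (?I M) L" by (intro gsum_mono aug_mono Y(4) subset_refl)
      have inj: "z - w \<in> gsum (?I M) L"
        if zw: "z \<in> gsum (?I M) Y" "w \<in> gsum (?I M) Y" "\<pi> z - \<pi> w \<in> gsum (?I Y) L" for z w
      proof -
        have "(z - \<pi> z) - (w - \<pi> w) + (\<pi> z - \<pi> w) \<in> gsum (?I M) L"
          by (rule subgp_add[OF IMs(1) subgp_diff[OF IMs(1)]])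
            (use \<pi>[OF zw(1)] \<pi>[OF zw(2)] I_R YR zw(3) in blast)+
        then show ?thesis by simp
      qed
      have pY: "\<pi> ` gsum (?I M) Y \<subseteq> Y" using \<pi> by blast
      have f2: "fin_ix (gsum (?I M) Y) (gsum (?I M) L)"
        by (rule ix_le_map(1)[OF IMs(1,3) 1(1) pY inj])
      have l2: "ix (gsum (?I M) Y) (gsum (?I M) L) \<le> ix Y (gsum (?I Y) L)"
        by (rule ix_le_map(2)[OF IMs(1,3) 1(1) pY inj])
      have "ix M (gsum (?I M) L) \<le> ix M (gsum (?I M) Y) * ix (gsum (?I M) Y) (gsum (?I M) L)"
        by (rule tower_le(2)[OF IMs(2,1) fMY f2])
      also have "\<dots> \<le> (C * q ^ nat (a * c)) * (CJ * p ^ nat (a * c))"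
        by (rule mult_mono[OF up[OF ac] order_trans[OF l2 order_trans[OF 1(2) CJ[OF ac]]]]) simp_all
      also have "\<dots> = (C * CJ) * (q * p) ^ nat (a * c)" by (simp add: power_mult_distrib)
      also have "\<dots> \<le> (C * (CJ + 1)) * (q * p) ^ nat (a * c)" by (intro mult_right_mono mult_left_mono) simp_all
      finally show ?thesis .
    qed
    have "C * (CJ + 1) > 0" "q * p > 0" using C prime_gt_0_nat[OF p(1)] by simp_all
    then show ?thesis unfolding upper_claim_def using F' up' low' by blast
  qed
  then show ?thesis using Y LY by blast
qed

lemma upper_claim_all:
  assumes "submod L" "L \<subseteq> M" "mclosed L" shows "upper_claim L"
proof (rule ccontr)
  assume nL: "\<not> upper_claim L"
  let ?A = "{L. submod L \<and> L \<subseteq> M \<and> mclosed L \<and> \<not> upper_claim L}"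
  have ne: "?A \<noteq> {}" using assms nL by blast
  have sm: "submod H \<and> H \<subseteq> M" if "H \<in> ?A" for H using that by blast
  obtain H where H: "H \<in> ?A" "\<forall>H'\<in>?A. H \<subseteq> H' \<longrightarrow> H' = H"
    using acc_max[OF ne sm] by (rule bexE)
  have Hs: "submod H" "H \<subseteq> M" "mclosed H" "\<not> upper_claim H" using H(1) by simp_all
  have "H \<noteq> M" using Hs(4) upper_claim_M by metis
  obtain Y where Y: "submod Y \<and> Y \<subseteq> M \<and> mclosed Y \<and> H \<subset> Y \<and> (upper_claim Y \<longrightarrow> upper_claim H)"
    using upper_claim_step[OF Hs(1-3) \<open>H \<noteq> M\<close>] by (rule exE)
  have "Y \<in> ?A" using Y Hs(4) by simp
  from H(2)[rule_format, OF this] Y show False by auto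
qed

text \<open>\<open>N\<close> is the monic closure of 0, so one monic \<open>g\<close> kills all of
  it. The claim for L = N leaves only the contribution of \<open>N\<close> itself to the index.
  Counting modulo \<open>N\<close> can only shrink a span, so the lower estimate passes to
  cardinalities.\<close>

theorem upper_bound:
  "\<exists>N g C q F. submod N \<and> N \<subseteq> M \<and> g \<in> mon \<and> (\<forall>x\<in>N. g x = 0) \<and> C > 0 \<and> q > 0 \<and>
     subgp F \<and> finite F \<and> F \<subseteq> M \<and>
     (\<forall>a b c. a > 0 \<longrightarrow> c > 0 \<longrightarrow>
        ix M (aug (a, 0) (b, c) M) \<le> C * q ^ nat (a * c) * ix N (aug (a, 0) (b, c) N)) \<and>
     (\<forall>W. finite W \<longrightarrow> (q::nat) ^ card W \<le> card (sp W F))"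
proof -
  have S0: "submod {0}" by (rule submodI[OF subgp_singleton]) (simp add: u_zero)
  have Ms: "subgp M" by (rule submod_subgp[OF submod_M])
  have "{0} \<subseteq> M" using subgp_0[OF Ms] by blast
  from mon_closure[OF S0 this] obtain g where g: "g \<in> mon"
    and N: "submod {y\<in>M. g y \<in> {0}}" "mclosed {y\<in>M. g y \<in> {0}}" by blast
  define N where "N = {y\<in>M. g y \<in> {0}}"
  have N: "submod N" "mclosed N" "N \<subseteq> M" "\<forall>x\<in>N. g x = 0" using N by (auto simp: N_def)
  have Ns: "subgp N" by (rule submod_subgp[OF N(1)])
  obtain C q F where C: "C > 0" "q > 0" and F: "subgp F" "finite F" "F \<subseteq> M"
    and up: "\<And>a b c. a > 0 \<Longrightarrow> c > 0 \<Longrightarrow> ix M (gsum (aug (a, 0) (b, c) M) N) \<le> C * q ^ nat (a * c)"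
    and low: "\<And>W. finite W \<Longrightarrow> (q::nat) ^ card W \<le> ix (sp W F) N"
    using upper_claim_all[OF N(1,3,2)] unfolding upper_claim_def by blast
  have low': "q ^ card W \<le> card (sp W F)" if "finite W" for W
    using low[OF that] ix_le_card[OF finite_sp[OF F(1,2) that], of N] by linarith
  have up': "ix M (aug (a, 0) (b, c) M) \<le> C * q ^ nat (a * c) * ix N (aug (a, 0) (b, c) N)"
    if ac: "a > 0" "c > 0" for a b c
  proof -
    let ?I = "aug (a, 0) (b, c)"
    have Is: "subgp (?I H)" if "submod H" for H by (rule submod_subgp[OF submod_aug[OF that]])
    have sN: "subgp (gsum (?I M) N)" by (intro subgp_gsum Is submod_M Ns)
    have fM: "fin_ix M (?I M)" by (rule fin_ix_aug[OF submod_M subset_refl ac])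
    have fMN: "fin_ix M (gsum (?I M) N)"
      by (rule ix_mono(1)[OF sN Is[OF submod_M] fM subset_refl]) (use gsum_left[OF Ns] in blast)
    define \<pi> where "\<pi> z = (SOME y. y \<in> N \<and> z - y \<in> ?I M)" for z
    have \<pi>: "\<pi> z \<in> N \<and> z - \<pi> z \<in> ?I M" if z: "z \<in> gsum (?I M) N" for z
    proof -
      obtain m y where "m \<in> ?I M" "y \<in> N" "z = m + y" using z unfolding gsum_def by blast
      then have "y \<in> N \<and> z - y \<in> ?I M" by simp
      then show ?thesis unfolding \<pi>_def by (rule someI)
    qed
    have inj: "z - w \<in> ?I M"
      if zw: "z \<in> gsum (?I M) N" "w \<in> gsum (?I M) N" "\<pi> z - \<pi> w \<in> ?I N" for z w
    proof -
      have "(z - \<pi> z) - (w - \<pi> w) + (\<pi> z - \<pi> w) \<in> ?I M"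
        by (rule subgp_add[OF Is[OF submod_M] subgp_diff[OF Is[OF submod_M]]])
          (use \<pi>[OF zw(1)] \<pi>[OF zw(2)] aug_mono[OF N(3)] zw(3) in blast)+
      then show ?thesis by simp
    qed
    have pN: "\<pi> ` gsum (?I M) N \<subseteq> N" using \<pi> by blast
    note mp = ix_le_map[OF Is[OF submod_M] Is[OF N(1)] fin_ix_aug[OF N(1,3) ac] pN inj]
    have "ix M (?I M) \<le> ix M (gsum (?I M) N) * ix (gsum (?I M) N) (?I M)"
      by (rule tower_le(2)[OF sN Is[OF submod_M] fMN mp(1)])
    also have "\<dots> \<le> C * q ^ nat (a * c) * ix N (?I N)"
      by (rule mult_mono[OF up[OF ac] mp(2)]) simp_all
    finally show ?thesis .
  qed
  show ?thesis
    by (rule exI[of _ N], rule exI[of _ g], rule exI[of _ C], rule exI[of _ q], rule exI[of _ F])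
      (intro conjI allI impI N(1,3,4) g C F low' up')
qed

text \<open>The slope \<kappa> must not depend on \<open>E\<close>: entropy is a supremum over
  covers, and each cover brings its own \<open>E\<close>. Only the strip width and the additive
  constant are allowed to depend on it.\<close>

lemma strip_growth:
  assumes N: "submod N" "N \<subseteq> M" and g: "g \<in> mon" "\<forall>x\<in>N. g x = 0"
  shows "\<exists>\<kappa>\<ge>0. \<forall>E. subgp E \<and> finite E \<and> E \<subseteq> N \<longrightarrow>
    (\<exists>c. \<forall>K::nat. ln (real (card (sp ((\<lambda>k. (int k * m1, int k * m2)) ` {..<K}) E))) \<le> \<kappa> * real K + c)"
proof (cases "m1 = 0 \<and> m2 = 0")
  case True
  show ?thesis
  proof (rule exI[of _ "0::real"], intro conjI allI impI)
    fix E :: "'a set" assume E: "subgp E \<and> finite E \<and> E \<subseteq> N"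
    have "ln (real (card (sp ((\<lambda>k. (int k * m1, int k * m2)) ` {..<K}) E))) \<le> 0 * real K + ln (real (card (sp {0} E)))"
      for K :: nat
    proof -
      have "card (sp ((\<lambda>k. (int k * m1, int k * m2)) ` {..<K}) E) \<le> card (sp {0} E)"
        by (rule card_sp_mono) (use E True in \<open>auto simp: zero_prod_def\<close>)
      then show ?thesis using E card_sp_pos[of E "(\<lambda>k. (int k * m1, int k * m2)) ` {..<K}"] by simp
    qed
    then show "\<exists>c. \<forall>K::nat. ln (real (card (sp ((\<lambda>k. (int k * m1, int k * m2)) ` {..<K}) E))) \<le> 0 * real K + c" by blast
  qed simp
next
  case False
  then have m: "m1 \<noteq> 0 \<or> m2 \<noteq> 0" by blast
  obtain F where F: "subgp F" "finite F" "F \<subseteq> N" "gen F = N" using finitely_generated[OF N] by blast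
  obtain T where T: "T \<in> Op neg" "g = (\<lambda>x. x + T x)" using g(1) by (auto simp: mon_def)
  obtain S where S: "finite S" "S \<subseteq> neg" "T \<in> Op S" using Op_finite[OF T(1)] by blast
  have gz: "u n f + T (u n f) = 0" if "f \<in> F" for n f
    using g(2) submod_u[OF N(1), of f n] that F(3) unfolding T(2) by blast
  have Sneg: "phi t < 0" if "t \<in> S" for t using S(2) that by blast
  define f where "f v = m1 * fst v + m2 * snd v" for v :: "int \<times> int"
  define h where "h v = m2 * fst v - m1 * snd v" for v :: "int \<times> int"
  define R where "R = m1 * m1 + m2 * m2"
  have bnd: "\<exists>B\<ge>0. \<forall>v\<in>V. \<bar>f v\<bar> \<le> B \<and> \<bar>h v\<bar> \<le> B" if "finite V" for V
    using that
  proof (induction V rule: finite_induct)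
    case empty
    show ?case by (rule exI[of _ 0]) simp
  next
    case (insert v V)
    then obtain B where "B \<ge> 0" "\<forall>v\<in>V. \<bar>f v\<bar> \<le> B \<and> \<bar>h v\<bar> \<le> B" by blast
    then show ?case by (intro exI[of _ "B + \<bar>f v\<bar> + \<bar>h v\<bar>"]) force
  qed
  obtain b where b: "b \<ge> 0" "\<forall>t\<in>S. \<bar>f t\<bar> \<le> b \<and> \<bar>h t\<bar> \<le> b" using bnd[OF S(1)] by blast
  have F1: "card F \<ge> 1" using F(2) subgp_0[OF F(1)] card_gt_0_iff[of F] by (simp add: Suc_le_eq) blast
  \<comment> \<open>Each step along (m1, m2) lengthens the strip by R = m1^2 + m2^2 in the
    coordinate \<open>f\<close>, and each unit of length adds 2 b to the bound on boundary
    points.\<close>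
  define \<kappa> where "\<kappa> = ln (real (card F)) * real_of_int (2 * b * R)"
  have R0: "R \<ge> 0" by (simp add: R_def)
  have k0: "\<kappa> \<ge> 0" unfolding \<kappa>_def using F1 b(1) R0 by (intro mult_nonneg_nonneg) simp_all
  have "\<exists>c. \<forall>K::nat. ln (real (card (sp ((\<lambda>k. (int k * m1, int k * m2)) ` {..<K}) E))) \<le> \<kappa> * real K + c"
    if E: "subgp E" "finite E" "E \<subseteq> N" for E
  proof -
    obtain V where V: "finite V" "E \<subseteq> sp V F" using gen_in_sp[OF F(1) E(2)] E(3) F(4) by blast
    obtain B where B: "B \<ge> 0" "\<forall>v\<in>V. \<bar>f v\<bar> \<le> B \<and> \<bar>h v\<bar> \<le> B" using bnd[OF V(1)] by blast
    define c where "c = ln (real (card F)) * real_of_int (2 * b * (2 * B + 1) + 2 * b * (2 * B + 1))"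
    have "ln (real (card (sp ((\<lambda>k. (int k * m1, int k * m2)) ` {..<K}) E))) \<le> \<kappa> * real K + c" for K :: nat
    proof -
      let ?I = "(\<lambda>k. (int k * m1, int k * m2)) ` {..<K}"
      define L where "L = int K * R + B"
      have L0: "L \<ge> 0" using R0 B(1) by (simp add: L_def)
      define P where "P = {v. - B \<le> f v \<and> f v \<le> L \<and> - B \<le> h v \<and> h v \<le> B}"
      have P: "finite P" "int (card {v\<in>P. \<exists>t\<in>S. t + v \<notin> P}) \<le> 2 * b * (2 * B + 1) + 2 * b * (L + B + 1)"
        using strip_boundary_count[OF m b(1) B(1) L0, of S] b(2) unfolding P_def f_def h_def by blast+
      have "sp ?I E \<subseteq> sp P F"
      proof (rule sp_subset[OF subgp_sp[OF F(1)]])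
        fix n e assume n: "n \<in> ?I" and e: "e \<in> E"
        obtain k where k: "k < K" "n = (int k * m1, int k * m2)" using n by blast
        have "u n e \<in> sp ((+) n ` V) F" using e V(2) sp_image by blast
        moreover have "(+) n ` V \<subseteq> P"
        proof (rule image_subsetI)
          fix v assume v: "v \<in> V"
          have 1: "f (n + v) = int k * R + f v" "h (n + v) = h v"
            by (simp_all add: f_def h_def R_def k(2) algebra_simps)
          have 2: "0 \<le> int k * R" "int k * R \<le> int K * R" using k(1) R0 by (simp_all add: mult_right_mono)
          have "\<bar>f v\<bar> \<le> B" "\<bar>h v\<bar> \<le> B" using B(2) v by blast+
          then show "n + v \<in> P" unfolding P_def mem_Collect_eq 1 L_def using 2 by linarith
        qed
        ultimately show "u n e \<in> sp P F" using sp_subset_sp[OF F(1) P(1) _ subset_refl] by blast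
      qed
      also have "sp P F \<subseteq> sp {v\<in>P. \<exists>t\<in>S. t + v \<notin> P} F" by (rule sp_boundary[OF F(1) P(1) S(3) Sneg gz])
      finally have sub: "sp ?I E \<subseteq> sp {v\<in>P. \<exists>t\<in>S. t + v \<notin> P} F" .
      have fB: "finite {v\<in>P. \<exists>t\<in>S. t + v \<notin> P}" using P(1) by simp
      have "card (sp ?I E) \<le> card (sp {v\<in>P. \<exists>t\<in>S. t + v \<notin> P} F)" by (rule card_mono[OF finite_sp[OF F(1,2) fB] sub])
      also have "\<dots> \<le> card F ^ card {v\<in>P. \<exists>t\<in>S. t + v \<notin> P}" by (rule card_sp_le[OF F(1,2) fB])
      finally have "real (card (sp ?I E)) \<le> real (card F) ^ card {v\<in>P. \<exists>t\<in>S. t + v \<notin> P}"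
        by (simp only: of_nat_power[symmetric] of_nat_le_iff)
      then have "ln (real (card (sp ?I E))) \<le> ln (real (card F) ^ card {v\<in>P. \<exists>t\<in>S. t + v \<notin> P})"
        using card_sp_pos[OF E(1,2), of ?I] F1 by (subst ln_le_cancel_iff) simp_all
      also have "\<dots> = ln (real (card F)) * real_of_int (int (card {v\<in>P. \<exists>t\<in>S. t + v \<notin> P}))"
        using F1 by (simp add: ln_realpow)
      also have "\<dots> \<le> ln (real (card F)) * real_of_int (2 * b * (2 * B + 1) + 2 * b * (L + B + 1))"
        using F1 by (intro mult_left_mono) (simp_all only: of_int_le_iff P(2), simp)
      also have "\<dots> = \<kappa> * real K + c" by (simp add: \<kappa>_def c_def L_def algebra_simps)
      finally show ?thesis .
    qed
    then show ?thesis by blast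
  qed
  then show ?thesis using k0 by blast
qed

end


subsection \<open>Compact groups in duality with modules\<close>

locale cpt_group =
  fixes T :: "'x topology" and add :: "'x \<Rightarrow> 'x \<Rightarrow> 'x" and neg :: "'x \<Rightarrow> 'x" and zero :: 'x
  assumes grp: "cpt_ab_group T add neg zero"
begin

abbreviation X where "X \<equiv> topspace T"

lemma zero_in: "zero \<in> X" and add_in: "x \<in> X \<Longrightarrow> y \<in> X \<Longrightarrow> add x y \<in> X"
  and neg_in: "x \<in> X \<Longrightarrow> neg x \<in> X"
  and add_assoc: "x \<in> X \<Longrightarrow> y \<in> X \<Longrightarrow> z \<in> X \<Longrightarrow> add (add x y) z = add x (add y z)"
  and add_comm: "x \<in> X \<Longrightarrow> y \<in> X \<Longrightarrow> add x y = add y x"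
  and zero_add: "x \<in> X \<Longrightarrow> add zero x = x" and neg_add: "x \<in> X \<Longrightarrow> add (neg x) x = zero"
  and cpt: "compact_space T"
  using grp unfolding cpt_ab_group_def by blast+

end

text \<open>The pairing is abstract because it is used twice: for X with its character module, and
  for a quotient of X with the submodule \<open>N\<close>. Open level sets express that characters
  are locally constant. The two separation axioms, together with compactness and counting, yield all
  the duality that is used.\<close>

locale dual_pair = noeth_module u M + cpt_group T add neg zero
  for u :: "int \<times> int \<Rightarrow> 'g::ab_group_add \<Rightarrow> 'g" and M
    and T :: "'x topology" and add :: "'x \<Rightarrow> 'x \<Rightarrow> 'x" and neg :: "'x \<Rightarrow> 'x" and zero :: 'x +
  fixes \<alpha> :: "int \<times> int \<Rightarrow> 'x \<Rightarrow> 'x" and pr :: "'g \<Rightarrow> 'x \<Rightarrow> complex"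
  assumes act: "z2_aut_action T add \<alpha>"
    and pr_plus: "\<And>\<gamma> \<psi> x. \<gamma> \<in> M \<Longrightarrow> \<psi> \<in> M \<Longrightarrow> x \<in> topspace T \<Longrightarrow> pr (\<gamma> + \<psi>) x = pr \<gamma> x * pr \<psi> x"
    and pr_add: "\<And>\<gamma> x y. \<gamma> \<in> M \<Longrightarrow> x \<in> topspace T \<Longrightarrow> y \<in> topspace T \<Longrightarrow> pr \<gamma> (add x y) = pr \<gamma> x * pr \<gamma> y"
    and pr_norm: "\<And>\<gamma> x. \<gamma> \<in> M \<Longrightarrow> x \<in> topspace T \<Longrightarrow> cmod (pr \<gamma> x) = 1"
    and pr_u: "\<And>\<gamma> n x. \<gamma> \<in> M \<Longrightarrow> x \<in> topspace T \<Longrightarrow> pr (u n \<gamma>) x = pr \<gamma> (\<alpha> n x)"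
    and pr_open: "\<And>\<gamma> c. \<gamma> \<in> M \<Longrightarrow> openin T {x\<in>topspace T. pr \<gamma> x = c}"
    and sep_X: "\<And>x. x \<in> topspace T \<Longrightarrow> (\<And>\<gamma>. \<gamma> \<in> M \<Longrightarrow> pr \<gamma> x = 1) \<Longrightarrow> x = zero"
    and sep_M: "\<And>\<gamma>. \<gamma> \<in> M \<Longrightarrow> (\<And>x. x \<in> topspace T \<Longrightarrow> pr \<gamma> x = 1) \<Longrightarrow> \<gamma> = 0"
begin

lemma \<alpha>_in: "x \<in> X \<Longrightarrow> \<alpha> n x \<in> X"
proof -
  assume x: "x \<in> X"
  have "continuous_map T T (\<alpha> n)" using act unfolding z2_aut_action_def by blast
  then show ?thesis using continuous_map_image_subset_topspace x by blast
qed

lemma \<alpha>_plus: "x \<in> X \<Longrightarrow> \<alpha> (m + n) x = \<alpha> m (\<alpha> n x)"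
  using act unfolding z2_aut_action_def by blast

lemma \<alpha>_0: "x \<in> X \<Longrightarrow> \<alpha> 0 x = x"
  using act unfolding z2_aut_action_def by blast

lemma M_sub: "subgp M" by (rule submod_subgp[OF submod_M])

lemma pr_nz: "\<gamma> \<in> M \<Longrightarrow> x \<in> X \<Longrightarrow> pr \<gamma> x \<noteq> 0"
  using pr_norm[of \<gamma> x] by force

lemma pr_zero_right: "\<gamma> \<in> M \<Longrightarrow> pr \<gamma> zero = 1"
  using pr_add[of \<gamma> zero zero] zero_in pr_nz[of \<gamma> zero] zero_add[of zero] by simp

lemma pr_neg: assumes "\<gamma> \<in> M" "x \<in> X" shows "pr \<gamma> (neg x) = inverse (pr \<gamma> x)"
proof -
  have "pr \<gamma> (neg x) * pr \<gamma> x = 1"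
    using pr_add[OF assms(1) neg_in[OF assms(2)] assms(2)] neg_add[OF assms(2)] pr_zero_right[OF assms(1)] by simp
  then show ?thesis using pr_nz[OF assms] by (simp add: field_simps)
qed

lemma pr_0: "x \<in> X \<Longrightarrow> pr 0 x = 1"
  using pr_plus[of 0 0 x] subgp_0[OF M_sub] pr_nz[of 0 x] by simp

lemma pr_diff:
  assumes "\<gamma> \<in> M" "\<psi> \<in> M" "x \<in> X" shows "pr (\<gamma> - \<psi>) x = pr \<gamma> x / pr \<psi> x"
proof -
  have "pr (\<gamma> - \<psi> + \<psi>) x = pr (\<gamma> - \<psi>) x * pr \<psi> x"
    by (rule pr_plus[OF subgp_diff[OF M_sub assms(1,2)] assms(2,3)])
  then show ?thesis using pr_nz[OF assms(2,3)] by (simp add: field_simps)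
qed

lemma sep_eq:
  assumes "x \<in> X" "y \<in> X" "\<And>\<gamma>. \<gamma> \<in> M \<Longrightarrow> pr \<gamma> x = pr \<gamma> y" shows "x = y"
proof -
  have "add (neg y) x = zero"
    by (rule sep_X) (use assms add_in neg_in pr_add pr_neg pr_nz in auto)
  then have "add y (add (neg y) x) = y" using add_comm[OF assms(2) zero_in] zero_add[OF assms(2)] by simp
  moreover have "add y (add (neg y) x) = x"
    using add_assoc[OF assms(2) neg_in[OF assms(2)] assms(1)] add_comm[OF assms(2) neg_in[OF assms(2)]]
      neg_add[OF assms(2)] zero_add[OF assms(1)] by simp
  ultimately show ?thesis by simp
qed

lemma subgp_agree:
  assumes "x \<in> X" "y \<in> X" shows "subgp {\<gamma>\<in>M. pr \<gamma> x = pr \<gamma> y}"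
  by (rule subgpI) (use assms subgp_0[OF M_sub] subgp_diff[OF M_sub] pr_diff pr_0 in auto)

definition code :: "'g set \<Rightarrow> 'x \<Rightarrow> 'g \<Rightarrow> complex" where
  "code E x = restrict (\<lambda>\<gamma>. pr \<gamma> x) E"

text \<open>For points \<open>x\<close> of X and \<open>E\<close> inside M this is the coset of the
  annihilator of \<open>E\<close> through \<open>x\<close>; \<open>code E\<close> labels these
  cosets by their values on \<open>E\<close>.\<close>

definition cl :: "'g set \<Rightarrow> 'x \<Rightarrow> 'x set" where
  "cl E x = {y\<in>X. \<forall>\<gamma>\<in>E. pr \<gamma> y = pr \<gamma> x}"

lemma code_eq: "code E x = code E y \<longleftrightarrow> (\<forall>\<gamma>\<in>E. pr \<gamma> x = pr \<gamma> y)"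
  by (auto simp: code_def restrict_def fun_eq_iff)

lemma cl_self: "x \<in> X \<Longrightarrow> x \<in> cl E x" by (simp add: cl_def)

lemma open_cl:
  assumes "finite E" "E \<subseteq> M" shows "openin T (cl E x)"
proof -
  have "cl E x = X \<inter> (\<Inter>\<gamma>\<in>E. {y\<in>X. pr \<gamma> y = pr \<gamma> x})" by (auto simp: cl_def)
  moreover have "openin T (X \<inter> (\<Inter>\<gamma>\<in>E. {y\<in>X. pr \<gamma> y = pr \<gamma> x}))"
  proof (cases "E = {}")
    case False
    then have "openin T (\<Inter>\<gamma>\<in>E. {y\<in>X. pr \<gamma> y = pr \<gamma> x})"
      using assms pr_open by (intro openin_INT2) blast+
    then show ?thesis by (intro openin_Int) auto
  qed simp
  ultimately show ?thesis by simp
qed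

lemma pr_closed: assumes "\<gamma> \<in> M" shows "closedin T {x\<in>X. pr \<gamma> x = c}"
proof -
  have "openin T (\<Union>d\<in>- {c}. {x\<in>X. pr \<gamma> x = d})" by (rule openin_Union) (use pr_open[OF assms] in blast)
  moreover have "X - {x\<in>X. pr \<gamma> x = c} = (\<Union>d\<in>- {c}. {x\<in>X. pr \<gamma> x = d})" by auto
  ultimately show ?thesis unfolding closedin_def by auto
qed

lemma finite_cl:
  assumes "finite E" "E \<subseteq> M" shows "finite (cl E ` X)"
proof -
  have op: "\<forall>U\<in>cl E ` X. openin T U" using open_cl[OF assms] by blast
  have cov: "X \<subseteq> \<Union>(cl E ` X)" using cl_self by blast
  obtain F where F: "finite F" "F \<subseteq> cl E ` X" "X \<subseteq> \<Union>F"
    using cpt[unfolded compact_space_alt, rule_format, of "cl E ` X"] op cov by blast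
  have "cl E ` X \<subseteq> F"
  proof
    fix U assume "U \<in> cl E ` X"
    then obtain x where x: "x \<in> X" "U = cl E x" by blast
    obtain V where V: "V \<in> F" "x \<in> V" using F(3) x(1) by blast
    then obtain y where y: "y \<in> X" "V = cl E y" using F(2) by blast
    have "cl E y = cl E x" using V(2) y by (auto simp: cl_def)
    then show "U \<in> F" using V(1) x y by simp
  qed
  then show ?thesis using F(1) finite_subset by blast
qed

lemma finite_code:
  assumes "finite E" "E \<subseteq> M" shows "finite (code E ` X)"
proof -
  have "code E ` X \<subseteq> (\<lambda>U. code E (SOME y. y \<in> U)) ` (cl E ` X)"
  proof
    fix \<kappa> assume "\<kappa> \<in> code E ` X"
    then obtain x where x: "x \<in> X" "\<kappa> = code E x" by blast
    have "(SOME y. y \<in> cl E x) \<in> cl E x" by (rule someI[of "\<lambda>y. y \<in> cl E x", OF cl_self[OF x(1)]])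
    then have "code E (SOME y. y \<in> cl E x) = code E x" by (simp add: code_eq cl_def)
    then show "\<kappa> \<in> (\<lambda>U. code E (SOME y. y \<in> U)) ` (cl E ` X)"
      using x by (intro image_eqI[of _ _ "cl E x"]) simp_all
  qed
  then show ?thesis using finite_cl[OF assms] finite_surj by blast
qed

text \<open>Both evaluations of the double sum use that a nontrivial character of a group sums to zero.\<close>

lemma pairing_count:
  assumes E: "subgp E" "finite E" "E \<subseteq> M"
    and Q: "Q \<subseteq> X" "zero \<in> Q" "\<And>x y. x \<in> Q \<Longrightarrow> y \<in> Q \<Longrightarrow> add x y \<in> Q"
  shows "card (code E ` Q) * card {\<gamma>\<in>E. \<forall>x\<in>Q. pr \<gamma> x = 1} = card E"
proof -
  let ?K = "code E ` Q" let ?Z = "{\<gamma>\<in>E. \<forall>x\<in>Q. pr \<gamma> x = 1}"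
  have K: "finite ?K" using finite_subset[OF image_mono[OF Q(1)] finite_code[OF E(2,3)]] .
  have rows: "(\<Sum>\<gamma>\<in>E. \<kappa> \<gamma>) = (if \<kappa> = code E zero then of_nat (card E) else 0)" if k: "\<kappa> \<in> ?K" for \<kappa>
  proof -
    obtain x where x: "x \<in> Q" "\<kappa> = code E x" using k by blast
    have xX: "x \<in> X" using x Q by blast
    have s: "(\<Sum>\<gamma>\<in>E. \<kappa> \<gamma>) = (\<Sum>\<gamma>\<in>E. pr \<gamma> x)" by (rule sum.cong) (simp_all add: x code_def)
    show ?thesis
    proof (cases "\<kappa> = code E zero")
      case True
      then have "\<forall>\<gamma>\<in>E. pr \<gamma> x = pr \<gamma> zero" unfolding x(2) code_eq .
      then have "pr \<gamma> x = 1" if "\<gamma> \<in> E" for \<gamma> using that pr_zero_right E(3) by auto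
      then show ?thesis using True s by simp
    next
      case False
      then have "\<not> (\<forall>\<gamma>\<in>E. pr \<gamma> x = pr \<gamma> zero)" unfolding x(2) code_eq .
      then obtain \<gamma>0 where g0: "\<gamma>0 \<in> E" "pr \<gamma>0 x \<noteq> 1"
        using pr_zero_right E(3) by auto
      have "bij_betw (\<lambda>\<gamma>. \<gamma> + \<gamma>0) E E"
      proof (rule bij_betw_byWitness[of _ "\<lambda>\<gamma>. \<gamma> - \<gamma>0"])
        show "(\<lambda>\<gamma>. \<gamma> + \<gamma>0) ` E \<subseteq> E" using g0 subgp_add[OF E(1)] by blast
        show "(\<lambda>\<gamma>. \<gamma> - \<gamma>0) ` E \<subseteq> E" using g0 subgp_diff[OF E(1)] by blast
      qed simp_all
      then have "(\<Sum>\<gamma>\<in>E. pr \<gamma> x) = (\<Sum>\<gamma>\<in>E. pr (\<gamma> + \<gamma>0) x)" by (rule sum.reindex_bij_betw[symmetric])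
      also have "\<dots> = (\<Sum>\<gamma>\<in>E. pr \<gamma> x * pr \<gamma>0 x)" by (rule sum.cong) (use pr_plus E(3) g0 xX in auto)
      also have "\<dots> = (\<Sum>\<gamma>\<in>E. pr \<gamma> x) * pr \<gamma>0 x" by (simp add: sum_distrib_right)
      finally have "(\<Sum>\<gamma>\<in>E. pr \<gamma> x) = 0" using g0(2) by simp
      then show ?thesis using False s by simp
    qed
  qed
  have cols: "(\<Sum>\<kappa>\<in>?K. \<kappa> \<gamma>) = (if \<gamma> \<in> ?Z then of_nat (card ?K) else 0)" if g: "\<gamma> \<in> E" for \<gamma>
  proof (cases "\<gamma> \<in> ?Z")
    case True
    have "(\<Sum>\<kappa>\<in>?K. \<kappa> \<gamma>) = (\<Sum>\<kappa>\<in>?K. 1)" by (rule sum.cong) (use True in \<open>auto simp: code_def\<close>)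
    then show ?thesis using True by simp
  next
    case False
    then obtain x0 where x0: "x0 \<in> Q" "pr \<gamma> x0 \<noteq> 1" using g by blast
    have x0X: "x0 \<in> X" using x0 Q by blast
    define f where "f \<kappa> = restrict (\<lambda>\<gamma>. \<kappa> \<gamma> * pr \<gamma> x0) E" for \<kappa> :: "'g \<Rightarrow> complex"
    have fc: "f (code E x) = code E (add x x0)" if "x \<in> Q" for x
    proof (rule ext)
      fix \<psi>
      have "\<psi> \<in> E \<Longrightarrow> pr \<psi> x * pr \<psi> x0 = pr \<psi> (add x x0)"
        using that Q(1) E(3) x0X by (subst pr_add) blast+
      then show "f (code E x) \<psi> = code E (add x x0) \<psi>" by (simp add: f_def code_def restrict_def)
    qed
    have fK: "f ` ?K \<subseteq> ?K" using fc Q(3) x0(1) by auto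
    have inj: "inj_on f ?K"
    proof (rule inj_onI)
      fix \<kappa> \<kappa>' assume k: "\<kappa> \<in> ?K" "\<kappa>' \<in> ?K" and e: "f \<kappa> = f \<kappa>'"
      have "\<kappa> \<psi> = \<kappa>' \<psi>" for \<psi>
      proof (cases "\<psi> \<in> E")
        case True
        then show ?thesis using fun_cong[OF e, of \<psi>] pr_nz[of \<psi> x0] x0X E(3) by (auto simp: f_def)
      next
        case False
        then show ?thesis using k by (auto simp: code_def)
      qed
      then show "\<kappa> = \<kappa>'" by blast
    qed
    have "(\<Sum>\<kappa>\<in>?K. \<kappa> \<gamma>) = (\<Sum>\<kappa>\<in>f ` ?K. \<kappa> \<gamma>)" using endo_inj_surj[OF K fK inj] by simp
    also have "\<dots> = (\<Sum>\<kappa>\<in>?K. f \<kappa> \<gamma>)" by (simp add: sum.reindex[OF inj])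
    also have "\<dots> = (\<Sum>\<kappa>\<in>?K. \<kappa> \<gamma>) * pr \<gamma> x0" using g by (simp add: f_def sum_distrib_right)
    finally have "(\<Sum>\<kappa>\<in>?K. \<kappa> \<gamma>) = 0" using x0(2) by simp
    then show ?thesis unfolding if_not_P[OF False] .
  qed
  have "complex_of_nat (card E) = (\<Sum>\<kappa>\<in>?K. if \<kappa> = code E zero then of_nat (card E) else 0)"
    using K Q(2) by simp
  also have "\<dots> = (\<Sum>\<kappa>\<in>?K. \<Sum>\<gamma>\<in>E. \<kappa> \<gamma>)" by (rule sum.cong) (simp_all add: rows)
  also have "\<dots> = (\<Sum>\<gamma>\<in>E. \<Sum>\<kappa>\<in>?K. \<kappa> \<gamma>)" by (rule sum.swap)
  also have "\<dots> = (\<Sum>\<gamma>\<in>E. if \<gamma> \<in> ?Z then of_nat (card ?K) else 0)" by (rule sum.cong) (simp_all only: cols)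
  also have "\<dots> = (\<Sum>\<gamma>\<in>E \<inter> ?Z. of_nat (card ?K))" by (rule sum.inter_restrict[OF E(2), symmetric])
  also have "E \<inter> ?Z = ?Z" by blast
  also have "(\<Sum>\<gamma>\<in>?Z. complex_of_nat (card ?K)) = of_nat (card ?K * card ?Z)" by simp
  finally show ?thesis by (simp only: of_nat_eq_iff)
qed

text \<open>Only the zero element of M pairs to 1 with all of X, so by \<open>pairing_count\<close>
  the quotient of X by the annihilator of \<open>E\<close> has as many elements as
  \<open>E\<close>.\<close>

lemma card_code:
  assumes E: "subgp E" "finite E" "E \<subseteq> M" shows "card (code E ` X) = card E"
proof -
  have "{\<gamma>\<in>E. \<forall>x\<in>X. pr \<gamma> x = 1} = {0}"
    using sep_M E(3) subgp_0[OF E(1)] pr_0 by blast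
  then show ?thesis using pairing_count[OF E subset_refl zero_in add_in] by simp
qed

lemma finite_subgp_hull:
  assumes H: "subgp H" "H \<subseteq> M" and S: "finite S" "S \<subseteq> H"
  shows "\<exists>E. subgp E \<and> finite E \<and> S \<subseteq> E \<and> E \<subseteq> H"
  using S
proof (induction S rule: finite_induct)
  case empty
  show ?case using subgp_singleton subgp_0[OF H(1)] by (intro exI[of _ "{0}"]) simp
next
  case (insert x S)
  then obtain E where E: "subgp E" "finite E" "S \<subseteq> E" "E \<subseteq> H" by blast
  have x: "x \<in> H" "x \<in> M" using insert.prems H(2) by blast+
  note F = finite_extend[OF E(1,2) x(2)]
  have "subgp (cyc x)" using tors[OF x(2)] subgp_cyc by blast
  then have "E \<subseteq> gsum E (cyc x)" using gsum_left by blast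
  moreover have "gsum E (cyc x) \<subseteq> H" by (rule gsum_subset[OF H(1) E(4) cyc_subset[OF H(1) x(1)]])
  ultimately show ?case using F E(3) by (intro exI[of _ "gsum E (cyc x)"]) auto
qed

text \<open>If every point annihilating \<open>H\<close> also annihilated \<gamma>, then values on
  \<open>H\<close> would determine values on the group generated by \<open>H\<close> and \<gamma>,
  and \<open>card_code\<close> would force the two groups to have the same order.\<close>

lemma annihilator_finite:
  assumes H: "subgp H" "finite H" "H \<subseteq> M" and g: "\<gamma> \<in> M" "\<gamma> \<notin> H"
  shows "\<exists>x\<in>X. (\<forall>h\<in>H. pr h x = 1) \<and> pr \<gamma> x \<noteq> 1"
proof (rule ccontr)
  assume n: "\<not> ?thesis"
  let ?E = "gsum H (cyc \<gamma>)"
  note E = finite_extend[OF H(1,2) g(1)]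
  have EM: "?E \<subseteq> M" by (rule gsum_subset[OF M_sub H(3) cyc_subset[OF M_sub g(1)]])
  have cs: "subgp (cyc \<gamma>)" using tors[OF g(1)] subgp_cyc by blast
  have HE: "H \<subseteq> ?E" using gsum_left[OF cs] by blast
  have one: "pr e x = 1" if x: "x \<in> X" "\<forall>h\<in>H. pr h x = 1" and e: "e \<in> ?E" for x e
  proof -
    have "pr \<gamma> x = 1" using n x by blast
    then have "\<gamma> \<in> {\<psi>\<in>M. pr \<psi> x = pr \<psi> zero}" using g pr_zero_right by simp
    moreover have "H \<subseteq> {\<psi>\<in>M. pr \<psi> x = pr \<psi> zero}" using x(2) H(3) pr_zero_right by auto
    ultimately have "?E \<subseteq> {\<psi>\<in>M. pr \<psi> x = pr \<psi> zero}"
      by (intro gsum_subset subgp_agree x zero_in cyc_subset)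
    then show ?thesis using e pr_zero_right by auto
  qed
  have same: "code ?E x = code ?E y" if xy: "x \<in> X" "y \<in> X" "code H x = code H y" for x y
  proof -
    let ?z = "add x (neg y)"
    have z: "?z \<in> X" using xy add_in neg_in by blast
    have "\<forall>h\<in>H. pr h ?z = 1"
      using xy H(3) pr_nz by (auto simp: code_eq pr_add neg_in pr_neg subset_iff)
    then have "\<forall>e\<in>?E. pr e ?z = 1" using one[OF z] by blast
    then show ?thesis
      using xy(1,2) EM pr_nz unfolding code_eq by (auto simp: pr_add neg_in pr_neg subset_iff field_simps)
  qed
  have "code ?E ` X \<subseteq> (\<lambda>\<kappa>. code ?E (SOME y. y \<in> X \<and> code H y = \<kappa>)) ` (code H ` X)"
  proof
    fix \<kappa> assume "\<kappa> \<in> code ?E ` X"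
    then obtain x where x: "x \<in> X" "\<kappa> = code ?E x" by blast
    have "\<exists>y. y \<in> X \<and> code H y = code H x" using x by blast
    from someI_ex[OF this] have "code ?E (SOME y. y \<in> X \<and> code H y = code H x) = code ?E x"
      using same x(1) by blast
    then show "\<kappa> \<in> (\<lambda>\<kappa>. code ?E (SOME y. y \<in> X \<and> code H y = \<kappa>)) ` (code H ` X)"
      using x by (intro image_eqI[of _ _ "code H x"]) simp_all
  qed
  then have "card (code ?E ` X) \<le> card (code H ` X)"
    using finite_code[OF H(2,3)] by (meson card_image_le card_mono finite_imageI order_trans)
  then have "card ?E \<le> card H" using card_code[OF E(1,2) EM] card_code[OF H] by simp
  then have "H = ?E" using card_seteq[OF E(2) HE] by blast
  then show False using E(3) g(2) by blast
qed

text \<open>Compactness: for each h the points with pr h x = 1 and pr \<gamma> x \<noteq> 1 form a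
  closed set, and finitely many of these sets meet by the finite case.\<close>

lemma annihilator:
  assumes H: "subgp H" "H \<subseteq> M" and g: "\<gamma> \<in> M" "\<gamma> \<notin> H"
  shows "\<exists>x\<in>X. (\<forall>h\<in>H. pr h x = 1) \<and> pr \<gamma> x \<noteq> 1"
proof -
  define C where "C h = {x\<in>X. pr h x = 1 \<and> pr \<gamma> x \<noteq> 1}" for h
  have cl: "closedin T (C h)" if "h \<in> H" for h
  proof -
    have "C h = {x\<in>X. pr h x = 1} - {x\<in>X. pr \<gamma> x = 1}" by (auto simp: C_def)
    then show ?thesis using closedin_diff[OF pr_closed pr_open] that H(2) g(1) by auto
  qed
  have fip: "\<Inter>F \<noteq> {}" if F: "finite F" "F \<subseteq> C ` H" for F
  proof -
    obtain S where S: "finite S" "S \<subseteq> H" "F = C ` S" using finite_subset_image[OF F] by blast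
    obtain E where E: "subgp E" "finite E" "S \<subseteq> E" "E \<subseteq> H" using finite_subgp_hull[OF H S(1,2)] by blast
    obtain x where "x \<in> X" "\<forall>h\<in>E. pr h x = 1" "pr \<gamma> x \<noteq> 1"
      using annihilator_finite[OF E(1,2) _ g(1)] E(4) H(2) g(2) by blast
    then have "x \<in> \<Inter>F" using S(3) E(3) by (auto simp: C_def)
    then show ?thesis by blast
  qed
  have "\<Inter>(C ` H) \<noteq> {}"
    using cpt[unfolded compact_space_fip, rule_format, of "C ` H"] cl fip by blast
  then obtain x where "x \<in> \<Inter>(C ` H)" by blast
  then show ?thesis using subgp_0[OF H(1)] by (auto simp: C_def)
qed

lemma fixed_points:
  assumes "x \<in> X" shows "\<alpha> n x = x \<longleftrightarrow> (\<forall>\<gamma>\<in>M. pr (dd n \<gamma>) x = 1)"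
proof -
  have "pr (dd n \<gamma>) x = pr \<gamma> (\<alpha> n x) / pr \<gamma> x" if "\<gamma> \<in> M" for \<gamma>
    unfolding dd_def using pr_diff[OF submod_u[OF submod_M that] that assms] pr_u[OF that assms] by simp
  then have "(\<forall>\<gamma>\<in>M. pr (dd n \<gamma>) x = 1) \<longleftrightarrow> (\<forall>\<gamma>\<in>M. pr \<gamma> (\<alpha> n x) = pr \<gamma> x)"
    using pr_nz[OF _ assms] by (auto simp: field_simps)
  moreover have "\<alpha> n x = x" if "\<forall>\<gamma>\<in>M. pr \<gamma> (\<alpha> n x) = pr \<gamma> x"
    by (rule sep_eq[OF \<alpha>_in[OF assms] assms]) (use that in blast)
  ultimately show ?thesis by metis
qed

lemma ann_subgroup:
  assumes "H \<subseteq> M"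
  shows "zero \<in> {x\<in>X. \<forall>h\<in>H. pr h x = 1}"
    "x \<in> {x\<in>X. \<forall>h\<in>H. pr h x = 1} \<Longrightarrow> y \<in> {x\<in>X. \<forall>h\<in>H. pr h x = 1} \<Longrightarrow> add x y \<in> {x\<in>X. \<forall>h\<in>H. pr h x = 1}"
  using assms zero_in pr_zero_right add_in pr_add by (auto simp: subset_iff)

text \<open>The fixed points form the annihilator of the augmentation submodule. A finite group
  \<open>E\<close> containing representatives of the quotient already separates them. By
  \<open>annihilator\<close> the elements of \<open>E\<close> that are trivial on all fixed points
  are those in the submodule, so \<open>pairing_count\<close> on \<open>E\<close> gives the
  number.\<close>

lemma card_fixed:
  fixes a b c :: int
  assumes ac: "a > 0" "c > 0"
  defines "P \<equiv> {x\<in>X. \<alpha> (a, 0) x = x \<and> \<alpha> (b, c) x = x}"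
  shows "finite P" "card P = ix M (aug (a, 0) (b, c) M)"
proof -
  let ?I = "aug (a, 0) (b, c) M"
  have I: "submod ?I" "subgp ?I" "?I \<subseteq> M"
    using submod_aug[OF submod_M] submod_subgp aug_subset[OF submod_M] by blast+
  have P: "P = {x\<in>X. \<forall>h\<in>?I. pr h x = 1}"
  proof (intro equalityI subsetI)
    fix x assume "x \<in> P"
    then have x: "x \<in> X" "\<forall>\<gamma>\<in>M. pr (dd (a, 0) \<gamma>) x = 1" "\<forall>\<gamma>\<in>M. pr (dd (b, c) \<gamma>) x = 1"
      using fixed_points by (auto simp: P_def)
    have "pr h x = 1" if "h \<in> ?I" for h
    proof -
      obtain y z where "y \<in> M" "z \<in> M" "h = dd (a, 0) y + dd (b, c) z" using \<open>h \<in> ?I\<close> by (rule augE)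
      then show ?thesis using x pr_plus dd_in[OF submod_M] by simp
    qed
    then show "x \<in> {x\<in>X. \<forall>h\<in>?I. pr h x = 1}" using x(1) by blast
  next
    fix x assume x: "x \<in> {x\<in>X. \<forall>h\<in>?I. pr h x = 1}"
    then have "\<forall>\<gamma>\<in>M. pr (dd (a, 0) \<gamma>) x = 1" "\<forall>\<gamma>\<in>M. pr (dd (b, c) \<gamma>) x = 1"
      using aug_s[OF submod_M] aug_t[OF submod_M] by blast+
    then show "x \<in> P" using fixed_points x by (simp add: P_def)
  qed
  have fI: "fin_ix M ?I" by (rule fin_ix_aug[OF submod_M subset_refl ac])
  define R where "R = crep M ?I ` cosets_met M ?I"
  have R: "finite R" "R \<subseteq> M" using fI crep(1) by (auto simp: R_def)
  obtain E where E: "subgp E" "finite E" "R \<subseteq> E" "E \<subseteq> M" using finite_subgp_hull[OF M_sub subset_refl R] by blast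
  have inj: "inj_on (code E) P"
  proof (rule inj_onI)
    fix x y assume xy: "x \<in> P" "y \<in> P" "code E x = code E y"
    have X: "x \<in> X" "y \<in> X" using xy by (auto simp: P_def)
    have "pr \<gamma> x = pr \<gamma> y" if g: "\<gamma> \<in> M" for \<gamma>
    proof -
      let ?r = "crep M ?I (coset ?I \<gamma>)"
      have d: "\<gamma> - ?r \<in> ?I" by (rule crep_diff(1)[OF I(2) g])
      have r: "?r \<in> E" using E(3) g by (auto simp: R_def cosets_met_def)
      have rM: "?r \<in> M" using r E(4) by blast
      have "pr (\<gamma> - ?r) x = 1" "pr (\<gamma> - ?r) y = 1" using d xy P by blast+
      then have "pr \<gamma> x = pr ?r x" "pr \<gamma> y = pr ?r y"
        using pr_diff[OF g rM] X pr_nz[OF rM] by (auto simp: field_simps)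
      moreover have "pr ?r x = pr ?r y" using xy(3) r by (simp add: code_eq)
      ultimately show ?thesis by simp
    qed
    then show "x = y" using sep_eq X by blast
  qed
  have PX: "P \<subseteq> X" by (auto simp: P_def)
  have "finite (code E ` P)" using finite_subset[OF image_mono[OF PX] finite_code[OF E(2,4)]] .
  then show fP: "finite P" using inj finite_imageD by blast
  have Z: "{\<gamma>\<in>E. \<forall>x\<in>P. pr \<gamma> x = 1} = E \<inter> ?I"
  proof (intro equalityI subsetI)
    fix \<gamma> assume g: "\<gamma> \<in> {\<gamma>\<in>E. \<forall>x\<in>P. pr \<gamma> x = 1}"
    show "\<gamma> \<in> E \<inter> ?I"
    proof (rule ccontr)
      assume "\<gamma> \<notin> E \<inter> ?I"
      then have "\<gamma> \<in> M" "\<gamma> \<notin> ?I" using g E(4) by blast+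
      from annihilator[OF I(2,3) this] show False using g P by blast
    qed
  qed (use P in blast)
  have zP: "zero \<in> P" unfolding P by (rule ann_subgroup(1)[OF I(3)])
  have aP: "add x y \<in> P" if "x \<in> P" "y \<in> P" for x y
    using that unfolding P by (rule ann_subgroup(2)[OF I(3)])
  have "card (code E ` P) * card (E \<inter> ?I) = card E"
    using pairing_count[OF E(1,2,4) PX zP aP] unfolding Z .
  then have 1: "card P * card (E \<inter> ?I) = card E" using card_image[OF inj] by simp
  have EI: "subgp (E \<inter> ?I)" by (rule subgp_Int[OF E(1) I(2)])
  have fE: "fin_ix E {0}" by (rule fin_ix_finite[OF E(2)])
  have "ix E {0} = ix E (E \<inter> ?I) * ix (E \<inter> ?I) {0}"
    by (rule tower_eq[OF E(1) EI subgp_singleton _ _ fE]) (use subgp_0[OF EI] in auto)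
  then have 2: "card E = ix E (E \<inter> ?I) * card (E \<inter> ?I)" by (simp add: ix_zero)
  have "card (E \<inter> ?I) > 0" using subgp_0[OF EI] E(2) card_gt_0_iff by blast
  then have "card P = ix E (E \<inter> ?I)" using 1 2 by simp
  also have "\<dots> = ix M ?I"
  proof (rule antisym)
    have sub: "x - y \<in> E \<inter> ?I" if "x \<in> E" "y \<in> E" "x - y \<in> ?I" for x y
      using that subgp_diff[OF E(1)] by blast
    show "ix E (E \<inter> ?I) \<le> ix M ?I"
      by (rule ix_le_map(2)[OF EI I(2) fI, of "\<lambda>x. x"]) (use E(4) sub in auto)
    have rE: "(\<lambda>\<gamma>. crep M ?I (coset ?I \<gamma>)) ` M \<subseteq> E" using E(3) by (auto simp: R_def cosets_met_def)
    have fEI: "fin_ix E (E \<inter> ?I)" by (rule fin_ix_finite[OF E(2)])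
    have inj2: "x - y \<in> ?I" if xy: "x \<in> M" "y \<in> M"
      "crep M ?I (coset ?I x) - crep M ?I (coset ?I y) \<in> E \<inter> ?I" for x y
    proof -
      have "(x - crep M ?I (coset ?I x)) - (y - crep M ?I (coset ?I y)) +
        (crep M ?I (coset ?I x) - crep M ?I (coset ?I y)) \<in> ?I"
        by (rule subgp_add[OF I(2) subgp_diff[OF I(2) crep_diff(1)[OF I(2) xy(1)] crep_diff(1)[OF I(2) xy(2)]]])
          (use xy(3) in blast)
      then show ?thesis by simp
    qed
    show "ix M ?I \<le> ix E (E \<inter> ?I)" by (rule ix_le_map(2)[OF I(2) EI fEI rE inj2])
  qed
  finally show "card P = ix M ?I" .
qed

end


section \<open>Entropy through spans of characters\<close>

context dual_pair
begin

text \<open>The counterpart of a Lebesgue number. The classes around a point shrink to that point as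
  more characters are used, so by compactness finitely many characters suffice at each point, and
  then for all of X.\<close>

lemma cl_refines:
  assumes U: "\<U> \<in> open_covers T"
  shows "\<exists>E. subgp E \<and> finite E \<and> E \<subseteq> M \<and> (\<forall>x\<in>X. \<exists>V\<in>\<U>. cl E x \<subseteq> V)"
proof -
  have ex: "\<exists>S. finite S \<and> S \<subseteq> M \<and> (\<exists>V\<in>\<U>. cl S x \<subseteq> V)" if x: "x \<in> X" for x
  proof -
    obtain V where V: "V \<in> \<U>" "x \<in> V" "openin T V" using U x unfolding open_covers_def by blast
    define D where "D \<gamma> = {y\<in>X. pr \<gamma> y = pr \<gamma> x} - V" for \<gamma>
    have cl: "\<forall>C\<in>D ` M. closedin T C" using closedin_diff[OF pr_closed V(3)] by (auto simp: D_def)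
    have M0: "0 \<in> M" by (rule subgp_0[OF M_sub])
    have "\<Inter>(D ` M) = {}"
    proof (rule ccontr)
      assume "\<Inter>(D ` M) \<noteq> {}"
      then obtain y where y: "\<forall>\<gamma>\<in>M. y \<in> D \<gamma>" by blast
      then have yX: "y \<in> X" "y \<notin> V" using M0 by (auto simp: D_def)
      have "y = x" by (rule sep_eq[OF yX(1) x]) (use y in \<open>simp add: D_def\<close>)
      then show False using yX V by simp
    qed
    then obtain F where F: "finite F" "F \<subseteq> D ` M" "\<Inter>F = {}"
      using cpt[unfolded compact_space_fip, rule_format, of "D ` M"] cl by blast
    obtain S where S: "finite S" "S \<subseteq> M" "F = D ` S" using finite_subset_image[OF F(1,2)] by blast
    have "cl S x \<subseteq> V"
    proof
      fix y assume y: "y \<in> cl S x"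
      show "y \<in> V"
      proof (rule ccontr)
        assume "y \<notin> V"
        then have "y \<in> \<Inter>F" using y by (auto simp: S(3) D_def cl_def)
        then show False using F(3) by blast
      qed
    qed
    then show ?thesis using S V by blast
  qed
  define S where "S x = (SOME S. finite S \<and> S \<subseteq> M \<and> (\<exists>V\<in>\<U>. cl S x \<subseteq> V))" for x
  have S: "finite (S x) \<and> S x \<subseteq> M \<and> (\<exists>V\<in>\<U>. cl (S x) x \<subseteq> V)" if "x \<in> X" for x
    unfolding S_def by (rule someI_ex[OF ex[OF that]])
  let ?C = "(\<lambda>x. cl (S x) x) ` X"
  have "\<forall>C\<in>?C. openin T C" using open_cl S by blast
  moreover have "X \<subseteq> \<Union>?C" using cl_self by blast
  ultimately obtain F where F: "finite F" "F \<subseteq> ?C" "X \<subseteq> \<Union>F"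
    using cpt[unfolded compact_space_alt, rule_format, of ?C] by blast
  obtain Y where Y: "finite Y" "Y \<subseteq> X" "F = (\<lambda>x. cl (S x) x) ` Y" using finite_subset_image[OF F(1,2)] by blast
  have fS: "finite (\<Union>(S ` Y))" "\<Union>(S ` Y) \<subseteq> M" using S Y by auto
  obtain E where E: "subgp E" "finite E" "\<Union>(S ` Y) \<subseteq> E" "E \<subseteq> M"
    using finite_subgp_hull[OF M_sub subset_refl fS] by blast
  have "\<exists>V\<in>\<U>. cl E x \<subseteq> V" if x: "x \<in> X" for x
  proof -
    obtain y where y: "y \<in> Y" "x \<in> cl (S y) y" using F(3) x Y(3) by blast
    have "S y \<subseteq> E" using E(3) y(1) by blast
    then have "cl E x \<subseteq> cl (S y) y" using y(2) by (auto simp: cl_def subset_iff)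
    moreover have "\<exists>V\<in>\<U>. cl (S y) y \<subseteq> V" using S y Y(2) by blast
    ultimately show ?thesis by blast
  qed
  then show ?thesis using E by blast
qed

lemma code_sp:
  assumes E: "E \<subseteq> M" and x: "x \<in> X" "y \<in> X" and W: "finite W" "0 \<in> E"
  shows "code (sp W E) x = code (sp W E) y \<longleftrightarrow> (\<forall>n\<in>W. \<forall>\<gamma>\<in>E. pr \<gamma> (\<alpha> n x) = pr \<gamma> (\<alpha> n y))"
proof
  assume c: "code (sp W E) x = code (sp W E) y"
  show "\<forall>n\<in>W. \<forall>\<gamma>\<in>E. pr \<gamma> (\<alpha> n x) = pr \<gamma> (\<alpha> n y)"
  proof (intro ballI)
    fix n \<gamma> assume "n \<in> W" "\<gamma> \<in> E"
    then have "u n \<gamma> \<in> sp W E" "\<gamma> \<in> M" using u_in_sp[OF W] E by blast+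
    then show "pr \<gamma> (\<alpha> n x) = pr \<gamma> (\<alpha> n y)" using c x pr_u unfolding code_eq by metis
  qed
next
  assume c: "\<forall>n\<in>W. \<forall>\<gamma>\<in>E. pr \<gamma> (\<alpha> n x) = pr \<gamma> (\<alpha> n y)"
  have "sp W E \<subseteq> {\<gamma>\<in>M. pr \<gamma> x = pr \<gamma> y}"
  proof (rule sp_subset[OF subgp_agree[OF x]])
    fix n \<gamma> assume n: "n \<in> W" and g: "\<gamma> \<in> E"
    have gM: "\<gamma> \<in> M" using g E by blast
    have "pr (u n \<gamma>) x = pr (u n \<gamma>) y" unfolding pr_u[OF gM x(1)] pr_u[OF gM x(2)] using c n g by blast
    then show "u n \<gamma> \<in> {\<gamma>\<in>M. pr \<gamma> x = pr \<gamma> y}" using submod_u[OF submod_M gM] by blast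
  qed
  then show "code (sp W E) x = code (sp W E) y" unfolding code_eq by blast
qed

text \<open>One member of the join for each class of the span suffices. The index map \<nu> lets the
  same argument serve joins over squares and joins over the powers of a single \<alpha> n, which
  agree with the action only on X.\<close>

lemma subcover_upper:
  assumes E: "subgp E" "finite E" "E \<subseteq> M" and ref: "\<forall>x\<in>X. \<exists>V\<in>\<U>. cl E x \<subseteq> V"
    and I: "finite I" and a: "\<And>i x. i \<in> I \<Longrightarrow> x \<in> X \<Longrightarrow> a i x = \<alpha> (\<nu> i) x"
  shows "\<exists>\<W>\<subseteq>cover_join T a I \<U>. finite \<W> \<and> \<Union>\<W> = X \<and> card \<W> \<le> card (sp (\<nu> ` I) E)"
proof -
  let ?S = "sp (\<nu> ` I) E"
  have fI: "finite (\<nu> ` I)" using I by simp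
  have S: "subgp ?S" "finite ?S" "?S \<subseteq> M"
    using subgp_sp[OF E(1)] finite_sp[OF E(1,2) fI] sp_subset_M[OF E(3)] by blast+
  define V where "V x = (SOME V. V \<in> \<U> \<and> cl E x \<subseteq> V)" for x
  have V: "V x \<in> \<U> \<and> cl E x \<subseteq> V x" if "x \<in> X" for x
    unfolding V_def using someI_ex[of "\<lambda>V. V \<in> \<U> \<and> cl E x \<subseteq> V"] ref that by blast
  define xr where "xr \<kappa> = (SOME x. x \<in> X \<and> code ?S x = \<kappa>)" for \<kappa>
  have xr: "xr \<kappa> \<in> X \<and> code ?S (xr \<kappa>) = \<kappa>" if "\<kappa> \<in> code ?S ` X" for \<kappa>
    unfolding xr_def using someI_ex[of "\<lambda>x. x \<in> X \<and> code ?S x = \<kappa>"] that by blast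
  define Z where "Z x = X \<inter> (\<Inter>i\<in>I. {y. a i y \<in> V (\<alpha> (\<nu> i) x)})" for x
  let ?W = "(\<lambda>\<kappa>. Z (xr \<kappa>)) ` (code ?S ` X)"
  have fin: "finite (code ?S ` X)" by (rule finite_code[OF S(2,3)])
  have "?W \<subseteq> cover_join T a I \<U>"
  proof (rule image_subsetI)
    fix \<kappa> assume "\<kappa> \<in> code ?S ` X"
    then have "\<forall>i\<in>I. V (\<alpha> (\<nu> i) (xr \<kappa>)) \<in> \<U>" using xr V \<alpha>_in by blast
    then show "Z (xr \<kappa>) \<in> cover_join T a I \<U>" unfolding cover_join_def Z_def
      by (intro CollectI exI[of _ "\<lambda>i. V (\<alpha> (\<nu> i) (xr \<kappa>))"] conjI refl)
  qed
  moreover have "\<Union>?W = X"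
  proof
    show "\<Union>?W \<subseteq> X" unfolding Z_def by blast
    show "X \<subseteq> \<Union>?W"
    proof
      fix y assume y: "y \<in> X"
      let ?k = "code ?S y"
      have k: "?k \<in> code ?S ` X" using y by blast
      have "y \<in> Z (xr ?k)" unfolding Z_def
      proof (intro IntI y INT_I CollectI)
        fix i assume i: "i \<in> I"
        have "code ?S y = code ?S (xr ?k)" using xr[OF k] by simp
        then have "\<forall>n\<in>\<nu> ` I. \<forall>\<gamma>\<in>E. pr \<gamma> (\<alpha> n y) = pr \<gamma> (\<alpha> n (xr ?k))"
          using code_sp[OF E(3) y _ fI subgp_0[OF E(1)]] xr[OF k] by blast
        then have "\<alpha> (\<nu> i) y \<in> cl E (\<alpha> (\<nu> i) (xr ?k))" using i \<alpha>_in[OF y] by (simp add: cl_def)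
        then show "a i y \<in> V (\<alpha> (\<nu> i) (xr ?k))" unfolding a[OF i y] using V \<alpha>_in xr[OF k] by blast
      qed
      then show "y \<in> \<Union>?W" using k by blast
    qed
  qed
  moreover have "card ?W \<le> card ?S" using card_image_le[OF fin, of "\<lambda>\<kappa>. Z (xr \<kappa>)"] card_code[OF S] by simp
  moreover have "finite ?W" using fin by simp
  ultimately show ?thesis by blast
qed

text \<open>\<open>E\<close> is chosen from the cover alone, before the index set \<open>I\<close>;
  this is what makes the growth estimates for spans of a fixed group applicable.\<close>

lemma cover_num_upper:
  assumes U: "\<U> \<in> open_covers T"
  shows "\<exists>E. subgp E \<and> finite E \<and> E \<subseteq> M \<and> (\<forall>I (a :: 'i \<Rightarrow> 'x \<Rightarrow> 'x) \<nu>. finite I \<longrightarrow>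
    (\<forall>i\<in>I. \<forall>x\<in>X. a i x = \<alpha> (\<nu> i) x) \<longrightarrow> cover_num T (cover_join T a I \<U>) \<le> card (sp (\<nu> ` I) E))"
proof -
  obtain E where E: "subgp E" "finite E" "E \<subseteq> M" "\<forall>x\<in>X. \<exists>V\<in>\<U>. cl E x \<subseteq> V"
    using cl_refines[OF U] by blast
  have "cover_num T (cover_join T a I \<U>) \<le> card (sp (\<nu> ` I) E)"
    if I: "finite I" and a: "\<forall>i\<in>I. \<forall>x\<in>X. a i x = \<alpha> (\<nu> i) x" for I and a :: "'i \<Rightarrow> 'x \<Rightarrow> 'x" and \<nu>
  proof -
    obtain \<W> where W: "\<W> \<subseteq> cover_join T a I \<U>" "finite \<W>" "\<Union>\<W> = X" "card \<W> \<le> card (sp (\<nu> ` I) E)"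
      using subcover_upper[OF E I, of a \<nu>] a by blast
    have "cover_num T (cover_join T a I \<U>) \<le> card \<W>"
      unfolding cover_num_def by (rule Least_le) (use W in blast)
    then show ?thesis using W(4) by simp
  qed
  then show ?thesis using E by blast
qed

text \<open>The cover by classes of \<open>E\<close> is a partition, and points with different
  labels on the span lie in different members of its join, so a subcover needs at least one member
  per label.\<close>

lemma cover_num_lower:
  assumes E: "subgp E" "finite E" "E \<subseteq> M" and W: "finite W"
  shows "cl E ` X \<in> open_covers T" "card (sp W E) \<le> cover_num T (cover_join T \<alpha> W (cl E ` X))"
proof -
  show "cl E ` X \<in> open_covers T"
    unfolding open_covers_def using finite_cl[OF E(2,3)] open_cl[OF E(2,3)] cl_self by (auto simp: cl_def)
  let ?S = "sp W E"
  have S: "subgp ?S" "finite ?S" "?S \<subseteq> M"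
    using subgp_sp[OF E(1)] finite_sp[OF E(1,2) W] sp_subset_M[OF E(3)] by blast+
  let ?P = "\<lambda>n. \<exists>\<W>\<subseteq>cover_join T \<alpha> W (cl E ` X). finite \<W> \<and> \<Union>\<W> = X \<and> card \<W> = n"
  \<comment> \<open>\<open>cover_num\<close> is defined as a least number, so it is attained only
    because some finite subcover exists.\<close>
  have "\<exists>n. ?P n"
    using subcover_upper[OF E _ W, of "cl E ` X" \<alpha> "\<lambda>i. i"] by blast
  from LeastI_ex[OF this] obtain \<W> where \<W>: "\<W> \<subseteq> cover_join T \<alpha> W (cl E ` X)" "finite \<W>" "\<Union>\<W> = X"
    "card \<W> = cover_num T (cover_join T \<alpha> W (cl E ` X))" unfolding cover_num_def by blast
  define xr where "xr \<kappa> = (SOME x. x \<in> X \<and> code ?S x = \<kappa>)" for \<kappa>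
  have xr: "xr \<kappa> \<in> X \<and> code ?S (xr \<kappa>) = \<kappa>" if "\<kappa> \<in> code ?S ` X" for \<kappa>
    unfolding xr_def using someI_ex[of "\<lambda>x. x \<in> X \<and> code ?S x = \<kappa>"] that by blast
  define V where "V \<kappa> = (SOME V. V \<in> \<W> \<and> xr \<kappa> \<in> V)" for \<kappa>
  have V: "V \<kappa> \<in> \<W> \<and> xr \<kappa> \<in> V \<kappa>" if "\<kappa> \<in> code ?S ` X" for \<kappa>
    unfolding V_def using someI_ex[of "\<lambda>V. V \<in> \<W> \<and> xr \<kappa> \<in> V"] \<W>(3) xr[OF that] by blast
  have "inj_on V (code ?S ` X)"
  proof (rule inj_onI)
    fix \<kappa> \<kappa>' assume k: "\<kappa> \<in> code ?S ` X" "\<kappa>' \<in> code ?S ` X" "V \<kappa> = V \<kappa>'"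
    have "V \<kappa> \<in> cover_join T \<alpha> W (cl E ` X)" using V[OF k(1)] \<W>(1) by blast
    then obtain f where f: "\<forall>i\<in>W. f i \<in> cl E ` X" "V \<kappa> = X \<inter> (\<Inter>i\<in>W. {x. \<alpha> i x \<in> f i})"
      unfolding cover_join_def by blast
    have "\<forall>n\<in>W. \<forall>\<gamma>\<in>E. pr \<gamma> (\<alpha> n (xr \<kappa>)) = pr \<gamma> (\<alpha> n (xr \<kappa>'))"
    proof (intro ballI)
      fix n \<gamma> assume n: "n \<in> W" and g: "\<gamma> \<in> E"
      obtain z where "f n = cl E z" using f(1) n by blast
      moreover have "\<alpha> n (xr \<kappa>) \<in> f n" "\<alpha> n (xr \<kappa>') \<in> f n"
        using V[OF k(1)] V[OF k(2)] k(3) f(2) n by blast+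
      ultimately show "pr \<gamma> (\<alpha> n (xr \<kappa>)) = pr \<gamma> (\<alpha> n (xr \<kappa>'))" using g by (simp add: cl_def)
    qed
    then have "code ?S (xr \<kappa>) = code ?S (xr \<kappa>')"
      using code_sp[OF E(3) _ _ W subgp_0[OF E(1)]] xr[OF k(1)] xr[OF k(2)] by blast
    then show "\<kappa> = \<kappa>'" using xr[OF k(1)] xr[OF k(2)] by simp
  qed
  moreover have "V ` (code ?S ` X) \<subseteq> \<W>" using V by blast
  ultimately have "card (code ?S ` X) \<le> card \<W>" using card_inj_on_le \<W>(2) by blast
  then show "card ?S \<le> cover_num T (cover_join T \<alpha> W (cl E ` X))" using \<W>(4) card_code[OF S] by simp
qed

lemma entropy_ge:
  assumes F: "subgp F" "finite F" "F \<subseteq> M" and q: "q > 0" "\<And>W. finite W \<Longrightarrow> (q::nat) ^ card W \<le> card (sp W F)"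
  shows "ereal (ln (real q)) \<le> top_entropy_z2 T \<alpha>"
  unfolding top_entropy_z2_def
proof (rule SUP_upper2)
  show "cl F ` X \<in> open_covers T" by (rule cover_num_lower(1)[OF F finite.emptyI])
  show "ereal (ln (real q)) \<le> limsup (\<lambda>N::nat. ereal (ln (real (cover_num T
      (cover_join T \<alpha> ({0..<int N} \<times> {0..<int N}) (cl F ` X)))) / (real N)\<^sup>2))"
  proof (rule le_Limsup)
    show "\<forall>\<^sub>F N::nat in sequentially. ereal (ln (real q)) \<le> ereal (ln (real (cover_num T
      (cover_join T \<alpha> ({0..<int N} \<times> {0..<int N}) (cl F ` X)))) / (real N)\<^sup>2)"
    proof (rule eventually_sequentiallyI[of 1])
      fix N :: nat assume N: "1 \<le> N"
      let ?W = "{0..<int N} \<times> {0..<int N}"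
      have "q ^ (N * N) \<le> card (sp ?W F)" using q(2)[of ?W] by (simp add: card_cartesian_product)
      also have "\<dots> \<le> cover_num T (cover_join T \<alpha> ?W (cl F ` X))" by (rule cover_num_lower(2)[OF F]) simp
      finally have "real q ^ (N * N) \<le> real (cover_num T (cover_join T \<alpha> ?W (cl F ` X)))"
        by (simp only: of_nat_power[symmetric] of_nat_le_iff)
      moreover have "real q ^ (N * N) > 0" using q(1) by simp
      ultimately have "ln (real q ^ (N * N)) \<le> ln (real (cover_num T (cover_join T \<alpha> ?W (cl F ` X))))"
        by (subst ln_le_cancel_iff) linarith+
      then have "real N * real N * ln (real q) \<le> ln (real (cover_num T (cover_join T \<alpha> ?W (cl F ` X))))"
        using q(1) by (simp add: ln_realpow)
      then show "ereal (ln (real q)) \<le> ereal (ln (real (cover_num T (cover_join T \<alpha> ?W (cl F ` X)))) / (real N)\<^sup>2)"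
        using N by (simp add: pos_le_divide_eq power2_eq_square mult.commute)
    qed
  qed simp
qed

lemma ln_card_le: "n \<le> m \<Longrightarrow> ln (real n) \<le> ln (real m)" if "m > 0" for n m :: nat
  using that by (cases "n = 0") simp_all

lemma entropy_le:
  assumes mix: "\<forall>n x. n \<noteq> 0 \<longrightarrow> x \<in> M \<longrightarrow> u n x = x \<longrightarrow> x = 0"
    and abc: "a > 0" "b \<ge> 0" "c > 0"
  shows "top_entropy_z2 T \<alpha> \<le> ereal (ln (real (ix M (aug (a, 0) (b, c) M))) / real_of_int (a * c))"
  unfolding top_entropy_z2_def
proof (rule SUP_least)
  fix \<U> assume U: "\<U> \<in> open_covers T"
  let ?h = "ln (real (ix M (aug (a, 0) (b, c) M))) / real_of_int (a * c)"
  obtain E where E: "subgp E" "finite E" "E \<subseteq> M"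
    and up: "\<And>I. finite I \<Longrightarrow> cover_num T (cover_join T \<alpha> I \<U>) \<le> card (sp I E)"
  proof -
    obtain E where E: "subgp E \<and> finite E \<and> E \<subseteq> M \<and> (\<forall>I (a :: int \<times> int \<Rightarrow> 'x \<Rightarrow> 'x) \<nu>. finite I \<longrightarrow>
      (\<forall>i\<in>I. \<forall>x\<in>X. a i x = \<alpha> (\<nu> i) x) \<longrightarrow> cover_num T (cover_join T a I \<U>) \<le> card (sp (\<nu> ` I) E))"
      using cover_num_upper[OF U] by (rule exE)
    have "cover_num T (cover_join T \<alpha> I \<U>) \<le> card (sp ((\<lambda>i. i) ` I) E)" if "finite I" for I
      using E that by (metis (mono_tags, lifting))
    then show ?thesis using E that[of E] by simp
  qed
  have lim: "limsup (\<lambda>N::nat. ereal (ln (real (cover_num T (cover_join T \<alpha> ({0..<int N} \<times> {0..<int N}) \<U>))) / (real N)\<^sup>2))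
    \<le> ereal ?h + ereal e" if e: "e > 0" for e
  proof -
    obtain N0 where N0: "\<And>N. N \<ge> N0 \<Longrightarrow> ln (real (card (sp ({0..<int N} \<times> {0..<int N}) E))) \<le> (?h + e) * (real N)\<^sup>2"
      using square_growth[OF E abc mix e] by blast
    show ?thesis
    proof (rule Limsup_bounded, rule eventually_sequentiallyI[of "Suc N0"])
      fix N assume N: "Suc N0 \<le> N"
      let ?W = "{0..<int N} \<times> {0..<int N}"
      have "ln (real (cover_num T (cover_join T \<alpha> ?W \<U>))) \<le> ln (real (card (sp ?W E)))"
        by (rule ln_card_le[OF card_sp_pos[OF E(1,2)] up]) simp_all
      also have "\<dots> \<le> (?h + e) * (real N)\<^sup>2" by (rule N0) (use N in simp)
      finally have "ln (real (cover_num T (cover_join T \<alpha> ?W \<U>))) / (real N)\<^sup>2 \<le> ?h + e"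
        using N by (simp add: pos_divide_le_eq)
      then show "ereal (ln (real (cover_num T (cover_join T \<alpha> ?W \<U>))) / (real N)\<^sup>2) \<le> ereal ?h + ereal e"
        by simp
    qed
  qed
  show "limsup (\<lambda>N::nat. ereal (ln (real (cover_num T (cover_join T \<alpha> ({0..<int N} \<times> {0..<int N}) \<U>))) / (real N)\<^sup>2))
    \<le> ereal ?h" by (rule ereal_le_epsilon2) (rule lim)
qed

lemma rank_one:
  assumes g: "g \<in> mon" "\<forall>x\<in>M. g x = 0"
  shows "entropy_rank_one T \<alpha>"
  unfolding entropy_rank_one_def
proof
  fix n :: "int \<times> int"
  obtain m1 m2 where n: "n = (m1, m2)" by fastforce
  let ?\<nu> = "\<lambda>k::nat. (int k * m1, int k * m2)"
  have pow: "(\<alpha> n ^^ k) x = \<alpha> (?\<nu> k) x" if "x \<in> X" for k x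
  proof (induction k)
    case 0
    then show ?case using \<alpha>_0[OF that] by (simp add: zero_prod_def)
  next
    case (Suc k)
    have "?\<nu> (Suc k) = n + ?\<nu> k" by (simp add: n algebra_simps)
    then show ?case using Suc \<alpha>_plus[OF that, of n "?\<nu> k"] by simp
  qed
  obtain \<kappa> where \<kappa>: "\<forall>E. subgp E \<and> finite E \<and> E \<subseteq> M \<longrightarrow>
    (\<exists>c. \<forall>K::nat. ln (real (card (sp (?\<nu> ` {..<K}) E))) \<le> \<kappa> * real K + c)"
    using strip_growth[OF submod_M subset_refl g] by blast
  have "top_entropy_map T (\<alpha> n) \<le> ereal \<kappa>"
    unfolding top_entropy_map_def
  proof (rule SUP_least)
    fix \<U> assume U: "\<U> \<in> open_covers T"
    obtain E where E: "subgp E \<and> finite E \<and> E \<subseteq> M \<and> (\<forall>I (a :: nat \<Rightarrow> 'x \<Rightarrow> 'x) \<nu>. finite I \<longrightarrow>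
      (\<forall>i\<in>I. \<forall>x\<in>X. a i x = \<alpha> (\<nu> i) x) \<longrightarrow> cover_num T (cover_join T a I \<U>) \<le> card (sp (\<nu> ` I) E))"
      using cover_num_upper[OF U] by (rule exE)
    then have Ef: "subgp E" "finite E" by simp_all
    have up: "cover_num T (cover_join T (\<lambda>k. \<alpha> n ^^ k) {0..<N} \<U>) \<le> card (sp (?\<nu> ` {..<N}) E)" for N
    proof -
      have "cover_num T (cover_join T (\<lambda>k. \<alpha> n ^^ k) {0..<N} \<U>) \<le> card (sp (?\<nu> ` {0..<N}) E)"
        using E pow by (metis (mono_tags, lifting) finite_atLeastLessThan)
      then show ?thesis by (simp add: atLeast0LessThan)
    qed
    obtain c where c: "\<forall>K::nat. ln (real (card (sp (?\<nu> ` {..<K}) E))) \<le> \<kappa> * real K + c"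
      using \<kappa> E by metis
    have lim: "limsup (\<lambda>N::nat. ereal (ln (real (cover_num T (cover_join T (\<lambda>k. \<alpha> n ^^ k) {0..<N} \<U>))) / real N))
      \<le> ereal \<kappa> + ereal e" if e: "e > 0" for e
    proof -
      obtain N0 :: nat where N0: "real N0 \<ge> \<bar>c\<bar> / e" using real_arch_simple by blast
      show ?thesis
      proof (rule Limsup_bounded, rule eventually_sequentiallyI[of "Suc N0"])
        fix N assume N: "Suc N0 \<le> N"
        have "ln (real (cover_num T (cover_join T (\<lambda>k. \<alpha> n ^^ k) {0..<N} \<U>))) \<le> ln (real (card (sp (?\<nu> ` {..<N}) E)))"
          by (rule ln_card_le[OF card_sp_pos[OF Ef] up]) simp
        also have "\<dots> \<le> \<kappa> * real N + c" using c by blast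
        also have "\<dots> \<le> (\<kappa> + e) * real N"
        proof -
          have "\<bar>c\<bar> / e \<le> real N" using N0 N by linarith
          then have "\<bar>c\<bar> \<le> real N * e" using e by (simp add: pos_divide_le_eq)
          then show ?thesis by (simp add: algebra_simps)
        qed
        finally have "ln (real (cover_num T (cover_join T (\<lambda>k. \<alpha> n ^^ k) {0..<N} \<U>))) / real N \<le> \<kappa> + e"
          using N by (simp add: pos_divide_le_eq)
        then show "ereal (ln (real (cover_num T (cover_join T (\<lambda>k. \<alpha> n ^^ k) {0..<N} \<U>))) / real N) \<le> ereal \<kappa> + ereal e"
          by simp
      qed
    qed
    show "limsup (\<lambda>N::nat. ereal (ln (real (cover_num T (cover_join T (\<lambda>k. \<alpha> n ^^ k) {0..<N} \<U>))) / real N))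
      \<le> ereal \<kappa>" by (rule ereal_le_epsilon2) (rule lim)
  qed
  then show "top_entropy_map T (\<alpha> n) < \<infinity>" by (rule le_less_trans) simp
qed

end


section \<open>Open subgroups and separating characters\<close>

context cpt_group
begin

lemma add_zero: "x \<in> X \<Longrightarrow> add x zero = x"
  using add_comm zero_add zero_in by simp

lemma add_neg: "x \<in> X \<Longrightarrow> add x (neg x) = zero"
  using add_comm neg_add neg_in by simp

lemma add_left_comm: "x \<in> X \<Longrightarrow> y \<in> X \<Longrightarrow> z \<in> X \<Longrightarrow> add x (add y z) = add y (add x z)"
  by (metis add_assoc add_comm)

lemma neg_add_cancel: "x \<in> X \<Longrightarrow> z \<in> X \<Longrightarrow> add (neg x) (add x z) = z"
  using add_assoc[of "neg x" x z] neg_in neg_add zero_add by simp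

lemma add_neg_cancel: "x \<in> X \<Longrightarrow> z \<in> X \<Longrightarrow> add x (add (neg x) z) = z"
  using add_assoc[of x "neg x" z] neg_in add_neg zero_add by simp

lemma cont_add: "continuous_map (prod_topology T T) T (\<lambda>(x, y). add x y)"
  and cont_neg: "continuous_map T T neg" and hausdorff: "Hausdorff_space T"
  using grp unfolding cpt_ab_group_def by blast+

lemma cont_add_right: assumes "r \<in> X" shows "continuous_map T T (\<lambda>y. add y r)"
proof -
  have "continuous_map T (prod_topology T T) (\<lambda>y. (y, r))"
    by (intro continuous_map_pairedI continuous_map_id[unfolded id_def]) (simp add: assms)
  from continuous_map_compose[OF this cont_add] show ?thesis by (simp add: o_def)
qed

definition open_subgroup :: "'x set \<Rightarrow> bool" where
  "open_subgroup H \<longleftrightarrow> openin T H \<and> zero \<in> H \<and> (\<forall>x\<in>H. \<forall>y\<in>H. add x y \<in> H) \<and> (\<forall>x\<in>H. neg x \<in> H)"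

text \<open>\<open>H\<close> consists of the translations that preserve \<open>V\<close>. The pairs
  (h, v) violating this form a closed set in the product, and projection along the compact factor is
  a closed map, so the complement of the projection is open.\<close>

lemma open_subgroup_in_clopen:
  assumes V: "closedin T V" "openin T V" "zero \<in> V"
  shows "\<exists>H. open_subgroup H \<and> H \<subseteq> V \<and> (\<forall>h\<in>H. \<forall>v\<in>X. add h v \<in> V \<longleftrightarrow> v \<in> V)"
proof -
  let ?P = "prod_topology T T"
  define A where "A = {p\<in>topspace ?P. (\<lambda>(x, y). add x y) p \<in> V}"
  define B where "B = {p\<in>topspace ?P. snd p \<in> V}"
  have A: "openin ?P A" "closedin ?P A" unfolding A_def
    by (rule openin_continuous_map_preimage[OF cont_add V(2)], rule closedin_continuous_map_preimage[OF cont_add V(1)])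
  have B: "openin ?P B" "closedin ?P B" unfolding B_def
    by (rule openin_continuous_map_preimage[OF continuous_map_snd V(2)],
        rule closedin_continuous_map_preimage[OF continuous_map_snd V(1)])
  have W: "closedin ?P ((A - B) \<union> (B - A))" by (intro closedin_Un closedin_diff A B)
  have "closed_map ?P T fst" by (rule closed_map_fst[OF cpt])
  then have clW: "closedin T (fst ` ((A - B) \<union> (B - A)))" using W unfolding closed_map_def by blast
  define H where "H = X - fst ` ((A - B) \<union> (B - A))"
  have Hop: "openin T H" unfolding H_def by (rule openin_diff[OF openin_topspace clW])
  have H: "h \<in> H \<longleftrightarrow> h \<in> X \<and> (\<forall>v\<in>X. add h v \<in> V \<longleftrightarrow> v \<in> V)" for h
  proof -
    have "h \<in> fst ` ((A - B) \<union> (B - A)) \<longleftrightarrow> (\<exists>v. (h, v) \<in> (A - B) \<union> (B - A))" by force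
    also have "\<dots> \<longleftrightarrow> h \<in> X \<and> (\<exists>v\<in>X. \<not> (add h v \<in> V \<longleftrightarrow> v \<in> V))" by (auto simp: A_def B_def)
    finally show ?thesis by (auto simp: H_def)
  qed
  have "open_subgroup H" unfolding open_subgroup_def
  proof (intro conjI ballI Hop)
    show "zero \<in> H" using H zero_in zero_add by simp
    fix x y assume x: "x \<in> H" and y: "y \<in> H"
    then show "add x y \<in> H" using H add_in add_assoc by simp
  next
    fix x assume x: "x \<in> H"
    have xX: "x \<in> X" using x H by blast
    have "add (neg x) v \<in> V \<longleftrightarrow> v \<in> V" if v: "v \<in> X" for v
      using x H add_in[OF neg_in[OF xX] v] add_neg_cancel[OF xX v] by metis
    then show "neg x \<in> H" using H neg_in[OF xX] by blast
  qed
  moreover have "H \<subseteq> V"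
  proof
    fix h assume h: "h \<in> H"
    then have "add h zero \<in> V" using H zero_in V(3) by blast
    then show "h \<in> V" using add_zero h H by simp
  qed
  ultimately show ?thesis using H by blast
qed

text \<open>Zero dimension provides a clopen neighbourhood of \<open>zero\<close> that misses
  \<open>x\<close>, and the open subgroup lies inside it.\<close>

lemma separating_open_subgroup:
  assumes dim: "T dim_le 0" and x: "x \<in> X" "x \<noteq> zero"
  shows "\<exists>H. open_subgroup H \<and> x \<notin> H"
proof -
  have "neighbourhood_base_of (\<lambda>U. closedin T U \<and> openin T U) T" using dim dimension_le_0_neighbourhood_base_of_clopen by blast
  moreover have "openin T (X - {x})" using hausdorff x(1) by (intro openin_diff closedin_Hausdorff_singleton) simp_all
  ultimately obtain U V where "openin T U" "closedin T V" "openin T V" "zero \<in> U" "U \<subseteq> V" "V \<subseteq> X - {x}"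
    using x zero_in unfolding neighbourhood_base_of by (metis (no_types, lifting) Diff_iff singletonD)
  then show ?thesis using open_subgroup_in_clopen[of V] by blast
qed

lemma open_subgroup_sub: "open_subgroup H \<Longrightarrow> H \<subseteq> X"
  unfolding open_subgroup_def by (meson openin_subset)

lemma finite_index:
  assumes H: "open_subgroup H"
  shows "\<exists>Y. finite Y \<and> Y \<subseteq> X \<and> (\<forall>y\<in>X. \<exists>r\<in>Y. add y (neg r) \<in> H)"
proof -
  define C where "C r = {y\<in>X. add y (neg r) \<in> H}" for r
  have "openin T H" using H by (simp add: open_subgroup_def)
  then have "openin T (C r)" if "r \<in> X" for r
    unfolding C_def by (rule openin_continuous_map_preimage[OF cont_add_right[OF neg_in[OF that]]])
  moreover have "r \<in> C r" if "r \<in> X" for r using that H add_neg by (simp add: C_def open_subgroup_def)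
  ultimately obtain F where F: "finite F" "F \<subseteq> C ` X" "X \<subseteq> \<Union>F"
    using cpt[unfolded compact_space_alt, rule_format, of "C ` X"] by blast
  obtain Y where Y: "finite Y" "Y \<subseteq> X" "F = C ` Y" using finite_subset_image[OF F(1,2)] by blast
  have "\<exists>r\<in>Y. add y (neg r) \<in> H" if "y \<in> X" for y using F(3) Y(3) that by (auto simp: C_def)
  then show ?thesis using Y by blast
qed

definition mult :: "nat \<Rightarrow> 'x \<Rightarrow> 'x" where "mult n y = (add y ^^ n) zero"

lemma mult_0: "mult 0 y = zero" and mult_Suc: "mult (Suc n) y = add y (mult n y)"
  by (simp_all add: mult_def)

lemma mult_in: "y \<in> X \<Longrightarrow> mult n y \<in> X"
  by (induction n) (simp_all add: mult_0 mult_Suc zero_in add_in)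

lemma mult_plus: "y \<in> X \<Longrightarrow> mult (i + j) y = add (mult i y) (mult j y)"
  by (induction i) (simp_all add: mult_0 mult_Suc zero_add add_assoc mult_in)

text \<open>Pigeonhole on the finitely many cosets of \<open>H\<close> met by the multiples of
  \<open>y\<close>.\<close>

lemma finite_order:
  assumes H: "open_subgroup H" and y: "y \<in> X" shows "\<exists>n>0. mult n y \<in> H"
proof -
  obtain Y where Y: "finite Y" "Y \<subseteq> X" "\<forall>y\<in>X. \<exists>r\<in>Y. add y (neg r) \<in> H" using finite_index[OF H] by blast
  define r where "r k = (SOME r. r \<in> Y \<and> add (mult k y) (neg r) \<in> H)" for k
  have r: "r k \<in> Y \<and> add (mult k y) (neg (r k)) \<in> H" for k
  proof -
    have "\<exists>r. r \<in> Y \<and> add (mult k y) (neg r) \<in> H" using Y(3) mult_in[OF y, of k] by blast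
    then show ?thesis unfolding r_def by (rule someI_ex)
  qed
  have "\<not> inj_on r (UNIV :: nat set)"
    using r Y(1) by (metis finite_imageD finite_subset image_subsetI infinite_UNIV_nat)
  then obtain i j where "i \<noteq> j" "r i = r j" unfolding inj_on_def by blast
  then obtain i j where ij: "i < j" "r i = r j" by (metis linorder_neqE_nat)
  let ?a = "mult i y" let ?d = "mult (j - i) y" let ?r = "neg (r i)"
  have X: "?a \<in> X" "?d \<in> X" "?r \<in> X" using mult_in[OF y] r Y(2) neg_in by blast+
  have 1: "add ?a ?r \<in> H" "add (mult j y) ?r \<in> H" using r ij(2) by metis+
  have "mult j y = add ?d ?a" using mult_plus[OF y, of "j - i" i] ij(1) by simp
  then have 2: "add ?d (add ?a ?r) \<in> H" using 1(2) add_assoc X by simp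
  have 3: "neg (add ?a ?r) \<in> H" using 1(1) H by (simp add: open_subgroup_def)
  have arX: "add ?a ?r \<in> X" using X add_in by blast
  have "add (add ?d (add ?a ?r)) (neg (add ?a ?r)) \<in> H" using 2 3 H by (simp add: open_subgroup_def)
  then have "?d \<in> H" using add_assoc[OF X(2) arX neg_in[OF arX]] add_neg[OF arX] add_zero[OF X(2)] by simp
  then show ?thesis using ij(1) by (intro exI[of _ "j - i"]) simp
qed

text \<open>\<open>f\<close> is an eigenfunction of translation by \<open>y\<close> with eigenvalue
  \<open>c\<close>. A nonzero joint eigenfunction of all translations is a multiplicative function
  up to scaling, which is how characters are produced.\<close>

definition eig :: "('x \<Rightarrow> complex) \<Rightarrow> 'x \<Rightarrow> complex \<Rightarrow> bool" where
  "eig f y c \<longleftrightarrow> (\<forall>z\<in>X. f (add y z) = c * f z)"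

text \<open>Translation by \<open>y\<close> acts on \<open>f\<close> with order dividing
  \<open>n\<close>, so \<open>f\<close> is the average of its components \<open>g j\<close> for the
  n-th roots of unity. The components inherit all eigenrelations of \<open>f\<close> because
  translations commute. If \<open>f\<close> is not invariant under \<open>y\<close>, some component
  with j \<noteq> 0 is nonzero, and its eigenvalue differs from 1.\<close>

lemma eigen_projection:
  assumes H: "open_subgroup H" and f: "\<forall>h\<in>H. eig f h 1" and nz: "\<exists>z\<in>X. f z \<noteq> 0" and y: "y \<in> X"
  shows "\<exists>g c. (\<exists>z\<in>X. g z \<noteq> 0) \<and> eig g y c \<and> (\<forall>w\<in>X. \<forall>d. eig f w d \<longrightarrow> eig g w d) \<and>
    (\<not> eig f y 1 \<longrightarrow> c \<noteq> 1)"
proof -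
  obtain n where n: "n > 0" "mult n y \<in> H" using finite_order[OF H y] by blast
  define \<omega> where "\<omega> = exp (2 * of_real pi * \<i> / of_nat n)"
  have \<omega>p: "\<omega> ^ k = exp (2 * of_real pi * \<i> * of_nat k / of_nat n)" for k
    unfolding \<omega>_def exp_of_nat_mult[symmetric] by (simp add: algebra_simps)
  have \<omega>1: "\<omega> ^ k = 1 \<longleftrightarrow> n dvd k" for k unfolding \<omega>p using complex_root_unity_eq_1[of n k] n(1) by simp
  have \<omega>nz: "\<omega> \<noteq> 0" by (simp add: \<omega>_def)
  define g where "g j z = (\<Sum>k<n. (\<omega> ^ j) ^ k * f (add (mult k y) z))" for j z
  have gy: "eig (g j) y (inverse (\<omega> ^ j))" for j
    unfolding eig_def
  proof
    fix z assume z: "z \<in> X"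
    define t where "t k = (\<omega> ^ j) ^ k * f (add (mult k y) z)" for k
    have tn: "t n = t 0"
    proof -
      have "(\<omega> ^ j) ^ n = 1" unfolding power_mult[symmetric] using \<omega>1 by simp
      moreover have "f (add (mult n y) z) = f z" using f n(2) z unfolding eig_def by simp
      ultimately show ?thesis using zero_add[OF z] by (simp add: t_def mult_0)
    qed
    have "\<omega> ^ j * g j (add y z) = (\<Sum>k<n. t (Suc k))"
    proof -
      have "add (mult k y) (add y z) = add (mult (Suc k) y) z" for k
        using add_assoc add_left_comm mult_in[OF y] y z by (simp add: mult_Suc)
      then show ?thesis by (simp add: g_def t_def sum_distrib_left mult.assoc)
    qed
    also have "\<dots> = (\<Sum>k<n. t k)"
      using sum.lessThan_Suc_shift[of t n] sum.lessThan_Suc[of t n] tn by simp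
    also have "\<dots> = g j z" by (simp add: g_def t_def)
    finally show "g j (add y z) = inverse (\<omega> ^ j) * g j z" using \<omega>nz by (simp add: field_simps)
  qed
  have gw: "eig (g j) w d" if w: "w \<in> X" "eig f w d" for j w d
    unfolding eig_def
  proof
    fix z assume z: "z \<in> X"
    have "f (add (mult k y) (add w z)) = d * f (add (mult k y) z)" for k
      using w(2) add_left_comm[OF mult_in[OF y] w(1) z] add_in[OF mult_in[OF y] z] by (simp add: eig_def)
    then show "g j (add w z) = d * g j z" by (simp add: g_def sum_distrib_left mult.left_commute)
  qed
  have total: "(\<Sum>j<n. g j z) = of_nat n * f z" if z: "z \<in> X" for z
  proof -
    have geo: "(\<Sum>j<n. (\<omega> ^ j) ^ k) = (if k = 0 then of_nat n else 0)" if k: "k < n" for k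
    proof (cases "k = 0")
      case False
      have "\<omega> ^ k \<noteq> 1" using \<omega>1 k False nat_dvd_not_less by blast
      then have "(\<Sum>j<n. (\<omega> ^ k) ^ j) = ((\<omega> ^ k) ^ n - 1) / (\<omega> ^ k - 1)" by (rule geometric_sum)
      moreover have "(\<omega> ^ k) ^ n = 1" unfolding power_mult[symmetric] using \<omega>1 by simp
      ultimately show ?thesis using False by (simp add: power_mult[symmetric] mult.commute)
    qed simp
    have "(\<Sum>j<n. g j z) = (\<Sum>k<n. (\<Sum>j<n. (\<omega> ^ j) ^ k) * f (add (mult k y) z))"
      unfolding g_def sum_distrib_right by (rule sum.swap)
    also have "\<dots> = (\<Sum>k<n. if k = 0 then of_nat n * f z else 0)"
      by (rule sum.cong) (simp_all add: geo mult_0 zero_add[OF z])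
    also have "\<dots> = of_nat n * f z" using n(1) by simp
    finally show ?thesis .
  qed
  show ?thesis
  proof (cases "eig f y 1")
    case True
    then show ?thesis using nz by (intro exI[of _ f] exI[of _ "1::complex"]) simp
  next
    case False
    have "\<exists>j<n. j \<noteq> 0 \<and> (\<exists>z\<in>X. g j z \<noteq> 0)"
    proof (rule ccontr)
      assume "\<not> ?thesis"
      then have z0: "g j z = 0" if "j < n" "j \<noteq> 0" "z \<in> X" for j z using that by blast
      have "of_nat n * f z = g 0 z" if "z \<in> X" for z
      proof -
        have "(\<Sum>j<n. g j z) = (\<Sum>j<n. if j = 0 then g 0 z else 0)"
          by (rule sum.cong) (use z0[OF _ _ that] in auto)
        then show ?thesis using total[OF that] n(1) by simp
      qed
      moreover have "g 0 (add y z) = g 0 z" if "z \<in> X" for z using gy[of 0] that by (simp add: eig_def)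
      ultimately have "of_nat n * f (add y z) = of_nat n * f z" if "z \<in> X" for z
        using that add_in[OF y that] by simp
      then have "eig f y 1" using n(1) by (simp add: eig_def)
      then show False using False by blast
    qed
    then obtain j where j: "j < n" "j \<noteq> 0" "\<exists>z\<in>X. g j z \<noteq> 0" by blast
    have "\<not> n dvd j" using j(1,2) nat_dvd_not_less by blast
    then have "inverse (\<omega> ^ j) \<noteq> 1" using \<omega>1[of j] by (simp add: inverse_eq_1_iff)
    then show ?thesis using j(3) gy gw by (intro exI[of _ "g j"] exI[of _ "inverse (\<omega> ^ j)"]) blast
  qed
qed

text \<open>Start from the indicator function of \<open>H\<close>. Projecting at \<open>x\<close>
  first fixes an eigenvalue other than 1 there; projecting in turn at representatives of the
  finitely many cosets of \<open>H\<close> keeps it and ends in a joint eigenfunction, whose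
  eigenvalues form the character.\<close>

lemma separating_character:
  assumes H: "open_subgroup H" and x: "x \<in> X" "x \<notin> H"
  shows "\<exists>\<rho>::'x \<Rightarrow> complex. (\<forall>y\<in>X. \<forall>z\<in>X. \<rho> (add y z) = \<rho> y * \<rho> z) \<and> (\<forall>y\<in>X. cmod (\<rho> y) = 1) \<and>
    (\<forall>h\<in>H. \<rho> h = 1) \<and> \<rho> x \<noteq> 1"
proof -
  have Hs: "zero \<in> H" "\<And>a b. a \<in> H \<Longrightarrow> b \<in> H \<Longrightarrow> add a b \<in> H" "\<And>a. a \<in> H \<Longrightarrow> neg a \<in> H" "H \<subseteq> X"
    using H open_subgroup_sub unfolding open_subgroup_def by blast+
  define f0 where "f0 z = (if z \<in> H then 1 else 0 :: complex)" for z
  have "\<forall>h\<in>H. eig f0 h 1"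
  proof
    fix h assume h: "h \<in> H"
    have "add h z \<in> H \<longleftrightarrow> z \<in> H" if z: "z \<in> X" for z
      using Hs(2)[OF Hs(3)[OF h], of "add h z"] neg_add_cancel[OF _ z, of h] Hs(2)[OF h, of z] h Hs(4) by auto
    then show "eig f0 h 1" by (simp add: eig_def f0_def)
  qed
  moreover have "\<exists>z\<in>X. f0 z \<noteq> 0" using Hs(1) zero_in by (auto simp: f0_def)
  moreover have "\<not> eig f0 x 1"
  proof
    assume "eig f0 x 1"
    then have "f0 (add x zero) = f0 zero" using zero_in by (simp add: eig_def)
    then show False using add_zero[OF x(1)] x(2) Hs(1) by (simp add: f0_def)
  qed
  ultimately obtain f1 c1 where f1: "\<exists>z\<in>X. f1 z \<noteq> 0" "eig f1 x c1" "\<forall>w\<in>X. \<forall>d. eig f0 w d \<longrightarrow> eig f1 w d" "c1 \<noteq> 1"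
    using eigen_projection[OF H _ _ x(1), of f0] by blast
  have f1H: "\<forall>h\<in>H. eig f1 h 1" using f1(3) \<open>\<forall>h\<in>H. eig f0 h 1\<close> Hs(4) by blast
  obtain Y where Y: "finite Y" "Y \<subseteq> X" "\<forall>y\<in>X. \<exists>r\<in>Y. add y (neg r) \<in> H" using finite_index[OF H] by blast
  have "\<exists>f. (\<exists>z\<in>X. f z \<noteq> 0) \<and> eig f x c1 \<and> (\<forall>h\<in>H. eig f h 1) \<and> (\<forall>y\<in>Y. \<exists>c. eig f y c)"
    using Y(1,2)
  proof (induction Y rule: finite_induct)
    case empty
    then show ?case using f1 f1H by (intro exI[of _ f1]) simp
  next
    case (insert y Y)
    then obtain f where f: "\<exists>z\<in>X. f z \<noteq> 0" "eig f x c1" "\<forall>h\<in>H. eig f h 1" "\<forall>y\<in>Y. \<exists>c. eig f y c" by blast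
    have yX: "y \<in> X" using insert.prems by blast
    obtain g c where g: "\<exists>z\<in>X. g z \<noteq> 0" "eig g y c" "\<forall>w\<in>X. \<forall>d. eig f w d \<longrightarrow> eig g w d"
      using eigen_projection[OF H f(3,1) yX] by blast
    have "eig g x c1" using g(3) f(2) x(1) by blast
    moreover have "\<forall>h\<in>H. eig g h 1" using g(3) f(3) Hs(4) by blast
    moreover have "\<forall>w\<in>insert y Y. \<exists>c. eig g w c" using g(2,3) f(4) insert.prems by blast
    ultimately show ?case using g(1) by blast
  qed
  then obtain f where f: "\<exists>z\<in>X. f z \<noteq> 0" "eig f x c1" "\<forall>h\<in>H. eig f h 1" "\<forall>y\<in>Y. \<exists>c. eig f y c" by blast
  obtain z0 where z0: "z0 \<in> X" "f z0 \<noteq> 0" using f(1) by blast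
  define \<rho> where "\<rho> y = f (add y z0) / f z0" for y
  have ex: "\<exists>c. eig f y c" if y: "y \<in> X" for y
  proof -
    obtain r where r: "r \<in> Y" "add y (neg r) \<in> H" using Y(3) y by blast
    obtain c where c: "eig f r c" using f(4) r(1) by blast
    have rX: "r \<in> X" using r Y(2) by blast
    have "f (add y z) = c * f z" if z: "z \<in> X" for z
    proof -
      have "add y z = add (add y (neg r)) (add r z)"
        using add_assoc[OF y neg_in[OF rX] add_in[OF rX z]] neg_add_cancel[OF rX z] by simp
      moreover have "f (add (add y (neg r)) (add r z)) = f (add r z)"
        using f(3) r(2) add_in[OF rX z] by (simp add: eig_def)
      ultimately show ?thesis using c z by (simp add: eig_def)
    qed
    then show ?thesis unfolding eig_def by blast
  qed
  have \<rho>: "eig f y (\<rho> y)" if y: "y \<in> X" for y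
  proof -
    obtain c where c: "eig f y c" using ex[OF y] by blast
    then have "\<rho> y = c" using z0 by (simp add: \<rho>_def eig_def)
    then show ?thesis using c by simp
  qed
  have hom: "\<rho> (add y z) = \<rho> y * \<rho> z" if y: "y \<in> X" and z: "z \<in> X" for y z
  proof -
    have "f (add (add y z) z0) = \<rho> y * (\<rho> z * f z0)"
      using \<rho>[OF y] \<rho>[OF z] add_assoc[OF y z z0(1)] add_in[OF z z0(1)] z0(1) by (simp add: eig_def)
    then show ?thesis using z0(2) by (simp add: \<rho>_def[of "add y z"])
  qed
  have uniq: "d = \<rho> y" if "eig f y d" for y d using that z0 by (simp add: \<rho>_def eig_def)
  have one: "\<rho> h = 1" if "h \<in> H" for h using uniq[of h 1] f(3) that by auto
  have pow: "\<rho> (mult k y) = \<rho> y ^ k" if y: "y \<in> X" for y k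
    by (induction k) (simp_all add: mult_0 mult_Suc one[OF Hs(1)] hom[OF y mult_in[OF y]])
  \<comment> \<open>Some multiple of \<open>y\<close> lies in \<open>H\<close>, so the value is a
    root of unity.\<close>
  have "cmod (\<rho> y) = 1" if y: "y \<in> X" for y
  proof -
    obtain n where n: "n > 0" "mult n y \<in> H" using finite_order[OF H y] by blast
    have "\<rho> y ^ n = 1" using pow[OF y, of n] one[OF n(2)] by simp
    then have "cmod (\<rho> y) ^ n = 1" by (metis norm_one norm_power)
    then show ?thesis using n(1) power_eq_1_iff[of "cmod (\<rho> y)" n] by simp
  qed
  moreover have "\<rho> x \<noteq> 1" using uniq[OF f(2)] f1(4) by simp
  ultimately show ?thesis using hom one by blast
qed

end


subsection \<open>The character module of a zero-dimensional group\<close>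

text \<open>The circle as an additive group type: functions into it then form an abelian group under
  pointwise operations, as the module part requires.\<close>

typedef circ = "{z::complex. cmod z = 1}" morphisms cval Circ
  by (rule exI[of _ 1]) simp

lemma norm_cval: "cmod (cval c) = 1" using cval by blast

instantiation circ :: ab_group_add
begin
definition "0 = Circ 1"
definition "a + b = Circ (cval a * cval b)"
definition "- a = Circ (inverse (cval a))"
definition "a - b = Circ (cval a / cval b)"

lemma cval_simps:
  "cval 0 = 1" "cval (a + b) = cval a * cval b" "cval (- a) = inverse (cval a)" "cval (a - b) = cval a / cval b"
  by (simp_all add: zero_circ_def plus_circ_def uminus_circ_def minus_circ_def Circ_inverse
      norm_mult norm_divide norm_inverse norm_cval)

instance
proof
  have nz: "cval a \<noteq> 0" for a using norm_cval[of a] by force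
  fix a b c :: circ
  show "a + b + c = a + (b + c)" by (simp add: cval_inject[symmetric] cval_simps)
  show "a + b = b + a" by (simp add: cval_inject[symmetric] cval_simps)
  show "0 + a = a" by (simp add: cval_inject[symmetric] cval_simps)
  show "- a + a = 0" using nz[of a] by (simp add: cval_inject[symmetric] cval_simps)
  show "a - b = a + - b" by (simp add: cval_inject[symmetric] cval_simps field_simps)
qed
end

lemma cval_eq_1: "cval c = 1 \<longleftrightarrow> c = 0"
  by (simp add: cval_inject[symmetric] cval_simps)

text \<open>Translation by \<open>v\<close> permutes \<open>V\<close>, so adding \<open>v\<close> to
  each element does not change the sum over \<open>V\<close>.\<close>

lemma finite_subgroup_exponent:
  fixes V :: "'g::ab_group_add set"
  assumes "finite V" "\<And>v w. v \<in> V \<Longrightarrow> w \<in> V \<Longrightarrow> w + v \<in> V" "v \<in> V"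
  shows "nm (card V) v = 0"
proof -
  have c: "finite W \<Longrightarrow> (\<Sum>w\<in>W. v) = nm (card W) v" for W :: "'g set"
    by (induction W rule: finite_induct) (simp_all add: add.commute)
  have inj: "inj_on (\<lambda>w. w + v) V" by (rule inj_onI) simp
  have "(\<lambda>w. w + v) ` V = V" by (rule endo_inj_surj[OF assms(1) _ inj]) (use assms(2,3) in blast)
  then have "(\<Sum>w\<in>V. w) = (\<Sum>w\<in>V. w + v)" using sum.reindex[OF inj, of "\<lambda>w. w"] by simp
  also have "\<dots> = (\<Sum>w\<in>V. w) + nm (card V) v" by (simp add: sum.distrib c[OF assms(1)])
  finally show ?thesis by simp
qed

lemma nm_fun: "nm n f x = nm n (f x)" for f :: "'x \<Rightarrow> 'g::ab_group_add"
  by (induction n) (simp_all add: plus_fun_def)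

locale z2_zero_dim = cpt_group T add neg zero
  for T :: "'x topology" and add :: "'x \<Rightarrow> 'x \<Rightarrow> 'x" and neg :: "'x \<Rightarrow> 'x" and zero :: 'x +
  fixes \<alpha> :: "int \<times> int \<Rightarrow> 'x \<Rightarrow> 'x"
  assumes action: "z2_aut_action T add \<alpha>" and dim: "T dim_le 0"
    and noetherian: "noetherian_action T add \<alpha>"
begin

lemma \<alpha>_cont: "continuous_map T T (\<alpha> n)"
  and \<alpha>_hom: "x \<in> X \<Longrightarrow> y \<in> X \<Longrightarrow> \<alpha> n (add x y) = add (\<alpha> n x) (\<alpha> n y)"
  and \<alpha>_id: "x \<in> X \<Longrightarrow> \<alpha> 0 x = x"
  and \<alpha>_comp: "x \<in> X \<Longrightarrow> \<alpha> (m + n) x = \<alpha> m (\<alpha> n x)"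
  using action unfolding z2_aut_action_def by blast+

lemma \<alpha>_closed: "x \<in> X \<Longrightarrow> \<alpha> n x \<in> X"
  using continuous_map_image_subset_topspace[OF \<alpha>_cont] by blast

text \<open>Off X the function is left alone, so that exponent 0 acts as the identity on all
  functions and the laws of \<open>z2_module\<close> hold on the whole type.\<close>

definition uact :: "int \<times> int \<Rightarrow> ('x \<Rightarrow> circ) \<Rightarrow> 'x \<Rightarrow> circ" where
  "uact n \<gamma> x = (if x \<in> X then \<gamma> (\<alpha> n x) else \<gamma> x)"

text \<open>Locally constant characters, made unique by the value 0 off X. They separate the points
  of X by \<open>chars_separate\<close>, and the hypothesis \<open>noetherian_action\<close> reaches
  them through \<open>emb\<close>.\<close>

definition chars :: "('x \<Rightarrow> circ) set" where
  "chars = {\<gamma>. (\<forall>x\<in>X. \<forall>y\<in>X. \<gamma> (add x y) = \<gamma> x + \<gamma> y) \<and> (\<forall>x. x \<notin> X \<longrightarrow> \<gamma> x = 0) \<and>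
     (\<forall>c. openin T {x\<in>X. \<gamma> x = c})}"

definition emb :: "('x \<Rightarrow> circ) \<Rightarrow> 'x \<Rightarrow> complex" where
  "emb \<gamma> = restrict (\<lambda>x. cval (\<gamma> x)) X"

sublocale dual: z2_module uact
proof
  fix n m :: "int \<times> int" and \<gamma> \<psi> :: "'x \<Rightarrow> circ"
  show "uact n (\<gamma> - \<psi>) = uact n \<gamma> - uact n \<psi>" by (rule ext) (simp add: uact_def)
  show "uact 0 \<gamma> = \<gamma>" by (rule ext) (simp add: uact_def \<alpha>_id)
  show "uact (m + n) \<gamma> = uact m (uact n \<gamma>)"
  proof (rule ext)
    fix x show "uact (m + n) \<gamma> x = uact m (uact n \<gamma>) x"
      using \<alpha>_comp[of x n m] \<alpha>_closed[of x m] by (simp add: uact_def add.commute)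
  qed
qed

lemma charsD:
  assumes "\<gamma> \<in> chars"
  shows "x \<in> X \<Longrightarrow> y \<in> X \<Longrightarrow> \<gamma> (add x y) = \<gamma> x + \<gamma> y" "x \<notin> X \<Longrightarrow> \<gamma> x = 0" "openin T {x\<in>X. \<gamma> x = c}"
  using assms unfolding chars_def by blast+

lemma submod_chars: "dual.submod chars"
proof (rule dual.submodI[OF subgpI])
  have "openin T {x\<in>X. (0 :: 'x \<Rightarrow> circ) x = c}" for c by (cases "c = 0") auto
  then show "0 \<in> chars" by (simp add: chars_def)
next
  fix \<gamma> \<psi> assume g: "\<gamma> \<in> chars" "\<psi> \<in> chars"
  have "openin T {x\<in>X. (\<gamma> - \<psi>) x = c}" for c
  proof -
    have "{x\<in>X. (\<gamma> - \<psi>) x = c} = (\<Union>d. {x\<in>X. \<gamma> x = c + d} \<inter> {x\<in>X. \<psi> x = d})"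
      by (auto simp: algebra_simps)
    moreover have "openin T (\<Union>d. {x\<in>X. \<gamma> x = c + d} \<inter> {x\<in>X. \<psi> x = d})"
      by (intro openin_Union ballI) (auto intro!: openin_Int charsD(3)[OF g(1)] charsD(3)[OF g(2)])
    ultimately show ?thesis by simp
  qed
  then show "\<gamma> - \<psi> \<in> chars"
    using charsD(1,2)[OF g(1)] charsD(1,2)[OF g(2)] by (simp add: chars_def)
next
  fix n \<gamma> assume g: "\<gamma> \<in> chars"
  have "openin T {x\<in>X. uact n \<gamma> x = c}" for c
  proof -
    have "{x\<in>X. uact n \<gamma> x = c} = {x\<in>X. \<alpha> n x \<in> {y\<in>X. \<gamma> y = c}}" using \<alpha>_closed[of _ n] by (auto simp: uact_def)
    then show ?thesis using openin_continuous_map_preimage[OF \<alpha>_cont charsD(3)[OF g]] by simp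
  qed
  moreover have "uact n \<gamma> (add x y) = uact n \<gamma> x + uact n \<gamma> y" if "x \<in> X" "y \<in> X" for x y
    using that charsD(1)[OF g \<alpha>_closed \<alpha>_closed, of x y n n] add_in \<alpha>_hom by (simp add: uact_def)
  moreover have "uact n \<gamma> x = 0" if "x \<notin> X" for x using that charsD(2)[OF g] by (simp add: uact_def)
  ultimately show "uact n \<gamma> \<in> chars" by (simp add: chars_def)
qed

lemma subgp_chars: "subgp chars" by (rule dual.submod_subgp[OF submod_chars])

lemma inj_emb: "inj_on emb chars"
proof (rule inj_onI)
  fix \<gamma> \<psi> assume g: "\<gamma> \<in> chars" "\<psi> \<in> chars" and e: "emb \<gamma> = emb \<psi>"
  show "\<gamma> = \<psi>"
  proof
    fix x show "\<gamma> x = \<psi> x"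
    proof (cases "x \<in> X")
      case True
      then show ?thesis using fun_cong[OF e, of x] by (simp add: emb_def cval_inject)
    qed (simp add: charsD(2)[OF g(1)] charsD(2)[OF g(2)])
  qed
qed

lemma is_character_emb:
  assumes g: "\<gamma> \<in> chars" shows "is_character T add (emb \<gamma>)"
proof -
  have "openin T {x\<in>X. emb \<gamma> x \<in> U}" for U
  proof -
    have "{x\<in>X. emb \<gamma> x \<in> U} = (\<Union>c\<in>{c. cval c \<in> U}. {x\<in>X. \<gamma> x = c})" by (auto simp: emb_def)
    then show ?thesis using charsD(3)[OF g] by (auto intro!: openin_Union)
  qed
  then have "continuous_map T euclidean (emb \<gamma>)" by (simp add: continuous_map_def)
  then show ?thesis unfolding is_character_def
    using add_in charsD(1)[OF g] by (simp add: emb_def norm_cval cval_simps)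
qed

lemma dual_submodule_emb:
  assumes S: "dual.submod S" "S \<subseteq> chars" shows "dual_submodule T add \<alpha> (emb ` S)"
proof -
  have s: "subgp S" by (rule dual.submod_subgp[OF S(1)])
  have "restrict (\<lambda>_. 1) X = emb 0" by (simp add: emb_def cval_simps)
  moreover have "restrict (\<lambda>x. emb \<gamma> x * emb \<psi> x) X = emb (\<gamma> + \<psi>)" for \<gamma> \<psi>
    by (rule ext) (simp add: emb_def restrict_def cval_simps)
  moreover have "restrict (\<lambda>x. inverse (emb \<gamma> x)) X = emb (- \<gamma>)" for \<gamma>
    by (rule ext) (simp add: emb_def restrict_def cval_simps)
  moreover have "restrict (\<lambda>x. emb \<gamma> (\<alpha> n x)) X = emb (uact n \<gamma>)" for \<gamma> n
    by (rule ext) (simp add: emb_def restrict_def uact_def \<alpha>_closed)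
  ultimately show ?thesis unfolding dual_submodule_def
    using is_character_emb S(2) subgp_0[OF s] subgp_add[OF s] subgp_minus[OF s] dual.submod_u[OF S(1)]
    by (auto intro!: imageI)
qed

text \<open>Chains are carried by the injective \<open>emb\<close> to chains of complex-valued
  characters. Torsion holds because the level sets of a character form an open partition of a
  compact space: there are finitely many values, they are closed under addition, and their number
  kills the character.\<close>

sublocale dual: noeth_module uact chars
proof
  show "dual.submod chars" by (rule submod_chars)
next
  fix S :: "nat \<Rightarrow> ('x \<Rightarrow> circ) set"
  assume S: "\<And>k. dual.submod (S k)" "\<And>k. S k \<subseteq> chars" "\<And>k. S k \<subseteq> S (Suc k)"
  have "(\<forall>k. dual_submodule T add \<alpha> (emb ` S k)) \<and> (\<forall>k. emb ` S k \<subseteq> emb ` S (Suc k))"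
    by (intro conjI allI dual_submodule_emb[OF S(1,2)] image_mono[OF S(3)])
  then have "\<exists>N. \<forall>k\<ge>N. emb ` S k = emb ` S N"
    by (rule noetherian[unfolded noetherian_action_def, THEN spec, THEN mp])
  then obtain N where N: "\<forall>k\<ge>N. emb ` S k = emb ` S N" by (rule exE)
  have "S k = S N" if k: "k \<ge> N" for k
  proof -
    have "emb ` S k = emb ` S N" using N k by blast
    then show ?thesis unfolding inj_on_image_eq_iff[OF inj_emb S(2) S(2)] .
  qed
  then show "\<exists>N. \<forall>k\<ge>N. S k = S N" by blast
next
  fix \<gamma> assume g: "\<gamma> \<in> chars"
  let ?C = "(\<lambda>c. {x\<in>X. \<gamma> x = c}) ` \<gamma> ` X"
  have "\<forall>U\<in>?C. openin T U" using charsD(3)[OF g] by blast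
  moreover have "X \<subseteq> \<Union>?C" by blast
  ultimately obtain F where F: "finite F" "F \<subseteq> ?C" "X \<subseteq> \<Union>F"
    using cpt[unfolded compact_space_alt, rule_format, of ?C] by blast
  obtain V where V: "finite V" "V \<subseteq> \<gamma> ` X" "F = (\<lambda>c. {x\<in>X. \<gamma> x = c}) ` V"
    using finite_subset_image[OF F(1,2)] by blast
  have "\<gamma> ` X \<subseteq> V" using F(3) V(3) by auto
  then have fin: "finite (\<gamma> ` X)" using V(1) finite_subset by blast
  have cl: "w + v \<in> \<gamma> ` X" if "v \<in> \<gamma> ` X" "w \<in> \<gamma> ` X" for v w
    using that charsD(1)[OF g] add_in by (metis (no_types, lifting) imageE imageI)
  have "nm (card (\<gamma> ` X)) \<gamma> = 0"
  proof
    fix x show "nm (card (\<gamma> ` X)) \<gamma> x = 0 x"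
    proof (cases "x \<in> X")
      case True
      then show ?thesis using finite_subgroup_exponent[OF fin cl, of "\<gamma> x"] by (simp add: nm_fun)
    qed (simp add: nm_fun charsD(2)[OF g] nm_zero)
  qed
  moreover have "card (\<gamma> ` X) > 0" using fin zero_in card_gt_0_iff by blast
  ultimately show "\<exists>n>0. nm n \<gamma> = 0" by blast
qed

lemma chars_separate:
  assumes x: "x \<in> X" "x \<noteq> zero" shows "\<exists>\<gamma>\<in>chars. \<gamma> x \<noteq> 0"
proof -
  obtain H where H: "open_subgroup H" "x \<notin> H" using separating_open_subgroup[OF dim x] by blast
  obtain \<rho> :: "'x \<Rightarrow> complex" where r: "\<And>y z. y \<in> X \<Longrightarrow> z \<in> X \<Longrightarrow> \<rho> (add y z) = \<rho> y * \<rho> z"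
    "\<And>y. y \<in> X \<Longrightarrow> cmod (\<rho> y) = 1" "\<And>h. h \<in> H \<Longrightarrow> \<rho> h = 1" "\<rho> x \<noteq> 1"
    using separating_character[OF H(1) x(1) H(2)] by blast
  define \<gamma> where "\<gamma> y = (if y \<in> X then Circ (\<rho> y) else 0)" for y
  have cg: "cval (\<gamma> y) = \<rho> y" if "y \<in> X" for y using that r(2) by (simp add: \<gamma>_def Circ_inverse)
  have "\<gamma> \<in> chars" unfolding chars_def
  proof (intro CollectI conjI ballI allI impI)
    fix y z assume "y \<in> X" "z \<in> X"
    then show "\<gamma> (add y z) = \<gamma> y + \<gamma> z"
      using cg add_in r(1) by (simp add: cval_inject[symmetric] cval_simps)
  next
    fix y assume "y \<notin> X" then show "\<gamma> y = 0" by (simp add: \<gamma>_def)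
  next
    fix c
    have Hop: "openin T H" using H(1) by (simp add: open_subgroup_def)
    show "openin T {y\<in>X. \<gamma> y = c}"
    proof (subst openin_subopen, intro ballI)
      fix y assume "y \<in> {y\<in>X. \<gamma> y = c}"
      then have y: "y \<in> X" "\<gamma> y = c" by simp_all
      let ?U = "{z\<in>X. add z (neg y) \<in> H}"
      have "openin T ?U" by (rule openin_continuous_map_preimage[OF cont_add_right[OF neg_in[OF y(1)]] Hop])
      moreover have "y \<in> ?U" using y(1) add_neg H(1) by (simp add: open_subgroup_def)
      moreover have "?U \<subseteq> {y\<in>X. \<gamma> y = c}"
      proof
        fix z assume z: "z \<in> ?U"
        then have "\<rho> (add z (neg y)) = 1" "z \<in> X" using r(3) by simp_all
        then have "\<rho> z * \<rho> (neg y) = 1" using r(1) neg_in[OF y(1)] by simp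
        moreover have "\<rho> y * \<rho> (neg y) = 1"
          using r(1)[OF y(1) neg_in[OF y(1)]] add_neg[OF y(1)] r(3)[of zero] H(1) by (simp add: open_subgroup_def)
        ultimately have "\<rho> z = \<rho> y" by (metis mult.commute mult_cancel_left zero_neq_one mult_zero_left)
        then have "cval (\<gamma> z) = cval (\<gamma> y)" using cg y(1) \<open>z \<in> X\<close> by simp
        then show "z \<in> {y\<in>X. \<gamma> y = c}" using y(2) \<open>z \<in> X\<close> by (simp add: cval_inject)
      qed
      ultimately show "\<exists>U. openin T U \<and> y \<in> U \<and> U \<subseteq> {y\<in>X. \<gamma> y = c}" by blast
    qed
  qed
  moreover have "\<gamma> x \<noteq> 0" using cg[OF x(1)] r(4) by (metis cval_simps(1))
  ultimately show ?thesis by blast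
qed

lemma nontrivial_character:
  assumes g: "\<gamma> \<in> chars" "\<And>x. x \<in> X \<Longrightarrow> cval (\<gamma> x) = 1" shows "\<gamma> = 0"
proof
  fix x show "\<gamma> x = 0 x"
    using assms charsD(2)[OF g(1), of x] by (cases "x \<in> X") (simp_all add: cval_eq_1)
qed

sublocale dual: dual_pair uact chars T add neg zero \<alpha> "\<lambda>\<gamma> x. cval (\<gamma> x)"
proof
  show "z2_aut_action T add \<alpha>" by (rule action)
  show "\<And>\<gamma> \<psi> x. cval ((\<gamma> + \<psi>) x) = cval (\<gamma> x) * cval (\<psi> x)" for \<gamma> \<psi> x by (simp add: cval_simps)
  show "cval (\<gamma> (add x y)) = cval (\<gamma> x) * cval (\<gamma> y)" if "\<gamma> \<in> chars" "x \<in> X" "y \<in> X" for \<gamma> x y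
    using charsD(1)[OF that] by (simp add: cval_simps)
  show "cmod (cval (\<gamma> x)) = 1" for \<gamma> x by (rule norm_cval)
  show "cval (uact n \<gamma> x) = cval (\<gamma> (\<alpha> n x))" if "x \<in> X" for \<gamma> n x using that by (simp add: uact_def)
  show "openin T {x\<in>X. cval (\<gamma> x) = c}" if "\<gamma> \<in> chars" for \<gamma> c
  proof (cases "cmod c = 1")
    case True
    then have e: "{x\<in>X. cval (\<gamma> x) = c} = {x\<in>X. \<gamma> x = Circ c}" by (auto simp: Circ_inverse cval_inverse)
    show ?thesis unfolding e by (rule charsD(3)[OF that])
  next
    case False
    then have e: "{x\<in>X. cval (\<gamma> x) = c} = {}" using norm_cval by auto
    show ?thesis unfolding e by (rule openin_empty)
  qed
  show "x = zero" if "x \<in> X" "\<And>\<gamma>. \<gamma> \<in> chars \<Longrightarrow> cval (\<gamma> x) = 1" for x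
    using chars_separate[OF that(1)] that(2) cval_eq_1 by blast
  show "\<gamma> = 0" if "\<gamma> \<in> chars" "\<And>x. x \<in> X \<Longrightarrow> cval (\<gamma> x) = 1" for \<gamma>
    by (rule nontrivial_character[OF that])
qed

end


lemma card_image_cong_fibres:
  assumes "\<And>x y. x \<in> B \<Longrightarrow> y \<in> B \<Longrightarrow> f x = f y \<longleftrightarrow> g x = g y"
  shows "card (f ` B) = card (g ` B)"
proof -
  have iv: "inv_into B f c \<in> B" "f (inv_into B f c) = c" if "c \<in> f ` B" for c
    using that by (rule inv_into_into, rule f_inv_into_f)
  have "bij_betw (\<lambda>c. g (inv_into B f c)) (f ` B) (g ` B)"
  proof (rule bij_betwI')
    fix c d assume c: "c \<in> f ` B" and d: "d \<in> f ` B"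
    show "(g (inv_into B f c) = g (inv_into B f d)) = (c = d)"
      using assms[OF iv(1)[OF c] iv(1)[OF d]] iv(2)[OF c] iv(2)[OF d] by simp
  next
    fix c assume "c \<in> f ` B"
    then show "g (inv_into B f c) \<in> g ` B" using iv(1) by blast
  next
    fix d assume "d \<in> g ` B"
    then obtain x where x: "x \<in> B" "d = g x" by blast
    have fx: "f x \<in> f ` B" using x by blast
    have "g (inv_into B f (f x)) = g x" using assms[OF iv(1)[OF fx] x(1)] iv(2)[OF fx] by blast
    then show "\<exists>c\<in>f ` B. d = g (inv_into B f c)" using x(2) fx by (intro bexI[of _ "f x"]) simp_all
  qed
  then show ?thesis by (rule bij_betw_same_card)
qed

context dual_pair
begin

lemma countable_M: "countable M"
proof -
  obtain F where F: "subgp F" "finite F" "F \<subseteq> M" "gen F = M"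
    using finitely_generated[OF submod_M subset_refl] by blast
  have "countable (\<Union>V\<in>{V. finite V}. sp V F)"
    by (intro countable_UN countable_Collect_finite countable_finite finite_sp F) simp
  moreover have "gen F = (\<Union>V\<in>{V. finite V}. sp V F)" by (auto simp: gen_def)
  ultimately show ?thesis using F(4) by simp
qed

lemma cl_nbhd:
  assumes V: "openin T V" "x \<in> V"
  shows "\<exists>E. subgp E \<and> finite E \<and> E \<subseteq> M \<and> cl E x \<subseteq> V"
proof -
  have x: "x \<in> X" using V openin_subset by blast
  have hd: "Hausdorff_space T" using grp unfolding cpt_ab_group_def by blast
  have "openin T (X - {x})" using hd x by (intro openin_diff closedin_Hausdorff_singleton) simp_all
  then have "{V, X - {x}} \<in> open_covers T" using V openin_subset[OF V(1)] by (auto simp: open_covers_def)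
  from cl_refines[OF this] obtain E where E: "subgp E" "finite E" "E \<subseteq> M" "\<exists>V\<in>{V, X - {x}}. cl E x \<subseteq> V"
    using x by blast
  then show ?thesis using cl_self[OF x, of E] by blast
qed

subsection \<open>Haar measure\<close>

definition clopens where "clopens = {A. openin T A \<and> closedin T A}"

lemma cl_clopen:
  assumes "finite E" "E \<subseteq> M" shows "cl E x \<in> clopens"
proof -
  have "X - cl E x = (\<Union>y\<in>X - cl E x. cl E y)"
    using cl_self by (auto simp: cl_def)
  moreover have "openin T (\<Union>y\<in>X - cl E x. cl E y)" using open_cl[OF assms] by (intro openin_Union) blast
  ultimately have "closedin T (cl E x)" unfolding closedin_def by (auto simp: cl_def)
  then show ?thesis using open_cl[OF assms] by (simp add: clopens_def)
qed

text \<open>The module is countable, so the classes of its finite subsets form a countable base of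
  clopen sets. Borel measures can therefore be handled on clopen sets.\<close>

lemma borel_clopens: "sigma_sets X {U. openin T U} = sigma_sets X clopens"
proof
  show "sigma_sets X clopens \<subseteq> sigma_sets X {U. openin T U}"
    by (rule sigma_sets_mono') (auto simp: clopens_def)
  show "sigma_sets X {U. openin T U} \<subseteq> sigma_sets X clopens"
  proof (rule sigma_sets_mono, rule subsetI)
    fix U assume "U \<in> {U. openin T U}"
    then have U: "openin T U" by simp
    let ?\<E> = "{E. finite E \<and> E \<subseteq> M}"
    let ?B = "{C \<in> (\<Union>E\<in>?\<E>. cl E ` X). C \<subseteq> U}"
    have "countable (\<Union>E\<in>?\<E>. cl E ` X)"
      by (intro countable_UN countable_Collect_finite_subset countable_M countable_finite finite_cl) auto
    then have cB: "countable ?B" by (rule countable_subset[rotated]) blast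
    have "\<Union>?B = U"
    proof
      show "U \<subseteq> \<Union>?B"
      proof
        fix x assume x: "x \<in> U"
        obtain E where E: "finite E" "E \<subseteq> M" "cl E x \<subseteq> U" using cl_nbhd[OF U x] by blast
        have xX: "x \<in> X" using x openin_subset[OF U] by blast
        have "cl E x \<in> ?B" using E xX by blast
        then show "x \<in> \<Union>?B" using cl_self[OF xX] by blast
      qed
    qed blast
    moreover have "\<Union>?B \<in> sigma_sets X clopens"
      by (rule sigma_sets_UNION[OF cB]) (use cl_clopen in \<open>auto intro: sigma_sets.Basic\<close>)
    ultimately show "U \<in> sigma_sets X clopens" by simp
  qed
qed

text \<open>\<open>A\<close> is a union of cosets of the annihilator of the finite group
  \<open>E\<close>, so membership in \<open>A\<close> depends on finitely many characters.\<close>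

definition good :: "'g set \<Rightarrow> 'x set \<Rightarrow> bool" where
  "good E A \<longleftrightarrow> subgp E \<and> finite E \<and> E \<subseteq> M \<and> A \<subseteq> X \<and> (\<forall>x\<in>A. cl E x \<subseteq> A)"

lemma good_mono:
  assumes "good E A" "E \<subseteq> E'" "subgp E'" "finite E'" "E' \<subseteq> M" shows "good E' A"
proof -
  have "cl E' x \<subseteq> cl E x" for x using assms(2) by (auto simp: cl_def)
  then show ?thesis using assms unfolding good_def by blast
qed

lemma good_ex: assumes "A \<in> clopens" shows "\<exists>E. good E A"
proof -
  have A: "openin T A" "A \<subseteq> X" "openin T (X - A)" using assms openin_subset by (auto simp: clopens_def)
  then have "{A, X - A} \<in> open_covers T" by (auto simp: open_covers_def)
  from cl_refines[OF this] obtain E where E: "subgp E" "finite E" "E \<subseteq> M"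
    "\<forall>x\<in>X. \<exists>V\<in>{A, X - A}. cl E x \<subseteq> V" by blast
  have "cl E x \<subseteq> A" if "x \<in> A" for x using E(4) that A(2) cl_self[of x E] by blast
  then show ?thesis using E A(2) unfolding good_def by blast
qed

lemma good_common: assumes "good E A" "good E' B" shows "\<exists>E. good E A \<and> good E B"
proof -
  have "finite (E \<union> E')" "E \<union> E' \<subseteq> M" using assms by (auto simp: good_def)
  from finite_subgp_hull[OF M_sub subset_refl this] obtain D where "subgp D" "finite D" "E \<union> E' \<subseteq> D" "D \<subseteq> M" by blast
  then show ?thesis using good_mono[OF assms(1)] good_mono[OF assms(2)] by blast
qed

lemma code_add_left:
  assumes E: "E \<subseteq> M" and X: "x \<in> X" "y \<in> X" "z \<in> X"
  shows "code E (add x y) = code E (add x z) \<longleftrightarrow> code E y = code E z"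
proof -
  have "pr \<gamma> (add x y) = pr \<gamma> (add x z) \<longleftrightarrow> pr \<gamma> y = pr \<gamma> z" if "\<gamma> \<in> E" for \<gamma>
    using that E X pr_add[of \<gamma> x] pr_nz[of \<gamma> x] by auto
  then show ?thesis unfolding code_eq by blast
qed

lemma card_code_translate:
  assumes E: "E \<subseteq> M" and x: "x \<in> X" and A: "A \<subseteq> X"
  shows "card (code E ` (add x ` A)) = card (code E ` A)"
proof -
  have "bij_betw (\<lambda>\<kappa>. code E (add x (SOME y. y \<in> A \<and> code E y = \<kappa>))) (code E ` A) (code E ` (add x ` A))"
  proof (rule bij_betwI')
    have s: "(SOME y. y \<in> A \<and> code E y = \<kappa>) \<in> A \<and> code E (SOME y. y \<in> A \<and> code E y = \<kappa>) = \<kappa>"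
      if k: "\<kappa> \<in> code E ` A" for \<kappa>
    proof -
      have "\<exists>y. y \<in> A \<and> code E y = \<kappa>" using k by blast
      then show ?thesis by (rule someI_ex)
    qed
    fix \<kappa> assume k: "\<kappa> \<in> code E ` A"
    let ?s = "\<lambda>\<kappa>. SOME y. y \<in> A \<and> code E y = \<kappa>"
    show "code E (add x (?s \<kappa>)) \<in> code E ` (add x ` A)" using s[OF k] by blast
    fix \<kappa>' assume k': "\<kappa>' \<in> code E ` A"
    have "?s \<kappa> \<in> X" "?s \<kappa>' \<in> X" using s[OF k] s[OF k'] A by blast+
    from code_add_left[OF E x this] show "(code E (add x (?s \<kappa>)) = code E (add x (?s \<kappa>'))) = (\<kappa> = \<kappa>')"
      using s[OF k] s[OF k'] by simp
  next
    fix \<eta> assume "\<eta> \<in> code E ` (add x ` A)"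
    then obtain y where y: "y \<in> A" "\<eta> = code E (add x y)" by blast
    let ?y = "SOME z. z \<in> A \<and> code E z = code E y"
    have "\<exists>z. z \<in> A \<and> code E z = code E y" using y by blast
    then have sy: "?y \<in> A \<and> code E ?y = code E y" by (rule someI_ex)
    have "?y \<in> X" "y \<in> X" using sy y A by blast+
    from code_add_left[OF E x this] have "code E (add x ?y) = \<eta>" using sy y(2) by simp
    then show "\<exists>\<kappa>\<in>code E ` A. \<eta> = code E (add x (SOME y. y \<in> A \<and> code E y = \<kappa>))"
      using y(1) by (intro bexI[of _ "code E y"]) auto
  qed
  from bij_betw_same_card[OF this] show ?thesis by simp
qed

lemma code_cl_disjoint: "x \<in> X \<Longrightarrow> y \<in> X \<Longrightarrow> code E x = code E y \<longleftrightarrow> y \<in> cl E x"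
  by (auto simp: code_eq cl_def)

lemma cl_translate: assumes "E \<subseteq> M" "x \<in> X" shows "add x ` cl E zero = cl E x"
proof
  show "add x ` cl E zero \<subseteq> cl E x"
    using assms pr_zero_right by (auto simp: cl_def add_in pr_add subset_iff)
  show "cl E x \<subseteq> add x ` cl E zero"
  proof
    fix y assume y: "y \<in> cl E x"
    then have yX: "y \<in> X" by (simp add: cl_def)
    have "add (neg x) y \<in> cl E zero"
      using y assms pr_zero_right pr_nz by (auto simp: cl_def add_in neg_in pr_add pr_neg subset_iff)
    then show "y \<in> add x ` cl E zero" using add_neg_cancel[OF assms(2) yX] by (metis imageI)
  qed
qed

text \<open>A saturated set is a union of classes, and all classes of \<open>E\<close> split into equally many classes of
  a larger \<open>E'\<close>.\<close>

lemma card_code_refine: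
  assumes g: "good E A" and E': "E \<subseteq> E'" "subgp E'" "finite E'" "E' \<subseteq> M"
  shows "card (code E' ` A) * card E = card (code E ` A) * card E'"
proof -
  have E: "subgp E" "finite E" "E \<subseteq> M" and A: "A \<subseteq> X" "\<And>x. x \<in> A \<Longrightarrow> cl E x \<subseteq> A"
    using g by (auto simp: good_def)
  define N where "N = card (code E' ` cl E zero)"
  have main: "card (code E' ` B) = card (code E ` B) * N" if B: "B \<subseteq> X" "\<And>x. x \<in> B \<Longrightarrow> cl E x \<subseteq> B" for B
  proof -
    have fin: "finite (code E' ` C)" if "C \<subseteq> X" for C
      using finite_subset[OF image_mono[OF that] finite_code[OF E'(3,4)]] .
    have fE: "finite (cl E ` B)" using finite_subset[OF image_mono[OF B(1)] finite_cl[OF E(2,3)]] .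
    have clX: "cl E x \<subseteq> X" for x by (auto simp: cl_def)
    have UB: "B = (\<Union>C\<in>cl E ` B. C)"
    proof
      show "B \<subseteq> (\<Union>C\<in>cl E ` B. C)"
      proof
        fix x assume x: "x \<in> B"
        then have "x \<in> cl E x" using B(1) cl_self by blast
        then show "x \<in> (\<Union>C\<in>cl E ` B. C)" using x by blast
      qed
      show "(\<Union>C\<in>cl E ` B. C) \<subseteq> B" using B(2) by blast
    qed
    have "code E' ` B = code E' ` (\<Union>C\<in>cl E ` B. C)" using UB by (rule arg_cong)
    also have "\<dots> = (\<Union>C\<in>cl E ` B. code E' ` C)" by (rule image_UN)
    also have "card \<dots> = (\<Sum>C\<in>cl E ` B. card (code E' ` C))"
    proof (rule card_UN_disjoint[OF fE])
      show "\<forall>C\<in>cl E ` B. finite (code E' ` C)" using fin clX by blast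
      show "\<forall>C\<in>cl E ` B. \<forall>D\<in>cl E ` B. C \<noteq> D \<longrightarrow> code E' ` C \<inter> code E' ` D = {}"
      proof (intro ballI impI)
        fix C D assume C: "C \<in> cl E ` B" and D: "D \<in> cl E ` B" and ne: "C \<noteq> D"
        obtain x y where xy: "C = cl E x" "D = cl E y" using C D by blast
        show "code E' ` C \<inter> code E' ` D = {}"
        proof (rule ccontr)
          assume "code E' ` C \<inter> code E' ` D \<noteq> {}"
          then obtain v w where vw: "v \<in> C" "w \<in> D" "code E' v = code E' w" by blast
          have "pr \<gamma> x = pr \<gamma> y" if "\<gamma> \<in> E" for \<gamma>
          proof -
            have "pr \<gamma> v = pr \<gamma> x" "pr \<gamma> w = pr \<gamma> y" using vw(1,2) that by (simp_all add: xy cl_def)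
            moreover have "pr \<gamma> v = pr \<gamma> w" using vw(3) that E'(1) unfolding code_eq by blast
            ultimately show ?thesis by simp
          qed
          then show False using ne unfolding xy cl_def by auto
        qed
      qed
    qed
    also have "\<dots> = (\<Sum>C\<in>cl E ` B. N)"
    proof (rule sum.cong[OF refl])
      fix C assume "C \<in> cl E ` B"
      then obtain x where x: "x \<in> X" "C = cl E x" using B(1) by blast
      show "card (code E' ` C) = N"
        unfolding x(2) cl_translate[OF E(3) x(1), symmetric] N_def
        by (rule card_code_translate[OF E'(4) x(1) clX])
    qed
    also have "\<dots> = card (cl E ` B) * N" by simp
    also have "card (cl E ` B) = card (code E ` B)"
    proof -
      have "cl E x = cl E y \<longleftrightarrow> code E x = code E y" if "x \<in> B" "y \<in> B" for x y
        using that B(1) cl_self[of y E] by (auto simp: code_eq cl_def)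
      then show ?thesis by (rule card_image_cong_fibres)
    qed
    finally show ?thesis .
  qed
  have "card E' = card E * N"
    using main[of X] card_code[OF E] card_code[OF E'(2,3,4)] by (auto simp: cl_def)
  then show ?thesis using main[OF A] by simp
qed

text \<open>The Haar measure of a saturated set. The value does not depend on the choice of \<open>E\<close>, but it is junk
  when no \<open>E\<close> is good for \<open>A\<close>.\<close>

definition wt :: "'x set \<Rightarrow> real" where
  "wt A = (let E = SOME E. good E A in real (card (code E ` A)) / real (card E))"

lemma card_good: "good E A \<Longrightarrow> card E > 0"
  using subgp_0[of E] card_gt_0_iff[of E] by (auto simp: good_def)

lemma wt_eq: assumes g: "good E A" shows "wt A = real (card (code E ` A)) / real (card E)"
proof -
  define D where "D = (SOME E. good E A)"
  have D: "good D A" unfolding D_def by (rule someI[of "\<lambda>E. good E A", OF g])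
  have "finite (E \<union> D)" "E \<union> D \<subseteq> M" using D g by (auto simp: good_def)
  from finite_subgp_hull[OF M_sub subset_refl this] obtain E' where E': "subgp E'" "finite E'" "E \<union> D \<subseteq> E'" "E' \<subseteq> M" by blast
  have 1: "card (code E' ` A) * card E = card (code E ` A) * card E'"
    by (rule card_code_refine[OF g _ E'(1,2,4)]) (use E'(3) in blast)
  have 2: "card (code E' ` A) * card D = card (code D ` A) * card E'"
    by (rule card_code_refine[OF D _ E'(1,2,4)]) (use E'(3) in blast)
  have pos: "card E > 0" "card D > 0" "card E' > 0"
    using card_good[OF g] card_good[OF D] subgp_0[OF E'(1)] E'(2) card_gt_0_iff[of E'] by auto
  have "real (card (code E' ` A)) * real (card E) = real (card (code E ` A)) * real (card E')"
    "real (card (code E' ` A)) * real (card D) = real (card (code D ` A)) * real (card E')"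
    using 1 2 by (simp_all only: of_nat_mult[symmetric])
  then have "real (card (code E ` A)) / real (card E) = real (card (code E' ` A)) / real (card E')"
    "real (card (code D ` A)) / real (card D) = real (card (code E' ` A)) / real (card E')"
    using pos by (simp_all add: field_simps)
  then show ?thesis unfolding wt_def Let_def D_def[symmetric] by simp
qed

lemma wt_add:
  assumes "A \<in> clopens" "B \<in> clopens" "A \<inter> B = {}" shows "wt (A \<union> B) = wt A + wt B"
proof -
  obtain E where E: "good E A" "good E B" using good_ex[OF assms(1)] good_ex[OF assms(2)] good_common by blast
  have U: "good E (A \<union> B)" using E by (auto simp: good_def)
  have f: "finite (code E ` A)" "finite (code E ` B)"
    using E finite_code[of E] finite_subset[OF image_mono] unfolding good_def by blast+
  have "code E ` A \<inter> code E ` B = {}"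
  proof (rule ccontr)
    assume "code E ` A \<inter> code E ` B \<noteq> {}"
    then obtain x y where xy: "x \<in> A" "y \<in> B" "code E x = code E y" by blast
    have "x \<in> X" "y \<in> X" using xy E unfolding good_def by blast+
    then have "y \<in> cl E x" using xy code_cl_disjoint by blast
    moreover have "cl E x \<subseteq> A" using xy(1) E(1) unfolding good_def by blast
    ultimately show False using xy(2) assms(3) by blast
  qed
  then have "card (code E ` (A \<union> B)) = card (code E ` A) + card (code E ` B)"
    unfolding image_Un by (rule card_Un_disjoint[OF f])
  then show ?thesis unfolding wt_eq[OF E(1)] wt_eq[OF E(2)] wt_eq[OF U] by (simp add: add_divide_distrib)
qed

lemma clopens_alg: "{} \<in> clopens" "X \<in> clopens" "A \<in> clopens \<Longrightarrow> B \<in> clopens \<Longrightarrow> A \<union> B \<in> clopens"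
  "A \<in> clopens \<Longrightarrow> B \<in> clopens \<Longrightarrow> A - B \<in> clopens" "A \<in> clopens \<Longrightarrow> B \<in> clopens \<Longrightarrow> A \<inter> B \<in> clopens"
  "clopens \<subseteq> Pow X"
  using openin_subset by (auto simp: clopens_def openin_diff closedin_diff)

lemma wt_empty: "wt {} = 0" using wt_add[OF clopens_alg(1,1)] by simp

lemma wt_X: "wt X = 1"
proof -
  obtain E where E: "good E X" using good_ex[OF clopens_alg(2)] by blast
  then have "card (code E ` X) = card E" using card_code by (simp add: good_def)
  then show ?thesis using wt_eq[OF E] card_good[OF E] by simp
qed

lemma wt_nonneg: "A \<in> clopens \<Longrightarrow> wt A \<ge> 0"
  using good_ex wt_eq by force

lemma wt_translate: assumes "A \<in> clopens" "x \<in> X" shows "wt (add x ` A) = wt A"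
proof -
  obtain E where E: "good E A" using good_ex[OF assms(1)] by blast
  have Ef: "subgp E" "finite E" "E \<subseteq> M" "A \<subseteq> X" "\<And>y. y \<in> A \<Longrightarrow> cl E y \<subseteq> A" using E by (auto simp: good_def)
  have "cl E z \<subseteq> add x ` A" if z: "z \<in> add x ` A" for z
  proof
    fix w assume w: "w \<in> cl E z"
    obtain y where y: "y \<in> A" "z = add x y" using z by blast
    have X: "y \<in> X" "w \<in> X" using y Ef(4) w by (auto simp: cl_def)
    have "code E (add x y) = code E (add x (add (neg x) w))"
      using w y(2) add_neg_cancel[OF assms(2) X(2)] by (simp add: code_eq cl_def)
    then have "code E y = code E (add (neg x) w)"
      using code_add_left[OF Ef(3) assms(2) X(1) add_in[OF neg_in[OF assms(2)] X(2)]] by simp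
    then have "add (neg x) w \<in> A"
      using code_cl_disjoint[OF X(1) add_in[OF neg_in[OF assms(2)] X(2)]] Ef(5)[OF y(1)] by blast
    then show "w \<in> add x ` A" using add_neg_cancel[OF assms(2) X(2)] by (metis imageI)
  qed
  then have "good E (add x ` A)" using Ef add_in[OF assms(2)] by (auto simp: good_def)
  then show ?thesis using wt_eq[OF E] wt_eq card_code_translate[OF Ef(3) assms(2) Ef(4)] by simp
qed

lemma wt_finite_Union:
  "finite I \<Longrightarrow> (\<And>i. i \<in> I \<Longrightarrow> A i \<in> clopens) \<Longrightarrow> disjoint_family_on A I \<Longrightarrow>
    (\<Union>i\<in>I. A i) \<in> clopens \<and> wt (\<Union>i\<in>I. A i) = (\<Sum>i\<in>I. wt (A i))"
proof (induction I rule: finite_induct)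
  case empty
  then show ?case by (simp add: clopens_alg wt_empty)
next
  case (insert j I)
  have IH: "(\<Union>i\<in>I. A i) \<in> clopens" "wt (\<Union>i\<in>I. A i) = (\<Sum>i\<in>I. wt (A i))"
    using insert by (auto simp: disjoint_family_on_def)
  have d: "A j \<inter> (\<Union>i\<in>I. A i) = {}"
    using insert.prems(2) insert.hyps(2) by (auto simp: disjoint_family_on_def)
  have j: "A j \<in> clopens" using insert.prems(1) by blast
  show ?case using wt_add[OF j IH(1) d] clopens_alg(3)[OF j IH(1)] IH(2) insert.hyps by simp
qed

text \<open>A clopen set is compact, so a disjoint decomposition of it into clopen sets has only
  finitely many nonempty members.\<close>

lemma wt_countably_additive: "countably_additive clopens (\<lambda>A. ennreal (wt A))"
  unfolding countably_additive_def
proof (intro allI impI)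
  fix A :: "nat \<Rightarrow> 'x set"
  assume A: "range A \<subseteq> clopens" "disjoint_family A" "(\<Union>i. A i) \<in> clopens"
  have "compactin T (\<Union>i. A i)" using A(3) cpt closedin_compact_space by (auto simp: clopens_def)
  moreover have "\<forall>U\<in>range A. openin T U" using A(1) by (auto simp: clopens_def)
  ultimately obtain F where F: "finite F" "F \<subseteq> range A" "(\<Union>i. A i) \<subseteq> \<Union>F"
    unfolding compactin_def by (metis order_refl)
  obtain I where I: "finite I" "F = A ` I" using finite_subset_image[OF F(1,2)] by blast
  have e: "A i = {}" if "i \<notin> I" for i
  proof (rule ccontr)
    assume "A i \<noteq> {}"
    then obtain x where x: "x \<in> A i" by blast
    then obtain j where "j \<in> I" "x \<in> A j" using F(3) I(2) by blast
    moreover have "A i \<inter> A j = {}"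
      using A(2) \<open>j \<in> I\<close> that unfolding disjoint_family_on_def by (metis UNIV_I)
    ultimately show False using x by blast
  qed
  have AI: "A i \<in> clopens" for i using A(1) by blast
  have dI: "disjoint_family_on A I" using A(2) by (auto simp: disjoint_family_on_def)
  have "(\<Sum>i. ennreal (wt (A i))) = (\<Sum>i\<in>I. ennreal (wt (A i)))"
    by (rule suminf_finite[OF I(1)]) (simp add: e wt_empty)
  also have "\<dots> = ennreal (\<Sum>i\<in>I. wt (A i))" by (rule sum_ennreal) (rule wt_nonneg[OF AI])
  also have "(\<Sum>i\<in>I. wt (A i)) = wt (\<Union>i\<in>I. A i)" using wt_finite_Union[OF I(1) AI dI] by simp
  also have "(\<Union>i\<in>I. A i) = (\<Union>i. A i)" using e by blast
  finally show "(\<Sum>i. ennreal (wt (A i))) = ennreal (wt (\<Union>i. A i))" .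
qed

text \<open>Translation invariance gives all classes of \<open>E\<close> the same measure, namely 1
  / |E| because there are |E| of them, and \<open>A\<close> is a union of such classes.\<close>

lemma haar_clopen:
  assumes h: "is_haar T add \<mu>" and A: "A \<in> clopens"
  shows "emeasure \<mu> A = ennreal (wt A)"
proof -
  have sp: "space \<mu> = X" "sets \<mu> = sigma_sets X clopens" "emeasure \<mu> (space \<mu>) = 1"
    and inv: "\<And>x A. x \<in> X \<Longrightarrow> A \<in> sets \<mu> \<Longrightarrow> measure \<mu> (add x ` A) = measure \<mu> A"
    using h borel_clopens unfolding is_haar_def by auto
  interpret finite_measure \<mu> by (rule finite_measureI) (simp add: sp(3))
  obtain E where g: "good E A" using good_ex[OF A] by blast
  then have E: "subgp E" "finite E" "E \<subseteq> M" "A \<subseteq> X" "\<And>x. x \<in> A \<Longrightarrow> cl E x \<subseteq> A" by (auto simp: good_def)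
  have cls: "cl E x \<in> sets \<mu>" for x using cl_clopen[OF E(2,3)] sp(2) by blast
  have count: "measure \<mu> B = real (card (code E ` B)) * measure \<mu> (cl E zero)"
    if B: "B \<subseteq> X" "\<And>x. x \<in> B \<Longrightarrow> cl E x \<subseteq> B" for B
  proof -
    define s where "s \<kappa> = (SOME y. y \<in> B \<and> code E y = \<kappa>)" for \<kappa>
    have s: "s \<kappa> \<in> B \<and> code E (s \<kappa>) = \<kappa>" if k: "\<kappa> \<in> code E ` B" for \<kappa>
    proof -
      have "\<exists>y. y \<in> B \<and> code E y = \<kappa>" using k by blast
      then show ?thesis unfolding s_def by (rule someI_ex)
    qed
    have fin: "finite (code E ` B)" using finite_subset[OF image_mono[OF B(1)] finite_code[OF E(2,3)]] .
    have "B = (\<Union>\<kappa>\<in>code E ` B. cl E (s \<kappa>))"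
    proof
      show "B \<subseteq> (\<Union>\<kappa>\<in>code E ` B. cl E (s \<kappa>))"
      proof
        fix y assume y: "y \<in> B"
        have "s (code E y) \<in> B" "code E (s (code E y)) = code E y" using s[of "code E y"] y by blast+
        then have "y \<in> cl E (s (code E y))" using code_cl_disjoint y B(1) by blast
        then show "y \<in> (\<Union>\<kappa>\<in>code E ` B. cl E (s \<kappa>))" using y by blast
      qed
      show "(\<Union>\<kappa>\<in>code E ` B. cl E (s \<kappa>)) \<subseteq> B" using s B(2) by blast
    qed
    moreover have "measure \<mu> (\<Union>\<kappa>\<in>code E ` B. cl E (s \<kappa>)) = (\<Sum>\<kappa>\<in>code E ` B. measure \<mu> (cl E (s \<kappa>)))"
    proof (rule measure_finite_Union[OF fin])
      show "(\<lambda>\<kappa>. cl E (s \<kappa>)) ` code E ` B \<subseteq> sets \<mu>" using cls by blast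
      show "disjoint_family_on (\<lambda>\<kappa>. cl E (s \<kappa>)) (code E ` B)"
        unfolding disjoint_family_on_def
      proof (intro ballI impI)
        fix \<kappa> \<kappa>' assume k: "\<kappa> \<in> code E ` B" "\<kappa>' \<in> code E ` B" "\<kappa> \<noteq> \<kappa>'"
        show "cl E (s \<kappa>) \<inter> cl E (s \<kappa>') = {}"
        proof (rule ccontr)
          assume "cl E (s \<kappa>) \<inter> cl E (s \<kappa>') \<noteq> {}"
          then have "code E (s \<kappa>) = code E (s \<kappa>')" unfolding code_eq by (auto simp: cl_def)
          then show False using s[OF k(1)] s[OF k(2)] k(3) by simp
        qed
      qed
    qed (simp add: emeasure_eq_measure)
    moreover have "measure \<mu> (cl E (s \<kappa>)) = measure \<mu> (cl E zero)" if "\<kappa> \<in> code E ` B" for \<kappa>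
      using inv[OF _ cls, of "s \<kappa>" zero] cl_translate[OF E(3), of "s \<kappa>"] s[OF that] B(1) by auto
    ultimately show ?thesis by simp
  qed
  have "measure \<mu> X = real (card E) * measure \<mu> (cl E zero)"
    using count[of X] card_code[OF E(1-3)] by (auto simp: cl_def)
  moreover have "measure \<mu> X = 1" using sp by (simp add: measure_def)
  ultimately have "measure \<mu> (cl E zero) = 1 / real (card E)" using card_good[OF g] by (simp add: field_simps)
  then have "measure \<mu> A = wt A" using count[OF E(4,5)] wt_eq[OF g] by simp
  then show ?thesis by (simp add: emeasure_eq_measure)
qed

lemma clopen_measures_eq:
  assumes "sets \<mu> = sigma_sets X clopens" "sets \<nu> = sigma_sets X clopens"
    "\<And>A. A \<in> clopens \<Longrightarrow> emeasure \<mu> A = ennreal (wt A)" "\<And>A. A \<in> clopens \<Longrightarrow> emeasure \<nu> A = ennreal (wt A)"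
  shows "\<mu> = \<nu>"
proof (rule measure_eqI_generator_eq[where E = clopens and \<Omega> = X and A = "\<lambda>_. X"])
  show "Int_stable clopens" using clopens_alg(5) by (auto simp: Int_stable_def)
qed (use assms clopens_alg in auto)

lemma haar_unique:
  assumes "is_haar T add \<mu>" "is_haar T add \<nu>" shows "\<mu> = \<nu>"
  by (rule clopen_measures_eq)
    (use assms haar_clopen[OF assms(1)] haar_clopen[OF assms(2)] borel_clopens in \<open>auto simp: is_haar_def\<close>)

lemma translate_clopen:
  assumes A: "A \<in> clopens" and x: "x \<in> X"
  shows "{y\<in>X. add x y \<in> A} \<in> clopens" "add x ` A \<in> clopens"
proof -
  have c: "continuous_map T T (add z)" if "z \<in> X" for z
  proof -
    have "continuous_map (prod_topology T T) T (\<lambda>(x, y). add x y)" using grp unfolding cpt_ab_group_def by blast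
    moreover have "continuous_map T (prod_topology T T) (\<lambda>y. (z, y))"
      by (intro continuous_map_pairedI continuous_map_id[unfolded id_def]) (simp add: that)
    ultimately have "continuous_map T T ((\<lambda>(x, y). add x y) \<circ> (\<lambda>y. (z, y)))" by (rule continuous_map_compose[rotated])
    then show ?thesis by (simp add: o_def)
  qed
  have p: "{y\<in>X. add z y \<in> A} \<in> clopens" if "z \<in> X" for z
    using A openin_continuous_map_preimage[OF c[OF that]] closedin_continuous_map_preimage[OF c[OF that]]
    by (simp add: clopens_def)
  show "{y\<in>X. add x y \<in> A} \<in> clopens" by (rule p[OF x])
  have AX: "A \<subseteq> X" using A clopens_alg(6) by blast
  have "add x ` A = {y\<in>X. add (neg x) y \<in> A}"
  proof (intro equalityI subsetI)
    fix y assume "y \<in> add x ` A"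
    then show "y \<in> {y\<in>X. add (neg x) y \<in> A}" using AX x add_in neg_add_cancel by auto
  next
    fix y assume "y \<in> {y\<in>X. add (neg x) y \<in> A}"
    then show "y \<in> add x ` A" using add_neg_cancel[OF x, of y] by (metis (no_types, lifting) imageI mem_Collect_eq)
  qed
  then show "add x ` A \<in> clopens" using p[OF neg_in[OF x]] by simp
qed

text \<open>\<open>haar_mixing\<close> quantifies over all Haar measures and would say nothing if
  there were none. Caratheodory extension of \<open>wt\<close> from the clopen sets provides one;
  invariance passes to Borel sets because the image measure under a translation agrees with it on
  clopen sets.\<close>

lemma haar_exists: "\<exists>\<mu>. is_haar T add \<mu>"
proof -
  have ring: "ring_of_sets X clopens" unfolding ring_of_sets_iff using clopens_alg by blast
  have "positive clopens (\<lambda>A. ennreal (wt A))" by (simp add: positive_def wt_empty)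
  from ring_of_sets.caratheodory'[OF ring this wt_countably_additive]
  obtain \<mu>0 :: "'x set \<Rightarrow> ennreal" where m0: "\<forall>A\<in>clopens. \<mu>0 A = ennreal (wt A)" "measure_space X (sigma_sets X clopens) \<mu>0"
    by blast
  define \<mu> where "\<mu> = measure_of X (sigma_sets X clopens) \<mu>0"
  have sa: "sigma_algebra X (sigma_sets X clopens)" "positive (sigma_sets X clopens) \<mu>0"
    "countably_additive (sigma_sets X clopens) \<mu>0" using m0(2) by (auto simp: measure_space_def)
  have sub: "sigma_sets X clopens \<subseteq> Pow X" using sigma_sets_into_sp[OF clopens_alg(6)] by blast
  have st: "sets \<mu> = sigma_sets X clopens" "space \<mu> = X"
    unfolding \<mu>_def using sub sigma_algebra.sigma_sets_eq[OF sa(1)] by simp_all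
  have em: "emeasure \<mu> A = ennreal (wt A)" if A: "A \<in> clopens" for A
    unfolding \<mu>_def using emeasure_measure_of_sigma[OF sa, of A] A m0(1) by (simp add: sigma_sets.Basic)
  have inv: "measure \<mu> (add x ` A) = measure \<mu> A" if x: "x \<in> X" and A: "A \<in> sets \<mu>" for x A
  proof -
    have nx: "neg x \<in> X" by (rule neg_in[OF x])
    have meas: "add (neg x) \<in> measurable \<mu> \<mu>"
    proof (rule measurable_sigma_sets)
      show "sets \<mu> = sigma_sets X clopens" by (rule st)
      show "clopens \<subseteq> Pow X" by (rule clopens_alg(6))
      show "add (neg x) \<in> space \<mu> \<rightarrow> X" using add_in[OF nx] st by auto
      fix B assume B: "B \<in> clopens"
      have "add (neg x) -` B \<inter> space \<mu> = {y\<in>X. add (neg x) y \<in> B}" using st(2) by auto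
      then show "add (neg x) -` B \<inter> space \<mu> \<in> sets \<mu>"
        using translate_clopen(1)[OF B nx] st(1) by (simp add: sigma_sets.Basic)
    qed
    have img: "add (neg x) -` B \<inter> space \<mu> = add x ` B" if "B \<subseteq> X" for B
    proof (intro equalityI subsetI)
      fix y assume "y \<in> add (neg x) -` B \<inter> space \<mu>"
      then have "add (neg x) y \<in> B" "y \<in> X" using st by auto
      then show "y \<in> add x ` B" using add_neg_cancel[OF x, of y] by (metis imageI)
    next
      fix y assume "y \<in> add x ` B"
      then show "y \<in> add (neg x) -` B \<inter> space \<mu>" using that x add_in neg_add_cancel st(2) by auto
    qed
    have "distr \<mu> \<mu> (add (neg x)) = \<mu>"
    proof (rule clopen_measures_eq)
      fix B assume B: "B \<in> clopens"
      have BX: "B \<subseteq> X" using B clopens_alg(6) by blast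
      have "emeasure (distr \<mu> \<mu> (add (neg x))) B = emeasure \<mu> (add x ` B)"
        using emeasure_distr[OF meas, of B] B st(1) img[OF BX] by (simp add: sigma_sets.Basic)
      also have "\<dots> = ennreal (wt B)" using em[OF translate_clopen(2)[OF B x]] wt_translate[OF B x] by simp
      finally show "emeasure (distr \<mu> \<mu> (add (neg x))) B = ennreal (wt B)" .
    qed (simp_all add: st em)
    then have "emeasure \<mu> A = emeasure (distr \<mu> \<mu> (add (neg x))) A" by simp
    also have "\<dots> = emeasure \<mu> (add x ` A)"
      using emeasure_distr[OF meas A] img[of A] A st sub by auto
    finally show ?thesis by (simp add: measure_def)
  qed
  have "is_haar T add \<mu>"
    unfolding is_haar_def borel_clopens using st em[OF clopens_alg(2)] wt_X inv by auto
  then show ?thesis by blast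
qed

text \<open>The kernel \<open>A\<close> of \<gamma> is invariant under all multiples of
  \<open>n\<close>, so mixing along them forces the measure of \<open>A\<close> to equal its square.
  It is positive because \<open>A\<close> is clopen and nonempty, hence it is 1; a point where
  \<gamma> is not trivial would give a disjoint translate of the same measure.\<close>

lemma mixing_aperiodic:
  assumes mix: "haar_mixing T add \<alpha>" and n: "n \<noteq> 0" and g: "\<gamma> \<in> M" "u n \<gamma> = \<gamma>"
  shows "\<gamma> = 0"
proof (rule sep_M[OF g(1)])
  fix x assume x: "x \<in> X"
  obtain \<mu> where h: "is_haar T add \<mu>" using haar_exists by blast
  then have sp: "space \<mu> = X" "sets \<mu> = sigma_sets X clopens" "emeasure \<mu> (space \<mu>) = 1"
    and inv: "\<And>x A. x \<in> X \<Longrightarrow> A \<in> sets \<mu> \<Longrightarrow> measure \<mu> (add x ` A) = measure \<mu> A"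
    using borel_clopens unfolding is_haar_def by auto
  interpret finite_measure \<mu> by (rule finite_measureI) (simp add: sp(3))
  obtain m1 m2 where m: "n = (m1, m2)" by fastforce
  define \<nu> where "\<nu> k = (int k * m1, int k * m2)" for k
  have \<nu>Suc: "\<nu> (Suc k) = n + \<nu> k" for k by (simp add: \<nu>_def m algebra_simps)
  have ug: "u (\<nu> k) \<gamma> = \<gamma>" for k
  proof (induction k)
    case 0
    then show ?case by (simp add: \<nu>_def u_id zero_prod_def[symmetric])
  next
    case (Suc k)
    then show ?case unfolding \<nu>Suc u_plus by (simp add: g(2))
  qed
  define A where "A = {x\<in>X. pr \<gamma> x = 1}"
  have Ac: "A \<in> clopens" using pr_open[OF g(1)] pr_closed[OF g(1)] by (simp add: A_def clopens_def)
  then have A: "A \<in> sets \<mu>" using sp(2) by blast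
  have pre: "{x\<in>X. \<alpha> (\<nu> k) x \<in> A} = A" for k
    using pr_u[OF g(1), of _ "\<nu> k"] ug[of k] \<alpha>_in[of _ "\<nu> k"] by (auto simp: A_def)
  have inj: "inj \<nu>" using n by (auto simp: inj_on_def \<nu>_def m zero_prod_def)
  \<comment> \<open>\<open>haar_mixing\<close> is stated along \<open>cofinite\<close>; injectivity
    of \<nu> makes the multiples of \<open>n\<close> a sequence that leaves every finite
    set.\<close>
  have "filterlim \<nu> cofinite sequentially"
    unfolding filterlim_iff cofinite_eq_sequentially[symmetric] eventually_cofinite
  proof (intro allI impI)
    fix P :: "int \<times> int \<Rightarrow> bool" assume "finite {x. \<not> P x}"
    from finite_vimageI[OF this inj] show "finite {k. \<not> P (\<nu> k)}" by (simp add: vimage_def)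
  qed
  moreover have "((\<lambda>n. measure \<mu> ({x\<in>X. \<alpha> n x \<in> A} \<inter> A)) \<longlongrightarrow> measure \<mu> A * measure \<mu> A) cofinite"
    using mix h A unfolding haar_mixing_def by blast
  ultimately have "(\<lambda>k. measure \<mu> ({x\<in>X. \<alpha> (\<nu> k) x \<in> A} \<inter> A)) \<longlonglongrightarrow> measure \<mu> A * measure \<mu> A"
    by (rule filterlim_compose[rotated])
  then have "(\<lambda>k::nat. measure \<mu> A) \<longlonglongrightarrow> measure \<mu> A * measure \<mu> A" unfolding pre by simp
  then have sq: "measure \<mu> A = measure \<mu> A * measure \<mu> A" by (simp add: LIMSEQ_const_iff)
  have "measure \<mu> A > 0"
  proof -
    obtain E where E: "good E A" using good_ex[OF Ac] by blast
    have "zero \<in> A" using zero_in pr_zero_right[OF g(1)] by (simp add: A_def)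
    moreover have "finite (code E ` A)"
      using E finite_code[of E] finite_subset[OF image_mono] unfolding good_def by blast
    ultimately have "card (code E ` A) > 0" using card_gt_0_iff by blast
    then have "wt A > 0" using wt_eq[OF E] card_good[OF E] by simp
    then show ?thesis using haar_clopen[OF h Ac] by (simp add: measure_def)
  qed
  then have m1: "measure \<mu> A = 1" using sq by simp
  show "pr \<gamma> x = 1"
  proof (rule ccontr)
    assume ne: "pr \<gamma> x \<noteq> 1"
    have "add x ` A \<inter> A = {}"
      using pr_add[OF g(1) x] ne by (auto simp: A_def)
    then have "measure \<mu> (add x ` A \<union> A) = measure \<mu> (add x ` A) + measure \<mu> A"
      using translate_clopen(2)[OF Ac x] A sp(2) by (intro finite_measure_Union) auto
    also have "\<dots> = 2" using inv[OF x A] m1 by simp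
    finally have "measure \<mu> (add x ` A \<union> A) = 2" .
    moreover have "measure \<mu> (add x ` A \<union> A) \<le> measure \<mu> (space \<mu>)" by (rule bounded_measure)
    ultimately show False using sp(3) by (simp add: measure_def)
  qed
qed

end


section \<open>Coding quotients of X by real numbers\<close>

context z2_zero_dim
begin

lemma countable_values: assumes "\<gamma> \<in> chars" shows "countable (\<gamma> ` X)"
proof -
  have "\<gamma> ` X = (\<lambda>\<kappa>. Circ (\<kappa> \<gamma>)) ` (dual.code {\<gamma>} ` X)"
    by (simp add: image_image dual.code_def cval_inverse)
  then show ?thesis using dual.finite_code[of "{\<gamma>}"] assms by (simp add: countable_finite)
qed

text \<open>The graph over \<open>N\<close> of evaluation at a point is a subset of one countable
  set, because \<open>N\<close> is countable and each character takes countably many values. Subsets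
  of a countable set embed into sets of natural numbers, which are in bijection with the
  reals.\<close>

lemma real_quotient_map:
  assumes "N \<subseteq> chars"
  shows "\<exists>\<Phi>::'x \<Rightarrow> real. \<forall>x\<in>X. \<forall>y\<in>X. \<Phi> x = \<Phi> y \<longleftrightarrow> (\<forall>\<gamma>\<in>N. \<gamma> x = \<gamma> y)"
proof -
  define I where "I = (\<Union>\<gamma>\<in>N. Pair \<gamma> ` \<gamma> ` X)"
  have cN: "countable N" using dual.countable_M assms countable_subset by blast
  have I: "countable I" unfolding I_def
  proof (rule countable_UN[OF cN])
    fix \<gamma> assume "\<gamma> \<in> N"
    then have "\<gamma> \<in> chars" using assms by blast
    from countable_image[OF countable_values[OF this]] show "countable (Pair \<gamma> ` \<gamma> ` X)" .
  qed
  obtain j :: "nat set \<Rightarrow> real" where j: "bij j"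
    using nat_sets_eqpoll_reals unfolding eqpoll_def by blast
  define G where "G x = (\<lambda>\<gamma>. (\<gamma>, \<gamma> x)) ` N" for x
  have GI: "G x \<subseteq> I" if "x \<in> X" for x using that by (auto simp: G_def I_def)
  define \<Phi> where "\<Phi> x = j (to_nat_on I ` G x)" for x
  have "\<Phi> x = \<Phi> y \<longleftrightarrow> (\<forall>\<gamma>\<in>N. \<gamma> x = \<gamma> y)" if x: "x \<in> X" and y: "y \<in> X" for x y
  proof -
    have "\<Phi> x = \<Phi> y \<longleftrightarrow> to_nat_on I ` G x = to_nat_on I ` G y"
      unfolding \<Phi>_def by (rule inj_eq[OF bij_is_inj[OF j]])
    also have "\<dots> \<longleftrightarrow> G x = G y" by (rule inj_on_image_eq_iff[OF inj_on_to_nat_on[OF I] GI[OF x] GI[OF y]])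
    also have "\<dots> \<longleftrightarrow> (\<forall>\<gamma>\<in>N. \<gamma> x = \<gamma> y)"
    proof
      assume e: "G x = G y"
      show "\<forall>\<gamma>\<in>N. \<gamma> x = \<gamma> y"
      proof
        fix \<gamma> assume "\<gamma> \<in> N"
        then have "(\<gamma>, \<gamma> x) \<in> G y" unfolding e[symmetric] by (simp add: G_def)
        then show "\<gamma> x = \<gamma> y" by (auto simp: G_def)
      qed
    next
      assume "\<forall>\<gamma>\<in>N. \<gamma> x = \<gamma> y"
      then show "G x = G y" unfolding G_def by (intro image_cong) simp_all
    qed
    finally show ?thesis .
  qed
  then show ?thesis by blast
qed

end

subsection \<open>Quotients by annihilators\<close>

text \<open>The quotient of X by the annihilator of \<open>N\<close>, realised on the image of a
  function \<Phi> whose fibres in X are the cosets. Leaving the type of values open keeps the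
  construction apart from the coding by reals.\<close>

locale z2_quotient = z2_zero_dim T add neg zero \<alpha>
  for T :: "'x topology" and add :: "'x \<Rightarrow> 'x \<Rightarrow> 'x" and neg :: "'x \<Rightarrow> 'x" and zero :: 'x
    and \<alpha> :: "int \<times> int \<Rightarrow> 'x \<Rightarrow> 'x" +
  fixes N :: "('x \<Rightarrow> circ) set" and \<Phi> :: "'x \<Rightarrow> 'y"
  assumes N: "dual.submod N" "N \<subseteq> chars"
    and \<Phi>: "\<And>x y. x \<in> X \<Longrightarrow> y \<in> X \<Longrightarrow> \<Phi> x = \<Phi> y \<longleftrightarrow> (\<forall>\<gamma>\<in>N. \<gamma> x = \<gamma> y)"
begin

lemma N_char: "\<gamma> \<in> N \<Longrightarrow> \<gamma> \<in> chars" using N(2) by blast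

definition sec :: "'y \<Rightarrow> 'x" where "sec y = (SOME x. x \<in> X \<and> \<Phi> x = y)"

lemma sec: assumes "y \<in> \<Phi> ` X" shows "sec y \<in> X" "\<Phi> (sec y) = y"
proof -
  have "\<exists>x. x \<in> X \<and> \<Phi> x = y" using assms by blast
  from someI_ex[OF this] show "sec y \<in> X" "\<Phi> (sec y) = y" by (simp_all add: sec_def)
qed

lemma sec_\<Phi>: assumes "x \<in> X" "\<gamma> \<in> N" shows "\<gamma> (sec (\<Phi> x)) = \<gamma> x"
proof -
  have "\<Phi> x \<in> \<Phi> ` X" using assms by blast
  from sec[OF this] show ?thesis using \<Phi>[of "sec (\<Phi> x)" x] assms by blast
qed

definition qT :: "'y topology" where
  "qT = topology (\<lambda>V. V \<subseteq> \<Phi> ` X \<and> openin T {x\<in>X. \<Phi> x \<in> V})"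

lemma openin_qT: "openin qT V \<longleftrightarrow> V \<subseteq> \<Phi> ` X \<and> openin T {x\<in>X. \<Phi> x \<in> V}"
proof -
  have "istopology (\<lambda>V. V \<subseteq> \<Phi> ` X \<and> openin T {x\<in>X. \<Phi> x \<in> V})"
    unfolding istopology_def
  proof (intro conjI allI impI)
    fix S S' assume S: "S \<subseteq> \<Phi> ` X \<and> openin T {x\<in>X. \<Phi> x \<in> S}" and S': "S' \<subseteq> \<Phi> ` X \<and> openin T {x\<in>X. \<Phi> x \<in> S'}"
    show "S \<inter> S' \<subseteq> \<Phi> ` X" using S by blast
    have e: "{x\<in>X. \<Phi> x \<in> S \<inter> S'} = {x\<in>X. \<Phi> x \<in> S} \<inter> {x\<in>X. \<Phi> x \<in> S'}" by blast
    show "openin T {x\<in>X. \<Phi> x \<in> S \<inter> S'}" unfolding e using S S' by (intro openin_Int) simp_all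
  next
    fix \<K> assume K: "\<forall>K\<in>\<K>. K \<subseteq> \<Phi> ` X \<and> openin T {x\<in>X. \<Phi> x \<in> K}"
    show "\<Union>\<K> \<subseteq> \<Phi> ` X" using K by blast
    have "{x\<in>X. \<Phi> x \<in> \<Union>\<K>} = (\<Union>K\<in>\<K>. {x\<in>X. \<Phi> x \<in> K})" by blast
    moreover have "openin T (\<Union>K\<in>\<K>. {x\<in>X. \<Phi> x \<in> K})" by (intro openin_Union) (use K in blast)
    ultimately show "openin T {x\<in>X. \<Phi> x \<in> \<Union>\<K>}" by simp
  qed
  then show ?thesis unfolding qT_def by (simp add: topology_inverse')
qed

lemma topspace_qT: "topspace qT = \<Phi> ` X"
proof -
  have "{x\<in>X. \<Phi> x \<in> \<Phi> ` X} = X" by blast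
  then have "openin qT (\<Phi> ` X)" by (simp add: openin_qT)
  then show ?thesis using openin_subset openin_qT openin_topspace by (metis subset_antisym)
qed

lemma cont_\<Phi>: "continuous_map T qT \<Phi>"
  unfolding continuous_map_def topspace_qT openin_qT by blast

definition qadd where "qadd y z = \<Phi> (add (sec y) (sec z))"
definition qneg where "qneg y = \<Phi> (neg (sec y))"
definition qact where "qact n y = \<Phi> (\<alpha> n (sec y))"
definition qpr where "qpr \<gamma> y = cval (\<gamma> (sec y))"

lemma char_neg: assumes "\<gamma> \<in> chars" "x \<in> X" shows "\<gamma> (neg x) = - \<gamma> x"
proof -
  have "cval (\<gamma> (neg x)) = cval (- \<gamma> x)" using dual.pr_neg[OF assms] by (simp add: cval_simps)
  then show ?thesis by (simp add: cval_inject)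
qed

lemma \<Phi>_add: assumes x: "x \<in> X" and y: "y \<in> X" shows "qadd (\<Phi> x) (\<Phi> y) = \<Phi> (add x y)"
proof -
  have s: "sec (\<Phi> x) \<in> X" "sec (\<Phi> y) \<in> X" using sec x y by blast+
  have "\<gamma> (add (sec (\<Phi> x)) (sec (\<Phi> y))) = \<gamma> (add x y)" if "\<gamma> \<in> N" for \<gamma>
    using charsD(1)[OF N_char[OF that]] s x y sec_\<Phi>[OF _ that] by simp
  then show ?thesis unfolding qadd_def using \<Phi> add_in s x y by blast
qed

lemma \<Phi>_neg: assumes x: "x \<in> X" shows "qneg (\<Phi> x) = \<Phi> (neg x)"
proof -
  have s: "sec (\<Phi> x) \<in> X" using sec x by blast
  have "\<gamma> (neg (sec (\<Phi> x))) = \<gamma> (neg x)" if "\<gamma> \<in> N" for \<gamma>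
    using char_neg[OF N_char[OF that]] s x sec_\<Phi>[OF _ that] by simp
  then show ?thesis unfolding qneg_def using \<Phi> neg_in s x by blast
qed

lemma \<Phi>_act: assumes x: "x \<in> X" shows "qact n (\<Phi> x) = \<Phi> (\<alpha> n x)"
proof -
  have s: "sec (\<Phi> x) \<in> X" using sec x by blast
  have "\<gamma> (\<alpha> n (sec (\<Phi> x))) = \<gamma> (\<alpha> n x)" if "\<gamma> \<in> N" for \<gamma>
    using sec_\<Phi>[OF x dual.submod_u[OF N(1) that, of n]] s x by (simp add: uact_def)
  then show ?thesis unfolding qact_def using \<Phi> \<alpha>_closed s x by blast
qed

lemma \<Phi>_pr: "x \<in> X \<Longrightarrow> \<gamma> \<in> N \<Longrightarrow> qpr \<gamma> (\<Phi> x) = cval (\<gamma> x)"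
  by (simp add: qpr_def sec_\<Phi>)

lemma open_qpr: assumes g: "\<gamma> \<in> N" shows "openin qT {y\<in>\<Phi> ` X. qpr \<gamma> y = c}"
proof -
  have e: "{x\<in>X. \<Phi> x \<in> {y\<in>\<Phi> ` X. qpr \<gamma> y = c}} = {x\<in>X. cval (\<gamma> x) = c}"
  proof (rule Collect_cong)
    fix x show "(x \<in> X \<and> \<Phi> x \<in> {y\<in>\<Phi> ` X. qpr \<gamma> y = c}) = (x \<in> X \<and> cval (\<gamma> x) = c)"
      using \<Phi>_pr[OF _ g, of x] by (cases "x \<in> X") simp_all
  qed
  show ?thesis unfolding openin_qT e using dual.pr_open[OF N_char[OF g]] by blast
qed

definition qcl where "qcl E y = {z\<in>\<Phi> ` X. \<forall>\<gamma>\<in>E. qpr \<gamma> z = qpr \<gamma> y}"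

lemma open_qcl: assumes "finite E" "E \<subseteq> N" shows "openin qT (qcl E y)"
proof -
  have "qcl E y = \<Phi> ` X \<inter> (\<Inter>\<gamma>\<in>E. {z\<in>\<Phi> ` X. qpr \<gamma> z = qpr \<gamma> y})" by (auto simp: qcl_def)
  moreover have "openin qT (\<Phi> ` X \<inter> (\<Inter>\<gamma>\<in>E. {z\<in>\<Phi> ` X. qpr \<gamma> z = qpr \<gamma> y}))"
  proof (cases "E = {}")
    case False
    then have "openin qT (\<Inter>\<gamma>\<in>E. {z\<in>\<Phi> ` X. qpr \<gamma> z = qpr \<gamma> y})"
      using assms open_qpr by (intro openin_INT2) blast+
    then show ?thesis by (intro openin_Int) (simp add: topspace_qT[symmetric])
  next
    case True
    have "openin qT (topspace qT)" by (rule openin_topspace)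
    then show ?thesis using True by (simp add: topspace_qT)
  qed
  ultimately show ?thesis by simp
qed

text \<open>Compactness of X: the closed sets of points that agree with \<open>x\<close> on one
  character of \<open>N\<close> but lie outside the preimage of \<open>V\<close> have empty
  intersection, so finitely many characters already suffice.\<close>

lemma qcl_nbhd:
  assumes V: "openin qT V" "y \<in> V"
  shows "\<exists>E. finite E \<and> E \<subseteq> N \<and> qcl E y \<subseteq> V"
proof -
  have VX: "V \<subseteq> \<Phi> ` X" "openin T {x\<in>X. \<Phi> x \<in> V}" using V(1) openin_qT by blast+
  obtain x where x: "x \<in> X" "y = \<Phi> x" using VX V(2) by blast
  define D where "D \<gamma> = {z\<in>X. cval (\<gamma> z) = cval (\<gamma> x)} - {x\<in>X. \<Phi> x \<in> V}" for \<gamma>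
  have cl: "\<forall>C\<in>D ` N. closedin T C"
    using closedin_diff[OF dual.pr_closed[OF N_char] VX(2)] by (auto simp: D_def)
  have N0: "0 \<in> N" by (rule subgp_0[OF dual.submod_subgp[OF N(1)]])
  have "\<Inter>(D ` N) = {}"
  proof (rule ccontr)
    assume "\<Inter>(D ` N) \<noteq> {}"
    then obtain z where z: "\<forall>\<gamma>\<in>N. z \<in> D \<gamma>" by blast
    then have zX: "z \<in> X" "\<Phi> z \<notin> V" using N0 by (auto simp: D_def)
    have "\<Phi> z = \<Phi> x" using \<Phi>[OF zX(1) x(1)] z by (auto simp: D_def cval_inject)
    then show False using zX V(2) x by simp
  qed
  then obtain F where F: "finite F" "F \<subseteq> D ` N" "\<Inter>F = {}"
    using cpt[unfolded compact_space_fip, rule_format, of "D ` N"] cl by blast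
  obtain E where E: "finite E" "E \<subseteq> N" "F = D ` E" using finite_subset_image[OF F(1,2)] by blast
  have "qcl E y \<subseteq> V"
  proof
    fix w assume w: "w \<in> qcl E y"
    then obtain z where z: "z \<in> X" "w = \<Phi> z" by (auto simp: qcl_def)
    show "w \<in> V"
    proof (rule ccontr)
      assume nV: "w \<notin> V"
      have "z \<in> D \<gamma>" if g: "\<gamma> \<in> E" for \<gamma>
      proof -
        have "qpr \<gamma> w = qpr \<gamma> y" using w g by (simp add: qcl_def)
        then have "cval (\<gamma> z) = cval (\<gamma> x)" using \<Phi>_pr[OF z(1)] \<Phi>_pr[OF x(1)] g E(2) z(2) x(2) by auto
        then show ?thesis using z nV by (simp add: D_def)
      qed
      then have "z \<in> \<Inter>F" using E(3) by blast
      then show False using F(3) by blast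
    qed
  qed
  then show ?thesis using E by blast
qed

lemma qcl_self: "y \<in> \<Phi> ` X \<Longrightarrow> y \<in> qcl E y" by (simp add: qcl_def)

lemma cpt_quotient: "cpt_ab_group qT qadd qneg (\<Phi> zero)"
  unfolding cpt_ab_group_def topspace_qT
proof (intro conjI ballI)
  show "\<Phi> zero \<in> \<Phi> ` X" using zero_in by blast
  show "compact_space qT"
  proof -
    have "compactin qT (\<Phi> ` X)"
      by (rule image_compactin[OF _ cont_\<Phi>]) (use cpt in \<open>simp add: compact_space_def\<close>)
    then show ?thesis by (simp add: compact_space_def topspace_qT)
  qed
  show "Hausdorff_space qT" unfolding Hausdorff_space_def topspace_qT
  proof (intro allI impI)
    fix y z assume yz: "y \<in> \<Phi> ` X \<and> z \<in> \<Phi> ` X \<and> y \<noteq> z"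
    then obtain x w where xw: "x \<in> X" "w \<in> X" "y = \<Phi> x" "z = \<Phi> w" by blast
    have "\<not> (\<forall>\<gamma>\<in>N. \<gamma> x = \<gamma> w)" using \<Phi>[OF xw(1,2)] yz xw(3,4) by simp
    then obtain \<gamma> where g: "\<gamma> \<in> N" "\<gamma> x \<noteq> \<gamma> w" by blast
    have ne: "qpr \<gamma> y \<noteq> qpr \<gamma> z" using g \<Phi>_pr xw by (simp add: cval_inject)
    show "\<exists>U V. openin qT U \<and> openin qT V \<and> y \<in> U \<and> z \<in> V \<and> disjnt U V"
      using open_qpr[OF g(1)] yz ne
      by (intro exI[of _ "{v\<in>\<Phi> ` X. qpr \<gamma> v = qpr \<gamma> y}"] exI[of _ "{v\<in>\<Phi> ` X. qpr \<gamma> v = qpr \<gamma> z}"])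
        (auto simp: disjnt_def)
  qed
  show "continuous_map qT qT qneg" unfolding continuous_map_def topspace_qT
  proof (intro conjI allI impI)
    show "qneg \<in> \<Phi> ` X \<rightarrow> \<Phi> ` X" using \<Phi>_neg neg_in by auto
    fix V assume V: "openin qT V"
    have e: "{x\<in>X. \<Phi> x \<in> {y\<in>\<Phi> ` X. qneg y \<in> V}} = {x\<in>X. neg x \<in> {x\<in>X. \<Phi> x \<in> V}}"
    proof (rule Collect_cong)
      fix x show "(x \<in> X \<and> \<Phi> x \<in> {y\<in>\<Phi> ` X. qneg y \<in> V}) = (x \<in> X \<and> neg x \<in> {x\<in>X. \<Phi> x \<in> V})"
        using \<Phi>_neg[of x] neg_in[of x] by (cases "x \<in> X") simp_all
    qed
    show "openin qT {y\<in>\<Phi> ` X. qneg y \<in> V}" unfolding openin_qT[of "{y\<in>_. _ y}"] e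
      using openin_continuous_map_preimage[OF cont_neg, of "{x\<in>X. \<Phi> x \<in> V}"] V unfolding openin_qT by blast
  qed
  show "continuous_map (prod_topology qT qT) qT (\<lambda>(x, y). qadd x y)"
    unfolding continuous_map_def topspace_prod_topology topspace_qT
  proof (intro conjI allI impI)
    show "(\<lambda>(x, y). qadd x y) \<in> \<Phi> ` X \<times> \<Phi> ` X \<rightarrow> \<Phi> ` X" using \<Phi>_add add_in by auto
    fix V assume V: "openin qT V"
    show "openin (prod_topology qT qT) {p\<in>\<Phi> ` X \<times> \<Phi> ` X. (\<lambda>(x, y). qadd x y) p \<in> V}"
    proof (subst openin_subopen, intro ballI)
      fix p assume "p \<in> {p\<in>\<Phi> ` X \<times> \<Phi> ` X. (\<lambda>(x, y). qadd x y) p \<in> V}"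
      then obtain x w where xw: "x \<in> X" "w \<in> X" "p = (\<Phi> x, \<Phi> w)" "qadd (\<Phi> x) (\<Phi> w) \<in> V" by auto
      \<comment> \<open>The classes \<open>qcl\<close> give product neighbourhoods directly, which
        avoids the question whether a product of quotient maps is again a quotient map.\<close>
      obtain E where E: "finite E" "E \<subseteq> N" "qcl E (qadd (\<Phi> x) (\<Phi> w)) \<subseteq> V" using qcl_nbhd[OF V xw(4)] by blast
      let ?U = "qcl E (\<Phi> x) \<times> qcl E (\<Phi> w)"
      have "openin (prod_topology qT qT) ?U" using open_qcl[OF E(1,2)] by (simp add: openin_prod_Times_iff)
      moreover have "p \<in> ?U" using xw qcl_self by simp
      moreover have "?U \<subseteq> {p\<in>\<Phi> ` X \<times> \<Phi> ` X. (\<lambda>(x, y). qadd x y) p \<in> V}"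
      proof
        fix q assume q: "q \<in> ?U"
        then obtain v v' where v: "v \<in> X" "v' \<in> X" "q = (\<Phi> v, \<Phi> v')" by (auto simp: qcl_def)
        have "qpr \<gamma> (\<Phi> (add v v')) = qpr \<gamma> (\<Phi> (add x w))" if g: "\<gamma> \<in> E" for \<gamma>
        proof -
          have gN: "\<gamma> \<in> N" using g E(2) by blast
          have "qpr \<gamma> (\<Phi> v) = qpr \<gamma> (\<Phi> x)" "qpr \<gamma> (\<Phi> v') = qpr \<gamma> (\<Phi> w)" using q v(3) g by (simp_all add: qcl_def)
          then have "cval (\<gamma> v) = cval (\<gamma> x)" "cval (\<gamma> v') = cval (\<gamma> w)" using \<Phi>_pr gN v xw by simp_all
          then show ?thesis using \<Phi>_pr[OF add_in gN] charsD(1)[OF N_char[OF gN]] v xw by (simp add: cval_simps)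
        qed
        then have "\<Phi> (add v v') \<in> qcl E (qadd (\<Phi> x) (\<Phi> w))"
          using v xw add_in by (simp add: qcl_def \<Phi>_add)
        then show "q \<in> {p\<in>\<Phi> ` X \<times> \<Phi> ` X. (\<lambda>(x, y). qadd x y) p \<in> V}" using E(3) v \<Phi>_add by auto
      qed
      ultimately show "\<exists>U. openin (prod_topology qT qT) U \<and> p \<in> U \<and>
        U \<subseteq> {p\<in>\<Phi> ` X \<times> \<Phi> ` X. (\<lambda>(x, y). qadd x y) p \<in> V}" by blast
    qed
  qed
qed (auto simp: \<Phi>_add \<Phi>_neg add_in neg_in zero_in add_assoc zero_add neg_add intro!: arg_cong[OF add_comm])

lemma dim_quotient: "qT dim_le 0"
  unfolding dimension_le_0_neighbourhood_base_of_clopen neighbourhood_base_of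
proof (intro allI impI)
  fix W y assume W: "openin qT W \<and> y \<in> W"
  obtain E where E: "finite E" "E \<subseteq> N" "qcl E y \<subseteq> W" using qcl_nbhd[of W y] W by blast
  have y: "y \<in> \<Phi> ` X" using W openin_qT[of W] by blast
  have "topspace qT - qcl E y = (\<Union>z\<in>\<Phi> ` X - qcl E y. qcl E z)"
    unfolding topspace_qT using qcl_self by (auto simp: qcl_def)
  moreover have "openin qT (\<Union>z\<in>\<Phi> ` X - qcl E y. qcl E z)" using open_qcl[OF E(1,2)] by (intro openin_Union) blast
  ultimately have "closedin qT (qcl E y)" unfolding closedin_def topspace_qT[symmetric] by (auto simp: qcl_def topspace_qT)
  then show "\<exists>U V. openin qT U \<and> (closedin qT V \<and> openin qT V) \<and> y \<in> U \<and> U \<subseteq> V \<and> V \<subseteq> W"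
    using open_qcl[OF E(1,2)] qcl_self[OF y] E(3) by blast
qed

lemma action_quotient: "z2_aut_action qT qadd qact"
  unfolding z2_aut_action_def topspace_qT
proof (intro conjI allI ballI)
  fix n show "continuous_map qT qT (qact n)" unfolding continuous_map_def topspace_qT
  proof (intro conjI allI impI)
    show "qact n \<in> \<Phi> ` X \<rightarrow> \<Phi> ` X" using \<Phi>_act[of _ n] \<alpha>_closed[of _ n] by auto
    fix V assume V: "openin qT V"
    have e: "{x\<in>X. \<Phi> x \<in> {y\<in>\<Phi> ` X. qact n y \<in> V}} = {x\<in>X. \<alpha> n x \<in> {x\<in>X. \<Phi> x \<in> V}}"
    proof (rule Collect_cong)
      fix x show "(x \<in> X \<and> \<Phi> x \<in> {y\<in>\<Phi> ` X. qact n y \<in> V}) = (x \<in> X \<and> \<alpha> n x \<in> {x\<in>X. \<Phi> x \<in> V})"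
        using \<Phi>_act[of x n] \<alpha>_closed[of x n] by (cases "x \<in> X") simp_all
    qed
    show "openin qT {y\<in>\<Phi> ` X. qact n y \<in> V}" unfolding openin_qT[of "{y\<in>_. _ y}"] e
      using openin_continuous_map_preimage[OF \<alpha>_cont, of "{x\<in>X. \<Phi> x \<in> V}"] V unfolding openin_qT by blast
  qed
next
  fix n y z assume "y \<in> \<Phi> ` X" "z \<in> \<Phi> ` X"
  then obtain v w where v: "v \<in> X" "w \<in> X" "y = \<Phi> v" "z = \<Phi> w" by blast
  show "qact n (qadd y z) = qadd (qact n y) (qact n z)"
    using \<Phi>_add[OF v(1,2)] \<Phi>_act[OF v(1), of n] \<Phi>_act[OF v(2), of n] \<Phi>_act[OF add_in[OF v(1,2)], of n]
      \<Phi>_add[OF \<alpha>_closed[OF v(1), of n] \<alpha>_closed[OF v(2), of n]] \<alpha>_hom[OF v(1,2), of n] v(3,4) by simp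
next
  fix y assume "y \<in> \<Phi> ` X"
  then obtain v where v: "v \<in> X" "y = \<Phi> v" by blast
  then show "qact 0 y = y" using \<Phi>_act[OF v(1), of 0] \<alpha>_id[OF v(1)] by simp
next
  fix m n y assume "y \<in> \<Phi> ` X"
  then obtain v where v: "v \<in> X" "y = \<Phi> v" by blast
  then show "qact (m + n) y = qact m (qact n y)" 
    using \<Phi>_act[OF v(1), of "m + n"] \<Phi>_act[OF v(1), of n] \<Phi>_act[OF \<alpha>_closed[OF v(1), of n], of m]
      \<alpha>_comp[OF v(1), of m n] by simp
qed

sublocale quot: dual_pair uact N qT qadd qneg "\<Phi> zero" qact qpr
proof
  show "dual.submod N" by (rule N(1))
next
  fix S :: "nat \<Rightarrow> ('x \<Rightarrow> circ) set"
  assume S: "\<And>k. dual.submod (S k)" "\<And>k. S k \<subseteq> N" "\<And>k. S k \<subseteq> S (Suc k)"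
  show "\<exists>N. \<forall>k\<ge>N. S k = S N"
  proof (rule dual.acc[of S])
    show "S k \<subseteq> chars" for k using S(2)[of k] N(2) by blast
  qed (rule S(1), rule S(3))
next
  show "\<exists>n>0. nm n \<gamma> = 0" if "\<gamma> \<in> N" for \<gamma> by (rule dual.tors[OF N_char[OF that]])
  show "cpt_ab_group qT qadd qneg (\<Phi> zero)" by (rule cpt_quotient)
  show "z2_aut_action qT qadd qact" by (rule action_quotient)
  show "qpr (\<gamma> + \<psi>) y = qpr \<gamma> y * qpr \<psi> y" for \<gamma> \<psi> y by (simp add: qpr_def cval_simps)
  show "qpr \<gamma> (qadd y z) = qpr \<gamma> y * qpr \<gamma> z" if g: "\<gamma> \<in> N" and yz: "y \<in> topspace qT" "z \<in> topspace qT" for \<gamma> y z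
  proof -
    obtain v w where vw: "v \<in> X" "w \<in> X" "y = \<Phi> v" "z = \<Phi> w" using yz unfolding topspace_qT by blast
    then show ?thesis
      using \<Phi>_add \<Phi>_pr[OF _ g] add_in charsD(1)[OF N_char[OF g]] by (simp add: cval_simps)
  qed
  show "cmod (qpr \<gamma> y) = 1" for \<gamma> y by (simp add: qpr_def norm_cval)
  show "qpr (uact n \<gamma>) y = qpr \<gamma> (qact n y)" if g: "\<gamma> \<in> N" and y: "y \<in> topspace qT" for \<gamma> n y
  proof -
    obtain v where v: "v \<in> X" "y = \<Phi> v" using y unfolding topspace_qT by blast
    have "qpr (uact n \<gamma>) y = cval (\<gamma> (\<alpha> n v))"
      using \<Phi>_pr[OF v(1) dual.submod_u[OF N(1) g]] v by (simp add: uact_def)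
    also have "\<dots> = qpr \<gamma> (qact n y)"
      using \<Phi>_act[OF v(1), of n] \<Phi>_pr[OF \<alpha>_closed[OF v(1), of n] g] v(2) by simp
    finally show ?thesis .
  qed
  show "openin qT {y\<in>topspace qT. qpr \<gamma> y = c}" if "\<gamma> \<in> N" for \<gamma> c
    unfolding topspace_qT by (rule open_qpr[OF that])
  show "y = \<Phi> zero" if y: "y \<in> topspace qT" "\<And>\<gamma>. \<gamma> \<in> N \<Longrightarrow> qpr \<gamma> y = 1" for y
  proof -
    obtain v where v: "v \<in> X" "y = \<Phi> v" using y(1) unfolding topspace_qT by blast
    have "\<gamma> v = \<gamma> zero" if "\<gamma> \<in> N" for \<gamma>
    proof -
      have "cval (\<gamma> v) = cval (\<gamma> zero)"
        using y(2)[OF that] \<Phi>_pr[OF v(1) that] dual.pr_zero_right[OF N_char[OF that]] v(2) by simp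
      then show ?thesis by (simp add: cval_inject)
    qed
    then show ?thesis using \<Phi>[OF v(1) zero_in] v(2) by blast
  qed
  show "\<gamma> = 0" if g: "\<gamma> \<in> N" "\<And>y. y \<in> topspace qT \<Longrightarrow> qpr \<gamma> y = 1" for \<gamma>
  proof (rule nontrivial_character[OF N_char[OF g(1)]])
    fix x assume "x \<in> X"
    then show "cval (\<gamma> x) = 1" using g(2)[of "\<Phi> x"] \<Phi>_pr[OF _ g(1), of x] topspace_qT by simp
  qed
qed

text \<open>Pullback along \<Phi> sends characters to characters and submodules to submodules, and
  it is injective, so a chain stabilises because its pullback to X does.\<close>

lemma noetherian_quotient: "noetherian_action qT qadd qact"
  unfolding noetherian_action_def
proof (intro allI impI)
  fix Ms :: "nat \<Rightarrow> ('y \<Rightarrow> complex) set"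
  assume Ms: "(\<forall>k. dual_submodule qT qadd qact (Ms k)) \<and> (\<forall>k. Ms k \<subseteq> Ms (Suc k))"
  define pb where "pb g = restrict (\<lambda>x. g (\<Phi> x)) X" for g :: "'y \<Rightarrow> complex"
  have X\<Phi>: "x \<in> X \<Longrightarrow> \<Phi> x \<in> topspace qT" for x by (simp add: topspace_qT)
  have ch: "is_character T add (pb g)" if g: "is_character qT qadd g" for g
  proof -
    have "continuous_map T euclidean (g \<circ> \<Phi>)"
      using g cont_\<Phi> unfolding is_character_def by (intro continuous_map_compose) blast+
    then have "continuous_map T euclidean (pb g)"
      by (rule continuous_map_eq) (simp add: pb_def)
    then show ?thesis using g X\<Phi> add_in unfolding is_character_def by (auto simp: pb_def \<Phi>_add[symmetric])
  qed
  have sub: "dual_submodule T add \<alpha> (pb ` Ms k)" for k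
  proof -
    have d: "dual_submodule qT qadd qact (Ms k)" using Ms by blast
    have 1: "pb (restrict (\<lambda>_. 1) (topspace qT)) = restrict (\<lambda>_. 1) X"
      using X\<Phi> by (auto simp: pb_def restrict_def)
    have 2: "pb (restrict (\<lambda>y. g y * h y) (topspace qT)) = restrict (\<lambda>x. pb g x * pb h x) X" for g h
      using X\<Phi> by (auto simp: pb_def restrict_def)
    have 3: "pb (restrict (\<lambda>y. inverse (g y)) (topspace qT)) = restrict (\<lambda>x. inverse (pb g x)) X" for g
      using X\<Phi> by (auto simp: pb_def restrict_def)
    have 4: "pb (restrict (\<lambda>y. g (qact n y)) (topspace qT)) = restrict (\<lambda>x. pb g (\<alpha> n x)) X" for g n
    proof
      fix x show "pb (restrict (\<lambda>y. g (qact n y)) (topspace qT)) x = restrict (\<lambda>x. pb g (\<alpha> n x)) X x"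
        using X\<Phi>[of x] \<alpha>_closed[of x n] \<Phi>_act[of x n] by (simp add: pb_def restrict_def)
    qed
    show ?thesis unfolding dual_submodule_def
    proof (intro conjI ballI allI)
      show "is_character T add \<gamma>" if "\<gamma> \<in> pb ` Ms k" for \<gamma>
        using that d ch unfolding dual_submodule_def by blast
      show "restrict (\<lambda>_. 1) X \<in> pb ` Ms k"
        using d unfolding dual_submodule_def 1[symmetric] by blast
      show "restrict (\<lambda>x. \<gamma> x * \<psi> x) X \<in> pb ` Ms k" if gp: "\<gamma> \<in> pb ` Ms k" "\<psi> \<in> pb ` Ms k" for \<gamma> \<psi>
      proof -
        obtain g h where gh: "g \<in> Ms k" "h \<in> Ms k" "\<gamma> = pb g" "\<psi> = pb h" using gp by blast
        show ?thesis unfolding gh(3,4) 2[symmetric] using d gh(1,2) unfolding dual_submodule_def by blast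
      qed
      show "restrict (\<lambda>x. inverse (\<gamma> x)) X \<in> pb ` Ms k" if gp: "\<gamma> \<in> pb ` Ms k" for \<gamma>
      proof -
        obtain g where gh: "g \<in> Ms k" "\<gamma> = pb g" using gp by blast
        show ?thesis unfolding gh(2) 3[symmetric] using d gh(1) unfolding dual_submodule_def by blast
      qed
      show "restrict (\<lambda>x. \<gamma> (\<alpha> n x)) X \<in> pb ` Ms k" if gp: "\<gamma> \<in> pb ` Ms k" for \<gamma> n
      proof -
        obtain g where gh: "g \<in> Ms k" "\<gamma> = pb g" using gp by blast
        show ?thesis unfolding gh(2) 4[symmetric] using d gh(1) unfolding dual_submodule_def by blast
      qed
    qed
  qed
  have "(\<forall>k. dual_submodule T add \<alpha> (pb ` Ms k)) \<and> (\<forall>k. pb ` Ms k \<subseteq> pb ` Ms (Suc k))"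
    using sub Ms by (intro conjI allI image_mono) blast+
  then have "\<exists>K. \<forall>k\<ge>K. pb ` Ms k = pb ` Ms K"
    by (rule noetherian[unfolded noetherian_action_def, THEN spec, THEN mp])
  then obtain K where K: "\<forall>k\<ge>K. pb ` Ms k = pb ` Ms K" by (rule exE)
  have inj: "inj_on pb (extensional (topspace qT))"
  proof (rule inj_onI)
    fix g h assume g: "g \<in> extensional (topspace qT)" "h \<in> extensional (topspace qT)" "pb g = pb h"
    show "g = h"
    proof (rule extensionalityI[OF g(1,2)])
      fix y assume "y \<in> topspace qT"
      then obtain x where "x \<in> X" "y = \<Phi> x" unfolding topspace_qT by blast
      then show "g y = h y" using fun_cong[OF g(3), of x] by (simp add: pb_def)
    qed
  qed
  have ext: "Ms k \<subseteq> extensional (topspace qT)" for k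
    using Ms unfolding dual_submodule_def is_character_def by blast
  have "Ms k = Ms K" if "k \<ge> K" for k
  proof -
    have "pb ` Ms k = pb ` Ms K" using K that by blast
    then show ?thesis unfolding inj_on_image_eq_iff[OF inj ext ext] .
  qed
  then show "\<exists>N. \<forall>k\<ge>N. Ms k = Ms N" by blast
qed

text \<open>The image under \<Phi> of a Haar measure of X is a Haar measure of the quotient, and by
  \<open>haar_unique\<close> it is the given one. Mixing is then read off from preimages in
  X.\<close>

lemma mixing_quotient:
  assumes mix: "haar_mixing T add \<alpha>" shows "haar_mixing qT qadd qact"
  unfolding haar_mixing_def
proof (intro allI impI ballI)
  fix \<mu>' A B assume h': "is_haar qT qadd \<mu>'" and A: "A \<in> sets \<mu>'" and B: "B \<in> sets \<mu>'"
  obtain \<mu> where h: "is_haar T add \<mu>" using dual.haar_exists by blast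
  have sp: "space \<mu> = X" "sets \<mu> = sigma_sets X {U. openin T U}" "emeasure \<mu> (space \<mu>) = 1"
    and inv: "\<And>x A. x \<in> X \<Longrightarrow> A \<in> sets \<mu> \<Longrightarrow> measure \<mu> (add x ` A) = measure \<mu> A"
    using h unfolding is_haar_def by auto
  have sp': "space \<mu>' = \<Phi> ` X" "sets \<mu>' = sigma_sets (\<Phi> ` X) {U. openin qT U}"
    using h' unfolding is_haar_def topspace_qT by auto
  have meas: "\<Phi> \<in> measurable \<mu> \<mu>'"
  proof (rule measurable_sigma_sets[OF sp'(2)])
    show "{U. openin qT U} \<subseteq> Pow (\<Phi> ` X)" using openin_qT by blast
    show "\<Phi> \<in> space \<mu> \<rightarrow> \<Phi> ` X" using sp(1) by simp
    fix V assume "V \<in> {U. openin qT U}"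
    then have "openin T {x\<in>X. \<Phi> x \<in> V}" using openin_qT by blast
    moreover have "\<Phi> -` V \<inter> space \<mu> = {x\<in>X. \<Phi> x \<in> V}" using sp(1) by auto
    ultimately show "\<Phi> -` V \<inter> space \<mu> \<in> sets \<mu>" using sp(2) by (simp add: sigma_sets.Basic)
  qed
  define \<nu> where "\<nu> = distr \<mu> \<mu>' \<Phi>"
  have pre: "\<Phi> -` C \<inter> space \<mu> = {x\<in>X. \<Phi> x \<in> C}" for C using sp(1) by auto
  have m\<nu>: "measure \<nu> C = measure \<mu> {x\<in>X. \<Phi> x \<in> C}" if "C \<in> sets \<mu>'" for C
    unfolding \<nu>_def using measure_distr[OF meas that] pre by simp
  have preS: "{x\<in>X. \<Phi> x \<in> C} \<in> sets \<mu>" if "C \<in> sets \<mu>'" for C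
    using measurable_sets[OF meas that] pre by simp
  have sub: "C \<subseteq> \<Phi> ` X" if "C \<in> sets \<mu>'" for C using sets.sets_into_space[OF that] sp'(1) by simp
  have shift: "{x\<in>X. \<Phi> x \<in> qadd y ` C} = add v ` {x\<in>X. \<Phi> x \<in> C}"
    if C: "C \<subseteq> \<Phi> ` X" and v: "v \<in> X" "y = \<Phi> v" for C y v
  proof (intro equalityI subsetI)
    fix x assume "x \<in> {x\<in>X. \<Phi> x \<in> qadd y ` C}"
    then obtain w where x: "x \<in> X" and w: "w \<in> X" "\<Phi> w \<in> C" "\<Phi> x = \<Phi> (add v w)" using C v \<Phi>_add by force
    have "\<Phi> (add (neg v) x) = \<Phi> (add (neg v) (add v w))"
      using \<Phi>_add[OF neg_in[OF v(1)] x] \<Phi>_add[OF neg_in[OF v(1)] add_in[OF v(1) w(1)]] w(3) by simp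
    then have "add (neg v) x \<in> {x\<in>X. \<Phi> x \<in> C}"
      using neg_add_cancel[OF v(1) w(1)] w(2) add_in[OF neg_in[OF v(1)] x] by simp
    then show "x \<in> add v ` {x\<in>X. \<Phi> x \<in> C}" using add_neg_cancel[OF v(1) x] by (metis imageI)
  next
    fix x assume "x \<in> add v ` {x\<in>X. \<Phi> x \<in> C}"
    then obtain w where w: "w \<in> X" "\<Phi> w \<in> C" "x = add v w" by blast
    then have "\<Phi> x = qadd y (\<Phi> w)" using \<Phi>_add v by simp
    then show "x \<in> {x\<in>X. \<Phi> x \<in> qadd y ` C}" using w add_in v(1) by blast
  qed
  have "is_haar qT qadd \<nu>"
    unfolding is_haar_def topspace_qT
  proof (intro conjI ballI)
    show "space \<nu> = \<Phi> ` X" "sets \<nu> = sigma_sets (\<Phi> ` X) {U. openin qT U}" using sp' by (simp_all add: \<nu>_def)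
    have "{x\<in>X. \<Phi> x \<in> \<Phi> ` X} = space \<mu>" using sp(1) by auto
    then show "emeasure \<nu> (space \<nu>) = 1"
      using emeasure_distr[OF meas sets.top] pre sp(3) sp'(1) by (simp add: \<nu>_def)
    fix y C assume y: "y \<in> \<Phi> ` X" and C: "C \<in> sets \<nu>"
    have C': "C \<in> sets \<mu>'" using C by (simp add: \<nu>_def)
    obtain v where v: "v \<in> X" "y = \<Phi> v" using y by blast
    show "measure \<nu> (qadd y ` C) = measure \<nu> C"
    proof (cases "qadd y ` C \<in> sets \<mu>'")
      case True
      show ?thesis unfolding m\<nu>[OF True] m\<nu>[OF C'] shift[OF sub[OF C'] v] by (rule inv[OF v(1) preS[OF C']])
    next
      \<comment> \<open>This case is contradictory: the translate of \<open>C\<close> by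
        \<open>y\<close> is its preimage under translation by the inverse of \<open>y\<close>, hence
        measurable.\<close>
      case False
      have ny: "qneg y \<in> \<Phi> ` X" and yq: "y \<in> topspace qT"
        using v \<Phi>_neg neg_in y topspace_qT by auto
      have cm: "qadd (qneg y) \<in> measurable \<mu>' \<mu>'"
      proof (rule measurable_sigma_sets[OF sp'(2)])
        show "{U. openin qT U} \<subseteq> Pow (\<Phi> ` X)" using openin_qT by blast
        show "qadd (qneg y) \<in> space \<mu>' \<rightarrow> \<Phi> ` X" using sp'(1) quot.add_in ny topspace_qT by auto
        fix V assume "V \<in> {U. openin qT U}"
        then have V: "openin qT V" by simp
        have "continuous_map qT (prod_topology qT qT) (\<lambda>z. (qneg y, z))"
          by (intro continuous_map_pairedI continuous_map_id[unfolded id_def]) (use ny topspace_qT in simp)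
        moreover have "continuous_map (prod_topology qT qT) qT (\<lambda>(x, y). qadd x y)"
          using cpt_quotient unfolding cpt_ab_group_def by blast
        ultimately have "continuous_map qT qT ((\<lambda>(x, y). qadd x y) \<circ> (\<lambda>z. (qneg y, z)))" by (rule continuous_map_compose)
        then have "openin qT {z\<in>topspace qT. qadd (qneg y) z \<in> V}"
          using openin_continuous_map_preimage[OF _ V] by (simp add: o_def)
        moreover have "qadd (qneg y) -` V \<inter> space \<mu>' = {z\<in>topspace qT. qadd (qneg y) z \<in> V}"
          using sp'(1) topspace_qT by auto
        ultimately show "qadd (qneg y) -` V \<inter> space \<mu>' \<in> sets \<mu>'" using sp'(2) by (simp add: sigma_sets.Basic)
      qed
      have "qadd y ` C = qadd (qneg y) -` C \<inter> space \<mu>'"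
      proof (intro equalityI subsetI)
        fix z assume "z \<in> qadd y ` C"
        then obtain c where c: "c \<in> C" "z = qadd y c" by blast
        have cX: "c \<in> topspace qT" using c(1) sub[OF C'] topspace_qT by blast
        show "z \<in> qadd (qneg y) -` C \<inter> space \<mu>'"
          using quot.neg_add_cancel[OF yq cX] quot.add_in[OF yq cX] c sp'(1) topspace_qT by simp
      next
        fix z assume z: "z \<in> qadd (qneg y) -` C \<inter> space \<mu>'"
        then have "z \<in> topspace qT" using sp'(1) topspace_qT by simp
        from quot.add_neg_cancel[OF yq this] z show "z \<in> qadd y ` C" by (metis IntE imageI vimageE)
      qed
      then have "qadd y ` C \<in> sets \<mu>'" using measurable_sets[OF cm C'] by simp
      then show ?thesis using False by blast
    qed
  qed
  from quot.haar_unique[OF h' this] have eq: "\<mu>' = \<nu>" .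
  have m': "measure \<mu>' C = measure \<mu> {x\<in>X. \<Phi> x \<in> C}" if "C \<in> sets \<mu>'" for C
    using m\<nu>[OF that] eq by simp
  let ?A = "{x\<in>X. \<Phi> x \<in> A}" let ?B = "{x\<in>X. \<Phi> x \<in> B}"
  have lim: "((\<lambda>n. measure \<mu> ({x\<in>X. \<alpha> n x \<in> ?A} \<inter> ?B)) \<longlongrightarrow> measure \<mu> ?A * measure \<mu> ?B) cofinite"
    using mix h preS[OF A] preS[OF B] unfolding haar_mixing_def by blast
  have "measure \<mu>' ({y\<in>topspace qT. qact n y \<in> A} \<inter> B) = measure \<mu> ({x\<in>X. \<alpha> n x \<in> ?A} \<inter> ?B)" for n
  proof -
    have cm: "qact n \<in> measurable \<mu>' \<mu>'"
    proof (rule measurable_sigma_sets[OF sp'(2)])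
      show "{U. openin qT U} \<subseteq> Pow (\<Phi> ` X)" using openin_qT by blast
      show "qact n \<in> space \<mu>' \<rightarrow> \<Phi> ` X" using sp'(1) quot.\<alpha>_in[of _ n] topspace_qT by auto
      fix V assume "V \<in> {U. openin qT U}"
      then have V: "openin qT V" by simp
      have "continuous_map qT qT (qact n)" using action_quotient unfolding z2_aut_action_def by blast
      from openin_continuous_map_preimage[OF this V] have "openin qT {z\<in>topspace qT. qact n z \<in> V}" .
      moreover have "qact n -` V \<inter> space \<mu>' = {z\<in>topspace qT. qact n z \<in> V}" using sp'(1) topspace_qT by auto
      ultimately show "qact n -` V \<inter> space \<mu>' \<in> sets \<mu>'" using sp'(2) by (simp add: sigma_sets.Basic)
    qed
    have "{y\<in>topspace qT. qact n y \<in> A} = qact n -` A \<inter> space \<mu>'" using sp'(1) topspace_qT by auto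
    then have S: "{y\<in>topspace qT. qact n y \<in> A} \<inter> B \<in> sets \<mu>'" using measurable_sets[OF cm A] B by simp
    have "{x\<in>X. \<Phi> x \<in> {y\<in>topspace qT. qact n y \<in> A} \<inter> B} = {x\<in>X. \<alpha> n x \<in> ?A} \<inter> ?B"
    proof (intro equalityI subsetI)
      fix x assume "x \<in> {x\<in>X. \<Phi> x \<in> {y\<in>topspace qT. qact n y \<in> A} \<inter> B}"
      then show "x \<in> {x\<in>X. \<alpha> n x \<in> ?A} \<inter> ?B" using \<Phi>_act[of x n] \<alpha>_closed[of x n] by simp
    next
      fix x assume "x \<in> {x\<in>X. \<alpha> n x \<in> ?A} \<inter> ?B"
      then show "x \<in> {x\<in>X. \<Phi> x \<in> {y\<in>topspace qT. qact n y \<in> A} \<inter> B}"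
        using \<Phi>_act[of x n] \<alpha>_closed[of x n] topspace_qT by simp
    qed
    then show ?thesis unfolding m'[OF S] by simp
  qed
  then show "((\<lambda>n. measure \<mu>' ({y\<in>topspace qT. qact n y \<in> A} \<inter> B)) \<longlongrightarrow> measure \<mu>' A * measure \<mu>' B) cofinite"
    using lim m'[OF A] m'[OF B] by simp
qed

end


subsection \<open>Bases of finite-index subgroups\<close>

lemma subgp_int_multiple:
  fixes S :: "(int \<times> int) set"
  assumes S: "subgp S" and xy: "(x, y) \<in> S" shows "(k * x, k * y) \<in> S"
proof (induction k rule: int_induct[where k = 0])
  case base
  then show ?case using subgp_0[OF S] by (simp add: zero_prod_def)
next
  case (step1 i)
  have "((i + 1) * x, (i + 1) * y) = (i * x, i * y) + (x, y)" by (simp add: algebra_simps)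
  then show ?case using subgp_add[OF S step1(2) xy] by metis
next
  case (step2 i)
  have "((i - 1) * x, (i - 1) * y) = (i * x, i * y) - (x, y)" by (simp add: algebra_simps)
  then show ?case using subgp_diff[OF S step2(2) xy] by metis
qed

lemma subgp_lat:
  fixes S :: "(int \<times> int) set"
  assumes S: "subgp S" and "(a, 0) \<in> S" "(b, c) \<in> S" shows "lat a b c k l \<in> S"
proof -
  have "(k * a, k * 0) + (l * b, l * c) \<in> S"
    by (rule subgp_add[OF S subgp_int_multiple[OF S assms(2)] subgp_int_multiple[OF S assms(3)]])
  then show ?thesis by (simp add: lat_def)
qed

lemma finite_index_subgp: assumes "finite_index_subgroup \<Lambda>" shows "subgp \<Lambda>"
proof (rule subgpI)
  have \<Lambda>: "0 \<in> \<Lambda>" "\<forall>a\<in>\<Lambda>. \<forall>b\<in>\<Lambda>. a + b \<in> \<Lambda>" "\<forall>a\<in>\<Lambda>. - a \<in> \<Lambda>"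
    using assms unfolding finite_index_subgroup_def by blast+
  show "0 \<in> \<Lambda>" by (rule \<Lambda>(1))
  fix m n assume "m \<in> \<Lambda>" "n \<in> \<Lambda>"
  then have "m + - n \<in> \<Lambda>" using \<Lambda>(2,3) by blast
  then show "m - n \<in> \<Lambda>" by simp
qed

text \<open>Pigeonhole: two distinct multiples of (x, y) lie in the same coset.\<close>

lemma finite_index_multiple:
  assumes L: "finite_index_subgroup \<Lambda>" shows "\<exists>n>0. (int n * x, int n * y) \<in> \<Lambda>"
proof -
  have \<Lambda>: "0 \<in> \<Lambda>" "finite (z2_cosets \<Lambda>)"
    using L unfolding finite_index_subgroup_def by blast+
  let ?v = "\<lambda>n::nat. (int n * x, int n * y)"
  let ?f = "\<lambda>n. (\<lambda>l. ?v n + l) ` \<Lambda>"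
  have "range ?f \<subseteq> z2_cosets \<Lambda>" unfolding z2_cosets_def by blast
  then have "finite (range ?f)" using \<Lambda>(2) by (rule finite_subset)
  then have "\<not> inj ?f" using range_inj_infinite[of ?f] by blast
  then obtain i' j' where ij': "i' \<noteq> j'" "?f i' = ?f j'" unfolding inj_on_def by blast
  obtain i j where ij: "i < j" "?f i = ?f j"
  proof (cases "i' < j'")
    case True
    then show ?thesis using ij'(2) by (rule that)
  next
    case False
    then have "j' < i'" using ij'(1) by simp
    then show ?thesis using ij'(2)[symmetric] by (rule that)
  qed
  have "?v j + 0 \<in> ?f j" using \<Lambda>(1) by (rule imageI)
  then obtain l where l: "l \<in> \<Lambda>" "?v j + 0 = ?v i + l" unfolding ij(2)[symmetric] by (elim imageE)
  have "l = (int (j - i) * x, int (j - i) * y)"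
    using l(2) ij(1) by (cases l) (simp add: of_nat_diff algebra_simps)
  then show ?thesis using l(1) ij(1) by (intro exI[of _ "j - i"]) simp
qed

text \<open>Hermite normal form: \<open>c\<close> is the least positive second coordinate in the
  lattice, and \<open>a\<close> the least positive number with (a, 0) in the lattice. Reducing the
  first entry of the second vector modulo \<open>a\<close> makes it nonnegative, which the covering
  by strips needs.\<close>

lemma lattice_basis:
  assumes L: "finite_index_subgroup \<Lambda>"
  shows "\<exists>a b c. a > 0 \<and> b \<ge> 0 \<and> c > 0 \<and> \<Lambda> = {lat a b c k l |k l. True} \<and> z2_index \<Lambda> = nat (a * c)"
proof -
  note \<Lambda> = finite_index_subgp[OF L]
  note diff = subgp_diff[OF \<Lambda>] and mul = subgp_int_multiple[OF \<Lambda>]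
  define Pc where "Pc n \<longleftrightarrow> n > 0 \<and> (\<exists>x. (x, int n) \<in> \<Lambda>)" for n :: nat
  define Pa where "Pa n \<longleftrightarrow> n > 0 \<and> (int n, 0) \<in> \<Lambda>" for n :: nat
  have exc: "\<exists>n. Pc n" using finite_index_multiple[OF L, of 0 1] by (auto simp: Pc_def)
  have exa: "\<exists>n. Pa n" using finite_index_multiple[OF L, of 1 0] by (auto simp: Pa_def)
  define c where "c = int (LEAST n. Pc n)"
  define a where "a = int (LEAST n. Pa n)"
  have c: "c > 0" "\<exists>x. (x, c) \<in> \<Lambda>" using LeastI_ex[OF exc] by (simp_all add: c_def Pc_def)
  have a: "a > 0" "(a, 0) \<in> \<Lambda>" using LeastI_ex[OF exa] by (simp_all add: a_def Pa_def)
  have cmin: "y = 0" if "(x, y) \<in> \<Lambda>" "0 \<le> y" "y < c" for x y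
  proof (rule ccontr)
    assume "y \<noteq> 0"
    then have "Pc (nat y)" using that by (auto simp: Pc_def)
    then have "(LEAST n. Pc n) \<le> nat y" by (rule Least_le)
    then show False using that by (simp add: c_def)
  qed
  have amin: "x = 0" if "(x, 0) \<in> \<Lambda>" "0 \<le> x" "x < a" for x
  proof (rule ccontr)
    assume "x \<noteq> 0"
    then have "Pa (nat x)" using that by (auto simp: Pa_def)
    then have "(LEAST n. Pa n) \<le> nat x" by (rule Least_le)
    then show False using that by (simp add: a_def)
  qed
  obtain b0 where b0: "(b0, c) \<in> \<Lambda>" using c(2) by blast
  define b where "b = b0 mod a"
  have b: "b \<ge> 0" using a(1) by (simp add: b_def)
  have "(b, c) = (b0, c) - (b0 div a * a, b0 div a * 0)" by (simp add: b_def minus_div_mult_eq_mod)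
  then have bc: "(b, c) \<in> \<Lambda>" using diff[OF b0 mul[OF a(2)]] by metis
  have sub: "n \<in> {lat a b c k l |k l. True}" if n: "n \<in> \<Lambda>" for n
  proof -
    obtain k l p where n': "n = lat a b c k l + p" "p \<in> pbox a c" using lat_decomp[OF a(1) c(1)] by blast
    have "n - lat a b c k l \<in> \<Lambda>" by (rule diff[OF n subgp_lat[OF \<Lambda> a(2) bc]])
    then have p: "p \<in> \<Lambda>" using n'(1) by simp
    obtain x y where xy: "p = (x, y)" "0 \<le> x" "x < a" "0 \<le> y" "y < c" using n'(2) by (auto simp: pbox_def)
    have "y = 0" by (rule cmin) (use p xy in auto)
    moreover have "x = 0" by (rule amin) (use p xy \<open>y = 0\<close> in auto)
    ultimately have "n = lat a b c k l" using n'(1) xy(1) by (simp add: zero_prod_def[symmetric])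
    then show ?thesis by blast
  qed
  have \<Lambda>eq: "\<Lambda> = {lat a b c k l |k l. True}"
    using sub subgp_lat[OF \<Lambda> a(2) bc] by blast
  have inj: "inj_on (\<lambda>p. (\<lambda>l. p + l) ` \<Lambda>) (pbox a c)"
  proof (rule inj_onI)
    fix p q assume p: "p \<in> pbox a c" and q: "q \<in> pbox a c" and e: "(\<lambda>l. p + l) ` \<Lambda> = (\<lambda>l. q + l) ` \<Lambda>"
    have "p + 0 \<in> (\<lambda>l. p + l) ` \<Lambda>" using subgp_0[OF \<Lambda>] by (rule imageI)
    then obtain n where n: "n \<in> \<Lambda>" "p + 0 = q + n" unfolding e by (elim imageE)
    obtain k l where kl: "n = lat a b c k l" using sub[OF n(1)] by blast
    obtain x y x' y' where xy: "p = (x, y)" "q = (x', y')" by fastforce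
    have B: "0 \<le> x" "x < a" "0 \<le> x'" "x' < a" "0 \<le> y" "y < c" "0 \<le> y'" "y' < c"
      using p q xy by (auto simp: pbox_def)
    have e1: "0 * c + y = l * c + y'" and e2: "x = k * a + l * b + x'" using n(2) kl xy by (simp_all add: lat_def)
    have l: "0 = l \<and> y = y'" by (rule divmod_unique[OF B(5-8) e1])
    have "0 * a + x = k * a + x'" using e2 l by simp
    then have "0 = k \<and> x = x'" by (rule divmod_unique[OF B(1-4)])
    then show "p = q" using l xy by simp
  qed
  have "z2_cosets \<Lambda> = (\<lambda>p. (\<lambda>l. p + l) ` \<Lambda>) ` pbox a c"
  proof
    show "z2_cosets \<Lambda> \<subseteq> (\<lambda>p. (\<lambda>l. p + l) ` \<Lambda>) ` pbox a c"
    proof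
      fix C assume "C \<in> z2_cosets \<Lambda>"
      then obtain v where v: "C = (\<lambda>l. v + l) ` \<Lambda>" unfolding z2_cosets_def by blast
      obtain k l p where p: "v = lat a b c k l + p" "p \<in> pbox a c" using lat_decomp[OF a(1) c(1)] by blast
      have m: "lat a b c k l \<in> \<Lambda>" by (rule subgp_lat[OF \<Lambda> a(2) bc])
      have "(\<lambda>l. v + l) ` \<Lambda> = (\<lambda>l. p + l) ` \<Lambda>"
      proof (intro equalityI subsetI)
        fix w assume "w \<in> (\<lambda>l. v + l) ` \<Lambda>"
        then obtain n where "n \<in> \<Lambda>" "w = p + (lat a b c k l + n)" using p(1) by (auto simp: algebra_simps)
        then show "w \<in> (\<lambda>l. p + l) ` \<Lambda>" using subgp_add[OF \<Lambda> m] by blast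
      next
        fix w assume "w \<in> (\<lambda>l. p + l) ` \<Lambda>"
        then obtain n where n: "n \<in> \<Lambda>" "w = p + n" by blast
        then have "w = v + (n - lat a b c k l)" using p(1) by simp
        then show "w \<in> (\<lambda>l. v + l) ` \<Lambda>" using diff[OF n(1) m] by blast
      qed
      then show "C \<in> (\<lambda>p. (\<lambda>l. p + l) ` \<Lambda>) ` pbox a c" unfolding v using p(2) by blast
    qed
    show "(\<lambda>p. (\<lambda>l. p + l) ` \<Lambda>) ` pbox a c \<subseteq> z2_cosets \<Lambda>" unfolding z2_cosets_def by blast
  qed
  then have "z2_index \<Lambda> = card (pbox a c)" unfolding z2_index_def using card_image[OF inj] by simp
  also have "\<dots> = nat (a * c)" using a(1) c(1) by (simp add: pbox_def card_cartesian_product nat_mult_distrib)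
  finally show ?thesis using a(1) b c(1) \<Lambda>eq by blast
qed

text \<open>The exponents fixing a point form a subgroup, so they contain the lattice as soon as
  they contain its two basis vectors; then \<open>card_fixed\<close> applies.\<close>

lemma (in dual_pair) fix_count_eq:
  assumes ac: "a > 0" "c > 0" and \<Lambda>: "\<Lambda> = {lat a b c k l |k l. True}"
  shows "fix_count T \<alpha> \<Lambda> = ereal (real (ix M (aug (a, 0) (b, c) M)))"
proof -
  have "{x\<in>X. \<forall>n\<in>\<Lambda>. \<alpha> n x = x} = {x\<in>X. \<alpha> (a, 0) x = x \<and> \<alpha> (b, c) x = x}"
  proof (rule Collect_cong)
    fix x
    show "(x \<in> X \<and> (\<forall>n\<in>\<Lambda>. \<alpha> n x = x)) = (x \<in> X \<and> \<alpha> (a, 0) x = x \<and> \<alpha> (b, c) x = x)"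
    proof (cases "x \<in> X")
      case True
      define S where "S = {n. \<alpha> n x = x}"
      have S: "subgp S"
      proof (rule subgpI)
        show "0 \<in> S" using \<alpha>_0[OF True] by (simp add: S_def)
        show "m - n \<in> S" if "m \<in> S" "n \<in> S" for m n
          using that \<alpha>_plus[OF True, of m "- n"] \<alpha>_plus[OF True, of "- n" n] \<alpha>_0[OF True] by (simp add: S_def)
      qed
      have "(a, 0) \<in> \<Lambda>" unfolding \<Lambda> using lat_simps(2)[of a b c] by (metis (mono_tags, lifting) mem_Collect_eq)
      moreover have "(b, c) \<in> \<Lambda>" unfolding \<Lambda> using lat_simps(3)[of a b c] by (metis (mono_tags, lifting) mem_Collect_eq)
      moreover have "\<Lambda> \<subseteq> S" if "(a, 0) \<in> S" "(b, c) \<in> S"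
        unfolding \<Lambda> using subgp_lat[OF S that] by blast
      ultimately have "\<Lambda> \<subseteq> S \<longleftrightarrow> (a, 0) \<in> S \<and> (b, c) \<in> S" by blast
      then show ?thesis using True by (simp add: S_def subset_eq)
    qed simp
  qed
  then show ?thesis unfolding fix_count_def Let_def using card_fixed[OF ac, of b] by simp
qed

theorem theorem5p1:
  fixes T :: "'a topology" and add :: "'a \<Rightarrow> 'a \<Rightarrow> 'a" and neg :: "'a \<Rightarrow> 'a" and zero :: 'a
    and \<alpha> :: "int \<times> int \<Rightarrow> 'a \<Rightarrow> 'a"
  assumes "cpt_ab_group T add neg zero"
    and "metrizable_space T"
    and "T dim_le 0"
    and "z2_aut_action T add \<alpha>"
    and "haar_mixing T add \<alpha>"
    and "noetherian_action T add \<alpha>"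
  shows "\<exists>(T' :: real topology) add' neg' zero' (\<beta> :: int \<times> int \<Rightarrow> real \<Rightarrow> real) (A::real) (B::real).
           cpt_ab_group T' add' neg' zero' \<and> T' dim_le 0 \<and>
           z2_aut_action T' add' \<beta> \<and> haar_mixing T' add' \<beta> \<and>
           noetherian_action T' add' \<beta> \<and> entropy_rank_one T' \<beta> \<and>
           A > 0 \<and> B > 0 \<and>
           (\<forall>\<Lambda>. finite_index_subgroup \<Lambda> \<longrightarrow>
              ereal (A * exp (real_of_ereal (top_entropy_z2 T \<alpha>) * real (z2_index \<Lambda>)))
                \<le> fix_count T \<alpha> \<Lambda> \<and>
              fix_count T \<alpha> \<Lambda>
                \<le> ereal (B * exp (real_of_ereal (top_entropy_z2 T \<alpha>) * real (z2_index \<Lambda>)))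
                   * fix_count T' \<beta> \<Lambda>)"
proof -
  interpret X: z2_zero_dim T add neg zero \<alpha>
    using assms(1,3,4,6) by unfold_locales
  have mix: "\<forall>n x. n \<noteq> 0 \<longrightarrow> x \<in> X.chars \<longrightarrow> X.uact n x = x \<longrightarrow> x = 0"
    using X.dual.mixing_aperiodic[OF assms(5)] by blast
  obtain N g C q F where N: "X.dual.submod N" "N \<subseteq> X.chars" and g: "g \<in> X.dual.mon" "\<forall>x\<in>N. g x = 0"
    and C: "C > 0" "q > 0" and F: "subgp F" "finite F" "F \<subseteq> X.chars"
    and up: "\<forall>a b c. a > 0 \<longrightarrow> c > 0 \<longrightarrow> ix X.chars (X.dual.aug (a, 0) (b, c) X.chars)
      \<le> C * q ^ nat (a * c) * ix N (X.dual.aug (a, 0) (b, c) N)"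
    and low: "\<forall>W. finite W \<longrightarrow> (q::nat) ^ card W \<le> card (X.dual.sp W F)"
    using X.dual.upper_bound by (elim exE conjE)
  obtain \<Phi> :: "'a \<Rightarrow> real" where \<Phi>: "\<forall>x\<in>topspace T. \<forall>y\<in>topspace T. \<Phi> x = \<Phi> y \<longleftrightarrow> (\<forall>\<gamma>\<in>N. \<gamma> x = \<gamma> y)"
    using X.real_quotient_map[OF N(2)] by (rule exE)
  interpret Q: z2_quotient T add neg zero \<alpha> N \<Phi>
    using N \<Phi> by unfold_locales blast+
  let ?ix = "\<lambda>a b c. ix X.chars (X.dual.aug (a, 0) (b, c) X.chars)"
  have q_le: "ereal (ln (real q)) \<le> top_entropy_z2 T \<alpha>"
    by (rule X.dual.entropy_ge[OF F C(2)]) (use low in blast)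
  have h_le: "top_entropy_z2 T \<alpha> \<le> ereal (ln (real (?ix a b c)) / real_of_int (a * c))"
    if "a > 0" "b \<ge> 0" "c > 0" for a b c
    by (rule X.dual.entropy_le[OF mix that])
  define h where "h = real_of_ereal (top_entropy_z2 T \<alpha>)"
  \<comment> \<open>The entropy lies between ln q and the estimate for the full lattice with basis
    (1, 0), (0, 1), so it is finite and \<open>real_of_ereal\<close> loses nothing.\<close>
  have h: "top_entropy_z2 T \<alpha> = ereal h"
    using q_le h_le[of 1 0 1] by (cases "top_entropy_z2 T \<alpha>") (simp_all add: h_def)
  \<comment> \<open>The constants are A = 1 and B = \<open>C\<close>. The lower bound is the entropy
    estimate for the basis of \<Lambda>, multiplied out; the upper bound replaces \<open>q\<close>
    by exp h.\<close>
  have bounds: "ereal (1 * exp (h * real (z2_index \<Lambda>))) \<le> fix_count T \<alpha> \<Lambda> \<and>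
      fix_count T \<alpha> \<Lambda> \<le> ereal (real C * exp (h * real (z2_index \<Lambda>))) * fix_count Q.qT Q.qact \<Lambda>"
    if L: "finite_index_subgroup \<Lambda>" for \<Lambda>
  proof -
    obtain a b c where abc: "a > 0" "b \<ge> 0" "c > 0" and \<Lambda>: "\<Lambda> = {lat a b c k l |k l. True}"
      and d: "z2_index \<Lambda> = nat (a * c)" using lattice_basis[OF L] by blast
    let ?D = "?ix a b c" and ?n = "nat (a * c)" and ?R = "ix N (X.dual.aug (a, 0) (b, c) N)"
    have ac: "real_of_int (a * c) = real ?n" "real ?n > 0" using abc by simp_all
    have \<alpha>: "fix_count T \<alpha> \<Lambda> = ereal (real ?D)" by (rule X.dual.fix_count_eq[OF abc(1,3) \<Lambda>])
    have \<beta>: "fix_count Q.qT Q.qact \<Lambda> = ereal (real ?R)" by (rule Q.quot.fix_count_eq[OF abc(1,3) \<Lambda>])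
    have D: "?D > 0"
      using ix_pos[OF X.dual.fin_ix_aug[OF X.dual.submod_M subset_refl abc(1,3)]]
        subgp_0[OF X.subgp_chars] by blast
    have "h \<le> ln (real ?D) / real ?n" using h_le[OF abc] unfolding h ac(1) by simp
    then have "h * real ?n \<le> ln (real ?D)" using ac(2) by (simp only: pos_le_divide_eq)
    then have lower: "exp (h * real ?n) \<le> real ?D" using D by (metis exp_le_cancel_iff exp_ln of_nat_0_less_iff)
    have "ln (real q) \<le> h" using q_le unfolding h by simp
    then have "real q \<le> exp h" using C(2) by (metis exp_le_cancel_iff exp_ln of_nat_0_less_iff)
    then have "real q ^ ?n \<le> exp h ^ ?n" by (rule power_mono) simp
    also have "\<dots> = exp (h * real ?n)" by (simp add: exp_of_nat_mult[symmetric] mult.commute)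
    finally have qn: "real q ^ ?n \<le> exp (h * real ?n)" .
    have "?D \<le> C * q ^ ?n * ?R" using up abc(1,3) by blast
    then have "real ?D \<le> real C * real q ^ ?n * real ?R"
      by (simp only: of_nat_mult[symmetric] of_nat_power[symmetric] of_nat_le_iff)
    also have "\<dots> \<le> real C * exp (h * real ?n) * real ?R"
      by (intro mult_right_mono mult_left_mono qn) simp_all
    finally have upper: "real ?D \<le> real C * exp (h * real ?n) * real ?R" .
    show ?thesis unfolding \<alpha> \<beta> d using lower upper by simp
  qed
  show ?thesis unfolding h_def[symmetric]
  proof (intro exI conjI allI impI)
    show "cpt_ab_group Q.qT Q.qadd Q.qneg (\<Phi> zero)" by (rule Q.cpt_quotient)
    show "Q.qT dim_le 0" by (rule Q.dim_quotient)
    show "z2_aut_action Q.qT Q.qadd Q.qact" by (rule Q.action_quotient)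
    show "haar_mixing Q.qT Q.qadd Q.qact" by (rule Q.mixing_quotient[OF assms(5)])
    show "noetherian_action Q.qT Q.qadd Q.qact" by (rule Q.noetherian_quotient)
    show "entropy_rank_one Q.qT Q.qact" by (rule Q.quot.rank_one[OF g])
    show "(1::real) > 0" by simp
    show "real C > 0" using C(1) by simp
    fix \<Lambda> assume "finite_index_subgroup \<Lambda>"
    from bounds[OF this] show "ereal (1 * exp (h * real (z2_index \<Lambda>))) \<le> fix_count T \<alpha> \<Lambda>"
      "fix_count T \<alpha> \<Lambda> \<le> ereal (real C * exp (h * real (z2_index \<Lambda>))) * fix_count Q.qT Q.qact \<Lambda>" by blast+
  qed
qed

end
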